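(* Let $(M,\mathcal{V})$ be an abstract, smooth CR structure, and let $X$ be an infinitesimal CR diffeomorphism of $M$ with distributional coefficients which extends microlocally to a wedge with edge $M$. Then for any $\omega\in E$ the evaluation $\omega(X)$ is smooth, and for any $\lambda\in\mathcal{S}$ the vector field $\lambda X$ is smooth.
   Context: An abstract CR manifold $(M,\mathcal{V})$ is a smooth real manifold $M$ with a smooth complex subbundle $\mathcal{V}\subset\mathbb{C}TM$ that is formally integrable ($[\Gamma(M,\mathcal{V}),\Gamma(M,\mathcal{V})]\subset\Gamma(M,\mathcal{V})$) and satisfies $\mathcal{V}\cap\overline{\mathcal{V}}=\{0\}$. No embeddability into $\mathbb{C}^N$ is assumed. Write $\dim_{\mathbb{R}}M=2n+d$, where $n=\dim_{\mathbb{C}}\mathcal{V}_p$, and $N=n+d$. $\Gamma(\cdot,\cdot)$ denotes smooth sections; sections of $\mathcal{V}$ are CR vector fields. $\mathcal{E}(M)$ is the ring of smooth complex-valued functions on $M$. $T'M=\mathcal{V}^\perp\subset\mathbb{C}T^*M$ (complex rank $N$) is the holomorphic cotangent bundle; its sections are holomorphic forms. $T^0M\subset T'M$ is the real subbundle of real covectors annihilating $\mathcal{V}+\overline{\mathcal{V}}$; its sections are characteristic forms. For a CR vector field $L$ and a holomorphic form $\alpha$, the Lie derivative $\mathcal{L}_L\alpha=d\alpha(L,\cdot)$ is again a holomorphic form. Distributional sections: $\mathcal{D}'(M,(T'M)^* )$ is the space of distributions on $M$ with values in $(T'M)^*$ (the dual of the space of compactly supported smooth sections of $T'M$ tensored with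 the density bundle). If $\omega^1,\dots,\omega^N$ is a local basis of $T'M$ on an open set $U$ with dual basis $\omega_1,\dots,\omega_N$ of $(T'M)^*$, then $X\in\mathcal{D}'(M,(T'M)^* )$ is given on $U$ by $X=\sum_j c_j\omega_j$ with scalar distributions $c_j\in\mathcal{D}'(U)$. For a holomorphic form $\omega=\sum_j f_j\omega^j$ on $U$ ($f_j$ smooth) one sets $\omega(X)=X(\omega)=\sum_j f_jc_j\in\mathcal{D}'(U)$; this defines $\omega(X)\in\mathcal{D}'(M)$ globally. $\lambda X$ is defined by $\omega(\lambda X)=\lambda\,\omega(X)$. $X\in\mathcal{D}'(M,(T'M)^* )$ is an infinitesimal CR diffeomorphism with distributional coefficients if $\tau(X)=\overline{\tau(X)}$ for all $\tau\in\Gamma(M,T^0M)$ and $L(\alpha(X))=(\mathcal{L}_L\alpha)(X)$ for all $L\in\Gamma(M,\mathcal{V})$ and all $\alpha\in\Gamma(M,T'M)$. $X$ extends microlocally to a wedge with edge $M$ if there is a set $\Gamma\subset T^0M$ such that for each $p\in M$ the fiber $\Gamma_p\subset T^0_pM\setminus\{0\}$ is a closed, convex cone, and $\mathrm{WF}(\omega(X))\subset\Gamma$ for every holomorphic form $\omega\in\Gamma(M,T'M)$, where $\mathrm{WF}$ is the ($C^\infty$) wavefront set. For $k\ge 0$, $E_k\subset\Gamma(M,T'M)$ is the $\mathcal{E}(M)$-module spanned by all $\mathcal{L}_{K_1}\cdots\mathcal{L}_{K_j}\theta$ with $0\le j\le k$, $K_q\in\Gamma(M,\mathcal{V})$, $\theta\in\Gamma(M,T^0M)$;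 $E=\bigcup_kE_k$. $\mathcal{S}=\bigwedge^N E\subset\mathcal{E}(M)$ is the ideal generated by all determinants $\det\big(V^i(\mathfrak{Y}_j)\big)_{i,j=1}^N$ with $V^i\in E$ and $\mathfrak{Y}_j\in\Gamma(M,(T'M)^* )$. *)

theory Defs
  imports "HOL-Analysis.Analysis"
begin

section \<open>Smooth functions on open sets of Euclidean space\<close>

definition pderiv1 :: "'k::finite \<Rightarrow> (real^'k \<Rightarrow> 'b::real_normed_vector) \<Rightarrow> real^'k \<Rightarrow> 'b" where
  "pderiv1 i f x = frechet_derivative f (at x) (axis i 1)"

definition pderivs :: "'k::finite list \<Rightarrow> (real^'k \<Rightarrow> 'b::real_normed_vector) \<Rightarrow> real^'k \<Rightarrow> 'b" where
  "pderivs is f = foldr pderiv1 is f"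

text \<open>To be used for open \<open>S\<close> only: being (Frechet) differentiable, every iterated
  partial derivative is in particular continuous.\<close>
definition smooth_on :: "(real^'k::finite) set \<Rightarrow> (real^'k \<Rightarrow> 'b::real_normed_vector) \<Rightarrow> bool" where
  "smooth_on S f \<longleftrightarrow> (\<forall>is. pderivs is f differentiable_on S)"


section \<open>Smooth manifolds\<close>

text \<open>A manifold is a whole second countable Hausdorff type \<open>'m\<close> with a (not necessarily
  maximal) smooth atlas modelled on \<open>real^'k\<close>. A chart is a pair of its domain and its
  coordinate map; the values of the latter outside the domain are irrelevant.\<close>

type_synonym ('m, 'k) chart = "'m set \<times> ('m \<Rightarrow> real^'k)"

abbreviation cdom :: "('m, 'k::finite) chart \<Rightarrow> 'm set" where "cdom c \<equiv> fst c"
abbreviation coord :: "('m, 'k::finite) chart \<Rightarrow> 'm \<Rightarrow> real^'k" where "coord c \<equiv> snd c"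

definition cran :: "('m, 'k::finite) chart \<Rightarrow> (real^'k) set" where
  "cran c = coord c ` cdom c"

definition cinv :: "('m, 'k::finite) chart \<Rightarrow> real^'k \<Rightarrow> 'm" where
  "cinv c = inv_into (cdom c) (coord c)"

definition smooth_atlas ::
    "('m::{t2_space,second_countable_topology}, 'k::finite) chart set \<Rightarrow> bool" where
  "smooth_atlas A \<longleftrightarrow>
     (\<Union>c\<in>A. cdom c) = UNIV \<and>
     (\<forall>c\<in>A. open (cdom c) \<and> open (cran c) \<and> homeomorphism (cdom c) (cran c) (coord c) (cinv c)) \<and>
     (\<forall>c\<in>A. \<forall>c'\<in>A. smooth_on (coord c ` (cdom c \<inter> cdom c')) (coord c' \<circ> cinv c))"

definition jac :: "('m, 'k::finite) chart \<Rightarrow> ('m, 'k) chart \<Rightarrow> 'm \<Rightarrow> real" where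
  "jac c c' p = det (matrix (frechet_derivative (coord c' \<circ> cinv c) (at (coord c p))))"

definition msmooth ::
    "('m::topological_space, 'k::finite) chart set \<Rightarrow> 'm set \<Rightarrow> ('m \<Rightarrow> complex) \<Rightarrow> bool" where
  "msmooth A U f \<longleftrightarrow> (\<forall>c\<in>A. smooth_on (coord c ` (U \<inter> cdom c)) (f \<circ> cinv c))"

definition smooth_funs ::
    "('m::topological_space, 'k::finite) chart set \<Rightarrow> ('m \<Rightarrow> complex) set" where
  "smooth_funs A = {f. msmooth A UNIV f}"


section \<open>Complexified tangent and cotangent spaces\<close>

text \<open>Elements of the complexified tangent space at \<open>p\<close> are the derivations at \<open>p\<close> of the
  algebra of smooth complex-valued functions. They are extended by 0 to arbitrary functions,
  and covectors are extended by 0 to arguments that are not tangent vectors at \<open>p\<close>, so that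
  equality of HOL functions is equality of (co)vectors.\<close>

type_synonym 'm tvec = "('m \<Rightarrow> complex) \<Rightarrow> complex"
type_synonym 'm covec = "'m tvec \<Rightarrow> complex"

definition tangent_space ::
    "('m::topological_space, 'k::finite) chart set \<Rightarrow> 'm \<Rightarrow> 'm tvec set" where
  "tangent_space A p = {v.
     (\<forall>f\<in>smooth_funs A. \<forall>g\<in>smooth_funs A. v (\<lambda>q. f q + g q) = v f + v g) \<and>
     (\<forall>a. \<forall>f\<in>smooth_funs A. v (\<lambda>q. a * f q) = a * v f) \<and>
     (\<forall>f\<in>smooth_funs A. \<forall>g\<in>smooth_funs A. v (\<lambda>q. f q * g q) = f p * v g + g p * v f) \<and>
     (\<forall>f. f \<notin> smooth_funs A \<longrightarrow> v f = 0)}"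

definition complex_linear_on :: "'m tvec set \<Rightarrow> 'm covec \<Rightarrow> bool" where
  "complex_linear_on W \<eta> \<longleftrightarrow>
     (\<forall>v\<in>W. \<forall>w\<in>W. \<eta> (\<lambda>f. v f + w f) = \<eta> v + \<eta> w) \<and>
     (\<forall>a. \<forall>v\<in>W. \<eta> (\<lambda>f. a * v f) = a * \<eta> v)"

definition cotangent_space ::
    "('m::topological_space, 'k::finite) chart set \<Rightarrow> 'm \<Rightarrow> 'm covec set" where
  "cotangent_space A p =
     {\<eta>. complex_linear_on (tangent_space A p) \<eta> \<and> (\<forall>v. v \<notin> tangent_space A p \<longrightarrow> \<eta> v = 0)}"

definition vec_cnj :: "'m tvec \<Rightarrow> 'm tvec" where
  "vec_cnj v = (\<lambda>f. cnj (v (\<lambda>q. cnj (f q))))"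

definition cov_cnj :: "'m covec \<Rightarrow> 'm covec" where
  "cov_cnj \<eta> = (\<lambda>v. cnj (\<eta> (vec_cnj v)))"

definition coord_vec ::
    "('m::topological_space, 'k::finite) chart set \<Rightarrow> ('m, 'k) chart \<Rightarrow> 'k \<Rightarrow> 'm \<Rightarrow> 'm tvec" where
  "coord_vec A c i p = (\<lambda>f. if f \<in> smooth_funs A then pderiv1 i (f \<circ> cinv c) (coord c p) else 0)"

definition vec_coeff ::
    "('m::topological_space, 'k::finite) chart set \<Rightarrow> ('m, 'k) chart \<Rightarrow> 'm \<Rightarrow> 'm tvec \<Rightarrow> 'k \<Rightarrow> complex" where
  "vec_coeff A c p v = (THE a. v = (\<lambda>f. \<Sum>i\<in>UNIV. a i * coord_vec A c i p f))"

definition vector_fields ::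
    "('m::topological_space, 'k::finite) chart set \<Rightarrow> 'm set \<Rightarrow> ('m \<Rightarrow> 'm tvec) set" where
  "vector_fields A U = {L. (\<forall>p\<in>U. L p \<in> tangent_space A p) \<and>
     (\<forall>f\<in>smooth_funs A. msmooth A U (\<lambda>p. L p f))}"

definition one_forms ::
    "('m::topological_space, 'k::finite) chart set \<Rightarrow> 'm set \<Rightarrow> ('m \<Rightarrow> 'm covec) set" where
  "one_forms A U = {\<alpha>. (\<forall>p\<in>U. \<alpha> p \<in> cotangent_space A p) \<and>
     (\<forall>K\<in>vector_fields A UNIV. msmooth A U (\<lambda>p. \<alpha> p (K p)))}"

definition bracket :: "('m \<Rightarrow> 'm tvec) \<Rightarrow> ('m \<Rightarrow> 'm tvec) \<Rightarrow> 'm \<Rightarrow> 'm tvec" where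
  "bracket K L p = (\<lambda>f. K p (\<lambda>q. L q f) - L p (\<lambda>q. K q f))"

definition ext_deriv ::
    "('m \<Rightarrow> 'm covec) \<Rightarrow> ('m \<Rightarrow> 'm tvec) \<Rightarrow> ('m \<Rightarrow> 'm tvec) \<Rightarrow> 'm \<Rightarrow> complex" where
  "ext_deriv \<alpha> K L p =
     K p (\<lambda>q. \<alpha> q (L q)) - L p (\<lambda>q. \<alpha> q (K q)) - \<alpha> p (bracket K L p)"

text \<open>\<open>d\<alpha>(L,\<cdot>)\<close>, evaluated on a tangent vector \<open>v\<close> by extending \<open>v\<close> to a global vector field;
  the value does not depend on the extension. For sections \<open>L\<close> of a bundle annihilated by \<open>\<alpha>\<close>
  this is the Lie derivative, as the second term \<open>d(\<alpha>(L))\<close> of Cartan's formula vanishes.\<close>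
definition lie ::
    "('m::topological_space, 'k::finite) chart set \<Rightarrow> ('m \<Rightarrow> 'm tvec) \<Rightarrow> ('m \<Rightarrow> 'm covec)
      \<Rightarrow> 'm \<Rightarrow> 'm covec" where
  "lie A L \<alpha> p = (\<lambda>v. if v \<in> tangent_space A p
     then ext_deriv \<alpha> L (SOME K. K \<in> vector_fields A UNIV \<and> K p = v) p else 0)"


section \<open>CR structures\<close>

definition sections_of ::
    "('m::topological_space, 'k::finite) chart set \<Rightarrow> ('m \<Rightarrow> 'm tvec set) \<Rightarrow> 'm set
      \<Rightarrow> ('m \<Rightarrow> 'm tvec) set" where
  "sections_of A V U = {L \<in> vector_fields A U. \<forall>p\<in>U. L p \<in> V p}"

abbreviation cr_fields where "cr_fields A V \<equiv> sections_of A V UNIV"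

definition complex_subbundle ::
    "('m::topological_space, 'k::finite) chart set \<Rightarrow> nat \<Rightarrow> ('m \<Rightarrow> 'm tvec set) \<Rightarrow> bool" where
  "complex_subbundle A n V \<longleftrightarrow>
     (\<forall>p. \<exists>U F. open U \<and> p \<in> U \<and> (\<forall>i<n. F i \<in> sections_of A V U) \<and>
        (\<forall>q\<in>U. V q = {(\<lambda>f. \<Sum>i<n. a i * F i q f) | a :: nat \<Rightarrow> complex. True} \<and>
           (\<forall>a :: nat \<Rightarrow> complex. (\<forall>f. (\<Sum>i<n. a i * F i q f) = 0) \<longrightarrow> (\<forall>i<n. a i = 0))))"

definition cr_manifold ::
    "('m::{t2_space,second_countable_topology}, 'k::finite) chart set \<Rightarrow> nat \<Rightarrow> nat
      \<Rightarrow> ('m \<Rightarrow> 'm tvec set) \<Rightarrow> bool" where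
  "cr_manifold A n d V \<longleftrightarrow>
     smooth_atlas A \<and> CARD('k) = 2 * n + d \<and> complex_subbundle A n V \<and>
     (\<forall>K\<in>cr_fields A V. \<forall>L\<in>cr_fields A V. bracket K L \<in> cr_fields A V) \<and>
     (\<forall>p. \<forall>v\<in>V p. vec_cnj v \<in> V p \<longrightarrow> v = (\<lambda>f. 0))"

definition hol_cotangent ::
    "('m::topological_space, 'k::finite) chart set \<Rightarrow> ('m \<Rightarrow> 'm tvec set) \<Rightarrow> 'm \<Rightarrow> 'm covec set" where
  "hol_cotangent A V p = {\<eta> \<in> cotangent_space A p. \<forall>v\<in>V p. \<eta> v = 0}"

definition char_cotangent ::
    "('m::topological_space, 'k::finite) chart set \<Rightarrow> ('m \<Rightarrow> 'm tvec set) \<Rightarrow> 'm \<Rightarrow> 'm covec set" where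
  "char_cotangent A V p = {\<eta> \<in> cotangent_space A p. cov_cnj \<eta> = \<eta> \<and>
     (\<forall>v\<in>V p. \<eta> v = 0 \<and> \<eta> (vec_cnj v) = 0)}"

definition hol_forms ::
    "('m::topological_space, 'k::finite) chart set \<Rightarrow> ('m \<Rightarrow> 'm tvec set) \<Rightarrow> ('m \<Rightarrow> 'm covec) set" where
  "hol_forms A V = {\<alpha> \<in> one_forms A UNIV. \<forall>p. \<alpha> p \<in> hol_cotangent A V p}"

definition char_forms ::
    "('m::topological_space, 'k::finite) chart set \<Rightarrow> ('m \<Rightarrow> 'm tvec set) \<Rightarrow> ('m \<Rightarrow> 'm covec) set" where
  "char_forms A V = {\<tau> \<in> one_forms A UNIV. \<forall>p. \<tau> p \<in> char_cotangent A V p}"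

text \<open>Smooth sections of the dual bundle of the holomorphic cotangent bundle.\<close>
definition dual_sections ::
    "('m::topological_space, 'k::finite) chart set \<Rightarrow> ('m \<Rightarrow> 'm tvec set)
      \<Rightarrow> ('m \<Rightarrow> 'm covec \<Rightarrow> complex) set" where
  "dual_sections A V = {Y.
     (\<forall>p. (\<forall>\<eta>\<in>hol_cotangent A V p. \<forall>\<zeta>\<in>hol_cotangent A V p.
              Y p (\<lambda>v. \<eta> v + \<zeta> v) = Y p \<eta> + Y p \<zeta>) \<and>
          (\<forall>a. \<forall>\<eta>\<in>hol_cotangent A V p. Y p (\<lambda>v. a * \<eta> v) = a * Y p \<eta>) \<and>
          (\<forall>\<eta>. \<eta> \<notin> hol_cotangent A V p \<longrightarrow> Y p \<eta> = 0)) \<and>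
     (\<forall>\<omega>\<in>hol_forms A V. (\<lambda>p. Y p (\<omega> p)) \<in> smooth_funs A)}"

definition E_step ::
    "('m::topological_space, 'k::finite) chart set \<Rightarrow> ('m \<Rightarrow> 'm tvec set) \<Rightarrow> nat
      \<Rightarrow> ('m \<Rightarrow> 'm covec) set" where
  "E_step A V k =
     {(\<lambda>p v. \<Sum>i<m. g i p * foldr (lie A) (Ks i) (\<theta> i) p v) | (m::nat) g Ks \<theta>.
        \<forall>i<m. g i \<in> smooth_funs A \<and> set (Ks i) \<subseteq> cr_fields A V \<and> length (Ks i) \<le> k \<and>
              \<theta> i \<in> char_forms A V}"

definition E_forms ::
    "('m::topological_space, 'k::finite) chart set \<Rightarrow> ('m \<Rightarrow> 'm tvec set) \<Rightarrow> ('m \<Rightarrow> 'm covec) set" where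
  "E_forms A V = (\<Union>k. E_step A V k)"

text \<open>The size \<open>N = n + d\<close> of the determinants is the cardinality of the index type \<open>'r\<close>.\<close>
definition S_ideal ::
    "'r::finite itself \<Rightarrow> ('m::topological_space, 'k::finite) chart set \<Rightarrow> ('m \<Rightarrow> 'm tvec set)
      \<Rightarrow> ('m \<Rightarrow> complex) set" where
  "S_ideal _ A V =
     {(\<lambda>p. \<Sum>l<m. g l p * det (\<chi> i j. Y l j p (W l i p) :: complex^'r^'r)) | (m::nat) g W Y.
        \<forall>l<m. g l \<in> smooth_funs A \<and>
              (\<forall>i. W l i \<in> E_forms A V) \<and> (\<forall>j. Y l j \<in> dual_sections A V)}"


section \<open>Distributions\<close>

text \<open>A density is the family of its coefficients in all charts of the atlas (extended by 0);
  the coefficients transform with the absolute value of the Jacobian determinant.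
  Likewise, a section of the holomorphic cotangent bundle tensored with the density bundle is
  the family of its covector-valued coefficients in the charts.\<close>

type_synonym ('m, 'k) dens = "('m, 'k) chart \<Rightarrow> 'm \<Rightarrow> complex"
type_synonym ('m, 'k) cdens = "('m, 'k) chart \<Rightarrow> 'm \<Rightarrow> 'm covec"

definition test_dens_in ::
    "('m::topological_space, 'k::finite) chart set \<Rightarrow> 'm set \<Rightarrow> ('m, 'k) dens set" where
  "test_dens_in A K = {\<mu>.
     (\<forall>c p. c \<in> A \<and> p \<in> cdom c \<and> p \<in> K \<or> \<mu> c p = 0) \<and>
     (\<forall>c\<in>A. \<forall>c'\<in>A. \<forall>p\<in>cdom c \<inter> cdom c'. \<mu> c p = of_real \<bar>jac c c' p\<bar> * \<mu> c' p) \<and>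
     (\<forall>c\<in>A. msmooth A (cdom c) (\<mu> c))}"

definition test_dens ::
    "('m::topological_space, 'k::finite) chart set \<Rightarrow> ('m, 'k) dens set" where
  "test_dens A = (\<Union>K\<in>{K. compact K}. test_dens_in A K)"

definition test_cdens_in ::
    "('m::topological_space, 'k::finite) chart set \<Rightarrow> ('m \<Rightarrow> 'm tvec set) \<Rightarrow> 'm set
      \<Rightarrow> ('m, 'k) cdens set" where
  "test_cdens_in A V K = {s.
     (\<forall>c p. c \<in> A \<and> p \<in> cdom c \<and> p \<in> K \<or> s c p = (\<lambda>v. 0)) \<and>
     (\<forall>c p. s c p \<in> hol_cotangent A V p) \<and>
     (\<forall>c\<in>A. \<forall>c'\<in>A. \<forall>p\<in>cdom c \<inter> cdom c'. s c p = (\<lambda>v. of_real \<bar>jac c c' p\<bar> * s c' p v)) \<and>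
     (\<forall>c\<in>A. s c \<in> one_forms A (cdom c))}"

definition test_cdens ::
    "('m::topological_space, 'k::finite) chart set \<Rightarrow> ('m \<Rightarrow> 'm tvec set) \<Rightarrow> ('m, 'k) cdens set" where
  "test_cdens A V = (\<Union>K\<in>{K. compact K}. test_cdens_in A V K)"

text \<open>Distributions with values in the dual of the holomorphic cotangent bundle. By a partition
  of unity it suffices to require the continuity estimates for compact sets inside one chart;
  \<open>B\<close> plays the role of the supremum norm of the derivatives of order at most \<open>r\<close>.\<close>
definition vdistributions ::
    "('m::topological_space, 'k::finite) chart set \<Rightarrow> ('m \<Rightarrow> 'm tvec set)
      \<Rightarrow> (('m, 'k) cdens \<Rightarrow> complex) set" where
  "vdistributions A V = {X.
     (\<forall>s\<in>test_cdens A V. \<forall>t\<in>test_cdens A V. X (\<lambda>c p v. s c p v + t c p v) = X s + X t) \<and>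
     (\<forall>a. \<forall>s\<in>test_cdens A V. X (\<lambda>c p v. a * s c p v) = a * X s) \<and>
     (\<forall>c\<in>A. \<forall>K. compact K \<and> K \<subseteq> cdom c \<longrightarrow>
        (\<exists>C r. \<forall>s\<in>test_cdens_in A V K. \<forall>B.
           (\<forall>i is. \<forall>p\<in>K. length is \<le> r \<longrightarrow>
              norm (pderivs is (\<lambda>x. s c (cinv c x) (coord_vec A c i (cinv c x))) (coord c p)) \<le> B)
           \<longrightarrow> norm (X s) \<le> C * B))}"

text \<open>The scalar distribution \<open>\<omega>(X)\<close>: for \<open>X = \<Sum>\<^sub>j c\<^sub>j \<omega>\<^sub>j\<close> and \<open>\<omega> = \<Sum>\<^sub>j f\<^sub>j \<omega>\<^sup>j\<close>,
  both sides applied to \<open>\<mu>\<close> are \<open>\<Sum>\<^sub>j c\<^sub>j (f\<^sub>j \<mu>)\<close>.\<close>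
definition pairing ::
    "('m \<Rightarrow> 'm covec) \<Rightarrow> (('m, 'k::finite) cdens \<Rightarrow> complex) \<Rightarrow> ('m, 'k) dens \<Rightarrow> complex" where
  "pairing \<omega> X = (\<lambda>\<mu>. X (\<lambda>c p v. \<mu> c p * \<omega> p v))"

definition mult_vdist ::
    "('m \<Rightarrow> complex) \<Rightarrow> (('m, 'k::finite) cdens \<Rightarrow> complex) \<Rightarrow> ('m, 'k) cdens \<Rightarrow> complex" where
  "mult_vdist g X = (\<lambda>s. X (\<lambda>c p v. g p * s c p v))"

definition dist_cnj ::
    "(('m, 'k::finite) dens \<Rightarrow> complex) \<Rightarrow> ('m, 'k) dens \<Rightarrow> complex" where
  "dist_cnj u = (\<lambda>\<mu>. cnj (u (\<lambda>c p. cnj (\<mu> c p))))"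

text \<open>Lie derivative of a density; in a chart, \<open>\<Sum>\<^sub>i \<partial>\<^sub>i (L\<^sup>i \<mu>)\<close>.\<close>
definition lie_dens ::
    "('m::topological_space, 'k::finite) chart set \<Rightarrow> ('m \<Rightarrow> 'm tvec) \<Rightarrow> ('m, 'k) dens
      \<Rightarrow> ('m, 'k) dens" where
  "lie_dens A L \<mu> = (\<lambda>c p. if c \<in> A \<and> p \<in> cdom c
     then \<Sum>i\<in>UNIV. pderiv1 i (\<lambda>x. vec_coeff A c (cinv c x) (L (cinv c x)) i * \<mu> c (cinv c x))
            (coord c p)
     else 0)"

definition dist_deriv ::
    "('m::topological_space, 'k::finite) chart set \<Rightarrow> ('m \<Rightarrow> 'm tvec)
      \<Rightarrow> (('m, 'k) dens \<Rightarrow> complex) \<Rightarrow> ('m, 'k) dens \<Rightarrow> complex" where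
  "dist_deriv A L u = (\<lambda>\<mu>. - u (lie_dens A L \<mu>))"

text \<open>Distributions are functionals on test densities only, so this is their equality.\<close>
definition dist_eq ::
    "('m::topological_space, 'k::finite) chart set \<Rightarrow> (('m, 'k) dens \<Rightarrow> complex)
      \<Rightarrow> (('m, 'k) dens \<Rightarrow> complex) \<Rightarrow> bool" where
  "dist_eq A u w \<longleftrightarrow> (\<forall>\<mu>\<in>test_dens A. u \<mu> = w \<mu>)"

definition smooth_dist ::
    "('m::topological_space, 'k::finite) chart set \<Rightarrow> (('m, 'k) dens \<Rightarrow> complex) \<Rightarrow> bool" where
  "smooth_dist A u \<longleftrightarrow> (\<exists>f\<in>smooth_funs A. \<forall>c\<in>A. \<forall>K. compact K \<and> K \<subseteq> cdom c \<longrightarrow>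
     (\<forall>\<mu>\<in>test_dens_in A K. u \<mu> = (LINT x:cran c|lborel. f (cinv c x) * \<mu> c (cinv c x))))"

definition smooth_vdist ::
    "('m::topological_space, 'k::finite) chart set \<Rightarrow> ('m \<Rightarrow> 'm tvec set)
      \<Rightarrow> (('m, 'k) cdens \<Rightarrow> complex) \<Rightarrow> bool" where
  "smooth_vdist A V X \<longleftrightarrow> (\<exists>Y\<in>dual_sections A V. \<forall>c\<in>A. \<forall>K. compact K \<and> K \<subseteq> cdom c \<longrightarrow>
     (\<forall>s\<in>test_cdens_in A V K. X s = (LINT x:cran c|lborel. Y (cinv c x) (s c (cinv c x)))))"


section \<open>The wavefront set\<close>

text \<open>The density whose coefficient in the chart \<open>c\<close> is the function \<open>\<psi>\<close> with compact support
  in the range of \<open>c\<close>.\<close>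
definition chart_dens ::
    "('m, 'k::finite) chart set \<Rightarrow> ('m, 'k) chart \<Rightarrow> (real^'k \<Rightarrow> complex) \<Rightarrow> ('m, 'k) dens" where
  "chart_dens A c \<psi> = (\<lambda>c' p. if c' \<in> A \<and> p \<in> cdom c' \<inter> cdom c
     then of_real \<bar>jac c' c p\<bar> * \<psi> (coord c p) else 0)"

definition test_funs :: "(real^'k::finite) set \<Rightarrow> (real^'k \<Rightarrow> complex) set" where
  "test_funs \<Omega> = {\<phi>. smooth_on UNIV \<phi> \<and> (\<exists>K. compact K \<and> K \<subseteq> \<Omega> \<and> (\<forall>x. x \<notin> K \<longrightarrow> \<phi> x = 0))}"

text \<open>Wavefront set of a distribution \<open>u\<close> on the open set \<open>\<Omega>\<close>; the expression
  \<open>u (\<lambda>x. \<phi> x * cis (- (x \<bullet> \<xi>)))\<close> is the Fourier transform of \<open>\<phi>u\<close> at \<open>\<xi>\<close>.\<close>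
definition WF_euclid ::
    "(real^'k::finite) set \<Rightarrow> ((real^'k \<Rightarrow> complex) \<Rightarrow> complex) \<Rightarrow> ((real^'k) \<times> (real^'k)) set" where
  "WF_euclid \<Omega> u = {(x0, \<xi>0). x0 \<in> \<Omega> \<and> \<xi>0 \<noteq> 0 \<and>
     \<not> (\<exists>\<phi>\<in>test_funs \<Omega>. \<phi> x0 \<noteq> 0 \<and>
         (\<exists>W. open W \<and> \<xi>0 \<in> W \<and> (\<forall>\<xi>\<in>W. \<forall>t>0. t *\<^sub>R \<xi> \<in> W) \<and>
            (\<forall>k::nat. \<exists>C. \<forall>\<xi>\<in>W.
               norm (u (\<lambda>x. \<phi> x * cis (- (x \<bullet> \<xi>)))) * (1 + norm \<xi>) ^ k \<le> C)))}"

text \<open>The wavefront set on the manifold is the union over all charts of the pullbacks of the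
  Euclidean wavefront sets (each of which is determined by any chart around the point).\<close>
definition WF ::
    "('m::topological_space, 'k::finite) chart set \<Rightarrow> (('m, 'k) dens \<Rightarrow> complex)
      \<Rightarrow> ('m \<times> 'm covec) set" where
  "WF A u = {(p, \<eta>). \<eta> \<in> cotangent_space A p \<and> cov_cnj \<eta> = \<eta> \<and>
     (\<exists>c\<in>A. p \<in> cdom c \<and>
        (coord c p, \<chi> i. Re (\<eta> (coord_vec A c i p)))
          \<in> WF_euclid (cran c) (\<lambda>\<psi>. u (chart_dens A c \<psi>)))}"


section \<open>Infinitesimal CR diffeomorphisms\<close>

definition inf_cr_diffeo ::
    "('m::topological_space, 'k::finite) chart set \<Rightarrow> ('m \<Rightarrow> 'm tvec set)
      \<Rightarrow> (('m, 'k) cdens \<Rightarrow> complex) \<Rightarrow> bool" where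
  "inf_cr_diffeo A V X \<longleftrightarrow> X \<in> vdistributions A V \<and>
     (\<forall>\<tau>\<in>char_forms A V. dist_eq A (pairing \<tau> X) (dist_cnj (pairing \<tau> X))) \<and>
     (\<forall>L\<in>cr_fields A V. \<forall>\<alpha>\<in>hol_forms A V.
        dist_eq A (dist_deriv A L (pairing \<alpha> X)) (pairing (lie A L \<alpha>) X))"

text \<open>Convex cones are closed under positive multiples and do not contain 0; closedness refers
  to the punctured fiber. The product topology on functions induces the usual topology on the
  finite-dimensional fibers.\<close>
definition extends_microlocally ::
    "('m::topological_space, 'k::finite) chart set \<Rightarrow> ('m \<Rightarrow> 'm tvec set)
      \<Rightarrow> (('m, 'k) cdens \<Rightarrow> complex) \<Rightarrow> bool" where
  "extends_microlocally A V X \<longleftrightarrow>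
     (\<exists>\<Gamma> :: 'm \<Rightarrow> 'm covec set.
        (\<forall>p. closedin (top_of_set (char_cotangent A V p - {\<lambda>v. 0})) (\<Gamma> p) \<and>
             (\<forall>\<eta>\<in>\<Gamma> p. \<forall>t::real. t > 0 \<longrightarrow> (\<lambda>v. of_real t * \<eta> v) \<in> \<Gamma> p) \<and>
             (\<forall>\<eta>\<in>\<Gamma> p. \<forall>\<zeta>\<in>\<Gamma> p. \<forall>t\<in>{0..1::real}.
                (\<lambda>v. of_real (1 - t) * \<eta> v + of_real t * \<zeta> v) \<in> \<Gamma> p)) \<and>
        (\<forall>\<omega>\<in>hol_forms A V. WF A (pairing \<omega> X) \<subseteq> Sigma UNIV \<Gamma>))"

end

theory Submission
  imports Defs "HOL-Combinatorics.Permutations"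
begin

section \<open>Calculus of smooth functions\<close>

lemma pderiv1_eq: "(f has_derivative f') (at x) \<Longrightarrow> pderiv1 i f x = f' (axis i 1)"
  unfolding pderiv1_def by (metis frechet_derivative_at)

lemma pderiv1_cong:
  assumes "open S" "x \<in> S" "\<And>y. y \<in> S \<Longrightarrow> f y = g y"
  shows "pderiv1 i f x = pderiv1 i g x"
proof -
  have "(f has_derivative f') (at x) \<longleftrightarrow> (g has_derivative f') (at x)" for f'
    using has_derivative_transform_within_open[OF _ assms(1,2)] assms(3) by metis
  thus ?thesis unfolding pderiv1_def frechet_derivative_def by simp
qed

lemma pderivs_Nil [simp]: "pderivs [] f = f"
  by (simp add: pderivs_def)

lemma pderivs_Cons: "pderivs (i # is) f = pderiv1 i (pderivs is f)"
  by (simp add: pderivs_def)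

lemma pderivs_snoc: "pderivs (is @ [i]) f = pderivs is (pderiv1 i f)"
  by (simp add: pderivs_def)

lemma pderivs_cong:
  assumes "open S" "\<And>y. y \<in> S \<Longrightarrow> f y = g y" "x \<in> S"
  shows "pderivs is f x = pderivs is g x"
  using assms(3)
proof (induction "is" arbitrary: x)
  case Nil thus ?case using assms by simp
next
  case (Cons i "is")
  thus ?case unfolding pderivs_Cons using pderiv1_cong[OF assms(1)] by blast
qed

definition smooth_upto :: "nat \<Rightarrow> (real^'k::finite) set \<Rightarrow> (real^'k \<Rightarrow> 'b::real_normed_vector) \<Rightarrow> bool" where
  "smooth_upto n S f \<longleftrightarrow> (\<forall>is. length is \<le> n \<longrightarrow> pderivs is f differentiable_on S)"

lemma smooth_on_iff_upto: "smooth_on S f \<longleftrightarrow> (\<forall>n. smooth_upto n S f)"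
  by (auto simp: smooth_on_def smooth_upto_def)

lemma smooth_upto_0: "smooth_upto 0 S f \<longleftrightarrow> f differentiable_on S"
  by (auto simp: smooth_upto_def)

lemma smooth_upto_Suc:
  "smooth_upto (Suc n) S f \<longleftrightarrow> f differentiable_on S \<and> (\<forall>i. smooth_upto n S (pderiv1 i f))"
proof safe
  assume *: "smooth_upto (Suc n) S f"
  show "f differentiable_on S" using *[unfolded smooth_upto_def, rule_format, of "[]"] by simp
  fix i show "smooth_upto n S (pderiv1 i f)"
    unfolding smooth_upto_def
  proof safe
    fix "is" :: "'a list" assume "length is \<le> n"
    thus "pderivs is (pderiv1 i f) differentiable_on S"
      using *[unfolded smooth_upto_def, rule_format, of "is @ [i]"] by (simp add: pderivs_snoc)
  qed
next
  assume *: "f differentiable_on S" "\<forall>i. smooth_upto n S (pderiv1 i f)"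
  show "smooth_upto (Suc n) S f"
    unfolding smooth_upto_def
  proof safe
    fix "is" :: "'a list" assume "length is \<le> Suc n"
    thus "pderivs is f differentiable_on S"
      using * by (cases "is" rule: rev_cases) (auto simp: pderivs_snoc smooth_upto_def)
  qed
qed

lemma smooth_upto_SucD: "smooth_upto (Suc n) S f \<Longrightarrow> smooth_upto n S f"
  by (auto simp: smooth_upto_def)

lemma differentiable_on_cong_open:
  assumes "open S" "\<And>x. x \<in> S \<Longrightarrow> f x = g x" "g differentiable_on S"
  shows "f differentiable_on S"
  using assms differentiable_on_eq_differentiable_at[OF assms(1)]
  by (metis differentiable_transform_within differentiable_on_def zero_less_one)

lemma smooth_upto_cong:
  assumes "open S" "\<And>x. x \<in> S \<Longrightarrow> f x = g x" "smooth_upto n S g"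
  shows "smooth_upto n S f"
  unfolding smooth_upto_def
proof safe
  fix "is" :: "'a list" assume "length is \<le> n"
  thus "pderivs is f differentiable_on S"
    using assms by (intro differentiable_on_cong_open[OF assms(1) pderivs_cong[OF assms(1,2)]])
       (auto simp: smooth_upto_def)
qed

lemma smooth_on_cong:
  assumes "open S" "\<And>x. x \<in> S \<Longrightarrow> f x = g x" "smooth_on S g"
  shows "smooth_on S f"
  using assms smooth_upto_cong unfolding smooth_on_iff_upto by blast

lemma smooth_on_subset: "smooth_on S f \<Longrightarrow> T \<subseteq> S \<Longrightarrow> smooth_on T f"
  by (auto simp: smooth_on_def intro: differentiable_on_subset)

lemma smooth_on_local:
  assumes "\<And>x. x \<in> S \<Longrightarrow> \<exists>T. open T \<and> x \<in> T \<and> smooth_on T f"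
  shows "smooth_on S f"
  unfolding smooth_on_def differentiable_on_def
proof safe
  fix "is" x assume "x \<in> S"
  with assms obtain T where "open T" "x \<in> T" "smooth_on T f" by blast
  hence "pderivs is f differentiable at x"
    by (auto simp: smooth_on_def differentiable_on_eq_differentiable_at)
  thus "pderivs is f differentiable at x within S"
    by (rule differentiable_at_withinI)
qed

lemma smooth_on_pderiv1: "smooth_on S f \<Longrightarrow> smooth_on S (pderiv1 i f)"
  unfolding smooth_on_iff_upto by (metis smooth_upto_Suc)

lemma smooth_on_pderivs: "smooth_on S f \<Longrightarrow> smooth_on S (pderivs is f)"
  by (induction "is") (auto simp: pderivs_Cons smooth_on_pderiv1)

lemma smooth_on_differentiable: "smooth_on S f \<Longrightarrow> f differentiable_on S"
  using smooth_on_iff_upto smooth_upto_0 by blast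

lemma smooth_on_differentiable_at: "smooth_on S f \<Longrightarrow> open S \<Longrightarrow> x \<in> S \<Longrightarrow> f differentiable at x"
  using smooth_on_differentiable differentiable_on_eq_differentiable_at by blast

lemma differentiable_onD: "f differentiable_on S \<Longrightarrow> open S \<Longrightarrow> x \<in> S \<Longrightarrow> f differentiable at x"
  using differentiable_on_eq_differentiable_at by blast

lemma differentiable_onI: "(\<And>x. x \<in> S \<Longrightarrow> f differentiable at x) \<Longrightarrow> f differentiable_on S"
  by (simp add: differentiable_at_withinI differentiable_on_def)

lemma smooth_on_continuous: "smooth_on S f \<Longrightarrow> continuous_on S f"
  using smooth_on_differentiable differentiable_imp_continuous_on by blast

lemma has_derivative_pderiv1:
  assumes "f differentiable at x"
  shows "(f has_derivative (\<lambda>v. \<Sum>i\<in>UNIV. (v $ i) *\<^sub>R pderiv1 i f x)) (at x)"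
proof -
  obtain f' where f': "(f has_derivative f') (at x)"
    using assms unfolding differentiable_def by blast
  interpret f': bounded_linear f' using f' by (rule has_derivative_bounded_linear)
  have "f' v = (\<Sum>i\<in>UNIV. (v $ i) *\<^sub>R pderiv1 i f x)" for v
  proof -
    have "f' v = f' (\<Sum>i\<in>UNIV. (v $ i) *\<^sub>R axis i 1)"
      by (metis basis_expansion scalar_mult_eq_scaleR)
    thus ?thesis by (simp add: f'.sum f'.scaleR pderiv1_eq[OF f'])
  qed
  hence "f' = (\<lambda>v. \<Sum>i\<in>UNIV. (v $ i) *\<^sub>R pderiv1 i f x)" by blast
  thus ?thesis using f' by simp
qed

lemma pderiv1_bounded_linear:
  assumes "bounded_linear h" "f differentiable at x"
  shows "pderiv1 i (\<lambda>x. h (f x)) x = h (pderiv1 i f x)"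
proof -
  obtain f' where f': "(f has_derivative f') (at x)"
    using assms unfolding differentiable_def by blast
  show ?thesis
    using pderiv1_eq[OF f'] pderiv1_eq[OF bounded_linear.has_derivative[OF assms(1) f']] by simp
qed

lemma smooth_upto_bounded_linear:
  fixes f :: "real^'k::finite \<Rightarrow> 'b::real_normed_vector"
  assumes h: "bounded_linear h" and S: "open S" and f: "smooth_upto n S f"
  shows "smooth_upto n S (\<lambda>x. h (f x))"
proof -
  have hd: "(\<lambda>x. h (f x)) differentiable_on S" if f: "f differentiable_on S" for f :: "real^'k \<Rightarrow> 'b"
  proof (rule differentiable_onI)
    fix x assume "x \<in> S"
    then obtain f' where f': "(f has_derivative f') (at x)"
      using differentiable_onD[OF f S] unfolding differentiable_def by blast
    show "(\<lambda>x. h (f x)) differentiable at x"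
      using bounded_linear.has_derivative[OF h f'] by (rule differentiableI)
  qed
  show ?thesis
    using f
  proof (induction n arbitrary: f)
    case 0 thus ?case by (simp add: smooth_upto_0 hd)
  next
    case (Suc n)
    have d: "f differentiable_on S" and fi: "\<And>i. smooth_upto n S (pderiv1 i f)"
      using Suc by (auto simp: smooth_upto_Suc)
    have "smooth_upto n S (pderiv1 i (\<lambda>x. h (f x)))" for i
      by (rule smooth_upto_cong[OF S pderiv1_bounded_linear[OF h differentiable_onD[OF d S]] Suc.IH[OF fi]])
    thus ?case using hd[OF d] by (auto simp: smooth_upto_Suc)
  qed
qed

lemma pderiv1_add:
  assumes "f differentiable at x" "g differentiable at x"
  shows "pderiv1 i (\<lambda>x. f x + g x) x = pderiv1 i f x + pderiv1 i g x"
proof -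
  obtain f' g' where f': "(f has_derivative f') (at x)" "(g has_derivative g') (at x)"
    using assms unfolding differentiable_def by blast
  show ?thesis
    using pderiv1_eq[OF f'(1)] pderiv1_eq[OF f'(2)] pderiv1_eq[OF has_derivative_add[OF f']] by simp
qed

lemma smooth_upto_add:
  assumes S: "open S" and "smooth_upto n S f" "smooth_upto n S g"
  shows "smooth_upto n S (\<lambda>x. f x + g x)"
  using assms(2,3)
proof (induction n arbitrary: f g)
  case 0 thus ?case by (simp add: smooth_upto_0 differentiable_on_add)
next
  case (Suc n)
  have d: "f differentiable_on S" "g differentiable_on S" using Suc by (auto simp: smooth_upto_Suc)
  have "smooth_upto n S (pderiv1 i (\<lambda>x. f x + g x))" for i
    using Suc.prems
    by (intro smooth_upto_cong[OF S pderiv1_add[OF d[THEN differentiable_onD, OF S]]] Suc.IH)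
       (auto simp: smooth_upto_Suc)
  thus ?case using d by (auto simp: smooth_upto_Suc differentiable_on_add)
qed

lemma pderiv1_bilinear:
  assumes h: "bounded_bilinear h" and "f differentiable at x" "g differentiable at x"
  shows "pderiv1 i (\<lambda>x. h (f x) (g x)) x = h (f x) (pderiv1 i g x) + h (pderiv1 i f x) (g x)"
proof -
  obtain f' g' where f': "(f has_derivative f') (at x)" "(g has_derivative g') (at x)"
    using assms unfolding differentiable_def by blast
  show ?thesis
    using pderiv1_eq[OF f'(1)] pderiv1_eq[OF f'(2)] pderiv1_eq[OF bounded_bilinear.FDERIV[OF h f']] by simp
qed

lemma smooth_upto_bilinear:
  fixes f :: "real^'k::finite \<Rightarrow> 'b::real_normed_vector" and g :: "real^'k \<Rightarrow> 'c::real_normed_vector"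
  assumes h: "bounded_bilinear h" and S: "open S" and "smooth_upto n S f" "smooth_upto n S g"
  shows "smooth_upto n S (\<lambda>x. h (f x) (g x))"
proof -
  have hd: "(\<lambda>x. h (f x) (g x)) differentiable_on S"
    if f: "f differentiable_on S" and g: "g differentiable_on S" for f :: "real^'k \<Rightarrow> 'b" and g :: "real^'k \<Rightarrow> 'c"
  proof (rule differentiable_onI)
    fix x assume "x \<in> S"
    then obtain f' g' where f': "(f has_derivative f') (at x)" "(g has_derivative g') (at x)"
      using differentiable_onD[OF f S] differentiable_onD[OF g S] unfolding differentiable_def by blast
    show "(\<lambda>x. h (f x) (g x)) differentiable at x"
      using bounded_bilinear.FDERIV[OF h f'] by (rule differentiableI)
  qed
  show ?thesis
    using assms(3,4)
  proof (induction n arbitrary: f g)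
    case 0
    thus ?case by (simp add: smooth_upto_0 hd)
  next
    case (Suc n)
    have d: "f differentiable_on S" "g differentiable_on S"
      and i: "\<And>i. smooth_upto n S (pderiv1 i f)" "\<And>i. smooth_upto n S (pderiv1 i g)"
      and n: "smooth_upto n S f" "smooth_upto n S g"
      using Suc.prems Suc.prems[THEN smooth_upto_SucD]
      by (auto simp only: smooth_upto_Suc[of _ _ f] smooth_upto_Suc[of _ _ g])
    have "smooth_upto n S (pderiv1 i (\<lambda>x. h (f x) (g x)))" for i
      by (rule smooth_upto_cong[OF S pderiv1_bilinear[OF h differentiable_onD[OF d(1) S] differentiable_onD[OF d(2) S]]])
        (assumption | intro smooth_upto_add[OF S] Suc.IH i n)+
    thus ?case using hd[OF d] by (auto simp: smooth_upto_Suc)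
  qed
qed

lemma pderiv1_const [simp]: "pderiv1 i (\<lambda>x. c) = (\<lambda>x. 0)"
  by (auto simp: fun_eq_iff intro!: pderiv1_eq[THEN trans])

lemma pderivs_zero [simp]: "pderivs is (\<lambda>x. 0) = (\<lambda>x. 0)"
  by (induction "is") (auto simp: pderivs_Cons)

named_theorems smooth_intros

lemma smooth_on_const [smooth_intros]: "smooth_on S (\<lambda>x. c)"
proof -
  have "smooth_upto n S (\<lambda>x. c)" for n
    by (induction n arbitrary: c) (auto simp: smooth_upto_0 smooth_upto_Suc)
  thus ?thesis by (auto simp: smooth_on_iff_upto)
qed

lemma smooth_on_bounded_linear:
  "bounded_linear h \<Longrightarrow> open S \<Longrightarrow> smooth_on S f \<Longrightarrow> smooth_on S (\<lambda>x. h (f x))"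
  unfolding smooth_on_iff_upto using smooth_upto_bounded_linear by blast

lemma smooth_on_add [smooth_intros]:
  "open S \<Longrightarrow> smooth_on S f \<Longrightarrow> smooth_on S g \<Longrightarrow> smooth_on S (\<lambda>x. f x + g x)"
  unfolding smooth_on_iff_upto using smooth_upto_add by blast

lemma smooth_on_bilinear:
  "bounded_bilinear h \<Longrightarrow> open S \<Longrightarrow> smooth_on S f \<Longrightarrow> smooth_on S g \<Longrightarrow> smooth_on S (\<lambda>x. h (f x) (g x))"
  unfolding smooth_on_iff_upto using smooth_upto_bilinear by blast

lemma smooth_on_mult [smooth_intros]:
  fixes f :: "real^'k::finite \<Rightarrow> 'b::real_normed_algebra"
  shows "open S \<Longrightarrow> smooth_on S f \<Longrightarrow> smooth_on S g \<Longrightarrow> smooth_on S (\<lambda>x. f x * g x)"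
  using smooth_on_bilinear[OF bounded_bilinear_mult] by blast

lemma smooth_on_scaleR [smooth_intros]:
  shows "open S \<Longrightarrow> smooth_on S f \<Longrightarrow> smooth_on S g \<Longrightarrow> smooth_on S (\<lambda>x. f x *\<^sub>R g x)"
  using smooth_on_bilinear[OF bounded_bilinear_scaleR] by blast

lemma smooth_on_minus [smooth_intros]:
  "open S \<Longrightarrow> smooth_on S f \<Longrightarrow> smooth_on S (\<lambda>x. - f x)"
  using smooth_on_bounded_linear[OF bounded_linear_minus[OF bounded_linear_ident]] by blast

lemma smooth_on_diff [smooth_intros]:
  "open S \<Longrightarrow> smooth_on S f \<Longrightarrow> smooth_on S g \<Longrightarrow> smooth_on S (\<lambda>x. f x - g x)"
  using smooth_on_add[of S f "\<lambda>x. - g x"] smooth_on_minus[of S g] by simp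

lemma smooth_on_of_real [smooth_intros]:
  "open S \<Longrightarrow> smooth_on S f \<Longrightarrow> smooth_on S (\<lambda>x. of_real (f x) :: 'b::{real_normed_algebra_1})"
  using smooth_on_bounded_linear[OF bounded_linear_of_real] by blast

lemma smooth_on_cnj [smooth_intros]:
  "open S \<Longrightarrow> smooth_on S f \<Longrightarrow> smooth_on S (\<lambda>x. cnj (f x))"
  using smooth_on_bounded_linear[OF bounded_linear_cnj] by blast

lemma smooth_on_nth [smooth_intros]:
  "open S \<Longrightarrow> smooth_on S f \<Longrightarrow> smooth_on S (\<lambda>x. f x $ i)"
  using smooth_on_bounded_linear[OF bounded_linear_vec_nth] by blast

lemma smooth_on_sum [smooth_intros]:
  assumes "open S" "\<And>i. i \<in> I \<Longrightarrow> smooth_on S (f i)"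
  shows "smooth_on S (\<lambda>x. \<Sum>i\<in>I. f i x)"
  using assms(2)
  by (induction I rule: infinite_finite_induct) (auto intro!: smooth_intros assms(1))

lemma smooth_on_prod [smooth_intros]:
  fixes f :: "'i \<Rightarrow> real^'k::finite \<Rightarrow> 'b::real_normed_field"
  assumes "open S" "\<And>i. i \<in> I \<Longrightarrow> smooth_on S (f i)"
  shows "smooth_on S (\<lambda>x. \<Prod>i\<in>I. f i x)"
  using assms(2)
  by (induction I rule: infinite_finite_induct) (auto intro!: smooth_intros assms(1))

lemma smooth_on_id [smooth_intros]: "smooth_on S (\<lambda>x. x)"
proof -
  have "pderiv1 i (\<lambda>x. x) = (\<lambda>x::real^'a. axis i 1)" for i
    by (auto simp: fun_eq_iff intro!: pderiv1_eq[THEN trans])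
  hence "smooth_upto n S (\<lambda>x. x)" for n
    using smooth_on_const[of S] by (cases n) (auto simp: smooth_upto_0 smooth_upto_Suc smooth_on_iff_upto)
  thus ?thesis by (auto simp: smooth_on_iff_upto)
qed

lemma pderiv1_compose:
  assumes g: "g differentiable at x" and f: "f differentiable at (g x)"
  shows "pderiv1 i (\<lambda>x. f (g x)) x = (\<Sum>j\<in>UNIV. (pderiv1 i g x $ j) *\<^sub>R pderiv1 j f (g x))"
  using pderiv1_eq[OF diff_chain_at[OF has_derivative_pderiv1[OF g] has_derivative_pderiv1[OF f]], of i]
  by (simp add: o_def axis_def if_distrib if_distribR cong: if_cong)

lemma smooth_upto_compose:
  fixes g :: "real^'l::finite \<Rightarrow> real^'k::finite" and f :: "real^'k \<Rightarrow> 'b::real_normed_vector"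
  assumes S: "open S" "open T" "g ` S \<subseteq> T" "smooth_on S g" "smooth_upto n T f"
  shows "smooth_upto n S (\<lambda>x. f (g x))"
proof -
  have gd: "g differentiable at x" if "x \<in> S" for x
    using smooth_on_differentiable_at[OF S(4,1) that] .
  have fd: "f differentiable at (g x)" if "f differentiable_on T" "x \<in> S" for x and f :: "real^'k \<Rightarrow> 'b"
    using differentiable_onD[OF that(1) S(2), of "g x"] S(3) that by blast
  have cd: "(\<lambda>x. f (g x)) differentiable_on S" if "f differentiable_on T" for f :: "real^'k \<Rightarrow> 'b"
  proof (rule differentiable_onI)
    fix x assume x: "x \<in> S"
    show "(\<lambda>x. f (g x)) differentiable at x"
      using differentiable_chain_at[OF gd[OF x] fd[OF that x]] by (simp add: o_def)
  qed
  show ?thesis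
    using assms(5)
  proof (induction n arbitrary: f)
    case 0
    thus ?case by (simp add: smooth_upto_0 cd)
  next
    case (Suc n)
    have d: "f differentiable_on T" and fi: "\<And>j. smooth_upto n T (pderiv1 j f)"
      using Suc.prems by (auto simp: smooth_upto_Suc)
    have gi: "smooth_upto n S (\<lambda>x. pderiv1 i g x $ j)" for i j
      using smooth_on_nth[OF S(1) smooth_on_pderiv1[OF S(4)]] smooth_on_iff_upto by blast
    have z: "smooth_upto n S (\<lambda>x. 0 :: 'b)"
      using smooth_on_const smooth_on_iff_upto by blast
    have sum: "smooth_upto n S (\<lambda>x. \<Sum>j\<in>J. (pderiv1 i g x $ j) *\<^sub>R pderiv1 j f (g x))"
      if "finite J" for i and J :: "'k set"
      using that
    proof (induction J)
      case (insert j J)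
      have "smooth_upto n S (\<lambda>x. (pderiv1 i g x $ j) *\<^sub>R pderiv1 j f (g x) +
          (\<Sum>j\<in>J. (pderiv1 i g x $ j) *\<^sub>R pderiv1 j f (g x)))"
        by (intro smooth_upto_add[OF S(1)] smooth_upto_bilinear[OF bounded_bilinear_scaleR S(1)]
            gi insert Suc.IH fi)
      thus ?case using insert by simp
    qed (simp add: z)
    have "smooth_upto n S (pderiv1 i (\<lambda>x. f (g x)))" for i
      by (rule smooth_upto_cong[OF S(1) pderiv1_compose[OF gd fd[OF d]]]) (auto intro!: sum)
    thus ?case using cd[OF d] by (simp add: smooth_upto_Suc)
  qed
qed

lemma smooth_on_compose:
  fixes g :: "real^'l::finite \<Rightarrow> real^'k::finite"
  assumes "open S" "open T" "g ` S \<subseteq> T" "smooth_on S g" "smooth_on T f"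
  shows "smooth_on S (\<lambda>x. f (g x))"
  using assms smooth_upto_compose unfolding smooth_on_iff_upto by blast

lemma smooth_on_inverse [smooth_intros]:
  fixes f :: "real^'k::finite \<Rightarrow> 'b::real_normed_field"
  assumes S: "open S" and f: "smooth_on S f" and nz: "\<And>x. x \<in> S \<Longrightarrow> f x \<noteq> 0"
  shows "smooth_on S (\<lambda>x. inverse (f x))"
proof -
  have fd: "f differentiable at x" if "x \<in> S" for x
    using smooth_on_differentiable_at[OF f S that] .
  have der: "((\<lambda>x. inverse (f x)) has_derivative
      (\<lambda>v. - (inverse (f x) * (\<Sum>i\<in>UNIV. (v $ i) *\<^sub>R pderiv1 i f x) * inverse (f x)))) (at x)" if "x \<in> S" for x
    by (rule Deriv.has_derivative_inverse[OF nz[OF that] has_derivative_pderiv1[OF fd[OF that]]])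
  have eq: "pderiv1 i (\<lambda>x. inverse (f x)) x = - (inverse (f x) * inverse (f x) * pderiv1 i f x)" if "x \<in> S" for x i
    using pderiv1_eq[OF der[OF that]]
    by (auto simp: axis_def if_distrib if_distribR mult_ac cong: if_cong)
  have dd: "(\<lambda>x. inverse (f x)) differentiable_on S"
    using der differentiable_on_eq_differentiable_at[OF S] differentiable_def by blast
  have "smooth_upto n S (\<lambda>x. inverse (f x))" for n
  proof (induction n)
    case (Suc n)
    have "smooth_upto n S (\<lambda>x. - (inverse (f x) * inverse (f x) * pderiv1 i f x))" for i
      using Suc smooth_on_pderiv1[OF f, of i]
      by (intro smooth_upto_bounded_linear[OF bounded_linear_minus[OF bounded_linear_ident] S]
          smooth_upto_bilinear[OF bounded_bilinear_mult S]) (auto simp: smooth_on_iff_upto)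
    thus ?case using dd smooth_upto_cong[OF S eq] by (auto simp: smooth_upto_Suc)
  qed (use dd in \<open>auto simp: smooth_upto_0\<close>)
  thus ?thesis by (auto simp: smooth_on_iff_upto)
qed

lemma smooth_on_divide [smooth_intros]:
  fixes f g :: "real^'k::finite \<Rightarrow> 'b::real_normed_field"
  assumes "open S" "smooth_on S f" "smooth_on S g" "\<And>x. x \<in> S \<Longrightarrow> g x \<noteq> 0"
  shows "smooth_on S (\<lambda>x. f x / g x)"
  unfolding divide_inverse using assms by (intro smooth_intros)

lemma smooth_on_inner [smooth_intros]:
  "open S \<Longrightarrow> smooth_on S f \<Longrightarrow> smooth_on S g \<Longrightarrow> smooth_on S (\<lambda>x. f x \<bullet> g x)"
  using smooth_on_bilinear[OF bounded_bilinear_inner] by blast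

section \<open>Cutoff functions\<close>

definition flat :: "nat \<Rightarrow> real \<Rightarrow> real" where
  "flat j t = (if t > 0 then exp (- 1 / t) / t ^ j else 0)"

lemma power_exp_minus_le:
  assumes "(y::real) \<ge> 0"
  shows "y ^ n * exp (- y) \<le> fact n"
proof -
  have "(\<Sum>k\<in>{n}. inverse (fact k) *\<^sub>R (y ^ k)) \<le> (\<Sum>k. inverse (fact k) *\<^sub>R (y ^ k))"
    using assms by (intro sum_le_suminf summable_exp_generic) auto
  also have "\<dots> = exp y" by (simp add: exp_def)
  finally have "y ^ n \<le> fact n * exp y" by (simp add: field_simps)
  hence "y ^ n * exp (- y) \<le> fact n * exp y * exp (- y)" by (intro mult_right_mono) auto
  thus ?thesis by (simp add: mult.assoc exp_add[symmetric] del: exp_minus)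
qed

lemma flat_le: "\<bar>flat j t\<bar> \<le> fact (j + n) * \<bar>t\<bar> ^ n"
proof (cases "t > 0")
  case True
  define y where "y = inverse t"
  have y: "y > 0" "t = inverse y" using True by (auto simp: y_def)
  have "y ^ (j + n) * exp (- y) \<le> fact (j + n)"
    using y by (intro power_exp_minus_le) auto
  hence "y ^ (j + n) * exp (- y) * t ^ n \<le> fact (j + n) * t ^ n"
    using True by (intro mult_right_mono) auto
  moreover have "y ^ (j + n) * exp (- y) * t ^ n = flat j t"
  proof -
    have "y ^ n * t ^ n = 1" using y by (simp add: power_mult_distrib[symmetric])
    hence "y ^ (j + n) * exp (- y) * t ^ n = y ^ j * exp (- y)"
      by (simp add: power_add mult_ac)
    thus ?thesis using y by (simp add: flat_def divide_inverse power_inverse mult_ac)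
  qed
  ultimately show ?thesis using True by (simp add: flat_def)
qed (simp add: flat_def)

lemma DERIV_flat: "(flat j has_real_derivative flat (j + 2) t - real j * flat (j + 1) t) (at t)"
proof -
  consider "t > 0" | "t < 0" | "t = 0" by linarith
  thus ?thesis
  proof cases
    case 1
    have "((\<lambda>t. exp (- inverse t) * inverse t ^ j) has_real_derivative
        exp (- inverse t) * inverse t ^ 2 * inverse t ^ j
        - exp (- inverse t) * (real j * inverse t ^ (j - 1) * inverse t ^ 2)) (at t)"
      using 1 by (auto intro!: derivative_eq_intros simp: power2_eq_square mult_ac)
    moreover have "exp (- inverse t) * inverse t ^ 2 * inverse t ^ j
        - exp (- inverse t) * (real j * inverse t ^ (j - 1) * inverse t ^ 2)
        = flat (j + 2) t - real j * flat (j + 1) t"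
    proof -
      have "real j * inverse t ^ (j - 1) * inverse t ^ 2 = real j * inverse t ^ (j + 1)"
        by (cases j) (auto simp: power2_eq_square)
      thus ?thesis using 1 by (simp add: flat_def divide_inverse power_inverse power_add mult_ac power2_eq_square)
    qed
    ultimately have "((\<lambda>t. exp (- 1 / t) / t ^ j) has_real_derivative flat (j + 2) t - real j * flat (j + 1) t) (at t)"
      by (simp add: divide_inverse power_inverse)
    thus ?thesis
      by (rule has_field_derivative_transform_within_open[OF _ open_greaterThan[of 0]]) (use 1 in \<open>auto simp: flat_def\<close>)
  next
    case 2
    have "((\<lambda>t. 0) has_real_derivative flat (j + 2) t - real j * flat (j + 1) t) (at t)"
      using 2 by (auto simp: flat_def)
    thus ?thesis
      by (rule has_field_derivative_transform_within_open[OF _ open_lessThan[of 0]]) (use 2 in \<open>auto simp: flat_def\<close>)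
  next
    case 3
    have "((\<lambda>h. (flat j (0 + h) - flat j 0) / h) \<longlongrightarrow> 0) (at 0)"
    proof (rule Lim_null_comparison)
      show "\<forall>\<^sub>F h in at 0. norm ((flat j (0 + h) - flat j 0) / h) \<le> fact (j + 2) * \<bar>h\<bar>"
      proof (rule eventually_at_topological[THEN iffD2], intro exI[of _ UNIV] conjI ballI impI)
        fix h :: real assume "h \<noteq> 0"
        thus "norm ((flat j (0 + h) - flat j 0) / h) \<le> fact (j + 2) * \<bar>h\<bar>"
          using flat_le[of j h 2] by (simp add: flat_def[of j 0] abs_divide pos_divide_le_eq power2_eq_square mult.assoc del: abs_mult_self_eq)
      qed auto
      show "((\<lambda>h. fact (j + 2) * \<bar>h\<bar>) \<longlongrightarrow> (0::real)) (at 0)"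
        by (auto intro!: tendsto_eq_intros)
    qed
    thus ?thesis using 3 by (auto simp: DERIV_def flat_def[of _ 0])
  qed
qed

lemma smooth_on_flat [smooth_intros]:
  assumes S: "open S" and q: "smooth_on S q"
  shows "smooth_on S (\<lambda>x. flat j (q x))"
proof -
  have qd: "q differentiable at x" if "x \<in> S" for x
    using smooth_on_differentiable_at[OF q S that] .
  have der: "((\<lambda>x. flat j (q x)) has_derivative (\<lambda>v. (\<Sum>i\<in>UNIV. (v $ i) *\<^sub>R pderiv1 i q x) *
      (flat (j + 2) (q x) - real j * flat (j + 1) (q x)))) (at x)" if "x \<in> S" for x j
    using has_derivative_compose[OF has_derivative_pderiv1[OF qd[OF that]]
        DERIV_flat[of j "q x", unfolded has_field_derivative_def]] by (simp add: mult.commute)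
  have eq: "pderiv1 i (\<lambda>x. flat j (q x)) x =
      pderiv1 i q x * (flat (j + 2) (q x) + (- real j) * flat (j + 1) (q x))" if "x \<in> S" for x i j
    using pderiv1_eq[OF der[OF that]]
    by (auto simp: axis_def if_distrib if_distribR cong: if_cong)
  have dd: "(\<lambda>x. flat j (q x)) differentiable_on S" for j
    using der differentiable_on_eq_differentiable_at[OF S] differentiable_def by blast
  have "smooth_upto n S (\<lambda>x. flat j (q x))" for n
  proof (induction n arbitrary: j)
    case (Suc n)
    have "smooth_upto n S (\<lambda>x. pderiv1 i q x * (flat (j + 2) (q x) + (- real j) * flat (j + 1) (q x)))" for i
      using Suc smooth_on_pderiv1[OF q, of i] smooth_on_const[of S "- real j"]
      by (intro smooth_upto_add smooth_upto_bilinear[OF bounded_bilinear_mult S] S)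
         (auto simp: smooth_on_iff_upto)
    thus ?case using dd smooth_upto_cong[OF S eq] by (auto simp: smooth_upto_Suc)
  qed (use dd in \<open>auto simp: smooth_upto_0\<close>)
  thus ?thesis by (auto simp: smooth_on_iff_upto)
qed

lemma flat_nonneg [simp]: "flat j t \<ge> 0" by (simp add: flat_def)
lemma flat_pos_iff [simp]: "flat j t > 0 \<longleftrightarrow> t > 0" by (simp add: flat_def)
lemma flat_eq_0_iff [simp]: "flat j t = 0 \<longleftrightarrow> t \<le> 0" by (simp add: flat_def)

definition cutoff :: "real^'k::finite \<Rightarrow> real \<Rightarrow> real^'k \<Rightarrow> real" where
  "cutoff a r x = flat 0 (r\<^sup>2 - (x - a) \<bullet> (x - a)) /
     (flat 0 (r\<^sup>2 - (x - a) \<bullet> (x - a)) + flat 0 ((x - a) \<bullet> (x - a) - (r / 2)\<^sup>2))"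

lemma smooth_on_cutoff: assumes "r > 0" "open S" shows "smooth_on S (cutoff a r)"
proof -
  have "flat 0 (r\<^sup>2 - (x - a) \<bullet> (x - a)) + flat 0 ((x - a) \<bullet> (x - a) - (r / 2)\<^sup>2) \<noteq> 0" for x
  proof -
    have "(r / 2)\<^sup>2 < r\<^sup>2" using assms by (simp add: power_divide)
    hence "r\<^sup>2 - (x - a) \<bullet> (x - a) > 0 \<or> (x - a) \<bullet> (x - a) - (r / 2)\<^sup>2 > 0" by linarith
    thus ?thesis using flat_nonneg flat_pos_iff by (metis add_nonneg_eq_0_iff less_irrefl)
  qed
  thus ?thesis unfolding cutoff_def using assms by (auto intro!: smooth_intros)
qed

lemma cutoff_eq_1: assumes "r > 0" "dist x a \<le> r / 2" shows "cutoff a r x = 1"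
proof -
  have "(x - a) \<bullet> (x - a) \<le> (r / 2)\<^sup>2"
    using assms power_mono[of "norm (x - a)" "r / 2" 2] by (simp add: dist_norm power2_norm_eq_inner)
  moreover have "(r / 2)\<^sup>2 < r\<^sup>2" using assms by (simp add: power_divide)
  ultimately show ?thesis by (auto simp: cutoff_def flat_eq_0_iff[THEN iffD2])
qed

lemma cutoff_eq_0: assumes "r > 0" "dist x a \<ge> r" shows "cutoff a r x = 0"
proof -
  have "(x - a) \<bullet> (x - a) \<ge> r\<^sup>2"
    using assms power_mono[of r "norm (x - a)" 2] by (simp add: dist_norm power2_norm_eq_inner)
  thus ?thesis by (simp add: cutoff_def)
qed

lemma cutoff_nonneg: "cutoff a r x \<ge> 0"
  by (simp add: cutoff_def)

section \<open>Test functions and their integrals\<close>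

lemma smooth_on_extend:
  assumes "open S" "closed K" "K \<subseteq> S" "smooth_on S f" "\<And>x. x \<notin> K \<Longrightarrow> f x = 0"
  shows "smooth_on UNIV f"
proof (rule smooth_on_local)
  fix x :: "real^'a"
  show "\<exists>T. open T \<and> x \<in> T \<and> smooth_on T f"
  proof (cases "x \<in> S")
    case False
    have "smooth_on (- K) f"
      by (rule smooth_on_cong[OF _ _ smooth_on_const[of _ 0]]) (use assms in auto)
    thus ?thesis using False assms by (intro exI[of _ "- K"]) auto
  qed (use assms in auto)
qed

lemma test_funsI:
  assumes "open \<Omega>" "compact K" "K \<subseteq> \<Omega>" "smooth_on \<Omega> f" "\<And>x. x \<notin> K \<Longrightarrow> f x = 0"
  shows "f \<in> test_funs \<Omega>"
  using assms smooth_on_extend[OF assms(1) compact_imp_closed[OF assms(2)] assms(3-5)]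
  by (auto simp: test_funs_def)

lemma test_funsE:
  assumes "f \<in> test_funs \<Omega>"
  obtains K where "compact K" "K \<subseteq> \<Omega>" "smooth_on UNIV f" "\<And>x. x \<notin> K \<Longrightarrow> f x = 0"
  using assms by (auto simp: test_funs_def)

lemma test_funs_smooth: "f \<in> test_funs \<Omega> \<Longrightarrow> smooth_on S f"
  by (auto simp: test_funs_def intro: smooth_on_subset)

lemma test_funs_outside: "f \<in> test_funs \<Omega> \<Longrightarrow> x \<notin> \<Omega> \<Longrightarrow> f x = 0"
  by (auto simp: test_funs_def)

lemma test_funs_mono: "f \<in> test_funs \<Omega> \<Longrightarrow> \<Omega> \<subseteq> \<Omega>' \<Longrightarrow> f \<in> test_funs \<Omega>'"
  by (auto simp: test_funs_def)

lemma test_funs_zero: "(\<lambda>x. 0) \<in> test_funs \<Omega>"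
  by (auto simp: test_funs_def smooth_on_const intro: exI[of _ "{}"])

lemma test_funs_add:
  assumes "f \<in> test_funs \<Omega>" "g \<in> test_funs \<Omega>"
  shows "(\<lambda>x. f x + g x) \<in> test_funs \<Omega>"
proof -
  obtain K L where "compact K" "K \<subseteq> \<Omega>" "\<And>x. x \<notin> K \<Longrightarrow> f x = 0" "compact L" "L \<subseteq> \<Omega>" "\<And>x. x \<notin> L \<Longrightarrow> g x = 0"
    using assms by (metis test_funsE)
  thus ?thesis
    using assms unfolding test_funs_def by (auto intro!: smooth_intros exI[of _ "K \<union> L"])
qed

lemma test_funs_smooth_mult:
  assumes "open \<Omega>" "f \<in> test_funs \<Omega>" "smooth_on \<Omega> g"
  shows "(\<lambda>x. g x * f x) \<in> test_funs \<Omega>"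
proof -
  obtain K where K: "compact K" "K \<subseteq> \<Omega>" "\<And>x. x \<notin> K \<Longrightarrow> f x = 0"
    using assms by (metis test_funsE)
  have "smooth_on \<Omega> (\<lambda>x. g x * f x)"
    using assms test_funs_smooth by (intro smooth_intros) auto
  thus ?thesis using K assms by (intro test_funsI[of \<Omega> K]) auto
qed

lemma test_funs_cmult: "f \<in> test_funs \<Omega> \<Longrightarrow> (\<lambda>x. c * f x) \<in> test_funs \<Omega>"
  unfolding test_funs_def by (auto intro!: smooth_intros)

lemma test_funs_mult: "f \<in> test_funs \<Omega> \<Longrightarrow> smooth_on UNIV g \<Longrightarrow> (\<lambda>x. g x * f x) \<in> test_funs \<Omega>"
  unfolding test_funs_def by (auto intro!: smooth_intros)

lemma test_funs_diff:
  assumes "f \<in> test_funs \<Omega>" "g \<in> test_funs \<Omega>"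
  shows "(\<lambda>x. f x - g x) \<in> test_funs \<Omega>"
  using test_funs_add[OF assms(1) test_funs_cmult[OF assms(2), of "-1"]] by simp

lemma test_funs_sum:
  assumes "\<And>i. i \<in> I \<Longrightarrow> f i \<in> test_funs \<Omega>"
  shows "(\<lambda>x. \<Sum>i\<in>I. f i x) \<in> test_funs \<Omega>"
  using assms by (induction I rule: infinite_finite_induct) (auto intro!: test_funs_zero test_funs_add)

lemma test_funs_cnj: "f \<in> test_funs \<Omega> \<Longrightarrow> (\<lambda>x. cnj (f x)) \<in> test_funs \<Omega>"
  unfolding test_funs_def by (auto intro!: smooth_intros)

lemma pderiv1_vanishes:
  assumes "closed K" "\<And>x. x \<notin> K \<Longrightarrow> f x = 0" "x \<notin> K"
  shows "pderiv1 i f x = 0"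
  using pderiv1_cong[of "- K" x f "\<lambda>x. 0" i] assms by auto

lemma test_funs_pderiv1: "f \<in> test_funs \<Omega> \<Longrightarrow> pderiv1 i f \<in> test_funs \<Omega>"
proof -
  assume f: "f \<in> test_funs \<Omega>"
  then obtain K where K: "compact K" "K \<subseteq> \<Omega>" "\<And>x. x \<notin> K \<Longrightarrow> f x = 0"
    by (metis test_funsE)
  thus ?thesis
    using pderiv1_vanishes[OF compact_imp_closed[OF K(1)] K(3)] smooth_on_pderiv1[OF test_funs_smooth[OF f]]
    unfolding test_funs_def by (auto intro!: exI[of _ K])
qed

lemma test_funs_pderivs: "f \<in> test_funs \<Omega> \<Longrightarrow> pderivs is f \<in> test_funs \<Omega>"
  by (induction "is") (auto simp: pderivs_Cons test_funs_pderiv1)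

lemma test_funs_cutoff:
  assumes "r > 0" "cball a r \<subseteq> \<Omega>"
  shows "(\<lambda>x. of_real (cutoff a r x)) \<in> test_funs \<Omega>"
  unfolding test_funs_def using assms
  by (auto simp: dist_commute intro!: smooth_intros smooth_on_cutoff exI[of _ "cball a r"] cutoff_eq_0)

lemma integrable_compact_support:
  fixes f :: "'a::euclidean_space \<Rightarrow> 'b::{banach, second_countable_topology}"
  assumes "compact K" "continuous_on K f" "\<And>x. x \<notin> K \<Longrightarrow> f x = 0"
  shows "integrable lborel f"
proof -
  have "(\<lambda>x. indicator K x *\<^sub>R f x) = f" using assms(3) by (auto simp: indicator_def)
  thus ?thesis using borel_integrable_compact[OF assms(1,2)] by simp
qed

lemma test_funs_continuous: "f \<in> test_funs \<Omega> \<Longrightarrow> continuous_on S f"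
  using smooth_on_continuous[OF test_funs_smooth] .

lemma test_funs_integrable_mult:
  assumes f: "f \<in> test_funs \<Omega>" and "continuous_on \<Omega> g"
  shows "integrable lborel (\<lambda>x. g x * f x)"
proof -
  obtain K where K: "compact K" "K \<subseteq> \<Omega>" "\<And>x. x \<notin> K \<Longrightarrow> f x = 0"
    using assms by (metis test_funsE)
  show ?thesis
    by (rule integrable_compact_support[OF K(1)])
      (use K in \<open>auto intro!: continuous_intros continuous_on_subset[OF assms(2)] test_funs_continuous[OF f]\<close>)
qed

lemma test_funs_integrable: "f \<in> test_funs \<Omega> \<Longrightarrow> integrable lborel f"
  using test_funs_integrable_mult[of f \<Omega> "\<lambda>x. 1"] by simp

lemma integral_translate:
  fixes f :: "'a::euclidean_space \<Rightarrow> 'b::{banach, second_countable_topology}"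
  assumes "f \<in> borel_measurable borel"
  shows "(LINT x|lborel. f (x + c)) = (LINT x|lborel. f x)"
proof -
  have "(LINT x|lborel. f x) = (LINT x|distr lborel borel ((+) c). f x)"
    by (simp add: lborel_distr_plus)
  also have "\<dots> = (LINT x|lborel. f (c + x))"
    using assms by (intro integral_distr) auto
  finally show ?thesis by (simp add: add.commute)
qed

lemma test_funs_bounded:
  assumes "f \<in> test_funs \<Omega>"
  obtains M where "M \<ge> 0" "\<And>x. norm (f x) \<le> M"
proof -
  obtain K where K: "compact K" "K \<subseteq> \<Omega>" "\<And>x. x \<notin> K \<Longrightarrow> f x = 0"
    using assms by (metis test_funsE)
  have "bounded (f ` K)"
    by (intro compact_imp_bounded compact_continuous_image K test_funs_continuous[OF assms])
  then obtain M where "\<And>x. x \<in> K \<Longrightarrow> norm (f x) \<le> M" by (auto simp: bounded_iff)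
  hence "norm (f x) \<le> max M 0" for x using K(3)[of x] by (cases "x \<in> K") fastforce+
  thus ?thesis using that[of "max M 0"] by auto
qed

text \<open>Translation invariance makes the integral of every difference quotient vanish.\<close>
lemma integral_pderiv1_eq_0:
  assumes f: "f \<in> test_funs \<Omega>"
  shows "(LINT x|lborel. pderiv1 i f x) = 0"
proof -
  define e where "e = (axis i 1 :: real^'a)"
  have ne [simp]: "norm e = 1" by (simp add: e_def)
  have e0: "e \<noteq> 0" using ne by (metis norm_zero zero_neq_one)
  define h where "h n = inverse (real (Suc n))" for n
  have h: "h n > 0" "h n \<le> 1" for n by (auto simp: h_def divide_simps)
  define s where "s n x = (f (x + h n *\<^sub>R e) - f x) /\<^sub>R h n" for n x
  obtain K where K: "compact K" "\<And>x. x \<notin> K \<Longrightarrow> f x = 0"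
    using f by (metis test_funsE)
  obtain R where R: "K \<subseteq> cball 0 R" using compact_imp_bounded[OF K(1)] bounded_subset_ballD[of K 0] ball_subset_cball by (metis subset_trans)
  obtain M where M: "M \<ge> 0" "\<And>x. norm (pderiv1 i f x) \<le> M"
    using test_funs_bounded[OF test_funs_pderiv1[OF f]] by blast
  have dif: "f differentiable at x" for x
    using smooth_on_differentiable_at[OF test_funs_smooth[OF f, of UNIV]] by simp
  have D: "(f has_derivative (\<lambda>v. \<Sum>j\<in>UNIV. (v $ j) *\<^sub>R pderiv1 j f x)) (at x)" for x
    by (rule has_derivative_pderiv1[OF dif])
  have De: "(\<Sum>j\<in>UNIV. ((t *\<^sub>R e) $ j) *\<^sub>R pderiv1 j f x) = t *\<^sub>R pderiv1 i f x" for t x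
    by (simp add: e_def axis_def if_distrib if_distribR cong: if_cong)
  have bound: "norm (s n x) \<le> M * indicat_real (cball 0 (R + 1)) x" for n x
  proof (cases "x \<in> cball 0 (R + 1)")
    case True
    have "norm (f (x + h n *\<^sub>R e) - f (x + 0 *\<^sub>R e)) \<le> M * norm (h n - 0)"
    proof (rule differentiable_bound[of "{0..h n}" "\<lambda>t. f (x + t *\<^sub>R e)" "\<lambda>t u. u *\<^sub>R pderiv1 i f (x + t *\<^sub>R e)"])
      fix t assume "t \<in> {0..h n}"
      have "((\<lambda>t. x + t *\<^sub>R e) has_derivative (\<lambda>u. u *\<^sub>R e)) (at t within {0..h n})"
        by (auto intro!: derivative_eq_intros)
      from has_derivative_compose[OF this D[of "x + t *\<^sub>R e"]]
      show "((\<lambda>t. f (x + t *\<^sub>R e)) has_derivative (\<lambda>u. u *\<^sub>R pderiv1 i f (x + t *\<^sub>R e))) (at t within {0..h n})"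
        unfolding De .
      show "onorm (\<lambda>u. u *\<^sub>R pderiv1 i f (x + t *\<^sub>R e)) \<le> M"
        using M(2)[of "x + t *\<^sub>R e"] by (intro onorm_bound M) (auto simp: mult.commute[of M] intro!: mult_left_mono)
    qed (use h[of n] in auto)
    hence "norm (f (x + h n *\<^sub>R e) - f x) / h n \<le> M" using h(1)[of n] by (simp add: pos_divide_le_eq)
    moreover have "norm (s n x) = norm (f (x + h n *\<^sub>R e) - f x) / h n"
      using h(1)[of n] by (simp add: s_def divide_inverse mult.commute)
    ultimately show ?thesis using True by simp
  next
    case False
    hence "norm x > R + 1" by simp
    moreover have "norm x \<le> norm (x + h n *\<^sub>R e) + norm (h n *\<^sub>R e)"
      by (metis add_diff_cancel norm_triangle_ineq4)
    ultimately have "norm (x + h n *\<^sub>R e) > R" "norm x > R" using h[of n] by auto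
    hence "f (x + h n *\<^sub>R e) = 0" "f x = 0" using R K(2) by fastforce+
    thus ?thesis using M by (simp add: s_def)
  qed
  have lim: "(\<lambda>n. s n x) \<longlonglongrightarrow> pderiv1 i f x" for x
  proof -
    have A: "((\<lambda>v. norm (f (x + v) - f x - (\<Sum>j\<in>UNIV. (v $ j) *\<^sub>R pderiv1 j f x)) / norm v) \<longlongrightarrow> 0) (at 0)"
      using D[of x] by (simp add: has_derivative_at)
    have B: "filterlim (\<lambda>n. h n *\<^sub>R e) (at 0) sequentially"
    proof -
      have "h \<longlonglongrightarrow> 0" using LIMSEQ_inverse_real_of_nat unfolding h_def .
      hence "(\<lambda>n. h n *\<^sub>R e) \<longlonglongrightarrow> 0 *\<^sub>R e" by (intro tendsto_intros)
      moreover have "h n *\<^sub>R e \<noteq> 0" for n using h(1)[of n] e0 by simp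
      ultimately show ?thesis by (simp add: filterlim_at)
    qed
    have "(\<lambda>n. norm (f (x + h n *\<^sub>R e) - f x - h n *\<^sub>R pderiv1 i f x) / norm (h n *\<^sub>R e)) \<longlonglongrightarrow> 0"
      using filterlim_compose[OF A B] by (simp only: De)
    moreover have "norm (f (x + h n *\<^sub>R e) - f x - h n *\<^sub>R pderiv1 i f x) / norm (h n *\<^sub>R e) = norm (s n x - pderiv1 i f x)" for n
    proof -
      have "f (x + h n *\<^sub>R e) - f x - h n *\<^sub>R pderiv1 i f x = h n *\<^sub>R (s n x - pderiv1 i f x)"
        using h(1)[of n] by (simp add: s_def scaleR_diff_right)
      thus ?thesis using h(1)[of n] by simp
    qed
    ultimately have "(\<lambda>n. s n x - pderiv1 i f x) \<longlonglongrightarrow> 0" by (simp only: tendsto_norm_zero_iff)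
    thus ?thesis by (rule LIM_zero_cancel)
  qed
  have fm [measurable]: "f \<in> borel_measurable borel"
    by (rule borel_measurable_continuous_onI[OF test_funs_continuous[OF f]])
  have sint: "integral\<^sup>L lborel (s n) = 0" for n
  proof -
    have "integrable lborel (\<lambda>x. f (x + h n *\<^sub>R e))"
    proof (rule integrable_compact_support)
      show "compact ((\<lambda>x. x - h n *\<^sub>R e) ` K)"
        by (intro compact_continuous_image continuous_intros K)
      show "continuous_on ((\<lambda>x. x - h n *\<^sub>R e) ` K) (\<lambda>x. f (x + h n *\<^sub>R e))"
        by (intro continuous_on_compose2[OF test_funs_continuous[OF f, of UNIV]] continuous_intros) auto
      fix x assume "x \<notin> (\<lambda>x. x - h n *\<^sub>R e) ` K"
      hence "x + h n *\<^sub>R e \<notin> K" by (metis (no_types, lifting) add_diff_cancel image_eqI)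
      thus "f (x + h n *\<^sub>R e) = 0" by (rule K)
    qed
    moreover have "s n = (\<lambda>x. (f (x + h n *\<^sub>R e) - f x) /\<^sub>R h n)" by (simp add: s_def fun_eq_iff)
    ultimately show ?thesis
      using test_funs_integrable[OF f] integral_translate[OF fm, of "h n *\<^sub>R e"] by simp
  qed
  have "(\<lambda>n. integral\<^sup>L lborel (s n)) \<longlonglongrightarrow> integral\<^sup>L lborel (pderiv1 i f)"
  proof (rule integral_dominated_convergence[where w="\<lambda>x. M * indicat_real (cball 0 (R + 1)) x"])
    show "pderiv1 i f \<in> borel_measurable lborel"
      using borel_measurable_continuous_onI[OF test_funs_continuous[OF test_funs_pderiv1[OF f]]] by simp
    show "s n \<in> borel_measurable lborel" for n
      unfolding s_def by measurable
    show "integrable lborel (\<lambda>x. M * indicat_real (cball 0 (R + 1)) x)"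
      using emeasure_lborel_cball_finite[of 0 "R + 1"]
      by (intro integrable_mult_right integrable_real_indicator) auto
  qed (use lim bound in auto)
  hence "(\<lambda>n. 0) \<longlonglongrightarrow> integral\<^sup>L lborel (pderiv1 i f)" by (simp only: sint)
  from LIMSEQ_unique[OF tendsto_const this] show ?thesis by simp
qed

lemma integral_by_parts:
  assumes "open \<Omega>" "f \<in> test_funs \<Omega>" "smooth_on \<Omega> g"
  shows "(LINT x|lborel. g x * pderiv1 i f x) = - (LINT x|lborel. pderiv1 i g x * f x)"
proof -
  have eq: "pderiv1 i (\<lambda>x. g x * f x) x = g x * pderiv1 i f x + pderiv1 i g x * f x" for x
  proof (cases "x \<in> \<Omega>")
    case True
    thus ?thesis
      using smooth_on_differentiable_at[OF assms(3,1)] smooth_on_differentiable_at[OF test_funs_smooth[OF assms(2)], of \<Omega>]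
      by (intro pderiv1_bilinear[OF bounded_bilinear_mult]) (auto simp: assms)
  next
    case False
    thus ?thesis
      using test_funs_outside[OF test_funs_pderiv1[OF test_funs_smooth_mult[OF assms]]]
        test_funs_outside[OF assms(2)] test_funs_outside[OF test_funs_pderiv1[OF assms(2)]] by simp
  qed
  have "0 = (LINT x|lborel. g x * pderiv1 i f x + pderiv1 i g x * f x)"
    using integral_pderiv1_eq_0[OF test_funs_smooth_mult[OF assms], of i] by (simp add: eq)
  also have "\<dots> = (LINT x|lborel. g x * pderiv1 i f x) + (LINT x|lborel. pderiv1 i g x * f x)"
    using assms
    by (intro Bochner_Integration.integral_add test_funs_integrable_mult[where \<Omega>=\<Omega>] test_funs_pderiv1 smooth_on_continuous smooth_on_pderiv1)
  finally show ?thesis by (simp add: eq_neg_iff_add_eq_0)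
qed

lemma fundamental_lemma:
  assumes "open \<Omega>" "continuous_on \<Omega> g" and zero: "\<And>\<psi>. \<psi> \<in> test_funs \<Omega> \<Longrightarrow> (LINT x|lborel. g x * \<psi> x) = 0"
    and a: "a \<in> \<Omega>"
  shows "g a = 0"
proof (rule ccontr)
  assume ga: "g a \<noteq> 0"
  define q where "q x = Re (cnj (g a) * g x)" for x
  have qc: "continuous_on \<Omega> q" unfolding q_def by (intro continuous_intros assms)
  define c where "c = (norm (g a))\<^sup>2 / 2"
  have "q a = (norm (g a))\<^sup>2" unfolding cmod_power2 by (simp add: q_def power2_eq_square)
  hence c: "c > 0" "q a > c" using ga by (auto simp: c_def)
  have op: "open (\<Omega> \<inter> q -` {c<..})" using qc assms(1) by (intro continuous_open_preimage) auto
  have "a \<in> \<Omega> \<inter> q -` {c<..}" using a c by auto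
  then obtain r where r: "r > 0" "cball a r \<subseteq> \<Omega> \<inter> q -` {c<..}"
    using open_contains_cball_eq[OF op] by blast
  define \<psi> where "\<psi> x = cnj (g a) * complex_of_real (cutoff a r x)" for x
  have \<psi>: "\<psi> \<in> test_funs \<Omega>"
    unfolding \<psi>_def using r by (intro test_funs_cmult test_funs_cutoff) auto
  have int: "integrable lborel (\<lambda>x. g x * \<psi> x)"
    by (rule test_funs_integrable_mult[OF \<psi> assms(2)])
  have "c * measure lborel (cball a (r / 2)) = (LINT x|lborel. c * indicat_real (cball a (r / 2)) x)"
    by simp
  also have "\<dots> \<le> (LINT x|lborel. Re (g x * \<psi> x))"
  proof (rule integral_mono)
    show "integrable lborel (\<lambda>x. c * indicat_real (cball a (r / 2)) x)"
      using emeasure_lborel_cball_finite[of a "r / 2"]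
      by (intro integrable_mult_right integrable_real_indicator) auto
    show "integrable lborel (\<lambda>x. Re (g x * \<psi> x))"
      using integrable_bounded_linear[OF bounded_linear_Re int] .
    fix x
    have eq: "Re (g x * \<psi> x) = q x * cutoff a r x" by (simp add: \<psi>_def q_def algebra_simps)
    show "c * indicat_real (cball a (r / 2)) x \<le> Re (g x * \<psi> x)"
    proof (cases "x \<in> cball a r")
      case True
      hence "q x > c" using r by auto
      thus ?thesis using c r cutoff_eq_1[of r x a] cutoff_nonneg[of a r x]
        unfolding eq by (auto simp: indicator_def dist_commute)
    next
      case False
      thus ?thesis using r cutoff_eq_0[of r x a] unfolding eq by (auto simp: indicator_def dist_commute)
    qed
  qed
  also have "\<dots> = Re (LINT x|lborel. g x * \<psi> x)"
    using integral_bounded_linear[OF bounded_linear_Re int] .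
  also have "\<dots> = 0" using zero[OF \<psi>] by simp
  finally have "c * measure lborel (cball a (r / 2)) \<le> 0" .
  moreover have "measure lborel (cball a (r / 2)) > 0" using content_cball_pos[of "r / 2" a] r by simp
  ultimately show False using c by (simp add: mult_le_0_iff)
qed

lemma smooth_Urysohn:
  assumes "open \<Omega>" "compact K" "K \<subseteq> \<Omega>"
  obtains \<kappa> where "\<kappa> \<in> test_funs \<Omega>" "\<And>x. x \<in> K \<Longrightarrow> \<kappa> x = 1"
proof -
  have "\<forall>a\<in>K. \<exists>r>0. cball a r \<subseteq> \<Omega>" using assms open_contains_cball by blast
  then obtain r where r: "\<And>a. a \<in> K \<Longrightarrow> r a > 0" "\<And>a. a \<in> K \<Longrightarrow> cball a (r a) \<subseteq> \<Omega>" by metis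
  have "\<And>a. a \<in> K \<Longrightarrow> open (ball a (r a / 2))" by auto
  moreover have "K \<subseteq> (\<Union>a\<in>K. ball a (r a / 2))" using r by fastforce
  ultimately obtain F where F: "F \<subseteq> K" "finite F" "K \<subseteq> (\<Union>a\<in>F. ball a (r a / 2))"
    by (rule compactE_image[OF assms(2)])
  define \<kappa> where "\<kappa> F x = 1 - (\<Prod>a\<in>F. 1 - complex_of_real (cutoff a (r a) x))" for F x
  have "\<kappa> F \<in> test_funs \<Omega>"
    using F(2,1)
  proof (induction F)
    case empty thus ?case using test_funs_zero by (simp add: \<kappa>_def)
  next
    case (insert a F)
    define c where "c x = complex_of_real (cutoff a (r a) x)" for x
    have c: "c \<in> test_funs \<Omega>" unfolding c_def using insert r by (intro test_funs_cutoff) auto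
    have "\<kappa> (insert a F) = (\<lambda>x. c x + (\<kappa> F x - c x * \<kappa> F x))"
      using insert by (auto simp: fun_eq_iff \<kappa>_def c_def algebra_simps)
    moreover have "(\<lambda>x. c x + (\<kappa> F x - c x * \<kappa> F x)) \<in> test_funs \<Omega>"
      using insert c by (intro test_funs_add test_funs_diff test_funs_mult test_funs_smooth[OF c]) auto
    ultimately show ?case by simp
  qed
  moreover have "\<kappa> F x = 1" if "x \<in> K" for x
  proof -
    obtain a where "a \<in> F" "x \<in> ball a (r a / 2)" using F(3) \<open>x \<in> K\<close> by blast
    hence a: "a \<in> F" "dist a x < r a / 2" by auto
    hence "cutoff a (r a) x = 1" using r F by (intro cutoff_eq_1) (auto simp: dist_commute)
    thus ?thesis using a F by (auto simp: \<kappa>_def)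
  qed
  ultimately show ?thesis using that by blast
qed

section \<open>Hadamard's lemma\<close>

definition ray_moment :: "real^'k::finite \<Rightarrow> nat \<Rightarrow> (real^'k \<Rightarrow> complex) \<Rightarrow> real^'k \<Rightarrow> complex" where
  "ray_moment a n F x = integral (cbox 0 (1::real)) (\<lambda>t. t ^ n *\<^sub>R F (a + t *\<^sub>R (x - a)))"

lemma ray_in_ball:
  fixes a :: "'a::real_normed_vector"
  assumes "x \<in> ball a r" "t \<in> cbox 0 (1::real)"
  shows "a + t *\<^sub>R (x - a) \<in> ball a r"
proof -
  have "norm (t *\<^sub>R (x - a)) \<le> 1 * norm (x - a)"
    unfolding norm_scaleR using assms by (intro mult_right_mono) auto
  thus ?thesis using assms by (auto simp: dist_norm norm_minus_commute)
qed

lemma has_derivative_ray_moment: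
  assumes F: "smooth_on (ball a r) F" and x0: "x0 \<in> ball a r"
  shows "(ray_moment a n F has_derivative (\<lambda>v. \<Sum>i\<in>UNIV. (v $ i) *\<^sub>R ray_moment a (Suc n) (pderiv1 i F) x0)) (at x0)"
proof -
  define fx where "fx x t = (\<Sum>i\<in>UNIV. blinfun_scaleR_left (t ^ Suc n *\<^sub>R pderiv1 i F (a + t *\<^sub>R (x - a)))
      o\<^sub>L blinfun_inner_left (axis i 1 :: real^'a))" for x and t :: real
  have fx: "blinfun_apply (fx x t) v = (\<Sum>i\<in>UNIV. (v $ i) *\<^sub>R (t ^ Suc n *\<^sub>R pderiv1 i F (a + t *\<^sub>R (x - a))))" for x t and v :: "real^'a"
    by (simp add: fx_def blinfun.sum_left cart_eq_inner_axis)
  have ray: "continuous_on (ball a r \<times> cbox 0 1) (\<lambda>(x, t). G (a + t *\<^sub>R (x - a)))"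
    if "continuous_on (ball a r) G" for G :: "real^'a \<Rightarrow> complex"
    unfolding split_beta
    by (rule continuous_on_compose2[OF that]) (auto intro!: continuous_intros ray_in_ball simp del: mem_ball)
  have ray1: "continuous_on (cbox 0 1) (\<lambda>t::real. G (a + t *\<^sub>R (x - a)))"
    if "continuous_on (ball a r) G" "x \<in> ball a r" for G :: "real^'a \<Rightarrow> complex" and x
    by (rule continuous_on_compose2[OF that(1)]) (use ray_in_ball[OF that(2)] in \<open>auto intro!: continuous_intros simp del: mem_ball\<close>)
  have Fc: "continuous_on (ball a r) F" "continuous_on (ball a r) (pderiv1 i F)" for i
    using F smooth_on_pderiv1 smooth_on_continuous by blast+
  have "((\<lambda>x. integral (cbox 0 1) (\<lambda>t. t ^ n *\<^sub>R F (a + t *\<^sub>R (x - a)))) has_derivative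
      blinfun_apply (integral (cbox 0 1) (fx x0))) (at x0 within ball a r)"
  proof (rule leibniz_rule)
    fix x and t :: real assume x: "x \<in> ball a r" and t: "t \<in> cbox 0 1"
    have "((\<lambda>x. a + t *\<^sub>R (x - a)) has_derivative (\<lambda>v. t *\<^sub>R v)) (at x within ball a r)"
      by (auto intro!: derivative_eq_intros simp: scaleR_diff_right)
    from has_derivative_compose[OF this has_derivative_pderiv1[OF smooth_on_differentiable_at[OF F open_ball ray_in_ball[OF x t]]]]
    have "((\<lambda>x. F (a + t *\<^sub>R (x - a))) has_derivative
        (\<lambda>v. \<Sum>i\<in>UNIV. ((t *\<^sub>R v) $ i) *\<^sub>R pderiv1 i F (a + t *\<^sub>R (x - a)))) (at x within ball a r)" by simp
    hence "((\<lambda>x. t ^ n *\<^sub>R F (a + t *\<^sub>R (x - a))) has_derivative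
        (\<lambda>v. t ^ n *\<^sub>R (\<Sum>i\<in>UNIV. ((t *\<^sub>R v) $ i) *\<^sub>R pderiv1 i F (a + t *\<^sub>R (x - a))))) (at x within ball a r)"
      by (rule has_derivative_scaleR_right)
    thus "((\<lambda>x. t ^ n *\<^sub>R F (a + t *\<^sub>R (x - a))) has_derivative blinfun_apply (fx x t)) (at x within ball a r)"
      by (rule has_derivative_eq_rhs) (simp add: fun_eq_iff fx scaleR_sum_right mult_ac)
  next
    fix x assume x: "x \<in> ball a r"
    show "(\<lambda>t. t ^ n *\<^sub>R F (a + t *\<^sub>R (x - a))) integrable_on cbox 0 1"
      by (intro integrable_continuous continuous_intros ray1 Fc x)
  next
    show "continuous_on (ball a r \<times> cbox 0 1) (\<lambda>(x, t). fx x t)"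
      using ray[OF Fc(2)] unfolding fx_def split_beta
      by (intro continuous_intros bounded_linear.continuous_on[OF bounded_linear_blinfun_scaleR_left])
  qed (use x0 in auto)
  moreover have "blinfun_apply (integral (cbox 0 1) (fx x0)) v =
      (\<Sum>i\<in>UNIV. (v $ i) *\<^sub>R ray_moment a (Suc n) (pderiv1 i F) x0)" for v
  proof -
    have int: "(\<lambda>t. t ^ Suc n *\<^sub>R pderiv1 i F (a + t *\<^sub>R (x0 - a))) integrable_on cbox 0 1" for i
      by (intro integrable_continuous continuous_intros ray1 Fc x0)
    have "continuous_on (cbox 0 1) (fx x0)"
      unfolding fx_def
      by (intro continuous_intros bounded_linear.continuous_on[OF bounded_linear_blinfun_scaleR_left] ray1 Fc x0)
    hence "fx x0 integrable_on cbox 0 1" by (rule integrable_continuous)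
    hence "blinfun_apply (integral (cbox 0 1) (fx x0)) v = integral (cbox 0 1) (\<lambda>t. blinfun_apply (fx x0 t) v)"
      by (rule blinfun_apply_integral)
    also have "\<dots> = (\<Sum>i\<in>UNIV. integral (cbox 0 1) (\<lambda>t. (v $ i) *\<^sub>R (t ^ Suc n *\<^sub>R pderiv1 i F (a + t *\<^sub>R (x0 - a)))))"
      unfolding fx by (intro integral_sum integrable_cmul int) auto
    also have "\<dots> = (\<Sum>i\<in>UNIV. (v $ i) *\<^sub>R ray_moment a (Suc n) (pderiv1 i F) x0)"
      unfolding ray_moment_def by (intro sum.cong refl integral_cmul)
    finally show ?thesis .
  qed
  hence "blinfun_apply (integral (cbox 0 1) (fx x0)) = (\<lambda>v. \<Sum>i\<in>UNIV. (v $ i) *\<^sub>R ray_moment a (Suc n) (pderiv1 i F) x0)"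
    by blast
  ultimately have "((\<lambda>x. integral (cbox 0 1) (\<lambda>t. t ^ n *\<^sub>R F (a + t *\<^sub>R (x - a)))) has_derivative
      (\<lambda>v. \<Sum>i\<in>UNIV. (v $ i) *\<^sub>R ray_moment a (Suc n) (pderiv1 i F) x0)) (at x0 within ball a r)"
    by simp
  moreover have "ray_moment a n F = (\<lambda>x. integral (cbox 0 1) (\<lambda>t. t ^ n *\<^sub>R F (a + t *\<^sub>R (x - a))))"
    by (simp add: ray_moment_def fun_eq_iff)
  ultimately show ?thesis by (simp only: at_within_open[OF x0 open_ball])
qed

lemma smooth_on_ray_moment:
  assumes F: "smooth_on (ball a r) F"
  shows "smooth_on (ball a r) (ray_moment a n F)"
proof -
  have "smooth_upto k (ball a r) (ray_moment a n F)" if "smooth_on (ball a r) F" for k n F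
    using that
  proof (induction k arbitrary: n F)
    case 0
    thus ?case using has_derivative_ray_moment[OF 0]
      by (auto simp: smooth_upto_0 intro!: differentiable_onI differentiableI)
  next
    case (Suc k)
    have eq: "pderiv1 i (ray_moment a n F) x = ray_moment a (Suc n) (pderiv1 i F) x" if "x \<in> ball a r" for i x
      using pderiv1_eq[OF has_derivative_ray_moment[OF Suc.prems that]]
      by (simp add: axis_def if_distrib if_distribR cong: if_cong)
    have "smooth_upto k (ball a r) (pderiv1 i (ray_moment a n F))" for i
      by (rule smooth_upto_cong[OF open_ball eq Suc.IH[OF smooth_on_pderiv1[OF Suc.prems]]])
    thus ?case using has_derivative_ray_moment[OF Suc.prems]
      by (auto simp: smooth_upto_Suc intro!: differentiable_onI differentiableI)
  qed
  thus ?thesis using F by (simp add: smooth_on_iff_upto)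
qed

lemma Hadamard:
  assumes F: "smooth_on (ball a r) F"
  shows "x \<in> ball a r \<Longrightarrow> F x = F a + (\<Sum>i\<in>UNIV. of_real (x $ i - a $ i) * ray_moment a 0 (pderiv1 i F) x)"
    and "ray_moment a 0 (pderiv1 i F) a = pderiv1 i F a"
proof -
  show "ray_moment a 0 (pderiv1 i F) a = pderiv1 i F a" by (simp add: ray_moment_def)
  assume x: "x \<in> ball a r"
  have "((\<lambda>t. \<Sum>i\<in>UNIV. (x $ i - a $ i) *\<^sub>R pderiv1 i F (a + t *\<^sub>R (x - a))) has_integral
      F (a + 1 *\<^sub>R (x - a)) - F (a + 0 *\<^sub>R (x - a))) {0..1}"
  proof (rule fundamental_theorem_of_calculus)
    fix t :: real assume "t \<in> {0..1}"
    hence t: "t \<in> cbox 0 1" by simp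
    have "((\<lambda>t. a + t *\<^sub>R (x - a)) has_derivative (\<lambda>u. u *\<^sub>R (x - a))) (at t within {0..1})"
      by (auto intro!: derivative_eq_intros)
    from has_derivative_compose[OF this has_derivative_pderiv1[OF smooth_on_differentiable_at[OF F open_ball ray_in_ball[OF x t]]]]
    show "((\<lambda>t. F (a + t *\<^sub>R (x - a))) has_vector_derivative
        (\<Sum>i\<in>UNIV. (x $ i - a $ i) *\<^sub>R pderiv1 i F (a + t *\<^sub>R (x - a)))) (at t within {0..1})"
      unfolding has_vector_derivative_def
      by (rule has_derivative_eq_rhs) (auto simp: fun_eq_iff scaleR_sum_right)
  qed simp
  hence "F x - F a = integral (cbox 0 1) (\<lambda>t. \<Sum>i\<in>UNIV. (x $ i - a $ i) *\<^sub>R pderiv1 i F (a + t *\<^sub>R (x - a)))"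
    by (simp add: integral_unique)
  also have "\<dots> = (\<Sum>i\<in>UNIV. integral (cbox 0 1) (\<lambda>t. (x $ i - a $ i) *\<^sub>R pderiv1 i F (a + t *\<^sub>R (x - a))))"
  proof (intro integral_sum integrable_cmul integrable_continuous)
    show "continuous_on (cbox 0 1) (\<lambda>t. pderiv1 i F (a + t *\<^sub>R (x - a)))" for i
      by (rule continuous_on_compose2[OF smooth_on_continuous[OF smooth_on_pderiv1[OF F]]])
        (use ray_in_ball[OF x] in \<open>auto intro!: continuous_intros simp del: mem_ball\<close>)
  qed auto
  also have "\<dots> = (\<Sum>i\<in>UNIV. of_real (x $ i - a $ i) * ray_moment a 0 (pderiv1 i F) x)"
    by (simp add: ray_moment_def scaleR_conv_of_real)
  finally show "F x = F a + (\<Sum>i\<in>UNIV. of_real (x $ i - a $ i) * ray_moment a 0 (pderiv1 i F) x)"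
    by (simp add: algebra_simps)
qed

section \<open>Fourier coefficients of test functions\<close>

definition wave :: "real^'k::finite \<Rightarrow> real^'k \<Rightarrow> complex" where
  "wave \<xi> x = cis (x \<bullet> \<xi>)"

lemma norm_wave [simp]: "norm (wave \<xi> x) = 1"
  by (simp add: wave_def)

lemma wave_nonzero [simp]: "wave \<xi> x \<noteq> 0"
  by (simp add: wave_def)

lemma wave_add: "wave (\<xi> + \<eta>) x = wave \<xi> x * wave \<eta> x"
  by (simp add: wave_def inner_add_right cis_mult)

lemma wave_add_right: "wave \<xi> (x + y) = wave \<xi> x * wave \<xi> y"
  by (simp add: wave_def inner_add_left cis_mult)

lemma wave_0 [simp]: "wave 0 x = 1" "wave \<xi> 0 = 1"
  by (simp_all add: wave_def)

lemma wave_uminus: "wave (- \<xi>) x = cnj (wave \<xi> x)"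
  by (simp add: wave_def cis_cnj)

lemma wave_mult_uminus [simp]: "wave \<xi> x * wave (- \<xi>) x = 1" "wave (- \<xi>) x * wave \<xi> x = 1"
  by (simp_all add: wave_add[symmetric])

lemma has_derivative_wave: "(wave \<xi> has_derivative (\<lambda>v. of_real (v \<bullet> \<xi>) * (\<i> * wave \<xi> x))) (at x)"
proof -
  have "((\<lambda>x. \<i> * of_real (x \<bullet> \<xi>)) has_derivative (\<lambda>v. \<i> * of_real (v \<bullet> \<xi>))) (at x)"
    by (auto intro!: derivative_eq_intros)
  from has_derivative_compose[OF this DERIV_exp[unfolded has_field_derivative_def]]
  show ?thesis by (simp add: wave_def[abs_def] cis_conv_exp mult_ac)
qed

lemma pderiv1_cmult_wave: "pderiv1 i (\<lambda>x. c * wave \<xi> x) = (\<lambda>x. (c * (\<i> * of_real (\<xi> $ i))) * wave \<xi> x)"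
proof
  fix x
  have "((\<lambda>x. c * wave \<xi> x) has_derivative (\<lambda>v. c * (of_real (v \<bullet> \<xi>) * (\<i> * wave \<xi> x)))) (at x)"
    by (rule has_derivative_mult_right[OF has_derivative_wave])
  from pderiv1_eq[OF this] show "pderiv1 i (\<lambda>x. c * wave \<xi> x) x = (c * (\<i> * of_real (\<xi> $ i))) * wave \<xi> x"
    by (simp add: inner_axis' mult_ac)
qed

definition symbol :: "real^'k::finite \<Rightarrow> 'k list \<Rightarrow> complex" where
  "symbol \<xi> is = prod_list (map (\<lambda>i. \<i> * of_real (\<xi> $ i)) is)"

lemma pderivs_cmult_wave: "pderivs is (\<lambda>x. c * wave \<xi> x) = (\<lambda>x. c * symbol \<xi> is * wave \<xi> x)"
proof (induction "is")
  case (Cons i "is")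
  show ?case unfolding pderivs_Cons Cons pderiv1_cmult_wave by (simp add: symbol_def mult_ac)
qed (simp add: symbol_def)

lemma pderivs_wave: "pderivs is (wave \<xi>) = (\<lambda>x. symbol \<xi> is * wave \<xi> x)"
  using pderivs_cmult_wave[of "is" 1] by simp

lemma norm_symbol_le: assumes "length is \<le> r" shows "norm (symbol \<xi> is) \<le> (1 + norm \<xi>) ^ r"
proof -
  have "norm (symbol \<xi> is) \<le> (1 + norm \<xi>) ^ length is"
  proof (induction "is")
    case (Cons i "is")
    have "norm (symbol \<xi> (i # is)) = \<bar>\<xi> $ i\<bar> * norm (symbol \<xi> is)"
      by (simp add: symbol_def norm_mult)
    also have "\<dots> \<le> (1 + norm \<xi>) * (1 + norm \<xi>) ^ length is"
      using Cons component_le_norm_cart[of \<xi> i] by (intro mult_mono) auto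
    finally show ?case by simp
  qed (simp add: symbol_def)
  also have "\<dots> \<le> (1 + norm \<xi>) ^ r" using assms by (intro power_increasing) auto
  finally show ?thesis .
qed

lemma smooth_on_wave [smooth_intros]: "smooth_on S (wave \<xi>)"
proof (rule smooth_on_subset[of UNIV])
  show "smooth_on UNIV (wave \<xi>)"
    unfolding smooth_on_def pderivs_wave
    using has_derivative_mult_right[OF has_derivative_wave]
    by (auto intro!: differentiable_onI differentiableI)
qed auto

lemma continuous_on_wave [continuous_intros]: "continuous_on S (wave \<xi>)"
  by (rule smooth_on_continuous[OF smooth_on_wave])

definition fourier :: "(real^'k::finite \<Rightarrow> complex) \<Rightarrow> real^'k \<Rightarrow> complex" where
  "fourier f \<xi> = (LINT x|lborel. wave (- \<xi>) x * f x)"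

lemma integrable_wave_mult: "f \<in> test_funs \<Omega> \<Longrightarrow> integrable lborel (\<lambda>x. wave \<xi> x * f x)"
  by (rule test_funs_integrable_mult) (auto intro: continuous_intros)

lemma fourier_diff:
  assumes "f \<in> test_funs \<Omega>" "g \<in> test_funs \<Omega>"
  shows "fourier (\<lambda>x. f x - g x) \<xi> = fourier f \<xi> - fourier g \<xi>"
  unfolding fourier_def using integrable_wave_mult[OF assms(1)] integrable_wave_mult[OF assms(2)]
  by (simp add: algebra_simps)

lemma fourier_cmult: "fourier (\<lambda>x. c * f x) \<xi> = c * fourier f \<xi>"
  unfolding fourier_def by (simp add: mult.left_commute)

lemma fourier_sum:
  assumes "\<And>i. i \<in> I \<Longrightarrow> f i \<in> test_funs \<Omega>"
  shows "fourier (\<lambda>x. \<Sum>i\<in>I. f i x) \<xi> = (\<Sum>i\<in>I. fourier (f i) \<xi>)"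
  unfolding fourier_def sum_distrib_left
  by (intro Bochner_Integration.integral_sum integrable_wave_mult[OF assms])

lemma fourier_wave_mult: "fourier (\<lambda>x. wave \<eta> x * f x) \<xi> = fourier f (\<xi> - \<eta>)"
proof -
  have "(\<lambda>x. wave (- \<xi>) x * (wave \<eta> x * f x)) = (\<lambda>x. wave (- (\<xi> - \<eta>)) x * f x)"
    using wave_add[of "- \<xi>" \<eta>] by (simp add: mult.assoc[symmetric])
  thus ?thesis unfolding fourier_def by (simp only:)
qed

lemma fourier_pderiv1:
  assumes "f \<in> test_funs \<Omega>"
  shows "fourier (pderiv1 i f) \<xi> = \<i> * of_real (\<xi> $ i) * fourier f \<xi>"
proof -
  have "pderiv1 i (wave (- \<xi>)) x = (\<i> * of_real (- \<xi> $ i)) * wave (- \<xi>) x" for x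
    using pderiv1_cmult_wave[of i 1 "- \<xi>"] by simp
  thus ?thesis unfolding fourier_def
    using integral_by_parts[OF open_UNIV test_funs_mono[OF assms subset_UNIV] smooth_on_wave, of "- \<xi>" i]
    by (simp add: mult.assoc)
qed

lemma fourier_pderivs:
  assumes "f \<in> test_funs \<Omega>"
  shows "fourier (pderivs is f) \<xi> = symbol \<xi> is * fourier f \<xi>"
  using assms
  by (induction "is") (auto simp: symbol_def pderivs_Cons fourier_pderiv1[OF test_funs_pderivs])

lemma fourier_decay:
  assumes "f \<in> test_funs \<Omega>"
  obtains C where "C \<ge> 0" "\<And>\<xi>. norm (fourier f \<xi>) * (1 + norm \<xi>) ^ N \<le> C"
proof -
  have "\<exists>C\<ge>0. \<forall>\<xi>. norm (fourier f \<xi>) * (1 + norm \<xi>) ^ N \<le> C" if "f \<in> test_funs \<Omega>" for f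
    using that
  proof (induction N arbitrary: f)
    case 0
    have "norm (fourier f \<xi>) \<le> (LINT x|lborel. norm (f x))" for \<xi>
      using integral_norm_bound[of lborel "\<lambda>x. wave (- \<xi>) x * f x"] by (simp add: fourier_def norm_mult)
    thus ?case by (auto intro!: exI[of _ "LINT x|lborel. norm (f x)"])
  next
    case (Suc N)
    obtain C where C: "C \<ge> 0" "\<And>\<xi>. norm (fourier f \<xi>) * (1 + norm \<xi>) ^ N \<le> C"
      using Suc by blast
    have "\<forall>i. \<exists>C\<ge>0. \<forall>\<xi>. norm (fourier (pderiv1 i f) \<xi>) * (1 + norm \<xi>) ^ N \<le> C"
      using Suc test_funs_pderiv1 by blast
    then obtain D where D: "\<And>i. D i \<ge> 0" "\<And>i \<xi>. norm (fourier (pderiv1 i f) \<xi>) * (1 + norm \<xi>) ^ N \<le> D i"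
      by metis
    show ?case
    proof (intro exI[of _ "C + (\<Sum>i\<in>UNIV. D i)"] conjI allI)
      show "0 \<le> C + (\<Sum>i\<in>UNIV. D i)" using C D by (simp add: sum_nonneg)
      fix \<xi> :: "real^'a"
      have "norm (fourier f \<xi>) * (1 + norm \<xi>) ^ Suc N = norm (fourier f \<xi>) * (1 + norm \<xi>) ^ N * (1 + norm \<xi>)"
        by (simp add: mult_ac)
      also have "\<dots> \<le> norm (fourier f \<xi>) * (1 + norm \<xi>) ^ N * (1 + (\<Sum>i\<in>UNIV. \<bar>\<xi> $ i\<bar>))"
        using norm_le_l1_cart[of \<xi>] by (intro mult_left_mono) auto
      also have "\<dots> = norm (fourier f \<xi>) * (1 + norm \<xi>) ^ N +
          (\<Sum>i\<in>UNIV. norm (fourier (pderiv1 i f) \<xi>) * (1 + norm \<xi>) ^ N)"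
        by (simp add: fourier_pderiv1[OF Suc.prems] norm_mult sum_distrib_left sum_distrib_right algebra_simps)
      also have "\<dots> \<le> C + (\<Sum>i\<in>UNIV. D i)"
        by (intro add_mono sum_mono C D)
      finally show "norm (fourier f \<xi>) * (1 + norm \<xi>) ^ Suc N \<le> C + (\<Sum>i\<in>UNIV. D i)" .
    qed
  qed
  thus ?thesis using assms that by blast
qed

section \<open>Fourier series\<close>

definition latt :: "real \<Rightarrow> int^'k::finite \<Rightarrow> real^'k" where
  "latt h m = (\<chi> i. h * of_int (m $ i))"

lemma latt_nth [simp]: "latt h m $ i = h * of_int (m $ i)"
  by (simp add: latt_def)

lemma summable_on_int_inverse_square:
  assumes "h > 0"
  shows "(\<lambda>n::int. inverse ((1 + h * \<bar>of_int n\<bar>)\<^sup>2) :: real) summable_on UNIV"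
proof -
  define a where "a n = inverse ((1 + h * \<bar>real_of_int n\<bar>)\<^sup>2)" for n
  have "summable (\<lambda>n. norm (inverse ((1 + h * real n)\<^sup>2)))"
  proof (rule summable_comparison_test)
    show "summable (\<lambda>n. inverse (h\<^sup>2) * inverse ((real n)\<^sup>2))"
      by (intro summable_mult inverse_power_summable) simp
    show "\<exists>N. \<forall>n\<ge>N. norm (norm (inverse ((1 + h * real n)\<^sup>2))) \<le> inverse (h\<^sup>2) * inverse ((real n)\<^sup>2)"
    proof (intro exI[of _ 1] allI impI)
      fix n :: nat assume "1 \<le> n"
      hence "inverse ((1 + h * real n)\<^sup>2) \<le> inverse ((h * real n)\<^sup>2)"
        using assms by (intro le_imp_inverse_le power_mono) auto
      thus "norm (norm (inverse ((1 + h * real n)\<^sup>2))) \<le> inverse (h\<^sup>2) * inverse ((real n)\<^sup>2)"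
        by (simp add: power_mult_distrib)
    qed
  qed
  hence S: "(\<lambda>n::nat. inverse ((1 + h * real n)\<^sup>2)) summable_on UNIV"
    by (rule norm_summable_imp_summable_on)
  have "a summable_on range int"
    by (subst summable_on_reindex) (use S in \<open>auto simp: o_def a_def\<close>)
  moreover have "a summable_on range (\<lambda>n. - int n)"
    by (subst summable_on_reindex) (use S in \<open>auto simp: o_def a_def inj_on_def\<close>)
  ultimately have "a summable_on (range int \<union> range (\<lambda>n. - int n))"
    by (rule summable_on_union)
  moreover have "range int \<union> range (\<lambda>n. - int n) = UNIV"
  proof -
    have "x \<in> range int \<union> range (\<lambda>n. - int n)" for x by (cases x rule: int_cases2) auto
    thus ?thesis by blast
  qed
  ultimately show ?thesis unfolding a_def by simp
qed

lemma lattice_summable: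
  assumes h: "h > 0"
  shows "(\<lambda>m::int^'k::finite. inverse ((1 + norm (latt h m)) ^ (2 * CARD('k)))) summable_on UNIV"
proof -
  define a where "a n = inverse ((1 + h * \<bar>real_of_int n\<bar>)\<^sup>2)" for n
  have a0: "a n \<ge> 0" for n by (simp add: a_def)
  have as: "a summable_on UNIV" unfolding a_def by (rule summable_on_int_inverse_square[OF h])
  have "(\<lambda>m::int^'k. \<Prod>i\<in>UNIV. a (m $ i)) summable_on UNIV"
  proof (rule nonneg_bdd_above_summable_on)
    show "bdd_above (sum (\<lambda>m::int^'k. \<Prod>i\<in>UNIV. a (m $ i)) ` {F. F \<subseteq> UNIV \<and> finite F})"
    proof (rule bdd_aboveI2)
      fix F :: "(int^'k) set" assume "F \<in> {F. F \<subseteq> UNIV \<and> finite F}"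
      hence F: "finite F" by simp
      define I where "I i = (\<lambda>m. m $ i) ` F" for i
      have I: "finite (I i)" for i using F by (simp add: I_def)
      have "(\<Sum>m\<in>F. \<Prod>i\<in>UNIV. a (m $ i)) = (\<Sum>g\<in>vec_nth ` F. \<Prod>i\<in>UNIV. a (g i))"
        by (subst sum.reindex) (auto simp: inj_on_def vec_nth_inject)
      also have "\<dots> \<le> (\<Sum>g\<in>Pi\<^sub>E UNIV I. \<Prod>i\<in>UNIV. a (g i))"
        using I a0 by (intro sum_mono2 finite_PiE prod_nonneg) (auto simp: I_def)
      also have "\<dots> = (\<Prod>i\<in>UNIV. \<Sum>n\<in>I i. a n)"
        by (rule prod_sum_PiE[symmetric]) (use I in auto)
      also have "\<dots> \<le> (\<Prod>i\<in>(UNIV::'k set). infsum a UNIV)"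
        using a0 as I by (intro prod_mono conjI sum_nonneg finite_sum_le_infsum) auto
      finally show "(\<Sum>m\<in>F. \<Prod>i\<in>UNIV. a (m $ i)) \<le> (\<Prod>i\<in>(UNIV::'k set). infsum a UNIV)" .
    qed
  qed (use a0 in \<open>auto intro: prod_nonneg\<close>)
  thus ?thesis
  proof (rule summable_on_comparison_test)
    fix m :: "int^'k"
    have "(\<Prod>i\<in>UNIV. (1 + h * \<bar>real_of_int (m $ i)\<bar>)\<^sup>2) \<le> (\<Prod>i\<in>(UNIV::'k set). (1 + norm (latt h m))\<^sup>2)"
    proof (intro prod_mono conjI power_mono)
      fix i
      show "1 + h * \<bar>real_of_int (m $ i)\<bar> \<le> 1 + norm (latt h m)"
        using component_le_norm_cart[of "latt h m" i] h by (simp add: abs_mult)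
    qed (use h in auto)
    also have "\<dots> = (1 + norm (latt h m)) ^ (2 * CARD('k))"
      by (simp add: power_mult)
    finally have "inverse ((1 + norm (latt h m)) ^ (2 * CARD('k))) \<le> inverse (\<Prod>i\<in>UNIV. (1 + h * \<bar>real_of_int (m $ i)\<bar>)\<^sup>2)"
      using h by (intro le_imp_inverse_le prod_pos zero_less_power ballI add_pos_nonneg) auto
    also have "\<dots> = (\<Prod>i\<in>UNIV. a (m $ i))"
      by (simp add: a_def prod_inversef[symmetric] o_def)
    finally show "inverse ((1 + norm (latt h m)) ^ (2 * CARD('k))) \<le> (\<Prod>i\<in>UNIV. a (m $ i))" .
  qed auto
qed

lemma has_sum_diff:
  fixes f g :: "'i \<Rightarrow> 'b::real_normed_vector"
  assumes "(f has_sum a) A" "(g has_sum b) A"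
  shows "((\<lambda>x. f x - g x) has_sum (a - b)) A"
  using has_sum_add[OF assms(1) has_sum_bounded_linear[OF bounded_linear_minus[OF bounded_linear_ident] assms(2)]]
  by simp

lemma has_sum_if_diff_has_sum_0:
  fixes f g :: "'i \<Rightarrow> 'b::real_normed_vector"
  assumes "((\<lambda>x. f x - g x) has_sum 0) A" "(g has_sum b) A"
  shows "(f has_sum b) A"
  using has_sum_add[OF assms] by simp

lemma has_sum_finite_sum:
  fixes f :: "'j \<Rightarrow> 'i \<Rightarrow> 'b::real_normed_vector"
  assumes "\<And>j. j \<in> J \<Longrightarrow> (f j has_sum a j) A"
  shows "((\<lambda>x. \<Sum>j\<in>J. f j x) has_sum (\<Sum>j\<in>J. a j)) A"
  using assms by (induction J rule: infinite_finite_induct) (auto intro: has_sum_add)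

definition rapid :: "real \<Rightarrow> (int^'k::finite \<Rightarrow> complex) \<Rightarrow> bool" where
  "rapid h c \<longleftrightarrow> (\<forall>N. (\<lambda>m. norm (c m) * (1 + norm (latt h m)) ^ N) summable_on UNIV)"

lemma rapidI:
  fixes c :: "int^'k::finite \<Rightarrow> complex"
  assumes h: "h > 0" and C: "\<And>N. \<exists>C. \<forall>m. norm (c m) * (1 + norm (latt h m)) ^ N \<le> C"
  shows "rapid h c"
  unfolding rapid_def
proof
  fix N
  obtain C where C: "\<And>m. norm (c m) * (1 + norm (latt h m)) ^ (N + 2 * CARD('k)) \<le> C"
    using C[of "N + 2 * CARD('k)"] by blast
  have "(\<lambda>m::int^'k. C * inverse ((1 + norm (latt h m)) ^ (2 * CARD('k)))) summable_on UNIV"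
    by (rule summable_on_cmult_right[OF lattice_summable[OF h]])
  thus "(\<lambda>m. norm (c m) * (1 + norm (latt h m)) ^ N) summable_on UNIV"
  proof (rule summable_on_comparison_test)
    fix m :: "int^'k"
    have p: "(1 + norm (latt h m)) ^ (2 * CARD('k)) > 0" by (intro zero_less_power add_pos_nonneg) auto
    show "norm (c m) * (1 + norm (latt h m)) ^ N \<le> C * inverse ((1 + norm (latt h m)) ^ (2 * CARD('k)))"
      using C[of m] p by (simp add: divide_inverse[symmetric] pos_le_divide_eq power_add mult_ac)
  qed auto
qed

lemma rapid_fourier: "h > 0 \<Longrightarrow> f \<in> test_funs \<Omega> \<Longrightarrow> rapid h (\<lambda>m. fourier f (latt h m))"
  by (rule rapidI) (metis fourier_decay)+

lemma rapid_abs_summable: "rapid h c \<Longrightarrow> (\<lambda>m. norm (c m)) summable_on UNIV"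
  unfolding rapid_def by (drule spec[of _ 0]) simp

lemma rapid_mult_bounded:
  assumes c: "rapid h c" and b: "\<And>m. norm (b m) \<le> B * (1 + norm (latt h m)) ^ M"
  shows "rapid h (\<lambda>m. c m * b m)"
  unfolding rapid_def
proof
  fix N
  have "(\<lambda>m. B * (norm (c m) * (1 + norm (latt h m)) ^ (M + N))) summable_on UNIV"
    using c unfolding rapid_def by (intro summable_on_cmult_right) blast
  thus "(\<lambda>m. norm (c m * b m) * (1 + norm (latt h m)) ^ N) summable_on UNIV"
  proof (rule summable_on_comparison_test)
    fix m
    have "norm (c m * b m) * (1 + norm (latt h m)) ^ N \<le> norm (c m) * (B * (1 + norm (latt h m)) ^ M) * (1 + norm (latt h m)) ^ N"
      unfolding norm_mult by (intro mult_right_mono mult_left_mono b) auto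
    thus "norm (c m * b m) * (1 + norm (latt h m)) ^ N \<le> B * (norm (c m) * (1 + norm (latt h m)) ^ (M + N))"
      by (simp add: power_add mult_ac)
  qed auto
qed

definition wave_series :: "real \<Rightarrow> (int^'k::finite \<Rightarrow> complex) \<Rightarrow> real^'k \<Rightarrow> complex" where
  "wave_series h c x = (\<Sum>\<^sub>\<infinity>m. c m * wave (latt h m) x)"

lemma wave_series_has_sum:
  assumes "rapid h c"
  shows "((\<lambda>m. c m * wave (latt h m) x) has_sum wave_series h c x) UNIV"
  unfolding wave_series_def
  by (rule has_sum_infsum, rule abs_summable_summable) (use rapid_abs_summable[OF assms] in \<open>simp add: norm_mult\<close>)

lemma wave_series_uniform:
  assumes "rapid h c"
  shows "uniform_limit UNIV (\<lambda>F x. \<Sum>m\<in>F. c m * wave (latt h m) x) (wave_series h c) (finite_subsets_at_top UNIV)"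
  unfolding wave_series_def[abs_def]
  by (rule Weierstrass_m_test_general[OF _ rapid_abs_summable[OF assms]]) (simp add: norm_mult)

lemma has_derivative_quadratic:
  assumes "bounded_linear D" "\<And>v. norm (f (x + v) - f x - D v) \<le> C * (norm v)\<^sup>2"
  shows "(f has_derivative D) (at x)"
  unfolding has_derivative_at
proof
  show "((\<lambda>v. norm (f (x + v) - f x - D v) / norm v) \<longlongrightarrow> 0) (at 0)"
  proof (rule Lim_null_comparison)
    have "norm (f (x + v) - f x - D v) / norm v \<le> C * norm v" for v
      using assms(2)[of v] by (cases "v = 0") (auto simp: divide_simps power2_eq_square mult_ac)
    thus "\<forall>\<^sub>F v in at 0. norm (norm (f (x + v) - f x - D v) / norm v) \<le> C * norm v"
      by (intro always_eventually) auto
    show "((\<lambda>v. C * norm v) \<longlongrightarrow> 0) (at 0)" by (auto intro!: tendsto_eq_intros)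
  qed
qed fact

lemma has_derivative_wave_series:
  assumes c: "rapid h c"
  shows "(wave_series h c has_derivative
    (\<lambda>v. \<Sum>i\<in>UNIV. (v $ i) *\<^sub>R wave_series h (\<lambda>m. c m * (\<i> * of_real (latt h m $ i))) x)) (at x)"
proof -
  have ci: "rapid h (\<lambda>m. c m * (\<i> * of_real (latt h m $ i)))" for i
  proof (rule rapid_mult_bounded[OF c])
    show "norm (\<i> * complex_of_real (latt h m $ i)) \<le> 1 * (1 + norm (latt h m)) ^ 1" for m
      using component_le_norm_cart[of "latt h m" i] by (simp add: norm_mult del: latt_nth)
  qed
  define C where "C = (\<Sum>\<^sub>\<infinity>m. norm (c m) * (1 + norm (latt h m))\<^sup>2)"
  have C: "((\<lambda>m. norm (c m) * (1 + norm (latt h m))\<^sup>2) has_sum C) UNIV"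
    unfolding C_def using c by (intro has_sum_infsum) (auto simp: rapid_def)
  show ?thesis
  proof (rule has_derivative_quadratic)
    show "bounded_linear (\<lambda>v. \<Sum>i\<in>UNIV. (v $ i) *\<^sub>R wave_series h (\<lambda>m. c m * (\<i> * of_real (latt h m $ i))) x)"
      by (intro bounded_linear_sum bounded_linear_compose[OF bounded_linear_scaleR_left bounded_linear_vec_nth])
    fix v :: "real^'a"
    define T where "T m = c m * wave (latt h m) (x + v) - c m * wave (latt h m) x
      - (\<Sum>i\<in>UNIV. (v $ i) *\<^sub>R (c m * (\<i> * of_real (latt h m $ i)) * wave (latt h m) x))" for m
    have sum: "(T has_sum (wave_series h c (x + v) - wave_series h c x
      - (\<Sum>i\<in>UNIV. (v $ i) *\<^sub>R wave_series h (\<lambda>m. c m * (\<i> * of_real (latt h m $ i))) x))) UNIV"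
      unfolding T_def
      by (intro has_sum_diff has_sum_finite_sum has_sum_bounded_linear[OF bounded_linear_scaleR_right] wave_series_has_sum c ci)
    have Tle: "norm (T m) \<le> (norm v)\<^sup>2 * (norm (c m) * (1 + norm (latt h m))\<^sup>2)" for m
    proof -
      define t where "t = v \<bullet> latt h m"
      have "(\<Sum>i\<in>UNIV. (v $ i) *\<^sub>R (c m * (\<i> * of_real (latt h m $ i)) * wave (latt h m) x)) =
          c m * wave (latt h m) x * (\<i> * of_real t)"
        by (simp add: t_def inner_vec_def sum_distrib_left scaleR_conv_of_real mult_ac)
      hence "T m = c m * wave (latt h m) x * (cis t - 1 - \<i> * of_real t)"
      proof -
        assume s: "(\<Sum>i\<in>UNIV. (v $ i) *\<^sub>R (c m * (\<i> * of_real (latt h m $ i)) * wave (latt h m) x)) =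
          c m * wave (latt h m) x * (\<i> * of_real t)"
        have w: "wave (latt h m) (x + v) = wave (latt h m) x * cis t"
          unfolding wave_add_right by (simp add: wave_def t_def)
        show ?thesis unfolding T_def s w by (simp add: algebra_simps)
      qed
      moreover have "norm (cis t - 1 - \<i> * of_real t) \<le> \<bar>t\<bar>\<^sup>2"
        using Taylor_exp[of "\<i> * of_real t" 1]
        by (simp add: cis_conv_exp norm_mult power2_eq_square diff_diff_eq del: abs_mult_self_eq)
      moreover have "\<bar>t\<bar> \<le> norm v * norm (latt h m)" unfolding t_def by (rule Cauchy_Schwarz_ineq2)
      ultimately have "norm (T m) \<le> norm (c m) * (norm v * norm (latt h m))\<^sup>2"
      proof -
        assume 1: "T m = c m * wave (latt h m) x * (cis t - 1 - \<i> * of_real t)"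
          and 2: "norm (cis t - 1 - \<i> * of_real t) \<le> \<bar>t\<bar>\<^sup>2" and 3: "\<bar>t\<bar> \<le> norm v * norm (latt h m)"
        have "norm (T m) = norm (c m) * norm (cis t - 1 - \<i> * of_real t)" by (simp add: 1 norm_mult)
        also have "\<dots> \<le> norm (c m) * \<bar>t\<bar>\<^sup>2" by (intro mult_left_mono 2) auto
        also have "\<dots> \<le> norm (c m) * (norm v * norm (latt h m))\<^sup>2"
          by (intro mult_left_mono power_mono 3) auto
        finally show ?thesis .
      qed
      also have "\<dots> \<le> norm (c m) * (norm v * (1 + norm (latt h m)))\<^sup>2"
        by (intro mult_left_mono power_mono) auto
      finally show ?thesis by (simp add: power_mult_distrib mult_ac)
    qed
    have "(\<lambda>m. (norm v)\<^sup>2 * (norm (c m) * (1 + norm (latt h m))\<^sup>2)) summable_on UNIV"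
      using C by (intro summable_on_cmult_right) (auto simp: summable_on_def)
    hence Ts: "(\<lambda>m. norm (T m)) summable_on UNIV"
      by (rule summable_on_comparison_test) (use Tle in auto)
    have "norm (infsum T UNIV) \<le> infsum (\<lambda>m. norm (T m)) UNIV"
      by (rule norm_infsum_bound[OF Ts])
    also have "\<dots> \<le> (norm v)\<^sup>2 * C"
      by (rule has_sum_mono[OF has_sum_infsum[OF Ts] has_sum_cmult_right[OF C] Tle])
    finally show "norm (wave_series h c (x + v) - wave_series h c x
      - (\<Sum>i\<in>UNIV. (v $ i) *\<^sub>R wave_series h (\<lambda>m. c m * (\<i> * of_real (latt h m $ i))) x)) \<le> C * (norm v)\<^sup>2"
      using infsumI[OF sum] by (simp add: mult.commute)
  qed
qed

lemma smooth_on_wave_series: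
  assumes "rapid h c"
  shows "smooth_on S (wave_series h c)"
proof -
  have "smooth_upto k UNIV (wave_series h c)" for k
    using assms
  proof (induction k arbitrary: c)
    case 0
    show ?case using has_derivative_wave_series[OF 0]
      by (auto simp: smooth_upto_0 intro!: differentiable_onI differentiableI)
  next
    case (Suc k)
    have ci: "rapid h (\<lambda>m. c m * (\<i> * of_real (latt h m $ i)))" for i
    proof (rule rapid_mult_bounded[OF Suc.prems])
      show "norm (\<i> * complex_of_real (latt h m $ i)) \<le> 1 * (1 + norm (latt h m)) ^ 1" for m
        using component_le_norm_cart[of "latt h m" i] by (simp add: norm_mult del: latt_nth)
    qed
    have "pderiv1 i (wave_series h c) = wave_series h (\<lambda>m. c m * (\<i> * of_real (latt h m $ i)))" for i
    proof
      fix x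
      show "pderiv1 i (wave_series h c) x = wave_series h (\<lambda>m. c m * (\<i> * of_real (latt h m $ i))) x"
        using pderiv1_eq[OF has_derivative_wave_series[OF Suc.prems], of i x]
        by (simp add: axis_def if_distrib if_distribR cong: if_cong)
    qed
    thus ?case using Suc.IH[OF ci] has_derivative_wave_series[OF Suc.prems]
      by (auto simp: smooth_upto_Suc intro!: differentiable_onI differentiableI)
  qed
  thus ?thesis using smooth_on_subset[of UNIV] smooth_on_iff_upto by blast
qed

lemma wave_series_integral:
  assumes c: "rapid h c" and \<psi>: "\<psi> \<in> test_funs \<Omega>"
  shows "((\<lambda>m. c m * (LINT x|lborel. wave (latt h m) x * \<psi> x)) has_sum (LINT x|lborel. wave_series h c x * \<psi> x)) UNIV"
  unfolding has_sum_def
proof (rule tendstoI)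
  fix e :: real assume e: "e > 0"
  define I where "I = (LINT x|lborel. norm (\<psi> x))"
  have I: "I \<ge> 0" by (simp add: I_def)
  have inorm: "integrable lborel (\<lambda>x. norm (\<psi> x))" using test_funs_integrable[OF \<psi>] by simp
  have iS: "integrable lborel (\<lambda>x. wave_series h c x * \<psi> x)"
    by (rule test_funs_integrable_mult[OF \<psi> smooth_on_continuous[OF smooth_on_wave_series[OF c]]])
  have "\<forall>\<^sub>F F in finite_subsets_at_top UNIV. \<forall>x\<in>UNIV.
      dist (\<Sum>m\<in>F. c m * wave (latt h m) x) (wave_series h c x) < e / (I + 1)"
    using e I by (intro uniform_limitD[OF wave_series_uniform[OF c]]) auto
  thus "\<forall>\<^sub>F F in finite_subsets_at_top UNIV.
      dist (\<Sum>m\<in>F. c m * (LINT x|lborel. wave (latt h m) x * \<psi> x)) (LINT x|lborel. wave_series h c x * \<psi> x) < e"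
  proof eventually_elim
    case (elim F)
    have i1: "integrable lborel (\<lambda>x. c m * (wave (latt h m) x * \<psi> x))" for m
      using integrable_wave_mult[OF \<psi>] by (rule integrable_mult_right)
    have iF: "integrable lborel (\<lambda>x. \<Sum>m\<in>F. c m * (wave (latt h m) x * \<psi> x))"
      by (intro Bochner_Integration.integrable_sum i1)
    have "(\<Sum>m\<in>F. c m * (LINT x|lborel. wave (latt h m) x * \<psi> x)) =
        (LINT x|lborel. (\<Sum>m\<in>F. c m * (wave (latt h m) x * \<psi> x)))"
      using i1 by (subst Bochner_Integration.integral_sum) auto
    hence "dist (\<Sum>m\<in>F. c m * (LINT x|lborel. wave (latt h m) x * \<psi> x)) (LINT x|lborel. wave_series h c x * \<psi> x)
        = norm (LINT x|lborel. (\<Sum>m\<in>F. c m * (wave (latt h m) x * \<psi> x)) - wave_series h c x * \<psi> x)"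
      using iF iS by (simp add: dist_norm)
    also have "\<dots> \<le> (LINT x|lborel. norm ((\<Sum>m\<in>F. c m * (wave (latt h m) x * \<psi> x)) - wave_series h c x * \<psi> x))"
      by (rule integral_norm_bound)
    also have "\<dots> \<le> (LINT x|lborel. e / (I + 1) * norm (\<psi> x))"
    proof (rule integral_mono)
      show "integrable lborel (\<lambda>x. norm ((\<Sum>m\<in>F. c m * (wave (latt h m) x * \<psi> x)) - wave_series h c x * \<psi> x))"
        using iF iS by simp
      show "integrable lborel (\<lambda>x. e / (I + 1) * norm (\<psi> x))" using inorm by simp
      fix x
      have "(\<Sum>m\<in>F. c m * (wave (latt h m) x * \<psi> x)) - wave_series h c x * \<psi> x =
          ((\<Sum>m\<in>F. c m * wave (latt h m) x) - wave_series h c x) * \<psi> x"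
        by (simp add: sum_distrib_right left_diff_distrib mult.assoc)
      moreover have "norm ((\<Sum>m\<in>F. c m * wave (latt h m) x) - wave_series h c x) \<le> e / (I + 1)"
        using elim by (auto simp: dist_norm intro: less_imp_le)
      ultimately show "norm ((\<Sum>m\<in>F. c m * (wave (latt h m) x * \<psi> x)) - wave_series h c x * \<psi> x) \<le> e / (I + 1) * norm (\<psi> x)"
        by (simp only: norm_mult mult_right_mono norm_ge_zero)
    qed
    also have "\<dots> = e / (I + 1) * I" by (simp add: I_def)
    also have "\<dots> < e" using e I by (simp add: field_simps)
    finally show ?case .
  qed
qed

definition cube :: "real \<Rightarrow> (real^'k::finite) set" where
  "cube h = {x. \<forall>i. \<bar>x $ i\<bar> < pi / h}"

lemma open_cube: "open (cube h :: (real^'k::finite) set)"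
proof -
  have "(cube h :: (real^'k) set) = (\<Inter>i\<in>UNIV. {x. \<bar>x $ i\<bar> < pi / h})" by (auto simp: cube_def)
  moreover have "open \<dots>" by (intro open_INT ballI open_Collect_less continuous_intros) auto
  ultimately show ?thesis by simp
qed

lemma bounded_cube: "bounded (cube h :: (real^'k::finite) set)"
  unfolding bounded_iff
proof (intro exI ballI)
  fix x :: "real^'k" assume "x \<in> cube h"
  hence "(\<Sum>i\<in>UNIV. \<bar>x $ i\<bar>) \<le> (\<Sum>i\<in>(UNIV::'k set). pi / h)" by (intro sum_mono) (auto simp: cube_def less_imp_le)
  thus "norm x \<le> (\<Sum>i\<in>(UNIV::'k set). pi / h)" using norm_le_l1_cart[of x] by linarith
qed

lemma cis_eq_imp_eq:
  assumes "cis s = cis t" "\<bar>s - t\<bar> < 2 * pi"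
  shows "s = t"
proof -
  have "cis (s - t) = 1" using assms(1) by (simp add: cis_divide[symmetric])
  hence "cos (s - t) = 1" by (simp add: complex_eq_iff)
  then obtain n :: int where n: "s - t = n * 2 * pi" using cos_one_2pi_int by auto
  hence "\<bar>of_int n\<bar> * (2 * pi) < 1 * (2 * pi)" using assms(2) by (simp add: abs_mult)
  hence "\<bar>real_of_int n\<bar> < 1" by (subst (asm) mult_less_cancel_right_pos) auto
  hence "n = 0" by linarith
  thus ?thesis using n by simp
qed

text \<open>On the cube, the coordinate difference \<open>x\<^sub>j - a\<^sub>j\<close> in Hadamard's lemma can be traded
  for the difference of the fundamental waves in direction \<open>j\<close>, which vanishes only where the
  coordinate difference does.\<close>
lemma wave_Hadamard:
  fixes a :: "real^'k::finite"
  assumes h: "h > 0" and f: "f \<in> test_funs (cube h)" and a: "a \<in> cube h" and fa: "f a = 0"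
  obtains G where "\<And>j. G j \<in> test_funs (cube h)"
    "\<And>x. f x = (\<Sum>j\<in>UNIV. (wave (latt h (axis j 1)) x - wave (latt h (axis j 1)) a) * G j x)"
proof -
  define W where "W j = wave (latt h (axis j 1) :: real^'k)" for j
  obtain R where R: "cube h \<subseteq> ball a R"
    using bounded_subset_ballD[OF bounded_cube] by blast
  define w where "w j = ray_moment a 0 (pderiv1 j (W j))" for j
  define g where "g j = ray_moment a 0 (pderiv1 j f)" for j
  have W: "smooth_on S (W j)" for S j unfolding W_def by (rule smooth_on_wave)
  have inner: "x \<bullet> latt h (axis j 1) = h * x $ j" for x :: "real^'k" and j
    by (simp add: inner_vec_def axis_def if_distrib if_distribR cong: if_cong)
  have Wd: "W j x - W j a = of_real (x $ j - a $ j) * w j x" if "x \<in> ball a R" for x j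
  proof -
    have "pderiv1 i (W j) = (\<lambda>x. 0)" if "i \<noteq> j" for i
      using pderiv1_cmult_wave[of i 1 "latt h (axis j 1)"] that by (simp add: W_def axis_def)
    hence "ray_moment a 0 (pderiv1 i (W j)) x = 0" if "i \<noteq> j" for i
      using that by (simp add: ray_moment_def)
    hence "(\<Sum>i\<in>UNIV. of_real (x $ i - a $ i) * ray_moment a 0 (pderiv1 i (W j)) x) = of_real (x $ j - a $ j) * w j x"
      unfolding w_def by (subst sum.remove[of _ j]) (auto intro!: sum.neutral)
    thus ?thesis using Hadamard(1)[OF W that, of j] by simp
  qed
  have wnz: "w j x \<noteq> 0" if x: "x \<in> cube h" for x j
  proof (cases "x $ j = a $ j")
    case True
    have "pderiv1 j (W j) = (\<lambda>x. \<i> * of_real h * W j x)"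
      using pderiv1_cmult_wave[of j 1 "latt h (axis j 1)"] by (simp add: W_def)
    moreover have "W j (a + t *\<^sub>R (x - a)) = W j a" for t
      unfolding W_def wave_def inner using True by simp
    ultimately have "pderiv1 j (W j) (a + t *\<^sub>R (x - a)) = \<i> * of_real h * W j a" for t
      by simp
    hence "w j x = \<i> * of_real h * W j a" by (simp add: w_def ray_moment_def)
    thus ?thesis using h by (simp add: W_def)
  next
    case False
    have "W j x \<noteq> W j a"
    proof
      assume "W j x = W j a"
      moreover have "\<bar>h * x $ j - h * a $ j\<bar> < 2 * pi"
      proof -
        have "\<bar>x $ j\<bar> < pi / h" "\<bar>a $ j\<bar> < pi / h" using x a by (auto simp: cube_def)
        hence "h * \<bar>x $ j\<bar> < pi" "h * \<bar>a $ j\<bar> < pi" using h by (auto simp: field_simps)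
        hence "\<bar>h * x $ j\<bar> < pi" "\<bar>h * a $ j\<bar> < pi" using h by (auto simp: abs_mult)
        thus ?thesis by linarith
      qed
      ultimately have "h * x $ j = h * a $ j"
        by (intro cis_eq_imp_eq) (auto simp: W_def wave_def inner)
      thus False using False h by simp
    qed
    thus ?thesis using Wd[of x j] x R by auto
  qed
  obtain K where K: "compact K" "K \<subseteq> cube h" "\<And>x. x \<notin> K \<Longrightarrow> f x = 0"
    using f by (metis test_funsE)
  obtain \<kappa> where \<kappa>: "\<kappa> \<in> test_funs (cube h)" "\<And>x. x \<in> K \<Longrightarrow> \<kappa> x = 1"
    using smooth_Urysohn[OF open_cube K(1,2)] by blast
  define G where "G j x = g j x / w j x * \<kappa> x" for j x
  show ?thesis
  proof
    show "G j \<in> test_funs (cube h)" for j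
    proof -
      have "smooth_on (cube h) (g j)"
        unfolding g_def by (rule smooth_on_subset[OF smooth_on_ray_moment R])
          (rule smooth_on_pderiv1[OF test_funs_smooth[OF f]])
      moreover have "smooth_on (cube h) (w j)"
        unfolding w_def by (rule smooth_on_subset[OF smooth_on_ray_moment R])
          (rule smooth_on_pderiv1[OF W])
      ultimately have "smooth_on (cube h) (\<lambda>x. g j x / w j x)"
        using wnz by (intro smooth_intros open_cube)
      thus ?thesis unfolding G_def by (rule test_funs_smooth_mult[OF open_cube \<kappa>(1)])
    qed
    fix x
    show "f x = (\<Sum>j\<in>UNIV. (wave (latt h (axis j 1)) x - wave (latt h (axis j 1)) a) * G j x)"
    proof (cases "x \<in> K")
      case True
      hence x: "x \<in> cube h" "x \<in> ball a R" using K R by auto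
      have "f x = (\<Sum>j\<in>UNIV. of_real (x $ j - a $ j) * g j x)"
        using Hadamard(1)[OF test_funs_smooth[OF f] x(2)] fa by (simp add: g_def)
      also have "\<dots> = (\<Sum>j\<in>UNIV. (W j x - W j a) * G j x)"
        using wnz[OF x(1)] \<kappa>(2)[OF True] unfolding Wd[OF x(2)] by (simp add: G_def)
      finally show ?thesis by (simp add: W_def)
    next
      case False
      have "(W j x - W j a) * G j x = of_real (x $ j - a $ j) * g j x * \<kappa> x" for j
      proof (cases "x \<in> cube h")
        case True
        thus ?thesis using wnz[OF True, of j] R Wd[of x j] by (auto simp: G_def)
      next
        case False
        thus ?thesis using test_funs_outside[OF \<kappa>(1)] by (simp add: G_def)
      qed
      hence "(\<Sum>j\<in>UNIV. (W j x - W j a) * G j x) = (\<Sum>j\<in>UNIV. of_real (x $ j - a $ j) * g j x) * \<kappa> x"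
        by (simp add: sum_distrib_right)
      also have "\<dots> = 0"
      proof (cases "x \<in> cube h")
        case True
        hence "(\<Sum>j\<in>UNIV. of_real (x $ j - a $ j) * g j x) = f x"
          using Hadamard(1)[OF test_funs_smooth[OF f], of x a R] R fa by (auto simp: g_def)
        thus ?thesis using K(3)[OF False] by simp
      qed (use test_funs_outside[OF \<kappa>(1)] in auto)
      finally show ?thesis using K(3)[OF False] by (simp add: W_def)
    qed
  qed
qed

lemma fourier_series_at_zero_of_function:
  fixes a :: "real^'k::finite"
  assumes h: "h > 0" and f: "f \<in> test_funs (cube h)" and a: "a \<in> cube h" and fa: "f a = 0"
  shows "((\<lambda>m. fourier f (latt h m) * wave (latt h m) a) has_sum 0) UNIV"
proof -
  obtain G where G: "\<And>j. G j \<in> test_funs (cube h)"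
    and fG: "\<And>x. f x = (\<Sum>j\<in>UNIV. (wave (latt h (axis j 1)) x - wave (latt h (axis j 1)) a) * G j x)"
    using wave_Hadamard[OF assms] by blast
  define b where "b j = (latt h (axis j 1) :: real^'k)" for j
  define S where "S j = wave_series h (\<lambda>m. fourier (G j) (latt h m)) a" for j
  have S: "((\<lambda>m. fourier (G j) (latt h m) * wave (latt h m) a) has_sum S j) UNIV" for j
    unfolding S_def by (rule wave_series_has_sum[OF rapid_fourier[OF h G]])
  have shift: "((\<lambda>m. fourier (G j) (latt h m - b j) * wave (latt h m) a) has_sum wave (b j) a * S j) UNIV" for j
  proof -
    have bij: "bij_betw (\<lambda>m. m - axis j 1 :: int^'k) UNIV UNIV"
      by (rule bij_betwI[where g="\<lambda>m. m + axis j 1"]) auto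
    have "((\<lambda>m. fourier (G j) (latt h (m - axis j 1)) * wave (latt h (m - axis j 1)) a) has_sum S j) UNIV"
      using S[of j] has_sum_reindex_bij_betw[OF bij, of "\<lambda>m. fourier (G j) (latt h m) * wave (latt h m) a"] by simp
    hence "((\<lambda>m. wave (b j) a * (fourier (G j) (latt h (m - axis j 1)) * wave (latt h (m - axis j 1)) a)) has_sum wave (b j) a * S j) UNIV"
      by (rule has_sum_cmult_right)
    moreover have "latt h (m - axis j 1) = latt h m - b j" for m
      by (simp add: vec_eq_iff b_def algebra_simps)
    moreover have "wave (b j) a * wave (latt h m - b j) a = wave (latt h m) a" for m
      by (simp add: wave_add[symmetric])
    ultimately show ?thesis by (simp add: mult.left_commute[of "wave (b j) a"])
  qed
  have "((\<lambda>m. \<Sum>j\<in>UNIV. fourier (G j) (latt h m - b j) * wave (latt h m) a - wave (b j) a * (fourier (G j) (latt h m) * wave (latt h m) a))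
      has_sum (\<Sum>j\<in>UNIV. wave (b j) a * S j - wave (b j) a * S j)) UNIV"
    by (intro has_sum_finite_sum has_sum_diff shift has_sum_cmult_right S)
  moreover have "(\<Sum>j\<in>UNIV. fourier (G j) (\<xi> - b j) - wave (b j) a * fourier (G j) \<xi>) = fourier f \<xi>" for \<xi>
  proof -
    have t: "(\<lambda>x. wave (b j) x * G j x) \<in> test_funs (cube h)" "(\<lambda>x. wave (b j) a * G j x) \<in> test_funs (cube h)" for j
      by (intro test_funs_mult test_funs_cmult G smooth_on_wave)+
    have "fourier f \<xi> = fourier (\<lambda>x. \<Sum>j\<in>UNIV. wave (b j) x * G j x - wave (b j) a * G j x) \<xi>"
      using fG by (simp add: fourier_def b_def left_diff_distrib)
    also have "\<dots> = (\<Sum>j\<in>UNIV. fourier (\<lambda>x. wave (b j) x * G j x - wave (b j) a * G j x) \<xi>)"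
      by (rule fourier_sum[OF test_funs_diff[OF t]])
    also have "\<dots> = (\<Sum>j\<in>UNIV. fourier (G j) (\<xi> - b j) - wave (b j) a * fourier (G j) \<xi>)"
      by (simp only: fourier_diff[OF t] fourier_wave_mult fourier_cmult)
    finally show ?thesis by simp
  qed
  hence "(\<Sum>j\<in>UNIV. fourier (G j) (latt h m - b j) * wave (latt h m) a - wave (b j) a * (fourier (G j) (latt h m) * wave (latt h m) a))
     = fourier f (latt h m) * wave (latt h m) a" for m
    by (simp add: sum_distrib_right[symmetric] left_diff_distrib[symmetric] mult.assoc[symmetric])
  ultimately show ?thesis by simp
qed

text \<open>The constant is the volume of the cube; only its being nonzero matters, and that follows
  from the orthogonality relation \<open>\<integral> f \<bar>f\<bar> = \<Sum> \<bar>f\<^sub>m\<bar>\<^sup>2\<close> for an arbitrary test function.\<close>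
lemma fourier_series:
  assumes h: "h > 0"
  obtains \<kappa> :: complex where "\<kappa> \<noteq> 0"
    "\<And>f x :: real^'k::finite. f \<in> test_funs (cube h) \<Longrightarrow> x \<in> cube h \<Longrightarrow>
       wave_series h (\<lambda>m. fourier f (latt h m)) x = \<kappa> * f x"
proof -
  define \<theta> where "\<theta> r = (\<lambda>x :: real^'k. complex_of_real (cutoff 0 r x))" for r
  define \<kappa> where "\<kappa> r = (\<Sum>\<^sub>\<infinity>m. fourier (\<theta> r) (latt h m))" for r
  have z: "(0::real^'k) \<in> cube h" using h by (simp add: cube_def)
  then obtain r0 where r0: "r0 > 0" "cball (0::real^'k) r0 \<subseteq> cube h"
    using open_contains_cball_eq[OF open_cube] by blast
  have ser: "((\<lambda>m. fourier f (latt h m) * wave (latt h m) x) has_sum wave_series h (\<lambda>m. fourier f (latt h m)) x) UNIV"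
    if "f \<in> test_funs (cube h)" for f and x :: "real^'k"
    by (rule wave_series_has_sum[OF rapid_fourier[OF h that]])
  have \<kappa>eq: "((\<lambda>m. fourier (\<theta> r) (latt h m)) has_sum \<kappa> r0) UNIV" if r: "r > 0" "cball (0::real^'k) r \<subseteq> cube h" for r
  proof -
    have t: "\<theta> r \<in> test_funs (cube h)" "\<theta> r0 \<in> test_funs (cube h)"
      unfolding \<theta>_def using r r0 by (auto intro: test_funs_cutoff)
    have "\<theta> r 0 - \<theta> r0 0 = 0" using r r0 cutoff_eq_1[of r 0 "0::real^'k"] cutoff_eq_1[of r0 0 "0::real^'k"] by (simp add: \<theta>_def)
    from fourier_series_at_zero_of_function[OF h test_funs_diff[OF t] z this]
    have "((\<lambda>m. fourier (\<theta> r) (latt h m) - fourier (\<theta> r0) (latt h m)) has_sum 0) UNIV"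
      using fourier_diff[OF t] by simp
    moreover have "((\<lambda>m. fourier (\<theta> r0) (latt h m)) has_sum \<kappa> r0) UNIV"
      unfolding \<kappa>_def by (rule has_sum_infsum[OF abs_summable_summable[OF rapid_abs_summable[OF rapid_fourier[OF h t(2)]]]])
    ultimately show ?thesis by (rule has_sum_if_diff_has_sum_0)
  qed
  have main: "wave_series h (\<lambda>m. fourier f (latt h m)) a = \<kappa> r0 * f a"
    if f: "f \<in> test_funs (cube h)" and a: "a \<in> cube h" for f and a :: "real^'k"
  proof -
    obtain ra where ra: "ra > 0" "cball a ra \<subseteq> cube h"
      using a open_contains_cball_eq[OF open_cube] by blast
    define r where "r = min ra r0"
    have r: "r > 0" "cball a r \<subseteq> cube h" "cball (0::real^'k) r \<subseteq> cube h"
      using ra r0 by (auto simp: r_def)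
    define t where "t x = complex_of_real (cutoff a r x)" for x
    have t: "t \<in> test_funs (cube h)" unfolding t_def using r by (intro test_funs_cutoff) auto
    have tt: "fourier t \<xi> = wave (- \<xi>) a * fourier (\<theta> r) \<xi>" for \<xi>
    proof -
      define H where "H x = wave (- \<xi>) x * t x" for x
      have "continuous_on UNIV H" unfolding H_def by (intro continuous_intros test_funs_continuous[OF t])
      hence "(LINT x|lborel. H (x + a)) = (LINT x|lborel. H x)"
        by (intro integral_translate borel_measurable_continuous_onI)
      moreover have "H (x + a) = wave (- \<xi>) a * (wave (- \<xi>) x * \<theta> r x)" for x
        by (simp add: H_def t_def \<theta>_def wave_add_right cutoff_def mult_ac)
      ultimately show ?thesis by (simp add: fourier_def H_def)
    qed
    have canc: "f a * (wave (- \<xi>) a * F) * wave \<xi> a = f a * F" for \<xi> F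
    proof -
      have "f a * (wave (- \<xi>) a * F) * wave \<xi> a = f a * F * (wave (- \<xi>) a * wave \<xi> a)"
        by (simp only: mult_ac)
      thus ?thesis by simp
    qed
    have "f a - f a * t a = 0" using r cutoff_eq_1[of r a a] by (simp add: t_def)
    from fourier_series_at_zero_of_function[OF h test_funs_diff[OF f test_funs_cmult[OF t]] a this]
    have "((\<lambda>m. fourier f (latt h m) * wave (latt h m) a - f a * fourier (\<theta> r) (latt h m)) has_sum 0) UNIV"
      by (simp only: fourier_diff[OF f test_funs_cmult[OF t]] fourier_cmult tt left_diff_distrib canc)
    moreover have "((\<lambda>m. f a * fourier (\<theta> r) (latt h m)) has_sum f a * \<kappa> r0) UNIV"
      by (rule has_sum_cmult_right[OF \<kappa>eq[OF r(1,3)]])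
    ultimately have "((\<lambda>m. fourier f (latt h m) * wave (latt h m) a) has_sum f a * \<kappa> r0) UNIV"
      by (rule has_sum_if_diff_has_sum_0)
    from infsumI[OF this] show ?thesis by (simp add: wave_series_def mult.commute)
  qed
  have "\<kappa> r0 \<noteq> 0"
  proof
    assume k0: "\<kappa> r0 = 0"
    have zero: "(LINT x|lborel. 1 * f x) = 0" if f: "f \<in> test_funs (cube h)" for f :: "real^'k \<Rightarrow> complex"
    proof -
      have f': "(\<lambda>x. cnj (f x)) \<in> test_funs (cube h)" by (rule test_funs_cnj[OF f])
      have cf: "(LINT x|lborel. wave \<xi> x * cnj (f x)) = cnj (fourier f \<xi>)" for \<xi>
        using integral_bounded_linear[OF bounded_linear_cnj integrable_wave_mult[OF f, of "- \<xi>"]]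
        by (simp add: fourier_def wave_uminus)
      have "(\<lambda>x. wave_series h (\<lambda>m. fourier f (latt h m)) x * cnj (f x)) = (\<lambda>x. 0)"
      proof
        fix x
        show "wave_series h (\<lambda>m. fourier f (latt h m)) x * cnj (f x) = 0"
          using main[OF f, of x] k0 test_funs_outside[OF f, of x] by (cases "x \<in> cube h") auto
      qed
      hence "((\<lambda>m. fourier f (latt h m) * cnj (fourier f (latt h m))) has_sum 0) UNIV"
        using wave_series_integral[OF rapid_fourier[OF h f] f'] by (simp only: cf Bochner_Integration.integral_zero)
      hence "((\<lambda>m. complex_of_real ((norm (fourier f (latt h m)))\<^sup>2)) has_sum 0) UNIV"
        by (simp only: complex_norm_square)
      from has_sum_bounded_linear[OF bounded_linear_Re this]
      have "((\<lambda>m. (norm (fourier f (latt h m)))\<^sup>2) has_sum 0) UNIV" by simp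
      from nonneg_has_sum_le_0D[OF this, of 0] have "fourier f (latt h 0) = 0" by simp
      moreover have "latt h 0 = (0::real^'k)" by (simp add: vec_eq_iff)
      ultimately show ?thesis by (simp add: fourier_def)
    qed
    have "(1::complex) = 0"
      by (rule fundamental_lemma[OF open_cube _ zero z]) (auto intro: continuous_intros)
    thus False by simp
  qed
  thus ?thesis using main that by blast
qed

section \<open>Distributions with empty wavefront set are smooth\<close>

lemma pderivs_bounded_linear:
  assumes h: "bounded_linear h" and S: "open S" and f: "smooth_on S f" and x: "x \<in> S"
  shows "pderivs is (\<lambda>x. h (f x)) x = h (pderivs is f x)"
  using x
proof (induction "is" arbitrary: x)
  case (Cons i "is")
  have "pderiv1 i (pderivs is (\<lambda>x. h (f x))) x = pderiv1 i (\<lambda>x. h (pderivs is f x)) x"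
    by (rule pderiv1_cong[OF S Cons.prems Cons.IH])
  also have "\<dots> = h (pderiv1 i (pderivs is f) x)"
    by (rule pderiv1_bounded_linear[OF h smooth_on_differentiable_at[OF smooth_on_pderivs[OF f] S Cons.prems]])
  finally show ?case by (simp add: pderivs_Cons)
qed simp

lemma pderivs_add:
  assumes S: "open S" and f: "smooth_on S f" and g: "smooth_on S g" and x: "x \<in> S"
  shows "pderivs is (\<lambda>x. f x + g x) x = pderivs is f x + pderivs is g x"
  using x
proof (induction "is" arbitrary: x)
  case (Cons i "is")
  have "pderiv1 i (pderivs is (\<lambda>x. f x + g x)) x = pderiv1 i (\<lambda>x. pderivs is f x + pderivs is g x) x"
    by (rule pderiv1_cong[OF S Cons.prems Cons.IH])
  also have "\<dots> = pderiv1 i (pderivs is f) x + pderiv1 i (pderivs is g) x"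
    using smooth_on_differentiable_at[OF smooth_on_pderivs[OF f] S Cons.prems]
      smooth_on_differentiable_at[OF smooth_on_pderivs[OF g] S Cons.prems] by (rule pderiv1_add)
  finally show ?case by (simp add: pderivs_Cons)
qed simp

lemma pderivs_sum:
  assumes S: "open S" and f: "\<And>j. j \<in> J \<Longrightarrow> smooth_on S (f j)" and x: "x \<in> S"
  shows "pderivs is (\<lambda>x. \<Sum>j\<in>J. f j x) x = (\<Sum>j\<in>J. pderivs is (f j) x)"
  using f
  by (induction J rule: infinite_finite_induct)
     (simp_all add: pderivs_add[OF S _ _ x] smooth_on_sum[OF S])

lemma pderivs_cmult:
  fixes f :: "real^'k::finite \<Rightarrow> 'b::real_normed_algebra"
  assumes "open S" "smooth_on S f" "x \<in> S"
  shows "pderivs is (\<lambda>x. c * f x) x = c * pderivs is f x"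
  by (rule pderivs_bounded_linear[OF bounded_linear_mult_right assms])

lemma pderivs_mult_bound:
  fixes p :: "real^'k::finite \<Rightarrow> complex"
  assumes S: "open S" and K: "compact K" "K \<subseteq> S" and p: "smooth_on S p"
  shows "\<exists>M\<ge>0. \<forall>q B. smooth_on S q \<longrightarrow>
    (\<forall>is. \<forall>x\<in>K. length is \<le> r \<longrightarrow> norm (pderivs is q x) \<le> B) \<longrightarrow>
    (\<forall>is. \<forall>x\<in>K. length is \<le> r \<longrightarrow> norm (pderivs is (\<lambda>x. p x * q x) x) \<le> M * B)"
  using p
proof (induction r arbitrary: p)
  case 0
  have "bounded (p ` K)"
    using K by (intro compact_imp_bounded compact_continuous_image continuous_on_subset[OF smooth_on_continuous[OF 0]]) auto
  then obtain M where M: "\<And>x. x \<in> K \<Longrightarrow> norm (p x) \<le> M" by (auto simp: bounded_iff)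
  show ?case
  proof (intro exI[of _ "max M 0"] conjI allI impI ballI)
    fix q :: "real^'k \<Rightarrow> complex" and B and "is" :: "'k list" and x
    assume q: "\<forall>is. \<forall>x\<in>K. length is \<le> 0 \<longrightarrow> norm (pderivs is q x) \<le> B" and x: "x \<in> K" and "length is \<le> (0::nat)"
    hence [simp]: "is = []" by simp
    have qB: "norm (q x) \<le> B" using q[rule_format, of x "[]"] x by simp
    have "norm (p x) * norm (q x) \<le> max M 0 * B"
      using M[OF x] qB by (intro mult_mono) auto
    thus "norm (pderivs is (\<lambda>x. p x * q x) x) \<le> max M 0 * B" by (simp add: norm_mult)
  qed auto
next
  case (Suc r)
  define P where "P p M \<longleftrightarrow> M \<ge> 0 \<and> (\<forall>q B. smooth_on S q \<longrightarrow>
    (\<forall>is :: 'k list. \<forall>x\<in>K. length is \<le> r \<longrightarrow> norm (pderivs is q x) \<le> B) \<longrightarrow>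
    (\<forall>is. \<forall>x\<in>K. length is \<le> r \<longrightarrow> norm (pderivs is (\<lambda>x. p x * q x) x) \<le> M * B))" for p :: "real^'k \<Rightarrow> complex" and M
  have IH: "\<exists>M. P p M" if "smooth_on S p" for p
    using Suc.IH[OF that] by (simp only: P_def)
  obtain M0 where M0: "P p M0" using IH[OF Suc.prems] by blast
  have "\<forall>i. \<exists>M. P (pderiv1 i p) M"
    using IH[OF smooth_on_pderiv1[OF Suc.prems]] by blast
  then obtain M where M: "\<And>i. P (pderiv1 i p) (M i)" by metis
  have Pos: "M0 \<ge> 0" "\<And>i. M i \<ge> 0" using M0 M by (auto simp: P_def)
  have PD: "norm (pderivs is (\<lambda>x. p x * q x) x) \<le> M * B"
    if "P p M" "smooth_on S q" "\<forall>is. \<forall>x\<in>K. length is \<le> r \<longrightarrow> norm (pderivs is q x) \<le> B" "x \<in> K" "length is \<le> r"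
    for p q :: "real^'k \<Rightarrow> complex" and M B and "is" :: "'k list" and x
    using that unfolding P_def by blast
  show ?case
  proof (intro exI[of _ "M0 + (\<Sum>i\<in>UNIV. M i)"] conjI allI impI ballI)
    show "0 \<le> M0 + (\<Sum>i\<in>UNIV. M i)" using Pos by (simp add: sum_nonneg)
    fix q :: "real^'k \<Rightarrow> complex" and B and "is" :: "'k list" and x
    assume q: "smooth_on S q" and qB: "\<forall>is. \<forall>x\<in>K. length is \<le> Suc r \<longrightarrow> norm (pderivs is q x) \<le> B"
      and x: "x \<in> K" and len: "length is \<le> Suc r"
    have "norm (q x) \<le> B" using qB[rule_format, of x "[]"] x by simp
    hence B: "B \<ge> 0" by (rule order_trans[OF norm_ge_zero])
    have xS: "x \<in> S" using x K by auto
    have qr: "\<forall>is. \<forall>x\<in>K. length is \<le> r \<longrightarrow> norm (pderivs is q x) \<le> B"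
      using qB by simp
    have b0: "M0 * B \<le> (M0 + (\<Sum>i\<in>UNIV. M i)) * B" using Pos B by (intro mult_right_mono) (auto simp: sum_nonneg)
    show "norm (pderivs is (\<lambda>x. p x * q x) x) \<le> (M0 + (\<Sum>i\<in>UNIV. M i)) * B"
    proof (cases "is" rule: rev_cases)
      case Nil
      hence "norm (pderivs is (\<lambda>x. p x * q x) x) \<le> M0 * B"
        using PD[OF M0 q qr x, of "[]"] by simp
      thus ?thesis using b0 by simp
    next
      case (snoc js i)
      have len': "length js \<le> r" using len snoc by simp
      have qi: "smooth_on S (pderiv1 i q)" by (rule smooth_on_pderiv1[OF q])
      have pi: "smooth_on S (pderiv1 i p)" by (rule smooth_on_pderiv1[OF Suc.prems])
      have qib: "\<forall>is. \<forall>x\<in>K. length is \<le> r \<longrightarrow> norm (pderivs is (pderiv1 i q) x) \<le> B"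
        using qB by (auto simp: pderivs_snoc[symmetric])
      have eq: "pderiv1 i (\<lambda>x. p x * q x) y = p y * pderiv1 i q y + pderiv1 i p y * q y" if "y \<in> S" for y
        using smooth_on_differentiable_at[OF Suc.prems S that] smooth_on_differentiable_at[OF q S that]
        by (rule pderiv1_bilinear[OF bounded_bilinear_mult])
      have "pderivs is (\<lambda>x. p x * q x) x = pderivs js (\<lambda>y. p y * pderiv1 i q y + pderiv1 i p y * q y) x"
        unfolding snoc pderivs_snoc by (rule pderivs_cong[OF S eq xS])
      also have "\<dots> = pderivs js (\<lambda>y. p y * pderiv1 i q y) x + pderivs js (\<lambda>y. pderiv1 i p y * q y) x"
        by (intro pderivs_add[OF S _ _ xS] smooth_on_mult S Suc.prems q qi pi)
      finally have "norm (pderivs is (\<lambda>x. p x * q x) x) \<le>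
          norm (pderivs js (\<lambda>y. p y * pderiv1 i q y) x) + norm (pderivs js (\<lambda>y. pderiv1 i p y * q y) x)"
        by (simp add: norm_triangle_ineq)
      also have "\<dots> \<le> M0 * B + M i * B"
        by (intro add_mono PD[OF M0 qi qib x len'] PD[OF M q qr x len'])
      also have "\<dots> \<le> (M0 + (\<Sum>i\<in>UNIV. M i)) * B"
        using B Pos member_le_sum[of i UNIV M] by (simp add: ring_distribs mult_right_mono)
      finally show ?thesis .
    qed
  qed
qed

locale euclidean_distribution =
  fixes \<Omega> :: "(real^'k::finite) set" and v :: "(real^'k \<Rightarrow> complex) \<Rightarrow> complex"
  assumes open_dom: "open \<Omega>"
    and v_add: "\<And>\<phi> \<psi>. \<phi> \<in> test_funs \<Omega> \<Longrightarrow> \<psi> \<in> test_funs \<Omega> \<Longrightarrow> v (\<lambda>x. \<phi> x + \<psi> x) = v \<phi> + v \<psi>"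
    and v_cmult: "\<And>c \<phi>. \<phi> \<in> test_funs \<Omega> \<Longrightarrow> v (\<lambda>x. c * \<phi> x) = c * v \<phi>"
    and v_cont: "\<And>K. compact K \<Longrightarrow> K \<subseteq> \<Omega> \<Longrightarrow> \<exists>C r. \<forall>\<phi>\<in>test_funs \<Omega>. \<forall>B.
       (\<forall>x. x \<notin> K \<longrightarrow> \<phi> x = 0) \<longrightarrow>
       (\<forall>is. \<forall>x\<in>K. length is \<le> r \<longrightarrow> norm (pderivs is \<phi> x) \<le> B) \<longrightarrow> norm (v \<phi>) \<le> C * B"
begin

lemma v_zero: "v (\<lambda>x. 0) = 0"
  using v_cmult[OF test_funs_zero, of 0] by simp

lemma v_diff: "\<phi> \<in> test_funs \<Omega> \<Longrightarrow> \<psi> \<in> test_funs \<Omega> \<Longrightarrow> v (\<lambda>x. \<phi> x - \<psi> x) = v \<phi> - v \<psi>"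
  using v_add[of \<phi> "\<lambda>x. (-1) * \<psi> x"] v_cmult[of \<psi> "-1"] test_funs_cmult[of \<psi> \<Omega> "-1"] by simp

lemma v_sum:
  assumes "\<And>j. j \<in> J \<Longrightarrow> \<phi> j \<in> test_funs \<Omega>"
  shows "v (\<lambda>x. \<Sum>j\<in>J. \<phi> j x) = (\<Sum>j\<in>J. v (\<phi> j))"
  using assms
  by (induction J rule: infinite_finite_induct) (simp_all add: v_zero v_add test_funs_sum)

lemma v_cont_mult:
  assumes \<phi>: "\<phi> \<in> test_funs \<Omega>" and K: "compact K" "K \<subseteq> \<Omega>" and out: "\<And>x. x \<notin> K \<Longrightarrow> \<phi> x = 0"
  obtains C r where "C \<ge> 0" "\<forall>q B. smooth_on UNIV q \<longrightarrow> B \<ge> 0 \<longrightarrow>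
     (\<forall>is. \<forall>x\<in>K. length is \<le> r \<longrightarrow> norm (pderivs is q x) \<le> B) \<longrightarrow>
     norm (v (\<lambda>x. \<phi> x * q x)) \<le> C * B"
proof -
  obtain C r where C: "\<And>f B. f \<in> test_funs \<Omega> \<Longrightarrow> (\<And>x. x \<notin> K \<Longrightarrow> f x = 0) \<Longrightarrow>
     (\<And>is x. x \<in> K \<Longrightarrow> length is \<le> r \<Longrightarrow> norm (pderivs is f x) \<le> B) \<Longrightarrow> norm (v f) \<le> C * B"
    using v_cont[OF K] by metis
  obtain M where M: "M \<ge> 0" "\<forall>q B. smooth_on UNIV q \<longrightarrow>
    (\<forall>is. \<forall>x\<in>K. length is \<le> r \<longrightarrow> norm (pderivs is q x) \<le> B) \<longrightarrow>
    (\<forall>is. \<forall>x\<in>K. length is \<le> r \<longrightarrow> norm (pderivs is (\<lambda>x. \<phi> x * q x) x) \<le> M * B)"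
    using pderivs_mult_bound[OF open_UNIV K(1) subset_UNIV test_funs_smooth[OF \<phi>], of r] by blast
  show ?thesis
  proof (rule that[of "\<bar>C\<bar> * M" r], goal_cases)
    case 1
    show "0 \<le> \<bar>C\<bar> * M" using M by simp
  next
    case 2
    show ?case
    proof (intro allI impI)
    fix q :: "real^'k \<Rightarrow> complex" and B :: real
    assume q: "smooth_on UNIV q" and B: "B \<ge> 0"
      and qB: "\<forall>is. \<forall>x\<in>K. length is \<le> r \<longrightarrow> norm (pderivs is q x) \<le> B"
    have t: "(\<lambda>x. \<phi> x * q x) \<in> test_funs \<Omega>"
      using test_funs_mult[OF \<phi> q] by (simp add: mult.commute)
    have "norm (pderivs is (\<lambda>x. \<phi> x * q x) x) \<le> M * B" if "x \<in> K" "length is \<le> r" for x "is"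
      using M(2) q qB that by blast
    hence "norm (v (\<lambda>x. \<phi> x * q x)) \<le> C * (M * B)"
      by (intro C[OF t]) (simp_all add: out)
    also have "\<dots> \<le> \<bar>C\<bar> * (M * B)" using M(1) B by (intro mult_right_mono) auto
    finally show "norm (v (\<lambda>x. \<phi> x * q x)) \<le> \<bar>C\<bar> * M * B" by (simp add: mult.assoc)
    qed
  qed
qed

lemma v_wave_polynomial_bound:
  assumes \<phi>: "\<phi> \<in> test_funs \<Omega>"
  obtains C r where "C \<ge> 0" "\<forall>\<eta>. norm (v (\<lambda>x. \<phi> x * wave \<eta> x)) \<le> C * (1 + norm \<eta>) ^ r"
proof -
  obtain K where K: "compact K" "K \<subseteq> \<Omega>" "\<And>x. x \<notin> K \<Longrightarrow> \<phi> x = 0" using \<phi> by (metis test_funsE)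
  obtain C r where C: "C \<ge> 0" "\<forall>q B. smooth_on UNIV q \<longrightarrow> B \<ge> 0 \<longrightarrow>
     (\<forall>is. \<forall>x\<in>K. length is \<le> r \<longrightarrow> norm (pderivs is q x) \<le> B) \<longrightarrow>
     norm (v (\<lambda>x. \<phi> x * q x)) \<le> C * B"
    by (rule v_cont_mult[OF \<phi> K])
  have "norm (v (\<lambda>x. \<phi> x * wave \<eta> x)) \<le> C * (1 + norm \<eta>) ^ r" for \<eta>
    by (rule C(2)[rule_format, OF smooth_on_wave]) (simp_all add: pderivs_wave norm_mult norm_symbol_le)
  thus ?thesis using C(1) that by blast
qed

text \<open>The partial sums of the Fourier series of \<open>\<psi>\<close> converge uniformly together with all
  derivatives, the derivatives of the partial sums being partial sums of the derivatives.\<close>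
lemma v_fourier_expansion:
  assumes h: "h > 0"
    and \<kappa>: "\<And>f x :: real^'k. f \<in> test_funs (cube h) \<Longrightarrow> x \<in> cube h \<Longrightarrow> wave_series h (\<lambda>m. fourier f (latt h m)) x = \<kappa> * f x"
    and \<phi>: "\<phi> \<in> test_funs \<Omega>" and K: "compact K" "K \<subseteq> \<Omega>" "K \<subseteq> cube h" and out: "\<And>x. x \<notin> K \<Longrightarrow> \<phi> x = 0"
    and \<psi>: "\<psi> \<in> test_funs (cube h)"
  shows "((\<lambda>m. fourier \<psi> (latt h m) * v (\<lambda>x. \<phi> x * wave (latt h m) x)) has_sum \<kappa> * v (\<lambda>x. \<phi> x * \<psi> x)) UNIV"
  unfolding has_sum_def
proof (rule tendstoI)
  fix e :: real assume e: "e > 0"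
  obtain C r where C: "C \<ge> 0" "\<forall>q B. smooth_on UNIV q \<longrightarrow> B \<ge> 0 \<longrightarrow>
     (\<forall>is. \<forall>x\<in>K. length is \<le> r \<longrightarrow> norm (pderivs is q x) \<le> B) \<longrightarrow>
     norm (v (\<lambda>x. \<phi> x * q x)) \<le> C * B"
    by (rule v_cont_mult[OF \<phi> K(1,2) out])
  define \<delta> where "\<delta> = e / (C + 1)"
  have \<delta>: "\<delta> > 0" "C * \<delta> < e" using e C(1) by (auto simp: \<delta>_def field_simps)
  define Ls where "Ls = {is :: 'k list. set is \<subseteq> UNIV \<and> length is \<le> r}"
  have Ls: "finite Ls" unfolding Ls_def by (rule finite_lists_length_le) simp
  have ev: "\<forall>\<^sub>F F in finite_subsets_at_top UNIV. \<forall>x\<in>UNIV.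
     dist (\<Sum>m\<in>F. fourier (pderivs is \<psi>) (latt h m) * wave (latt h m) x)
          (wave_series h (\<lambda>m. fourier (pderivs is \<psi>) (latt h m)) x) < \<delta>" for "is"
    by (rule uniform_limitD[OF wave_series_uniform[OF rapid_fourier[OF h test_funs_pderivs[OF \<psi>]]] \<delta>(1)])
  have "\<forall>\<^sub>F F in finite_subsets_at_top UNIV. \<forall>is\<in>Ls. \<forall>x\<in>UNIV.
     dist (\<Sum>m\<in>F. fourier (pderivs is \<psi>) (latt h m) * wave (latt h m) x)
          (wave_series h (\<lambda>m. fourier (pderivs is \<psi>) (latt h m)) x) < \<delta>"
    by (rule eventually_ball_finite[OF Ls]) (intro ballI[OF ev])
  moreover have "\<forall>\<^sub>F F :: (int^'k) set in finite_subsets_at_top UNIV. finite F"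
    by (rule eventually_finite_subsets_at_top_weakI) simp
  ultimately show "\<forall>\<^sub>F F in finite_subsets_at_top UNIV.
      dist (\<Sum>m\<in>F. fourier \<psi> (latt h m) * v (\<lambda>x. \<phi> x * wave (latt h m) x)) (\<kappa> * v (\<lambda>x. \<phi> x * \<psi> x)) < e"
  proof eventually_elim
    case (elim F)
    define q where "q x = (\<Sum>m\<in>F. fourier \<psi> (latt h m) * wave (latt h m) x) - \<kappa> * \<psi> x" for x
    have s1: "smooth_on UNIV (\<lambda>x. fourier \<psi> (latt h m) * wave (latt h m) x)" for m
      by (intro smooth_on_mult smooth_on_const smooth_on_wave) simp
    have s2: "smooth_on UNIV (\<lambda>x. (- \<kappa>) * \<psi> x)"
      by (intro smooth_on_mult smooth_on_const test_funs_smooth[OF \<psi>]) simp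
    have q': "q = (\<lambda>x. (\<Sum>m\<in>F. fourier \<psi> (latt h m) * wave (latt h m) x) + (- \<kappa>) * \<psi> x)"
      by (simp add: q_def fun_eq_iff)
    have qs: "smooth_on UNIV q"
      unfolding q' by (intro smooth_on_add smooth_on_sum s1 s2) auto
    have qd: "norm (pderivs is q x) \<le> \<delta>" if "x \<in> K" "length is \<le> r" for "is" x
    proof -
      have "pderivs is q x = (\<Sum>m\<in>F. pderivs is (\<lambda>x. fourier \<psi> (latt h m) * wave (latt h m) x) x) + (- \<kappa>) * pderivs is \<psi> x"
        unfolding q'
        by (simp only: pderivs_add[OF open_UNIV smooth_on_sum[OF open_UNIV s1] s2 UNIV_I]
           pderivs_sum[OF open_UNIV s1 UNIV_I] pderivs_cmult[OF open_UNIV test_funs_smooth[OF \<psi>] UNIV_I])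
      also have "\<dots> = (\<Sum>m\<in>F. fourier (pderivs is \<psi>) (latt h m) * wave (latt h m) x) - \<kappa> * pderivs is \<psi> x"
        by (simp add: pderivs_cmult_wave fourier_pderivs[OF \<psi>] mult_ac)
      also have "\<kappa> * pderivs is \<psi> x = wave_series h (\<lambda>m. fourier (pderivs is \<psi>) (latt h m)) x"
        by (rule \<kappa>[OF test_funs_pderivs[OF \<psi>], symmetric]) (use that K in auto)
      finally show ?thesis
        using elim(1) that by (auto simp: Ls_def dist_norm intro!: less_imp_le)
    qed
    have t: "(\<lambda>x. c * (\<phi> x * wave \<eta> x)) \<in> test_funs \<Omega>" "(\<lambda>x. \<phi> x * wave \<eta> x) \<in> test_funs \<Omega>" for c \<eta>
      using test_funs_mult[OF \<phi> smooth_on_wave, of \<eta>] test_funs_cmult by (auto simp: mult.commute)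
    have t2: "(\<lambda>x. \<phi> x * \<psi> x) \<in> test_funs \<Omega>" "(\<lambda>x. \<kappa> * (\<phi> x * \<psi> x)) \<in> test_funs \<Omega>"
      using test_funs_mult[OF \<phi> test_funs_smooth[OF \<psi>]] test_funs_cmult by (auto simp: mult.commute)
    have "v (\<lambda>x. \<phi> x * q x) = v (\<lambda>x. (\<Sum>m\<in>F. fourier \<psi> (latt h m) * (\<phi> x * wave (latt h m) x)) - \<kappa> * (\<phi> x * \<psi> x))"
      by (simp add: q_def right_diff_distrib sum_distrib_left mult.left_commute)
    also have "\<dots> = (\<Sum>m\<in>F. fourier \<psi> (latt h m) * v (\<lambda>x. \<phi> x * wave (latt h m) x)) - \<kappa> * v (\<lambda>x. \<phi> x * \<psi> x)"
      by (simp only: v_diff[OF test_funs_sum[OF t(1)] t2(2)] v_sum[OF t(1)] v_cmult[OF t(2)] v_cmult[OF t2(1)])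
    finally have "dist (\<Sum>m\<in>F. fourier \<psi> (latt h m) * v (\<lambda>x. \<phi> x * wave (latt h m) x)) (\<kappa> * v (\<lambda>x. \<phi> x * \<psi> x))
        = norm (v (\<lambda>x. \<phi> x * q x))" by (simp add: dist_norm)
    also have "\<dots> \<le> C * \<delta>" by (rule C(2)[rule_format, OF qs _ qd]) (use \<delta> in auto)
    also have "\<dots> < e" by (rule \<delta>)
    finally show ?case .
  qed
qed

definition decays :: "(real^'k \<Rightarrow> complex) \<Rightarrow> (real^'k) set \<Rightarrow> bool" where
  "decays \<phi> W \<longleftrightarrow> (\<forall>N::nat. \<exists>C. \<forall>\<xi>\<in>W. norm (v (\<lambda>x. \<phi> x * wave (- \<xi>) x)) * (1 + norm \<xi>) ^ N \<le> C)"

lemma bounded_subset_cube: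
  assumes "bounded (S :: (real^'k) set)"
  obtains h where "h > 0" "S \<subseteq> cube h"
proof -
  obtain R where R: "R > 0" "\<And>x. x \<in> S \<Longrightarrow> norm x \<le> R" using assms bounded_pos by metis
  have "S \<subseteq> cube (pi / (R + 1))"
  proof
    fix x assume "x \<in> S"
    hence "norm x < R + 1" using R(2)[of x] by simp
    hence "\<bar>x $ i\<bar> < R + 1" for i using component_le_norm_cart[of x i] by linarith
    thus "x \<in> cube (pi / (R + 1))" using R by (simp add: cube_def)
  qed
  thus ?thesis using R that[of "pi / (R + 1)"] by simp
qed

text \<open>Multiplication by \<open>\<psi>\<close> convolves the Fourier transform with that of \<open>\<psi>\<close>, which is
  concentrated near the origin: frequencies that stay inside \<open>W\<close> are controlled by the decay on
  \<open>W\<close>, and the others by the decay of the Fourier transform of \<open>\<psi>\<close>.\<close>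
lemma decays_mult:
  assumes \<phi>: "\<phi> \<in> test_funs \<Omega>" and \<psi>: "smooth_on UNIV \<psi>" and dec: "decays \<phi> W"
    and \<epsilon>: "\<epsilon> > 0" and W': "\<And>\<xi> \<eta>. \<xi> \<in> W' \<Longrightarrow> norm (\<xi> - \<eta>) \<le> \<epsilon> * norm \<xi> \<Longrightarrow> \<eta> \<in> W"
  shows "decays (\<lambda>x. \<phi> x * \<psi> x) W'"
  unfolding decays_def
proof
  fix N :: nat
  obtain K where K: "compact K" "K \<subseteq> \<Omega>" "\<And>x. x \<notin> K \<Longrightarrow> \<phi> x = 0" using \<phi> by (metis test_funsE)
  obtain h where h: "h > 0" "K \<subseteq> cube h" using bounded_subset_cube[OF compact_imp_bounded[OF K(1)]] by metis
  obtain \<beta> where \<beta>: "\<beta> \<in> test_funs (cube h)" "\<And>x. x \<in> K \<Longrightarrow> \<beta> x = 1"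
    using smooth_Urysohn[OF open_cube K(1) h(2)] by metis
  obtain \<kappa> :: complex where \<kappa>: "\<kappa> \<noteq> 0" "\<And>f x :: real^'k. f \<in> test_funs (cube h) \<Longrightarrow> x \<in> cube h \<Longrightarrow>
       wave_series h (\<lambda>m. fourier f (latt h m)) x = \<kappa> * f x"
    using fourier_series[OF h(1), where 'k='k] by metis
  define \<rho> where "\<rho> x = \<psi> x * \<beta> x" for x
  have \<rho>: "\<rho> \<in> test_funs (cube h)" unfolding \<rho>_def by (rule test_funs_mult[OF \<beta>(1) \<psi>])
  have \<phi>\<rho>: "\<phi> x * \<rho> x = \<phi> x * \<psi> x" for x using \<beta>(2)[of x] K(3)[of x] by (cases "x \<in> K") (auto simp: \<rho>_def)
  obtain CN where CN: "\<And>\<xi>. \<xi> \<in> W \<Longrightarrow> norm (v (\<lambda>x. \<phi> x * wave (- \<xi>) x)) * (1 + norm \<xi>) ^ N \<le> CN"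
    using dec unfolding decays_def by metis
  obtain C r where C: "C \<ge> 0" "\<forall>\<eta>. norm (v (\<lambda>x. \<phi> x * wave \<eta> x)) \<le> C * (1 + norm \<eta>) ^ r"
    by (rule v_wave_polynomial_bound[OF \<phi>])
  define D where "D = 1 + 1 / \<epsilon>"
  have D: "D \<ge> 1" using \<epsilon> by (simp add: D_def)
  define C' where "C' = \<bar>CN\<bar> + C * D ^ (r + N)"
  have C': "C' \<ge> 0" using C D by (simp add: C'_def)
  have key: "norm (v (\<lambda>x. \<phi> x * wave (- (\<xi> - \<mu>)) x)) * (1 + norm \<xi>) ^ N \<le> C' * (1 + norm \<mu>) ^ (r + N)"
    if \<xi>: "\<xi> \<in> W'" for \<xi> \<mu>
  proof (cases "norm \<mu> \<le> \<epsilon> * norm \<xi>")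
    case True
    hence W: "\<xi> - \<mu> \<in> W" using W'[OF \<xi>, of "\<xi> - \<mu>"] by simp
    have "norm \<xi> \<le> norm (\<xi> - \<mu>) + norm \<mu>"
      using norm_triangle_ineq[of "\<xi> - \<mu>" \<mu>] by simp
    moreover have "(1 + norm (\<xi> - \<mu>)) * (1 + norm \<mu>) = 1 + norm (\<xi> - \<mu>) + norm \<mu> + norm (\<xi> - \<mu>) * norm \<mu>"
      by (simp add: algebra_simps)
    moreover have "0 \<le> norm (\<xi> - \<mu>) * norm \<mu>" by simp
    ultimately have "1 + norm \<xi> \<le> (1 + norm (\<xi> - \<mu>)) * (1 + norm \<mu>)" by linarith
    hence "(1 + norm \<xi>) ^ N \<le> (1 + norm (\<xi> - \<mu>)) ^ N * (1 + norm \<mu>) ^ N"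
      unfolding power_mult_distrib[symmetric] by (intro power_mono) auto
    hence "norm (v (\<lambda>x. \<phi> x * wave (- (\<xi> - \<mu>)) x)) * (1 + norm \<xi>) ^ N
       \<le> norm (v (\<lambda>x. \<phi> x * wave (- (\<xi> - \<mu>)) x)) * ((1 + norm (\<xi> - \<mu>)) ^ N * (1 + norm \<mu>) ^ N)"
      by (intro mult_left_mono) auto
    also have "\<dots> \<le> \<bar>CN\<bar> * (1 + norm \<mu>) ^ N"
      unfolding mult.assoc[symmetric] using CN[OF W] by (intro mult_right_mono) auto
    also have "\<dots> \<le> C' * (1 + norm \<mu>) ^ (r + N)"
      using C D by (intro mult_mono power_increasing) (auto simp: C'_def)
    finally show ?thesis .
  next
    case False
    hence \<xi>l: "norm \<xi> \<le> norm \<mu> / \<epsilon>" using \<epsilon> by (simp add: field_simps)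
    have 1: "1 + norm \<xi> \<le> D * (1 + norm \<mu>)"
    proof -
      have "D * (1 + norm \<mu>) = 1 + norm \<mu> / \<epsilon> + norm \<mu> + 1 / \<epsilon>" by (simp add: D_def algebra_simps add_divide_distrib)
      moreover have "1 / \<epsilon> > 0" using \<epsilon> by simp
      ultimately show ?thesis using \<xi>l norm_ge_zero[of \<mu>] by linarith
    qed
    have 2: "1 + norm (- (\<xi> - \<mu>)) \<le> D * (1 + norm \<mu>)"
    proof -
      have "D * (1 + norm \<mu>) = 1 + norm \<mu> / \<epsilon> + norm \<mu> + 1 / \<epsilon>" by (simp add: D_def algebra_simps add_divide_distrib)
      moreover have "1 / \<epsilon> > 0" using \<epsilon> by simp
      moreover have "norm (- (\<xi> - \<mu>)) \<le> norm \<mu> + norm \<xi>" using norm_triangle_ineq4[of \<mu> \<xi>] by simp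
      ultimately show ?thesis using \<xi>l by linarith
    qed
    have "norm (v (\<lambda>x. \<phi> x * wave (- (\<xi> - \<mu>)) x)) * (1 + norm \<xi>) ^ N
        \<le> (C * (1 + norm (- (\<xi> - \<mu>))) ^ r) * (1 + norm \<xi>) ^ N"
      by (intro mult_right_mono C(2)[rule_format]) auto
    also have "\<dots> \<le> (C * (D * (1 + norm \<mu>)) ^ r) * (D * (1 + norm \<mu>)) ^ N"
      using C D by (intro mult_mono power_mono 1 2 mult_nonneg_nonneg zero_le_power) auto
    also have "\<dots> = (C * D ^ (r + N)) * (1 + norm \<mu>) ^ (r + N)"
      by (simp add: power_add power_mult_distrib mult_ac)
    also have "\<dots> \<le> C' * (1 + norm \<mu>) ^ (r + N)"
      by (intro mult_right_mono) (auto simp: C'_def)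
    finally show ?thesis .
  qed
  define T where "T = (\<Sum>\<^sub>\<infinity>m. C' * (norm (fourier \<rho> (latt h m)) * (1 + norm (latt h m)) ^ (r + N)))"
  have T: "((\<lambda>m. C' * (norm (fourier \<rho> (latt h m)) * (1 + norm (latt h m)) ^ (r + N))) has_sum T) UNIV"
    unfolding T_def using rapid_fourier[OF h(1) \<rho>] unfolding rapid_def
    by (intro has_sum_infsum summable_on_cmult_right) blast
  show "\<exists>C. \<forall>\<xi>\<in>W'. norm (v (\<lambda>x. \<phi> x * \<psi> x * wave (- \<xi>) x)) * (1 + norm \<xi>) ^ N \<le> C"
  proof (intro exI ballI)
    fix \<xi> assume \<xi>: "\<xi> \<in> W'"
    have t: "(\<lambda>x. \<phi> x * wave (- \<xi>) x) \<in> test_funs \<Omega>"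
      using test_funs_mult[OF \<phi> smooth_on_wave, of "- \<xi>"] by (simp add: mult.commute)
    have "((\<lambda>m. fourier \<rho> (latt h m) * v (\<lambda>x. \<phi> x * wave (- \<xi>) x * wave (latt h m) x)) has_sum
        \<kappa> * v (\<lambda>x. \<phi> x * wave (- \<xi>) x * \<rho> x)) UNIV"
      by (rule v_fourier_expansion[OF h(1) \<kappa>(2) t K(1,2) h(2) _ \<rho>]) (simp_all add: K)
    moreover have "(\<lambda>x. \<phi> x * wave (- \<xi>) x * wave (latt h m) x) = (\<lambda>x. \<phi> x * wave (- (\<xi> - latt h m)) x)" for m
      using wave_add[of "- \<xi>" "latt h m"] by (simp add: mult.assoc)
    moreover have "(\<lambda>x. \<phi> x * wave (- \<xi>) x * \<rho> x) = (\<lambda>x. \<phi> x * \<psi> x * wave (- \<xi>) x)"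
    proof
      fix x
      have "\<phi> x * wave (- \<xi>) x * \<rho> x = \<phi> x * \<rho> x * wave (- \<xi>) x" by (simp only: mult_ac)
      thus "\<phi> x * wave (- \<xi>) x * \<rho> x = \<phi> x * \<psi> x * wave (- \<xi>) x" by (simp only: \<phi>\<rho>)
    qed
    ultimately have hs: "((\<lambda>m. fourier \<rho> (latt h m) * v (\<lambda>x. \<phi> x * wave (- (\<xi> - latt h m)) x)) has_sum
        \<kappa> * v (\<lambda>x. \<phi> x * \<psi> x * wave (- \<xi>) x)) UNIV" by (simp only:)
    define f where "f m = fourier \<rho> (latt h m) * v (\<lambda>x. \<phi> x * wave (- (\<xi> - latt h m)) x) * of_real ((1 + norm \<xi>) ^ N)" for m
    have fs: "(f has_sum \<kappa> * v (\<lambda>x. \<phi> x * \<psi> x * wave (- \<xi>) x) * of_real ((1 + norm \<xi>) ^ N)) UNIV"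
      unfolding f_def by (rule has_sum_cmult_left[OF hs])
    have fle: "norm (f m) \<le> C' * (norm (fourier \<rho> (latt h m)) * (1 + norm (latt h m)) ^ (r + N))" for m
    proof -
      have p: "norm (complex_of_real ((1 + norm \<xi>) ^ N)) = (1 + norm \<xi>) ^ N"
        unfolding norm_of_real by (intro abs_of_nonneg zero_le_power add_nonneg_nonneg) auto
      have "norm (f m) = norm (fourier \<rho> (latt h m)) * (norm (v (\<lambda>x. \<phi> x * wave (- (\<xi> - latt h m)) x)) * (1 + norm \<xi>) ^ N)"
        unfolding f_def norm_mult p by (simp only: mult.assoc)
      also have "\<dots> \<le> norm (fourier \<rho> (latt h m)) * (C' * (1 + norm (latt h m)) ^ (r + N))"
        by (intro mult_left_mono key \<xi>) auto
      finally show ?thesis by (simp only: mult_ac)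
    qed
    have S: "(\<lambda>m. norm (f m)) summable_on UNIV"
      by (rule summable_on_comparison_test[of "\<lambda>m. C' * (norm (fourier \<rho> (latt h m)) * (1 + norm (latt h m)) ^ (r + N))"])
        (use T fle in \<open>auto simp: summable_on_def\<close>)
    have "norm (\<kappa> * v (\<lambda>x. \<phi> x * \<psi> x * wave (- \<xi>) x) * of_real ((1 + norm \<xi>) ^ N)) \<le> infsum (\<lambda>m. norm (f m)) UNIV"
      by (rule norm_has_sum_bound[OF has_sum_infsum[OF S] fs])
    also have "\<dots> \<le> T" by (rule has_sum_mono[OF has_sum_infsum[OF S] T fle])
    finally have "norm (\<kappa> * v (\<lambda>x. \<phi> x * \<psi> x * wave (- \<xi>) x) * of_real ((1 + norm \<xi>) ^ N)) \<le> T" .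
    moreover have p: "norm (complex_of_real ((1 + norm \<xi>) ^ N)) = (1 + norm \<xi>) ^ N"
      unfolding norm_of_real by (intro abs_of_nonneg zero_le_power add_nonneg_nonneg) auto
    ultimately have "norm \<kappa> * (norm (v (\<lambda>x. \<phi> x * \<psi> x * wave (- \<xi>) x)) * (1 + norm \<xi>) ^ N) \<le> T"
      unfolding norm_mult p by (simp only: mult.assoc)
    thus "norm (v (\<lambda>x. \<phi> x * \<psi> x * wave (- \<xi>) x)) * (1 + norm \<xi>) ^ N \<le> T / norm \<kappa>"
      using \<kappa>(1) by (simp add: pos_le_divide_eq mult.commute)
  qed
qed

lemma not_in_WF_euclid:
  assumes "(x0, \<xi>0) \<notin> WF_euclid \<Omega> v" "x0 \<in> \<Omega>" "\<xi>0 \<noteq> 0"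
  obtains \<phi> W where "\<phi> \<in> test_funs \<Omega>" "\<phi> x0 \<noteq> 0" "open W" "\<xi>0 \<in> W"
    "\<And>\<xi> t. \<xi> \<in> W \<Longrightarrow> t > 0 \<Longrightarrow> t *\<^sub>R \<xi> \<in> W" "decays \<phi> W"
proof -
  have w: "cis (- (x \<bullet> \<xi>)) = wave (- \<xi>) x" for x \<xi> :: "real^'k" by (simp add: wave_def)
  obtain \<phi> W where "\<phi> \<in> test_funs \<Omega>" "\<phi> x0 \<noteq> 0" "open W" "\<xi>0 \<in> W" "\<forall>\<xi>\<in>W. \<forall>t>0. t *\<^sub>R \<xi> \<in> W"
    "\<forall>k::nat. \<exists>C. \<forall>\<xi>\<in>W. norm (v (\<lambda>x. \<phi> x * cis (- (x \<bullet> \<xi>)))) * (1 + norm \<xi>) ^ k \<le> C"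
    using assms unfolding WF_euclid_def by blast
  thus ?thesis using that[of \<phi> W] unfolding decays_def w by blast
qed

lemma decays_everywhere:
  assumes WF: "WF_euclid \<Omega> v = {}" and x0: "x0 \<in> \<Omega>"
  obtains \<Phi> where "\<Phi> \<in> test_funs \<Omega>" "\<Phi> x0 \<noteq> 0" "decays \<Phi> UNIV"
proof -
  define Sph where "Sph = sphere (0::real^'k) 1"
  have ex: "\<forall>\<zeta>\<in>Sph. \<exists>\<phi> W \<delta>. \<phi> \<in> test_funs \<Omega> \<and> \<phi> x0 \<noteq> 0 \<and> (\<forall>\<xi>\<in>W. \<forall>t>0. t *\<^sub>R \<xi> \<in> W) \<and> decays \<phi> W \<and> \<delta> > 0 \<and> ball \<zeta> (2 * \<delta>) \<subseteq> W"
  proof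
    fix \<zeta> assume "\<zeta> \<in> Sph"
    hence "\<zeta> \<noteq> 0" by (auto simp: Sph_def)
    then obtain \<phi> W where *: "\<phi> \<in> test_funs \<Omega>" "\<phi> x0 \<noteq> 0" "open W" "\<zeta> \<in> W"
        "\<And>\<xi> t. \<xi> \<in> W \<Longrightarrow> t > 0 \<Longrightarrow> t *\<^sub>R \<xi> \<in> W" "decays \<phi> W"
      using not_in_WF_euclid[of x0 \<zeta>] WF x0 by blast
    obtain d where d: "d > 0" "ball \<zeta> d \<subseteq> W" using *(3,4) openE by metis
    show "\<exists>\<phi> W \<delta>. \<phi> \<in> test_funs \<Omega> \<and> \<phi> x0 \<noteq> 0 \<and> (\<forall>\<xi>\<in>W. \<forall>t>0. t *\<^sub>R \<xi> \<in> W) \<and> decays \<phi> W \<and> \<delta> > 0 \<and> ball \<zeta> (2 * \<delta>) \<subseteq> W"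
      using * d by (intro exI[of _ \<phi>] exI[of _ W] exI[of _ "d / 2"]) auto
  qed
  obtain \<phi> W \<delta> where B: "\<forall>\<zeta>\<in>Sph. \<phi> \<zeta> \<in> test_funs \<Omega> \<and> \<phi> \<zeta> x0 \<noteq> 0 \<and> (\<forall>\<xi>\<in>W \<zeta>. \<forall>t>0. t *\<^sub>R \<xi> \<in> W \<zeta>) \<and> decays (\<phi> \<zeta>) (W \<zeta>) \<and> \<delta> \<zeta> > 0 \<and> ball \<zeta> (2 * \<delta> \<zeta>) \<subseteq> W \<zeta>"
    using ex[unfolded bchoice_iff] by blast
  have
    \<phi>: "\<And>\<zeta>. \<zeta> \<in> Sph \<Longrightarrow> \<phi> \<zeta> \<in> test_funs \<Omega>" "\<And>\<zeta>. \<zeta> \<in> Sph \<Longrightarrow> \<phi> \<zeta> x0 \<noteq> 0"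
    and W: "\<And>\<zeta> \<xi> t. \<zeta> \<in> Sph \<Longrightarrow> \<xi> \<in> W \<zeta> \<Longrightarrow> t > 0 \<Longrightarrow> t *\<^sub>R \<xi> \<in> W \<zeta>"
    and dec: "\<And>\<zeta>. \<zeta> \<in> Sph \<Longrightarrow> decays (\<phi> \<zeta>) (W \<zeta>)"
    and \<delta>: "\<And>\<zeta>. \<zeta> \<in> Sph \<Longrightarrow> \<delta> \<zeta> > 0" "\<And>\<zeta>. \<zeta> \<in> Sph \<Longrightarrow> ball \<zeta> (2 * \<delta> \<zeta>) \<subseteq> W \<zeta>"
    using B by blast+
  have cover: "Sph \<subseteq> (\<Union>\<zeta>\<in>Sph. ball \<zeta> (\<delta> \<zeta>))" using \<delta> by fastforce
  obtain F where F: "F \<subseteq> Sph" "finite F" "Sph \<subseteq> (\<Union>\<zeta>\<in>F. ball \<zeta> (\<delta> \<zeta>))"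
    by (rule compactE_image[OF _ _ cover]) (auto simp: Sph_def)
  have "axis undefined 1 \<in> Sph" by (simp add: Sph_def)
  then obtain \<zeta>0 where \<zeta>0: "\<zeta>0 \<in> F" using F(3) by blast
  define \<Phi> where "\<Phi> x = (\<Prod>\<zeta>\<in>F. \<phi> \<zeta> x)" for x
  define \<Psi> where "\<Psi> \<zeta> x = (\<Prod>\<zeta>'\<in>F - {\<zeta>}. \<phi> \<zeta>' x)" for \<zeta> x
  have split: "\<Phi> = (\<lambda>x. \<phi> \<zeta> x * \<Psi> \<zeta> x)" if "\<zeta> \<in> F" for \<zeta>
    using that F by (auto simp: \<Phi>_def \<Psi>_def fun_eq_iff prod.remove)
  have \<Psi>: "smooth_on UNIV (\<Psi> \<zeta>)" for \<zeta>
    unfolding \<Psi>_def using F by (intro smooth_on_prod test_funs_smooth[OF \<phi>(1)]) auto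
  have \<Phi>t: "\<Phi> \<in> test_funs \<Omega>"
  proof -
    have "(\<lambda>x. \<Psi> \<zeta>0 x * \<phi> \<zeta>0 x) \<in> test_funs \<Omega>" using \<zeta>0 F by (intro test_funs_mult \<phi> \<Psi>) auto
    thus ?thesis using split[OF \<zeta>0] by (simp add: mult.commute)
  qed
  define W' where "W' \<zeta> = {\<xi>. \<xi> \<noteq> 0 \<and> \<xi> /\<^sub>R norm \<xi> \<in> ball \<zeta> (\<delta> \<zeta>)}" for \<zeta> :: "real^'k"
  have decW': "decays \<Phi> (W' \<zeta>)" if "\<zeta> \<in> F" for \<zeta>
    unfolding split[OF that]
  proof (rule decays_mult[where W = "W \<zeta>" and \<epsilon> = "\<delta> \<zeta>"])
    have \<zeta>: "\<zeta> \<in> Sph" using that F by auto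
    show "\<phi> \<zeta> \<in> test_funs \<Omega>" "decays (\<phi> \<zeta>) (W \<zeta>)" "\<delta> \<zeta> > 0" using \<phi> dec \<delta> \<zeta> by auto
    show "smooth_on UNIV (\<Psi> \<zeta>)" by (rule \<Psi>)
    fix \<xi> \<eta> assume \<xi>: "\<xi> \<in> W' \<zeta>" and \<eta>: "norm (\<xi> - \<eta>) \<le> \<delta> \<zeta> * norm \<xi>"
    have n: "norm \<xi> > 0" using \<xi> by (simp add: W'_def)
    have "norm (\<xi> /\<^sub>R norm \<xi> - \<eta> /\<^sub>R norm \<xi>) \<le> \<delta> \<zeta>"
    proof -
      have "\<xi> /\<^sub>R norm \<xi> - \<eta> /\<^sub>R norm \<xi> = (\<xi> - \<eta>) /\<^sub>R norm \<xi>" by (simp only: scaleR_diff_right)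
      hence "norm (\<xi> /\<^sub>R norm \<xi> - \<eta> /\<^sub>R norm \<xi>) = norm (\<xi> - \<eta>) / norm \<xi>"
        by (simp add: divide_inverse mult.commute)
      thus ?thesis using \<eta> n by (simp only: pos_divide_le_eq)
    qed
    moreover have "norm (\<zeta> - \<xi> /\<^sub>R norm \<xi>) < \<delta> \<zeta>" using \<xi> by (simp add: W'_def dist_norm)
    moreover have "norm (\<zeta> - \<eta> /\<^sub>R norm \<xi>) \<le> norm (\<zeta> - \<xi> /\<^sub>R norm \<xi>) + norm (\<xi> /\<^sub>R norm \<xi> - \<eta> /\<^sub>R norm \<xi>)"
      using norm_triangle_ineq[of "\<zeta> - \<xi> /\<^sub>R norm \<xi>" "\<xi> /\<^sub>R norm \<xi> - \<eta> /\<^sub>R norm \<xi>"] by simp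
    ultimately have "\<eta> /\<^sub>R norm \<xi> \<in> ball \<zeta> (2 * \<delta> \<zeta>)" by (simp add: dist_norm)
    hence "\<eta> /\<^sub>R norm \<xi> \<in> W \<zeta>" using \<delta>(2)[OF \<zeta>] by blast
    hence "norm \<xi> *\<^sub>R (\<eta> /\<^sub>R norm \<xi>) \<in> W \<zeta>" using n by (rule W[OF \<zeta>])
    thus "\<eta> \<in> W \<zeta>" using n by simp
  qed
  have "decays \<Phi> UNIV"
    unfolding decays_def
  proof
    fix N :: nat
    have "\<forall>\<zeta>\<in>F. \<exists>C. \<forall>\<xi>\<in>W' \<zeta>. norm (v (\<lambda>x. \<Phi> x * wave (- \<xi>) x)) * (1 + norm \<xi>) ^ N \<le> C"
      using decW' unfolding decays_def by (auto dest: spec[of _ N])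
    then obtain C where C: "\<forall>\<zeta>\<in>F. \<forall>\<xi>\<in>W' \<zeta>. norm (v (\<lambda>x. \<Phi> x * wave (- \<xi>) x)) * (1 + norm \<xi>) ^ N \<le> C \<zeta>"
      unfolding bchoice_iff by blast
    show "\<exists>C. \<forall>\<xi>\<in>UNIV. norm (v (\<lambda>x. \<Phi> x * wave (- \<xi>) x)) * (1 + norm \<xi>) ^ N \<le> C"
    proof (intro exI ballI)
      fix \<xi> :: "real^'k"
      show "norm (v (\<lambda>x. \<Phi> x * wave (- \<xi>) x)) * (1 + norm \<xi>) ^ N \<le> norm (v \<Phi>) + (\<Sum>\<zeta>\<in>F. \<bar>C \<zeta>\<bar>)"
      proof (cases "\<xi> = 0")
        case True
        have "0 \<le> (\<Sum>\<zeta>\<in>F. \<bar>C \<zeta>\<bar>)" by (simp add: sum_nonneg)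
        thus ?thesis using True by simp
      next
        case False
        hence "\<xi> /\<^sub>R norm \<xi> \<in> Sph" by (simp add: Sph_def)
        then obtain \<zeta> where \<zeta>: "\<zeta> \<in> F" "\<xi> \<in> W' \<zeta>" using F(3) False unfolding W'_def by blast
        have "norm (v (\<lambda>x. \<Phi> x * wave (- \<xi>) x)) * (1 + norm \<xi>) ^ N \<le> \<bar>C \<zeta>\<bar>" using C[rule_format, OF \<zeta>] by linarith
        also have "\<dots> \<le> (\<Sum>\<zeta>\<in>F. \<bar>C \<zeta>\<bar>)" using \<zeta> F by (intro member_le_sum) auto
        finally show ?thesis using norm_ge_zero[of "v \<Phi>"] by linarith
      qed
    qed
  qed
  moreover have "\<Phi> x0 \<noteq> 0" unfolding \<Phi>_def using F \<phi>(2) by auto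
  ultimately show ?thesis using \<Phi>t that by blast
qed

lemma locally_smooth:
  assumes WF: "WF_euclid \<Omega> v = {}" and x0: "x0 \<in> \<Omega>"
  obtains U g where "open U" "x0 \<in> U" "U \<subseteq> \<Omega>" "smooth_on U g"
    "\<And>\<psi>. \<psi> \<in> test_funs U \<Longrightarrow> v \<psi> = (LINT x|lborel. g x * \<psi> x)"
proof -
  obtain \<Phi> where \<Phi>: "\<Phi> \<in> test_funs \<Omega>" "\<Phi> x0 \<noteq> 0" "decays \<Phi> UNIV"
    using decays_everywhere[OF assms] by blast
  obtain K where K: "compact K" "K \<subseteq> \<Omega>" "\<And>x. x \<notin> K \<Longrightarrow> \<Phi> x = 0" using \<Phi>(1) by (metis test_funsE)
  obtain h where h: "h > 0" "K \<subseteq> cube h" using bounded_subset_cube[OF compact_imp_bounded[OF K(1)]] by metis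
  obtain \<kappa> :: complex where \<kappa>: "\<kappa> \<noteq> 0" "\<And>f x :: real^'k. f \<in> test_funs (cube h) \<Longrightarrow> x \<in> cube h \<Longrightarrow>
       wave_series h (\<lambda>m. fourier f (latt h m)) x = \<kappa> * f x"
    using fourier_series[OF h(1), where 'k='k] by metis
  define c where "c m = v (\<lambda>x. \<Phi> x * wave (- latt h m) x)" for m
  have c: "rapid h c"
    unfolding c_def using \<Phi>(3) unfolding decays_def by (intro rapidI h) blast
  define U where "U = {x. \<Phi> x \<noteq> 0}"
  have U: "open U" "x0 \<in> U" "U \<subseteq> K"
    using \<Phi>(2) K(3) test_funs_continuous[OF \<Phi>(1)] by (auto simp: U_def intro!: open_Collect_neq continuous_intros)
  define g where "g x = wave_series h c x / (\<kappa> * \<Phi> x)" for x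
  show ?thesis
  proof (rule that[of U g])
    show "smooth_on U g"
      unfolding g_def using U(1) \<kappa>(1)
      by (intro smooth_intros smooth_on_wave_series[OF c] test_funs_smooth[OF \<Phi>(1)]) (auto simp: U_def)
    fix \<psi> assume \<psi>: "\<psi> \<in> test_funs U"
    define \<rho> where "\<rho> x = inverse (\<Phi> x) * \<psi> x" for x
    have \<rho>U: "\<rho> \<in> test_funs U"
      unfolding \<rho>_def by (intro test_funs_smooth_mult U \<psi> smooth_on_inverse test_funs_smooth[OF \<Phi>(1)]) (auto simp: U_def)
    have \<rho>: "\<rho> \<in> test_funs (cube h)" by (rule test_funs_mono[OF \<rho>U]) (use U h in auto)
    have \<Phi>\<rho>: "\<Phi> x * \<rho> x = \<psi> x" for x
      using test_funs_outside[OF \<psi>, of x] by (cases "x \<in> U") (auto simp: \<rho>_def U_def)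
    have "((\<lambda>m. fourier \<rho> (latt h m) * v (\<lambda>x. \<Phi> x * wave (latt h m) x)) has_sum \<kappa> * v (\<lambda>x. \<Phi> x * \<rho> x)) UNIV"
      by (rule v_fourier_expansion[OF h(1) \<kappa>(2) \<Phi>(1) K(1,2) h(2) K(3) \<rho>])
    moreover have bij: "bij_betw uminus (UNIV :: (int^'k) set) UNIV"
      by (rule bij_betwI[where g=uminus]) auto
    ultimately have "((\<lambda>m. fourier \<rho> (latt h (- m)) * v (\<lambda>x. \<Phi> x * wave (latt h (- m)) x)) has_sum \<kappa> * v \<psi>) UNIV"
      using has_sum_reindex_bij_betw[OF bij, of "\<lambda>m. fourier \<rho> (latt h m) * v (\<lambda>x. \<Phi> x * wave (latt h m) x)"] by (simp add: \<Phi>\<rho>)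
    moreover have "fourier \<rho> (latt h (- m)) * v (\<lambda>x. \<Phi> x * wave (latt h (- m)) x) =
        c m * (LINT x|lborel. wave (latt h m) x * \<rho> x)" for m
    proof -
      have neg: "latt h (- m) = - latt h m" by (simp add: vec_eq_iff)
      show ?thesis unfolding neg c_def fourier_def minus_minus by (rule mult.commute)
    qed
    ultimately have "((\<lambda>m. c m * (LINT x|lborel. wave (latt h m) x * \<rho> x)) has_sum \<kappa> * v \<psi>) UNIV"
      by (simp only:)
    hence eq: "\<kappa> * v \<psi> = (LINT x|lborel. wave_series h c x * \<rho> x)"
      by (rule has_sum_unique[OF _ wave_series_integral[OF c \<rho>]])
    have "g x * \<psi> x = inverse \<kappa> * (wave_series h c x * \<rho> x)" for x
      by (simp add: g_def \<rho>_def divide_inverse mult_ac)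
    hence "(LINT x|lborel. g x * \<psi> x) = inverse \<kappa> * (\<kappa> * v \<psi>)"
      unfolding eq by simp
    thus "v \<psi> = (LINT x|lborel. g x * \<psi> x)" using \<kappa>(1) by simp
  qed (use U K in auto)
qed

theorem smooth_if_WF_empty:
  assumes WF: "WF_euclid \<Omega> v = {}"
  obtains g where "smooth_on \<Omega> g" "\<And>\<psi>. \<psi> \<in> test_funs \<Omega> \<Longrightarrow> v \<psi> = (LINT x|lborel. g x * \<psi> x)"
proof -
  have ex: "\<forall>x\<in>\<Omega>. \<exists>U g. open U \<and> x \<in> U \<and> U \<subseteq> \<Omega> \<and> smooth_on U g \<and>
      (\<forall>\<psi>\<in>test_funs U. v \<psi> = (LINT x|lborel. g x * \<psi> x))"
  proof
    fix x assume "x \<in> \<Omega>"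
    from locally_smooth[OF WF this]
    show "\<exists>U g. open U \<and> x \<in> U \<and> U \<subseteq> \<Omega> \<and> smooth_on U g \<and>
      (\<forall>\<psi>\<in>test_funs U. v \<psi> = (LINT x|lborel. g x * \<psi> x))" by (smt (verit))
  qed
  obtain U g where B: "\<forall>x\<in>\<Omega>. open (U x) \<and> x \<in> U x \<and> U x \<subseteq> \<Omega> \<and> smooth_on (U x) (g x) \<and>
      (\<forall>\<psi>\<in>test_funs (U x). v \<psi> = (LINT y|lborel. g x y * \<psi> y))"
    using ex[unfolded bchoice_iff] by blast
  have U: "\<And>x. x \<in> \<Omega> \<Longrightarrow> open (U x)" "\<And>x. x \<in> \<Omega> \<Longrightarrow> x \<in> U x" "\<And>x. x \<in> \<Omega> \<Longrightarrow> U x \<subseteq> \<Omega>"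
    and g: "\<And>x. x \<in> \<Omega> \<Longrightarrow> smooth_on (U x) (g x)"
    and rep: "\<And>x \<psi>. x \<in> \<Omega> \<Longrightarrow> \<psi> \<in> test_funs (U x) \<Longrightarrow> v \<psi> = (LINT y|lborel. g x y * \<psi> y)"
    using B by blast+
  define G where "G x = g x x" for x
  have agree: "G y = g x y" if x: "x \<in> \<Omega>" and y: "y \<in> U x" for x y
  proof -
    have y': "y \<in> \<Omega>" using U(3)[OF x] y by auto
    have c: "continuous_on (U y \<inter> U x) (g y)" "continuous_on (U y \<inter> U x) (g x)"
      using smooth_on_continuous[OF g[OF x]] smooth_on_continuous[OF g[OF y']] continuous_on_subset by blast+
    have "g y y - g x y = 0"
    proof (rule fundamental_lemma[of "U y \<inter> U x" "\<lambda>z. g y z - g x z"])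
      show "open (U y \<inter> U x)" using U x y' by auto
      show "continuous_on (U y \<inter> U x) (\<lambda>z. g y z - g x z)" by (intro continuous_intros c)
      fix \<psi> assume \<psi>: "\<psi> \<in> test_funs (U y \<inter> U x)"
      have "(LINT z|lborel. (g y z - g x z) * \<psi> z) = (LINT z|lborel. g y z * \<psi> z) - (LINT z|lborel. g x z * \<psi> z)"
        using test_funs_integrable_mult[OF \<psi> c(1)] test_funs_integrable_mult[OF \<psi> c(2)] by (simp add: left_diff_distrib)
      also have "\<dots> = v \<psi> - v \<psi>"
        using rep[OF x test_funs_mono[OF \<psi>]] rep[OF y' test_funs_mono[OF \<psi>]] by simp
      finally show "(LINT z|lborel. (g y z - g x z) * \<psi> z) = 0" by simp
    qed (use y U y' in auto)
    thus ?thesis by (simp add: G_def)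
  qed
  have Gs: "smooth_on \<Omega> G"
  proof (rule smooth_on_local)
    fix x assume x: "x \<in> \<Omega>"
    have "smooth_on (U x) G" by (rule smooth_on_cong[OF U(1)[OF x] agree[OF x] g[OF x]])
    thus "\<exists>T. open T \<and> x \<in> T \<and> smooth_on T G" using U x by blast
  qed
  have Gc: "continuous_on \<Omega> G" by (rule smooth_on_continuous[OF Gs])
  have "v \<psi> = (LINT x|lborel. G x * \<psi> x)" if \<psi>: "\<psi> \<in> test_funs \<Omega>" for \<psi>
  proof -
    define w where "w \<psi> = v \<psi> - (LINT x|lborel. G x * \<psi> x)" for \<psi>
    have w_add: "w (\<lambda>x. \<phi> x + \<psi> x) = w \<phi> + w \<psi>" if "\<phi> \<in> test_funs \<Omega>" "\<psi> \<in> test_funs \<Omega>" for \<phi> \<psi>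
      using test_funs_integrable_mult[OF that(1) Gc] test_funs_integrable_mult[OF that(2) Gc] v_add[OF that]
      by (simp add: w_def distrib_left)
    have w_local: "w \<psi> = 0" if x: "x \<in> \<Omega>" and \<psi>: "\<psi> \<in> test_funs (U x)" for x \<psi>
    proof -
      have "G y * \<psi> y = g x y * \<psi> y" for y
        using agree[OF x, of y] test_funs_outside[OF \<psi>, of y] by (cases "y \<in> U x") auto
      hence "(\<lambda>y. G y * \<psi> y) = (\<lambda>y. g x y * \<psi> y)" by blast
      thus ?thesis using rep[OF x \<psi>] by (simp only: w_def diff_self)
    qed
    obtain K where K: "compact K" "K \<subseteq> \<Omega>" "\<And>x. x \<notin> K \<Longrightarrow> \<psi> x = 0" using \<psi> by (metis test_funsE)
    have "\<forall>a\<in>K. \<exists>r>0. cball a r \<subseteq> U a"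
    proof
      fix a assume "a \<in> K"
      hence "open (U a)" "a \<in> U a" using U K by auto
      thus "\<exists>r>0. cball a r \<subseteq> U a" using open_contains_cball_eq by blast
    qed
    then obtain r where r: "\<And>a. a \<in> K \<Longrightarrow> r a > 0" "\<And>a. a \<in> K \<Longrightarrow> cball a (r a) \<subseteq> U a" by metis
    have cover: "K \<subseteq> (\<Union>a\<in>K. ball a (r a / 2))" using r by fastforce
    obtain F where F: "F \<subseteq> K" "finite F" "K \<subseteq> (\<Union>a\<in>F. ball a (r a / 2))"
      by (rule compactE_image[OF K(1) _ cover]) auto
    define ct where "ct a x = complex_of_real (cutoff a (r a) x)" for a x
    have peel: "w \<psi> = w (\<lambda>x. (\<Prod>a\<in>F. 1 - ct a x) * \<psi> x)"
      using F(2,1)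
    proof (induction F)
      case (insert a F)
      have a: "a \<in> K" "a \<in> \<Omega>" using insert K by auto
      have cta: "ct a \<in> test_funs (U a)" unfolding ct_def using r a by (intro test_funs_cutoff) auto
      have s: "smooth_on UNIV (\<lambda>x. \<Prod>a\<in>F. 1 - ct a x)"
        unfolding ct_def using insert r by (intro smooth_intros smooth_on_cutoff) auto
      define \<eta> where "\<eta> x = (\<Prod>a\<in>F. 1 - ct a x) * \<psi> x" for x
      have \<eta>: "\<eta> \<in> test_funs \<Omega>" unfolding \<eta>_def by (rule test_funs_mult[OF \<psi> s])
      have 1: "(\<lambda>x. \<eta> x * ct a x) \<in> test_funs (U a)" by (rule test_funs_mult[OF cta test_funs_smooth[OF \<eta>]])
      have 2: "(\<lambda>x. (1 - ct a x) * \<eta> x) \<in> test_funs \<Omega>"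
        by (intro test_funs_mult \<eta> smooth_intros test_funs_smooth[OF cta]) auto
      have "w \<eta> = w (\<lambda>x. \<eta> x * ct a x + (1 - ct a x) * \<eta> x)" by (simp add: algebra_simps)
      also have "\<dots> = w (\<lambda>x. (1 - ct a x) * \<eta> x)"
        using w_add[OF test_funs_mono[OF 1 U(3)[OF a(2)]] 2] w_local[OF a(2) 1] by simp
      also have "(\<lambda>x. (1 - ct a x) * \<eta> x) = (\<lambda>x. (\<Prod>a\<in>insert a F. 1 - ct a x) * \<psi> x)"
        using insert by (simp add: \<eta>_def mult.assoc)
      finally show ?case using insert by (simp add: \<eta>_def)
    qed simp
    have "(\<Prod>a\<in>F. 1 - ct a x) * \<psi> x = 0" for x
    proof (cases "x \<in> K")
      case True
      then obtain a where "a \<in> F" "x \<in> ball a (r a / 2)" using F(3) by blast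
      hence "a \<in> F" "ct a x = 1" using r(1)[of a] F(1) cutoff_eq_1[of "r a" x a] by (auto simp: ct_def dist_commute)
      thus ?thesis using F(2) by auto
    qed (use K in auto)
    hence "(\<lambda>x. (\<Prod>a\<in>F. 1 - ct a x) * \<psi> x) = (\<lambda>x. 0)" by blast
    hence "w \<psi> = w (\<lambda>x. 0)" using peel by (simp only:)
    also have "\<dots> = 0" by (simp add: w_def v_zero)
    finally show ?thesis by (simp add: w_def)
  qed
  thus ?thesis using Gs that by blast
qed

end

section \<open>Smooth functions on manifolds\<close>

locale smooth_manifold =
  fixes A :: "('m::{t2_space,second_countable_topology}, 'k::finite) chart set"
  assumes atlas: "smooth_atlas A"
begin

lemma chart_open: "c \<in> A \<Longrightarrow> open (cdom c)" "c \<in> A \<Longrightarrow> open (cran c)"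
  using atlas by (auto simp: smooth_atlas_def)

lemma chart_homeo: "c \<in> A \<Longrightarrow> homeomorphism (cdom c) (cran c) (coord c) (cinv c)"
  using atlas by (auto simp: smooth_atlas_def)

lemma chart_cover: "\<exists>c\<in>A. p \<in> cdom c"
  using atlas by (auto simp: smooth_atlas_def)

lemma cinv_coord: "c \<in> A \<Longrightarrow> p \<in> cdom c \<Longrightarrow> cinv c (coord c p) = p"
  using homeomorphism_apply1[OF chart_homeo] .

lemma coord_cinv: "c \<in> A \<Longrightarrow> x \<in> cran c \<Longrightarrow> coord c (cinv c x) = x"
  using homeomorphism_apply2[OF chart_homeo] .

lemma coord_in_cran: "p \<in> cdom c \<Longrightarrow> coord c p \<in> cran c"
  by (simp add: cran_def)

lemma cinv_in_cdom: "c \<in> A \<Longrightarrow> x \<in> cran c \<Longrightarrow> cinv c x \<in> cdom c"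
  using homeomorphism_image2[OF chart_homeo] by blast

lemma coord_image: "c \<in> A \<Longrightarrow> coord c ` (U \<inter> cdom c) = {x \<in> cran c. cinv c x \<in> U}"
proof (intro equalityI subsetI)
  fix x assume c: "c \<in> A" and "x \<in> coord c ` (U \<inter> cdom c)"
  then obtain p where "p \<in> U" "p \<in> cdom c" "x = coord c p" by blast
  thus "x \<in> {x \<in> cran c. cinv c x \<in> U}" using cinv_coord[OF c] by (simp add: coord_in_cran)
next
  fix x assume c: "c \<in> A" and x: "x \<in> {x \<in> cran c. cinv c x \<in> U}"
  hence "x = coord c (cinv c x)" "cinv c x \<in> U \<inter> cdom c"
    using coord_cinv[OF c] cinv_in_cdom[OF c] by auto
  thus "x \<in> coord c ` (U \<inter> cdom c)" by blast
qed

lemma open_coord_image: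
  assumes "c \<in> A" "open U"
  shows "open (coord c ` (U \<inter> cdom c))"
proof -
  have "continuous_on (cran c) (cinv c)"
    using chart_homeo[OF assms(1)] by (simp add: homeomorphism_def)
  hence "open (cran c \<inter> cinv c -` U)"
    using chart_open[OF assms(1)] assms(2) by (intro continuous_open_preimage)
  moreover have "cran c \<inter> cinv c -` U = coord c ` (U \<inter> cdom c)"
    using coord_image[OF assms(1)] by auto
  ultimately show ?thesis by simp
qed

lemma open_chart_preimage:
  assumes "c \<in> A" "open S"
  shows "open (cdom c \<inter> coord c -` S)"
  using chart_homeo[OF assms(1)] chart_open[OF assms(1)] assms(2)
  by (intro continuous_open_preimage) (auto simp: homeomorphism_def)

lemma transition_smooth:
  assumes "c \<in> A" "c' \<in> A"
  shows "smooth_on (coord c ` (cdom c \<inter> cdom c')) (\<lambda>x. coord c' (cinv c x))"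
  using assms atlas by (auto simp: smooth_atlas_def o_def)

lemma msmooth_def': "msmooth A U f \<longleftrightarrow> (\<forall>c\<in>A. smooth_on (coord c ` (U \<inter> cdom c)) (\<lambda>x. f (cinv c x)))"
  by (simp add: msmooth_def o_def)

lemma msmooth_subset: "msmooth A U f \<Longrightarrow> U' \<subseteq> U \<Longrightarrow> msmooth A U' f"
  unfolding msmooth_def by (blast intro: smooth_on_subset)

lemma msmooth_cong:
  assumes "open U" "\<And>p. p \<in> U \<Longrightarrow> f p = g p" "msmooth A U g"
  shows "msmooth A U f"
  unfolding msmooth_def'
proof
  fix c assume c: "c \<in> A"
  show "smooth_on (coord c ` (U \<inter> cdom c)) (\<lambda>x. f (cinv c x))"
  proof (rule smooth_on_cong[OF open_coord_image[OF c assms(1)]])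
    show "f (cinv c x) = g (cinv c x)" if "x \<in> coord c ` (U \<inter> cdom c)" for x
      using that assms(2) coord_image[OF c] by auto
    show "smooth_on (coord c ` (U \<inter> cdom c)) (\<lambda>x. g (cinv c x))"
      using assms(3) c unfolding msmooth_def' by blast
  qed
qed

lemma msmooth_local:
  assumes "\<And>p. p \<in> U \<Longrightarrow> \<exists>O'. open O' \<and> p \<in> O' \<and> msmooth A O' f"
  shows "msmooth A U f"
  unfolding msmooth_def
proof (intro ballI smooth_on_local)
  fix c x assume c: "c \<in> A" and "x \<in> coord c ` (U \<inter> cdom c)"
  then obtain p where p: "p \<in> U" "p \<in> cdom c" "x = coord c p" by auto
  obtain O' where O': "open O'" "p \<in> O'" "msmooth A O' f" using assms[OF p(1)] by blast
  show "\<exists>T. open T \<and> x \<in> T \<and> smooth_on T (f \<circ> cinv c)"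
    using O' p c open_coord_image[OF c O'(1)]
    by (intro exI[of _ "coord c ` (O' \<inter> cdom c)"]) (auto simp: msmooth_def)
qed

lemma msmooth_in_chart:
  assumes c: "c \<in> A" and U: "open U" "U \<subseteq> cdom c" and f: "smooth_on (coord c ` U) (\<lambda>x. f (cinv c x))"
  shows "msmooth A U f"
  unfolding msmooth_def'
proof
  fix c' assume c': "c' \<in> A"
  define S where "S = coord c' ` (U \<inter> cdom c')"
  have S: "open S" unfolding S_def by (rule open_coord_image[OF c' U(1)])
  have UU: "U \<inter> cdom c = U" using U by auto
  have T: "open (coord c ` U)" using open_coord_image[OF c U(1)] by (simp add: UU)
  have inS: "cinv c' x \<in> U" "x \<in> cran c'" "cinv c' x \<in> cdom c'" if "x \<in> S" for x
    using that coord_image[OF c', of U] cinv_in_cdom[OF c'] by (auto simp: S_def)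
  have "smooth_on S (\<lambda>x. f (cinv c (coord c (cinv c' x))))"
  proof (rule smooth_on_compose[OF S T])
    show "(\<lambda>x. coord c (cinv c' x)) ` S \<subseteq> coord c ` U" using inS by auto
    have "S \<subseteq> coord c' ` (cdom c' \<inter> cdom c)" using U by (auto simp: S_def)
    thus "smooth_on S (\<lambda>x. coord c (cinv c' x))"
      by (rule smooth_on_subset[OF transition_smooth[OF c' c]])
  qed (rule f)
  thus "smooth_on (coord c' ` (U \<inter> cdom c')) (\<lambda>x. f (cinv c' x))"
    unfolding S_def[symmetric]
  proof (rule smooth_on_cong[OF S, rotated])
    fix x assume "x \<in> S"
    hence "cinv c' x \<in> cdom c" using inS(1) U(2) by blast
    thus "f (cinv c' x) = f (cinv c (coord c (cinv c' x)))" by (simp only: cinv_coord[OF c])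
  qed
qed

lemma msmoothD: "msmooth A U f \<Longrightarrow> c \<in> A \<Longrightarrow> smooth_on (coord c ` (U \<inter> cdom c)) (\<lambda>x. f (cinv c x))"
  by (simp add: msmooth_def')

named_theorems msmooth_intros

lemma msmooth_const [msmooth_intros]: "msmooth A U (\<lambda>p. a)"
  by (simp add: msmooth_def' smooth_on_const)

lemma msmooth_add [msmooth_intros]:
  "open U \<Longrightarrow> msmooth A U f \<Longrightarrow> msmooth A U g \<Longrightarrow> msmooth A U (\<lambda>p. f p + g p)"
  unfolding msmooth_def' by (auto intro!: smooth_intros open_coord_image)

lemma msmooth_diff [msmooth_intros]:
  "open U \<Longrightarrow> msmooth A U f \<Longrightarrow> msmooth A U g \<Longrightarrow> msmooth A U (\<lambda>p. f p - g p)"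
  unfolding msmooth_def' by (auto intro!: smooth_intros open_coord_image)

lemma msmooth_mult [msmooth_intros]:
  "open U \<Longrightarrow> msmooth A U f \<Longrightarrow> msmooth A U g \<Longrightarrow> msmooth A U (\<lambda>p. f p * g p)"
  unfolding msmooth_def' by (auto intro!: smooth_intros open_coord_image)

lemma msmooth_cnj [msmooth_intros]:
  "open U \<Longrightarrow> msmooth A U f \<Longrightarrow> msmooth A U (\<lambda>p. cnj (f p))"
  unfolding msmooth_def' by (auto intro!: smooth_intros open_coord_image)

lemma msmooth_sum [msmooth_intros]:
  "open U \<Longrightarrow> (\<And>i. i \<in> I \<Longrightarrow> msmooth A U (f i)) \<Longrightarrow> msmooth A U (\<lambda>p. \<Sum>i\<in>I. f i p)"
  unfolding msmooth_def' by (auto intro!: smooth_on_sum open_coord_image)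

lemma msmooth_prod [msmooth_intros]:
  "open U \<Longrightarrow> (\<And>i. i \<in> I \<Longrightarrow> msmooth A U (f i)) \<Longrightarrow> msmooth A U (\<lambda>p. \<Prod>i\<in>I. f i p)"
  unfolding msmooth_def' by (auto intro!: smooth_on_prod open_coord_image)

lemma msmooth_det:
  assumes "open U" "\<And>i j. msmooth A U (\<lambda>p. M p i j)"
  shows "msmooth A U (\<lambda>p. det (\<chi> i j. M p i j :: complex^'r::finite^'r))"
  unfolding det_def using assms by (auto intro!: msmooth_intros)

lemma msmooth_coord: "c \<in> A \<Longrightarrow> msmooth A (cdom c) (\<lambda>p. of_real (coord c p $ i))"
proof (rule msmooth_in_chart)
  assume c: "c \<in> A"
  show "smooth_on (coord c ` cdom c) (\<lambda>x. complex_of_real (coord c (cinv c x) $ i))"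
    unfolding cran_def[symmetric]
    by (rule smooth_on_cong[OF chart_open(2)[OF c], of _ "\<lambda>x. complex_of_real (x $ i)"])
       (auto simp: coord_cinv[OF c] intro!: smooth_intros chart_open c)
qed (auto simp: chart_open)

lemma smooth_funs_msmooth: "f \<in> smooth_funs A \<Longrightarrow> msmooth A U f"
  by (auto simp: smooth_funs_def intro: msmooth_subset)

lemma smooth_funs_add: "f \<in> smooth_funs A \<Longrightarrow> g \<in> smooth_funs A \<Longrightarrow> (\<lambda>p. f p + g p) \<in> smooth_funs A"
  and smooth_funs_mult: "f \<in> smooth_funs A \<Longrightarrow> g \<in> smooth_funs A \<Longrightarrow> (\<lambda>p. f p * g p) \<in> smooth_funs A"
  and smooth_funs_diff: "f \<in> smooth_funs A \<Longrightarrow> g \<in> smooth_funs A \<Longrightarrow> (\<lambda>p. f p - g p) \<in> smooth_funs A"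
  and smooth_funs_const: "(\<lambda>p. a) \<in> smooth_funs A"
  and smooth_funs_cmult: "f \<in> smooth_funs A \<Longrightarrow> (\<lambda>p. a * f p) \<in> smooth_funs A"
  and smooth_funs_cnj: "f \<in> smooth_funs A \<Longrightarrow> (\<lambda>p. cnj (f p)) \<in> smooth_funs A"
  by (auto simp: smooth_funs_def intro!: msmooth_intros)

lemma smooth_funs_sum: "(\<And>i. i \<in> I \<Longrightarrow> f i \<in> smooth_funs A) \<Longrightarrow> (\<lambda>p. \<Sum>i\<in>I. f i p) \<in> smooth_funs A"
  by (auto simp: smooth_funs_def intro!: msmooth_intros)

lemma msmooth_extend:
  assumes "open U" "closed K" "K \<subseteq> U" "msmooth A (U \<inter> V) f" "\<And>p. p \<notin> K \<Longrightarrow> f p = 0" "open V"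
  shows "msmooth A V f"
proof (rule msmooth_local)
  fix p assume p: "p \<in> V"
  show "\<exists>O'. open O' \<and> p \<in> O' \<and> msmooth A O' f"
  proof (cases "p \<in> U")
    case False
    have "msmooth A (- K) f"
      by (rule msmooth_cong[OF _ _ msmooth_const[of _ 0]]) (use assms in auto)
    thus ?thesis using False assms by (intro exI[of _ "- K"]) auto
  qed (use assms p in \<open>intro exI[of _ "U \<inter> V"], auto\<close>)
qed

lemma smooth_funs_extend:
  assumes "open U" "closed K" "K \<subseteq> U" "msmooth A U f" "\<And>p. p \<notin> K \<Longrightarrow> f p = 0"
  shows "f \<in> smooth_funs A"
  unfolding smooth_funs_def using msmooth_extend[of U K UNIV f] assms by simp

definition bump_in :: "'m set \<Rightarrow> 'm set \<Rightarrow> 'm set \<Rightarrow> ('m \<Rightarrow> complex) \<Rightarrow> bool" where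
  "bump_in U O' K \<beta> \<longleftrightarrow> \<beta> \<in> smooth_funs A \<and> compact K \<and> K \<subseteq> U \<and> open O' \<and> O' \<subseteq> K \<and>
     (\<forall>q\<in>O'. \<beta> q = 1) \<and> (\<forall>q. q \<notin> K \<longrightarrow> \<beta> q = 0)"

lemma bump_inD:
  assumes "bump_in U O' K \<beta>"
  shows "\<beta> \<in> smooth_funs A" "compact K" "closed K" "K \<subseteq> U" "open O'" "O' \<subseteq> K" "O' \<subseteq> U"
    "\<And>q. q \<in> O' \<Longrightarrow> \<beta> q = 1" "\<And>q. q \<notin> K \<Longrightarrow> \<beta> q = 0"
  using assms compact_imp_closed unfolding bump_in_def by blast+

lemma bump_exists:
  assumes U: "open U'" and p: "p \<in> U'"
  obtains \<beta> K O' where "bump_in U' O' K \<beta>" "p \<in> O'"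
proof -
  obtain c where c: "c \<in> A" and pc: "p \<in> cdom c" using chart_cover by blast
  define U where "U = U' \<inter> cdom c"
  have U: "open U" "U \<subseteq> cdom c" and p: "p \<in> U" using U p pc chart_open(1)[OF c] by (auto simp: U_def)
  have UU: "U \<inter> cdom c = U" using U by auto
  have op: "open (coord c ` U)" using open_coord_image[OF c U(1)] by (simp add: UU)
  have "coord c p \<in> coord c ` U" using p by simp
  from open_contains_cball_eq[OF op, rule_format, THEN iffD1, OF this]
  obtain r where r: "r > 0" "cball (coord c p) r \<subseteq> coord c ` U" by blast
  have ran: "coord c ` U \<subseteq> cran c" using U by (auto simp: cran_def)
  define K where "K = cinv c ` cball (coord c p) r"
  define O' where "O' = cdom c \<inter> coord c -` ball (coord c p) (r / 2)"
  define \<beta> where "\<beta> q = (if q \<in> cdom c then complex_of_real (cutoff (coord c p) r (coord c q)) else 0)" for q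
  have KU: "K \<subseteq> U"
  proof
    fix q assume "q \<in> K"
    then obtain x where x: "x \<in> cball (coord c p) r" "q = cinv c x" by (auto simp: K_def)
    then obtain u where "u \<in> U" "x = coord c u" using r by blast
    thus "q \<in> U" using x cinv_coord[OF c] U by auto
  qed
  have inK: "q \<in> K" if "q \<in> cdom c" "dist (coord c q) (coord c p) \<le> r" for q
    unfolding K_def using that cinv_coord[OF c that(1)] by (intro image_eqI[of _ _ "coord c q"]) (auto simp: dist_commute)
  have Kc: "compact K"
  proof -
    have "continuous_on (cran c) (cinv c)" using chart_homeo[OF c] by (simp add: homeomorphism_def)
    hence "continuous_on (cball (coord c p) r) (cinv c)"
      by (rule continuous_on_subset) (rule order_trans[OF r(2) ran])
    thus ?thesis unfolding K_def by (rule compact_continuous_image) simp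
  qed
  have \<beta>0: "\<beta> q = 0" if "q \<notin> K" for q
  proof (cases "q \<in> cdom c")
    case True
    hence "\<not> dist (coord c q) (coord c p) \<le> r" using inK that by blast
    thus ?thesis using r(1) cutoff_eq_0[of r "coord c q" "coord c p"] by (simp add: \<beta>_def)
  qed (simp add: \<beta>_def)
  have "msmooth A (cdom c) \<beta>"
  proof (rule msmooth_in_chart[OF c chart_open(1)[OF c] order_refl])
    have "smooth_on (cran c) (\<lambda>x. \<beta> (cinv c x))"
      by (rule smooth_on_cong[OF chart_open(2)[OF c], of _ "\<lambda>x. complex_of_real (cutoff (coord c p) r x)"])
         (use r in \<open>auto simp: \<beta>_def cinv_in_cdom[OF c] coord_cinv[OF c] intro!: smooth_intros smooth_on_cutoff chart_open c\<close>)
    thus "smooth_on (coord c ` cdom c) (\<lambda>x. \<beta> (cinv c x))" by (simp add: cran_def)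
  qed
  hence "\<beta> \<in> smooth_funs A"
    using KU U by (intro smooth_funs_extend[OF chart_open(1)[OF c] compact_imp_closed[OF Kc] _ _ \<beta>0]) auto
  moreover have "open O'" unfolding O'_def by (rule open_chart_preimage[OF c open_ball])
  moreover have "p \<in> O'" using p U r by (auto simp: O'_def)
  moreover have "O' \<subseteq> K" using inK r by (auto simp: O'_def dist_commute)
  moreover have "\<beta> q = 1" if "q \<in> O'" for q
    using that r cutoff_eq_1[of r "coord c q" "coord c p"] by (auto simp: \<beta>_def O'_def dist_commute)
  ultimately have "bump_in U' O' K \<beta>" "p \<in> O'"
    using Kc KU \<beta>0 unfolding bump_in_def by (auto simp: U_def)
  thus ?thesis by (rule that)
qed

lemma bump_mult:
  assumes b: "bump_in U O' K \<beta>" and U: "open U" and f: "msmooth A U f"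
  shows "(\<lambda>q. \<beta> q * f q) \<in> smooth_funs A"
proof (rule smooth_funs_extend[of U K])
  show "msmooth A U (\<lambda>q. \<beta> q * f q)"
    by (intro msmooth_mult U f smooth_funs_msmooth bump_inD(1)[OF b])
qed (use bump_inD[OF b] U in auto)

definition coords_on :: "('m, 'k) chart \<Rightarrow> 'm set \<Rightarrow> ('k \<Rightarrow> 'm \<Rightarrow> complex) \<Rightarrow> bool" where
  "coords_on c O' y \<longleftrightarrow> open O' \<and> O' \<subseteq> cdom c \<and> (\<forall>i. y i \<in> smooth_funs A) \<and>
     (\<forall>i. \<forall>q\<in>O'. y i q = of_real (coord c q $ i))"

lemma coords_onD:
  assumes "coords_on c O' y"
  shows "open O'" "O' \<subseteq> cdom c" "y i \<in> smooth_funs A" "q \<in> O' \<Longrightarrow> y i q = of_real (coord c q $ i)"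
  using assms unfolding coords_on_def by blast+

lemma local_coordinates:
  assumes c: "c \<in> A" and U: "open U" and p: "p \<in> U" "p \<in> cdom c"
  obtains y O' where "coords_on c O' y" "p \<in> O'" "O' \<subseteq> U"
proof -
  have "open (U \<inter> cdom c)" "p \<in> U \<inter> cdom c" using U p chart_open[OF c] by auto
  then obtain \<beta> K O' where b: "bump_in (U \<inter> cdom c) O' K \<beta>" "p \<in> O'" by (rule bump_exists)
  have "coords_on c O' (\<lambda>i q. \<beta> q * of_real (coord c q $ i))"
    unfolding coords_on_def using bump_inD[OF b(1)] U chart_open[OF c]
    by (auto intro!: bump_mult[OF b(1)] msmooth_subset[OF msmooth_coord[OF c]])
  thus ?thesis using b(2) bump_inD(7)[OF b(1)] by (intro that[of O']) auto
qed

section \<open>Tangent vectors in coordinates\<close>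

lemma tangentD:
  assumes "v \<in> tangent_space A p"
  shows "\<And>f g. f \<in> smooth_funs A \<Longrightarrow> g \<in> smooth_funs A \<Longrightarrow> v (\<lambda>q. f q + g q) = v f + v g"
    and "\<And>a f. f \<in> smooth_funs A \<Longrightarrow> v (\<lambda>q. a * f q) = a * v f"
    and "\<And>f g. f \<in> smooth_funs A \<Longrightarrow> g \<in> smooth_funs A \<Longrightarrow> v (\<lambda>q. f q * g q) = f p * v g + g p * v f"
    and "\<And>f. f \<notin> smooth_funs A \<Longrightarrow> v f = 0"
  using assms by (auto simp: tangent_space_def)

lemma tangent_const: "v \<in> tangent_space A p \<Longrightarrow> v (\<lambda>q. a) = 0"
  using tangentD(3)[of v p "\<lambda>q. 1" "\<lambda>q. 1"] tangentD(2)[of v p "\<lambda>q. 1" a] smooth_funs_const by simp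

lemma tangent_diff:
  assumes v: "v \<in> tangent_space A p" and "f \<in> smooth_funs A" "g \<in> smooth_funs A"
  shows "v (\<lambda>q. f q - g q) = v f - v g"
  using tangentD(1)[OF v assms(2) smooth_funs_cmult[OF assms(3), of "-1"]] tangentD(2)[OF v assms(3), of "-1"] by simp

lemma tangent_sum_fun:
  assumes v: "v \<in> tangent_space A p" and "\<And>i. i \<in> I \<Longrightarrow> f i \<in> smooth_funs A"
  shows "v (\<lambda>q. \<Sum>i\<in>I. f i q) = (\<Sum>i\<in>I. v (f i))"
  using assms(2)
  by (induction I rule: infinite_finite_induct) (simp_all add: tangent_const[OF v] tangentD(1)[OF v] smooth_funs_sum)

lemma tangent_local:
  assumes v: "v \<in> tangent_space A p" and fg: "f \<in> smooth_funs A" "g \<in> smooth_funs A"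
    and U: "open U" "p \<in> U" "\<And>q. q \<in> U \<Longrightarrow> f q = g q"
  shows "v f = v g"
proof -
  obtain \<beta> K O' where b: "bump_in U O' K \<beta>" "p \<in> O'" by (rule bump_exists[OF U(1,2)])
  define h where "h = (\<lambda>q. f q - g q)"
  have h: "h \<in> smooth_funs A" unfolding h_def by (rule smooth_funs_diff[OF fg])
  have b1: "(\<lambda>q. 1 - \<beta> q) \<in> smooth_funs A"
    by (intro smooth_funs_diff smooth_funs_const bump_inD(1)[OF b(1)])
  have "h q * (1 - \<beta> q) = h q" for q
    using bump_inD(4,9)[OF b(1)] U(3)[of q] by (cases "q \<in> K") (auto simp: h_def)
  hence "(\<lambda>q. h q * (1 - \<beta> q)) = h" by blast
  hence "v h = v (\<lambda>q. h q * (1 - \<beta> q))" by simp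
  also have "\<dots> = h p * v (\<lambda>q. 1 - \<beta> q) + (1 - \<beta> p) * v h" by (rule tangentD(3)[OF v h b1])
  also have "\<dots> = 0" using bump_inD(8)[OF b] U(2,3) by (simp add: h_def)
  finally show ?thesis using tangent_diff[OF v fg] by (simp add: h_def)
qed

lemma tangent_zero: "(\<lambda>f. 0) \<in> tangent_space A p"
  by (auto simp: tangent_space_def)

lemma tangent_add: "v \<in> tangent_space A p \<Longrightarrow> w \<in> tangent_space A p \<Longrightarrow> (\<lambda>f. v f + w f) \<in> tangent_space A p"
  by (auto simp: tangent_space_def algebra_simps)

lemma tangent_cmult: "v \<in> tangent_space A p \<Longrightarrow> (\<lambda>f. a * v f) \<in> tangent_space A p"
  by (auto simp: tangent_space_def algebra_simps)

lemma tangent_sum: "(\<And>i. i \<in> I \<Longrightarrow> v i \<in> tangent_space A p) \<Longrightarrow> (\<lambda>f. \<Sum>i\<in>I. v i f) \<in> tangent_space A p"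
  by (induction I rule: infinite_finite_induct) (auto simp: tangent_zero tangent_add)

lemma smooth_funs_differentiable:
  assumes "f \<in> smooth_funs A" "c \<in> A" "p \<in> cdom c"
  shows "(\<lambda>x. f (cinv c x)) differentiable at (coord c p)"
  using msmoothD[OF smooth_funs_msmooth[OF assms(1), of UNIV] assms(2)] chart_open(2)[OF assms(2)] assms(3)
  by (intro smooth_on_differentiable_at[of "cran c"]) (auto simp: cran_def)

lemma coord_vec_apply: "f \<in> smooth_funs A \<Longrightarrow> coord_vec A c i p f = pderiv1 i (\<lambda>x. f (cinv c x)) (coord c p)"
  by (simp add: coord_vec_def o_def)

lemma coord_vec_tangent:
  assumes c: "c \<in> A" "p \<in> cdom c"
  shows "coord_vec A c i p \<in> tangent_space A p"
  unfolding tangent_space_def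
proof (intro CollectI conjI ballI allI impI)
  fix f g assume fg: "f \<in> smooth_funs A" "g \<in> smooth_funs A"
  note d = smooth_funs_differentiable[OF fg(1) c] smooth_funs_differentiable[OF fg(2) c]
  show "coord_vec A c i p (\<lambda>q. f q + g q) = coord_vec A c i p f + coord_vec A c i p g"
    using fg pderiv1_add[OF d] by (simp add: coord_vec_apply smooth_funs_add)
  show "coord_vec A c i p (\<lambda>q. f q * g q) = f p * coord_vec A c i p g + g p * coord_vec A c i p f"
    using fg pderiv1_bilinear[OF bounded_bilinear_mult d, of i] cinv_coord[OF c]
    by (simp add: coord_vec_apply smooth_funs_mult mult.commute)
next
  fix a f assume f: "f \<in> smooth_funs A"
  show "coord_vec A c i p (\<lambda>q. a * f q) = a * coord_vec A c i p f"
    using f pderiv1_bounded_linear[OF bounded_linear_mult_right smooth_funs_differentiable[OF f c]]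
    by (simp add: coord_vec_apply smooth_funs_cmult)
qed (simp add: coord_vec_def)

lemma tangent_coordinates:
  assumes c: "c \<in> A" and v: "v \<in> tangent_space A p" and y': "coords_on c O' y" and pO: "p \<in> O'"
  shows "v = (\<lambda>f. \<Sum>i\<in>UNIV. v (y i) * coord_vec A c i p f)"
proof
  note y = coords_onD(3,4)[OF y'] and O' = coords_onD(1)[OF y'] pO coords_onD(2)[OF y']
  fix f
  show "v f = (\<Sum>i\<in>UNIV. v (y i) * coord_vec A c i p f)"
  proof (cases "f \<in> smooth_funs A")
    case False
    thus ?thesis using tangentD(4)[OF v] by (simp add: coord_vec_def)
  next
    case f: True
    have p: "p \<in> cdom c" using O' by auto
    define F where "F x = f (cinv c x)" for x
    define x0 where "x0 = coord c p"
    have F: "smooth_on (cran c) F"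
      using msmoothD[OF smooth_funs_msmooth[OF f, of UNIV] c] by (simp add: F_def[abs_def] cran_def)
    have OO: "O' \<inter> cdom c = O'" using O' by auto
    have "open (coord c ` O')" using open_coord_image[OF c O'(1)] by (simp add: OO)
    moreover have "x0 \<in> coord c ` O'" using O' by (auto simp: x0_def)
    ultimately obtain r where r: "r > 0" "ball x0 r \<subseteq> coord c ` O'"
      using openE by blast
    have rr: "ball x0 r \<subseteq> cran c" using r O' by (auto simp: cran_def)
    have Fr: "smooth_on (ball x0 r) F" by (rule smooth_on_subset[OF F rr])
    define g where "g i = ray_moment x0 0 (pderiv1 i F)" for i
    define U where "U = cdom c \<inter> coord c -` ball x0 r"
    have U: "open U" "p \<in> U" "U \<subseteq> cdom c" "U \<subseteq> O'"
    proof -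
      show "open U" unfolding U_def by (rule open_chart_preimage[OF c open_ball])
      show "p \<in> U" "U \<subseteq> cdom c" using p r by (auto simp: U_def x0_def)
      show "U \<subseteq> O'"
      proof
        fix q assume q: "q \<in> U"
        then obtain u where "u \<in> O'" "coord c q = coord c u" using r by (auto simp: U_def)
        thus "q \<in> O'" using q cinv_coord[OF c, of q] cinv_coord[OF c, of u] O' by (auto simp: U_def)
      qed
    qed
    have gs: "msmooth A U (\<lambda>q. g i (coord c q))" for i
    proof (rule msmooth_in_chart[OF c U(1,3)])
      have UU: "U \<inter> cdom c = U" using U by auto
      have op: "open (coord c ` U)" using open_coord_image[OF c U(1)] by (simp add: UU)
      have sub: "coord c ` U \<subseteq> ball x0 r" by (auto simp: U_def)
      have "smooth_on (coord c ` U) (g i)"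
        unfolding g_def by (rule smooth_on_subset[OF smooth_on_ray_moment[OF smooth_on_pderiv1[OF Fr]] sub])
      thus "smooth_on (coord c ` U) (\<lambda>x. g i (coord c (cinv c x)))"
      proof (rule smooth_on_cong[OF op, rotated])
        fix x assume "x \<in> coord c ` U"
        hence "x \<in> cran c" using sub rr by blast
        thus "g i (coord c (cinv c x)) = g i x" by (simp only: coord_cinv[OF c])
      qed
    qed
    obtain \<beta> K O2 where b: "bump_in U O2 K \<beta>" "p \<in> O2" by (rule bump_exists[OF U(1,2)])
    define G where "G i q = \<beta> q * g i (coord c q)" for i q
    have G: "G i \<in> smooth_funs A" for i
      unfolding G_def by (rule bump_mult[OF b(1) U(1) gs])
    define Y where "Y i q = y i q - of_real (x0 $ i)" for i q
    have Y: "Y i \<in> smooth_funs A" for i unfolding Y_def by (intro smooth_funs_diff y smooth_funs_const)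
    define R where "R q = f p + (\<Sum>i\<in>UNIV. Y i q * G i q)" for q
    have R: "R \<in> smooth_funs A" unfolding R_def
      by (intro smooth_funs_add smooth_funs_const smooth_funs_sum smooth_funs_mult Y G)
    have "f q = R q" if q: "q \<in> O2" for q
    proof -
      have qU: "q \<in> U" using q bump_inD(7)[OF b(1)] by auto
      hence x: "coord c q \<in> ball x0 r" and qc: "q \<in> cdom c" by (auto simp: U_def)
      have "F (coord c q) = F x0 + (\<Sum>i\<in>UNIV. of_real (coord c q $ i - x0 $ i) * g i (coord c q))"
        unfolding g_def by (rule Hadamard(1)[OF Fr x])
      moreover have "F (coord c q) = f q" "F x0 = f p" using cinv_coord[OF c] qc p by (auto simp: F_def x0_def)
      moreover have "y i q = of_real (coord c q $ i)" for i using y(2) U(4) qU by auto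
      ultimately show ?thesis using bump_inD(8)[OF b(1) q] by (simp add: R_def Y_def G_def)
    qed
    hence "v f = v R" by (intro tangent_local[OF v f R bump_inD(5)[OF b(1)] b(2)])
    also have "\<dots> = (\<Sum>i\<in>UNIV. v (\<lambda>q. Y i q * G i q))"
      unfolding R_def using tangentD(1)[OF v smooth_funs_const smooth_funs_sum[OF smooth_funs_mult[OF Y G]]]
      by (simp add: tangent_const[OF v] tangent_sum_fun[OF v smooth_funs_mult[OF Y G]])
    also have "\<dots> = (\<Sum>i\<in>UNIV. v (y i) * coord_vec A c i p f)"
    proof (rule sum.cong[OF refl])
      fix i
      have "Y i p = 0" using y(2)[OF O'(2)] by (simp add: Y_def x0_def)
      moreover have "G i p = coord_vec A c i p f"
        using bump_inD(8)[OF b] Hadamard(2)[OF Fr, of i] f by (simp add: G_def g_def x0_def coord_vec_apply F_def[abs_def])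
      moreover have "v (Y i) = v (y i)"
        unfolding Y_def using tangent_diff[OF v y(1) smooth_funs_const] by (simp add: tangent_const[OF v])
      ultimately show "v (\<lambda>q. Y i q * G i q) = v (y i) * coord_vec A c i p f"
        using tangentD(3)[OF v Y G] by (simp add: mult.commute)
    qed
    finally show ?thesis .
  qed
qed

lemma coord_vec_coordinate:
  assumes c: "c \<in> A" and y': "coords_on c O' y" and pO: "p \<in> O'"
  shows "coord_vec A c i p (y j) = (if i = j then 1 else 0)"
proof -
  note y = coords_onD(3,4)[OF y'] and O' = coords_onD(1)[OF y'] pO coords_onD(2)[OF y']
  have OO: "O' \<inter> cdom c = O'" using O' by auto
  have op: "open (coord c ` O')" using open_coord_image[OF c O'(1)] by (simp add: OO)
  have "pderiv1 i (\<lambda>x. y j (cinv c x)) (coord c p) = pderiv1 i (\<lambda>x. complex_of_real (x $ j)) (coord c p)"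
  proof (rule pderiv1_cong[OF op])
    fix x assume "x \<in> coord c ` O'"
    then obtain q where "q \<in> O'" "x = coord c q" by auto
    thus "y j (cinv c x) = complex_of_real (x $ j)" using y O' cinv_coord[OF c, of q] by auto
  qed (use O' in auto)
  also have "\<dots> = of_real (axis i 1 $ j)"
  proof (rule pderiv1_eq)
    show "((\<lambda>x. complex_of_real (x $ j)) has_derivative (\<lambda>x. complex_of_real (x $ j))) (at (coord c p))"
      by (intro bounded_linear_imp_has_derivative bounded_linear_compose[OF bounded_linear_of_real bounded_linear_vec_nth])
  qed
  finally show ?thesis using y by (simp add: coord_vec_apply axis_def)
qed

lemma coord_vec_combination_apply:
  assumes c: "c \<in> A" and y': "coords_on c O' y" and pO: "p \<in> O'"
  shows "(\<Sum>i\<in>UNIV. a i * coord_vec A c i p (y j)) = a j"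
  unfolding coord_vec_coordinate[OF assms] by (simp add: if_distrib cong: if_cong)

lemma vec_coeff_eq:
  assumes c: "c \<in> A" and v: "v \<in> tangent_space A p" and y': "coords_on c O' y" and pO: "p \<in> O'"
  shows "vec_coeff A c p v = (\<lambda>i. v (y i))"
  unfolding vec_coeff_def
proof (rule the_equality)
  show "v = (\<lambda>f. \<Sum>i\<in>UNIV. v (y i) * coord_vec A c i p f)"
    by (rule tangent_coordinates[OF assms])
  fix a assume a: "v = (\<lambda>f. \<Sum>i\<in>UNIV. a i * coord_vec A c i p f)"
  show "a = (\<lambda>i. v (y i))"
  proof
    fix j
    show "a j = v (y j)" using coord_vec_combination_apply[OF c y' pO, of a j] fun_cong[OF a, of "y j"] by simp
  qed
qed

lemma vec_coeff_expand:
  assumes c: "c \<in> A" "p \<in> cdom c" and v: "v \<in> tangent_space A p"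
  shows "v = (\<lambda>f. \<Sum>i\<in>UNIV. vec_coeff A c p v i * coord_vec A c i p f)"
proof -
  obtain y O' where y: "coords_on c O' y" "p \<in> O'" "O' \<subseteq> UNIV"
    by (rule local_coordinates[OF c(1) open_UNIV UNIV_I c(2)])
  show ?thesis
    using tangent_coordinates[OF c(1) v y(1,2)] vec_coeff_eq[OF c(1) v y(1,2)] by simp
qed

lemma vec_coeff_combination:
  assumes c: "c \<in> A" "p \<in> cdom c"
  shows "vec_coeff A c p (\<lambda>f. \<Sum>i\<in>UNIV. a i * coord_vec A c i p f) = a"
proof -
  obtain y O' where y: "coords_on c O' y" "p \<in> O'" "O' \<subseteq> UNIV"
    by (rule local_coordinates[OF c(1) open_UNIV UNIV_I c(2)])
  have "(\<lambda>f. \<Sum>i\<in>UNIV. a i * coord_vec A c i p f) \<in> tangent_space A p"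
    by (intro tangent_sum tangent_cmult coord_vec_tangent c)
  from vec_coeff_eq[OF c(1) this y(1,2)] show ?thesis
    using coord_vec_combination_apply[OF c(1) y(1,2), of a] by (simp add: fun_eq_iff)
qed

lemma vector_fieldsD:
  assumes "L \<in> vector_fields A U"
  shows "p \<in> U \<Longrightarrow> L p \<in> tangent_space A p" "f \<in> smooth_funs A \<Longrightarrow> msmooth A U (\<lambda>p. L p f)"
  using assms by (auto simp: vector_fields_def)

lemma vector_fields_smooth_fun: "L \<in> vector_fields A UNIV \<Longrightarrow> (\<lambda>p. L p f) \<in> smooth_funs A"
proof (cases "f \<in> smooth_funs A")
  case True
  thus "L \<in> vector_fields A UNIV \<Longrightarrow> ?thesis" by (auto simp: vector_fields_def smooth_funs_def)
next
  case False
  assume "L \<in> vector_fields A UNIV"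
  hence "(\<lambda>p. L p f) = (\<lambda>p. 0)" using vector_fieldsD(1) tangentD(4) False by blast
  thus ?thesis using smooth_funs_const by simp
qed

lemma vec_coeff_smooth:
  assumes c: "c \<in> A" and U: "open U" and L: "L \<in> vector_fields A U"
  shows "msmooth A (U \<inter> cdom c) (\<lambda>p. vec_coeff A c p (L p) i)"
proof (rule msmooth_local)
  fix p assume p: "p \<in> U \<inter> cdom c"
  obtain y O' where y: "coords_on c O' y" "p \<in> O'" "O' \<subseteq> U"
    by (rule local_coordinates[OF c U IntD1[OF p] IntD2[OF p]])
  have "msmooth A O' (\<lambda>p. vec_coeff A c p (L p) i)"
  proof (rule msmooth_cong[OF coords_onD(1)[OF y(1)]])
    show "msmooth A O' (\<lambda>p. L p (y i))" by (rule msmooth_subset[OF vector_fieldsD(2)[OF L coords_onD(3)[OF y(1)]] y(3)])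
    fix q assume q: "q \<in> O'"
    show "vec_coeff A c q (L q) i = L q (y i)"
      using vec_coeff_eq[OF c vector_fieldsD(1)[OF L subsetD[OF y(3) q]] y(1) q] by simp
  qed
  thus "\<exists>O'. open O' \<and> p \<in> O' \<and> msmooth A O' (\<lambda>p. vec_coeff A c p (L p) i)" using y coords_onD(1)[OF y(1)] by blast
qed

lemma field_mult:
  assumes L: "L \<in> vector_fields A U" and U: "open U" and b: "bump_in U O' K \<beta>"
  shows "(\<lambda>p f. \<beta> p * L p f) \<in> vector_fields A UNIV"
  unfolding vector_fields_def
proof (intro CollectI conjI ballI)
  fix p
  show "(\<lambda>f. \<beta> p * L p f) \<in> tangent_space A p"
  proof (cases "p \<in> K")
    case True
    hence "p \<in> U" using bump_inD(4)[OF b] by blast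
    thus ?thesis by (intro tangent_cmult vector_fieldsD(1)[OF L])
  next
    case False
    thus ?thesis using bump_inD(9)[OF b] by (simp add: tangent_zero)
  qed
next
  fix f assume "f \<in> smooth_funs A"
  from bump_mult[OF b U vector_fieldsD(2)[OF L this]]
  show "msmooth A UNIV (\<lambda>p. \<beta> p * L p f)" by (simp add: smooth_funs_def)
qed

lemma coord_vec_field: "c \<in> A \<Longrightarrow> coord_vec A c i \<in> vector_fields A (cdom c)"
  unfolding vector_fields_def
proof (intro CollectI conjI ballI)
  fix f assume c: "c \<in> A" and f: "f \<in> smooth_funs A"
  show "msmooth A (cdom c) (\<lambda>p. coord_vec A c i p f)"
  proof (rule msmooth_in_chart[OF c chart_open(1)[OF c] order_refl])
    have "smooth_on (cran c) (\<lambda>x. f (cinv c x))"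
      using msmoothD[OF smooth_funs_msmooth[OF f, of UNIV] c] by (simp add: cran_def)
    hence "smooth_on (cran c) (pderiv1 i (\<lambda>x. f (cinv c x)))" by (rule smooth_on_pderiv1)
    hence "smooth_on (cran c) (\<lambda>x. coord_vec A c i (cinv c x) f)"
      by (rule smooth_on_cong[OF chart_open(2)[OF c], rotated]) (simp add: coord_vec_apply[OF f] coord_cinv[OF c])
    thus "smooth_on (coord c ` cdom c) (\<lambda>x. coord_vec A c i (cinv c x) f)" by (simp add: cran_def)
  qed
qed (rule coord_vec_tangent)

lemma fields_add:
  assumes "K \<in> vector_fields A U" "L \<in> vector_fields A U" "open U"
  shows "(\<lambda>p f. K p f + L p f) \<in> vector_fields A U"
  using assms by (auto simp: vector_fields_def intro!: tangent_add msmooth_intros)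

lemma fields_smult:
  assumes "L \<in> vector_fields A U" "msmooth A U g" "open U"
  shows "(\<lambda>p f. g p * L p f) \<in> vector_fields A U"
  using assms by (auto simp: vector_fields_def intro!: tangent_cmult msmooth_intros)

lemma fields_sum:
  assumes "\<And>i. i \<in> I \<Longrightarrow> L i \<in> vector_fields A U" "open U"
  shows "(\<lambda>p f. \<Sum>i\<in>I. L i p f) \<in> vector_fields A U"
  using assms by (auto simp: vector_fields_def intro!: tangent_sum msmooth_intros)

lemma field_extension:
  assumes v: "v \<in> tangent_space A p"
  obtains K where "K \<in> vector_fields A UNIV" "K p = v"
proof -
  obtain c where c: "c \<in> A" "p \<in> cdom c" using chart_cover by blast
  obtain \<beta> K O' where b: "bump_in (cdom c) O' K \<beta>" "p \<in> O'"
    by (rule bump_exists[OF chart_open(1)[OF c(1)] c(2)])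
  define L where "L q f = (\<Sum>i\<in>UNIV. vec_coeff A c p v i * coord_vec A c i q f)" for q f
  have "L \<in> vector_fields A (cdom c)"
    unfolding L_def by (intro fields_sum fields_smult coord_vec_field msmooth_const chart_open c)
  from field_mult[OF this chart_open(1)[OF c(1)] b(1)]
  have "(\<lambda>q f. \<beta> q * L q f) \<in> vector_fields A UNIV" .
  moreover have "(\<lambda>f. \<beta> p * L p f) = v"
    using bump_inD(8)[OF b] vec_coeff_expand[OF c v] by (simp add: L_def)
  ultimately show ?thesis by (rule that)
qed

section \<open>Covectors and one-forms\<close>

lemma cotangentD:
  assumes "\<eta> \<in> cotangent_space A p"
  shows "v \<in> tangent_space A p \<Longrightarrow> w \<in> tangent_space A p \<Longrightarrow> \<eta> (\<lambda>f. v f + w f) = \<eta> v + \<eta> w"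
    and "v \<in> tangent_space A p \<Longrightarrow> \<eta> (\<lambda>f. a * v f) = a * \<eta> v"
    and "v \<notin> tangent_space A p \<Longrightarrow> \<eta> v = 0"
  using assms by (auto simp: cotangent_space_def complex_linear_on_def)

lemma cotangent_zero: "\<eta> \<in> cotangent_space A p \<Longrightarrow> \<eta> (\<lambda>f. 0) = 0"
  using cotangentD(2)[OF _ tangent_zero, of \<eta> p 0] by simp

lemma cotangent_sum:
  assumes \<eta>: "\<eta> \<in> cotangent_space A p" and v: "\<And>i. i \<in> I \<Longrightarrow> v i \<in> tangent_space A p"
  shows "\<eta> (\<lambda>f. \<Sum>i\<in>I. a i * v i f) = (\<Sum>i\<in>I. a i * \<eta> (v i))"
  using v
proof (induction I rule: infinite_finite_induct)
  case (insert i I)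
  have "\<eta> (\<lambda>f. a i * v i f + (\<Sum>i\<in>I. a i * v i f)) = \<eta> (\<lambda>f. a i * v i f) + \<eta> (\<lambda>f. \<Sum>i\<in>I. a i * v i f)"
    using insert by (intro cotangentD(1)[OF \<eta>] tangent_cmult tangent_sum) auto
  thus ?case using insert cotangentD(2)[OF \<eta>, of "v i" "a i"] by simp
qed (simp_all add: cotangent_zero[OF \<eta>])

lemma cotangent_add_closed:
  "\<eta> \<in> cotangent_space A p \<Longrightarrow> \<zeta> \<in> cotangent_space A p \<Longrightarrow> (\<lambda>v. \<eta> v + \<zeta> v) \<in> cotangent_space A p"
  by (auto simp: cotangent_space_def complex_linear_on_def algebra_simps)

lemma cotangent_cmult_closed:
  "\<eta> \<in> cotangent_space A p \<Longrightarrow> (\<lambda>v. a * \<eta> v) \<in> cotangent_space A p"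
  by (auto simp: cotangent_space_def complex_linear_on_def algebra_simps)

lemma cotangent_zero_closed: "(\<lambda>v. 0) \<in> cotangent_space A p"
  by (auto simp: cotangent_space_def complex_linear_on_def)

lemma cotangent_sum_closed:
  "(\<And>i. i \<in> I \<Longrightarrow> \<eta> i \<in> cotangent_space A p) \<Longrightarrow> (\<lambda>v. \<Sum>i\<in>I. \<eta> i v) \<in> cotangent_space A p"
  by (induction I rule: infinite_finite_induct) (auto simp: cotangent_zero_closed cotangent_add_closed)

lemma one_formsD:
  assumes "\<alpha> \<in> one_forms A U"
  shows "p \<in> U \<Longrightarrow> \<alpha> p \<in> cotangent_space A p"
    "K \<in> vector_fields A UNIV \<Longrightarrow> msmooth A U (\<lambda>p. \<alpha> p (K p))"
  using assms by (auto simp: one_forms_def)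

lemma one_form_local_field_smooth:
  assumes \<alpha>: "\<alpha> \<in> one_forms A U" and U: "open U" and W: "open W" and L: "L \<in> vector_fields A W"
  shows "msmooth A (U \<inter> W) (\<lambda>p. \<alpha> p (L p))"
proof (rule msmooth_local)
  fix p assume p: "p \<in> U \<inter> W"
  obtain \<beta> K O' where b: "bump_in W O' K \<beta>" "p \<in> O'" using bump_exists[OF W IntD2[OF p]] by metis
  have "msmooth A (O' \<inter> U) (\<lambda>p. \<alpha> p (L p))"
  proof (rule msmooth_cong)
    show "open (O' \<inter> U)" using bump_inD[OF b(1)] U by auto
    show "msmooth A (O' \<inter> U) (\<lambda>p. \<alpha> p (\<lambda>f. \<beta> p * L p f))"
      by (rule msmooth_subset[OF one_formsD(2)[OF \<alpha> field_mult[OF L W b(1)]]]) simp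
    show "\<alpha> q (L q) = \<alpha> q (\<lambda>f. \<beta> q * L q f)" if "q \<in> O' \<inter> U" for q
      using bump_inD(8)[OF b(1), of q] that by simp
  qed
  thus "\<exists>O'. open O' \<and> p \<in> O' \<and> msmooth A O' (\<lambda>p. \<alpha> p (L p))"
    using p b(2) bump_inD(5)[OF b(1)] U by (intro exI[of _ "O' \<inter> U"]) auto
qed

lemma one_form_coeff_smooth:
  assumes "\<alpha> \<in> one_forms A U" "open U" "c \<in> A"
  shows "msmooth A (U \<inter> cdom c) (\<lambda>p. \<alpha> p (coord_vec A c i p))"
  by (rule one_form_local_field_smooth[OF assms(1,2) chart_open(1)[OF assms(3)] coord_vec_field[OF assms(3)]])

lemma one_forms_smooth_fun:
  assumes "\<alpha> \<in> one_forms A UNIV" "K \<in> vector_fields A UNIV"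
  shows "(\<lambda>p. \<alpha> p (K p)) \<in> smooth_funs A"
  using one_formsD(2)[OF assms] by (simp add: smooth_funs_def)

lemma real_covector_exists:
  assumes c: "c \<in> A" "p \<in> cdom c"
  obtains \<eta> where "\<eta> \<in> cotangent_space A p" "cov_cnj \<eta> = \<eta>" "\<And>i. \<eta> (coord_vec A c i p) = of_real (\<xi> $ i)"
proof -
  obtain y O' where y: "coords_on c O' y" "p \<in> O'" "O' \<subseteq> UNIV"
    by (rule local_coordinates[OF c(1) open_UNIV UNIV_I c(2)])
  define \<eta> where "\<eta> v = (if v \<in> tangent_space A p then \<Sum>i\<in>UNIV. of_real (\<xi> $ i) * v (y i) else 0)" for v
  have cnj_tangent: "vec_cnj v \<in> tangent_space A p" if v: "v \<in> tangent_space A p" for v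
    unfolding tangent_space_def vec_cnj_def
  proof (intro CollectI conjI ballI allI impI)
    fix f assume "f \<notin> smooth_funs A"
    hence "(\<lambda>q. cnj (f q)) \<notin> smooth_funs A" using smooth_funs_cnj[of "\<lambda>q. cnj (f q)"] by auto
    thus "cnj (v (\<lambda>q. cnj (f q))) = 0" using tangentD(4)[OF v] by simp
  qed (simp_all add: tangentD[OF v] smooth_funs_cnj)
  have inv: "vec_cnj (vec_cnj v) = v" for v :: "'m tvec" by (simp add: vec_cnj_def)
  have vy: "vec_cnj v (y i) = cnj (v (y i))" if v: "v \<in> tangent_space A p" for v i
  proof -
    have "v (\<lambda>q. cnj (y i q)) = v (y i)"
      by (rule tangent_local[OF v smooth_funs_cnj[OF coords_onD(3)[OF y(1)]] coords_onD(3)[OF y(1)] coords_onD(1)[OF y(1)] y(2)])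
        (simp add: coords_onD(4)[OF y(1)])
    thus ?thesis by (simp add: vec_cnj_def)
  qed
  show ?thesis
  proof (rule that[of \<eta>])
    show "\<eta> \<in> cotangent_space A p"
      unfolding cotangent_space_def complex_linear_on_def
      by (auto simp: \<eta>_def tangent_add tangent_cmult sum.distrib[symmetric] sum_distrib_left algebra_simps intro!: sum.cong)
    show "cov_cnj \<eta> = \<eta>"
    proof
      fix v
      show "cov_cnj \<eta> v = \<eta> v"
      proof (cases "v \<in> tangent_space A p")
        case True
        thus ?thesis using cnj_tangent[OF True] vy[OF True] by (simp add: cov_cnj_def \<eta>_def)
      next
        case False
        hence "vec_cnj v \<notin> tangent_space A p" using cnj_tangent[of "vec_cnj v"] inv by auto
        thus ?thesis using False by (simp add: cov_cnj_def \<eta>_def)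
      qed
    qed
    fix i
    have "(\<Sum>j\<in>UNIV. of_real (\<xi> $ j) * coord_vec A c i p (y j)) = (of_real (\<xi> $ i) :: complex)"
      unfolding coord_vec_coordinate[OF c(1) y(1,2)] by (simp add: if_distrib cong: if_cong)
    thus "\<eta> (coord_vec A c i p) = of_real (\<xi> $ i)"
      using coord_vec_tangent[OF c] by (simp add: \<eta>_def)
  qed
qed

section \<open>The Lie derivative is tensorial\<close>

lemma bracket_nonsmooth:
  assumes "K \<in> vector_fields A UNIV" "L \<in> vector_fields A UNIV" "f \<notin> smooth_funs A"
  shows "bracket K L p f = 0"
proof -
  have "(\<lambda>q. L q f) = (\<lambda>q. 0)" "(\<lambda>q. K q f) = (\<lambda>q. 0)"
    using tangentD(4)[OF vector_fieldsD(1)[OF assms(1)] assms(3)] tangentD(4)[OF vector_fieldsD(1)[OF assms(2)] assms(3)] by auto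
  thus ?thesis
    using tangent_const[OF vector_fieldsD(1)[OF assms(1)], of p 0] tangent_const[OF vector_fieldsD(1)[OF assms(2)], of p 0]
    by (simp add: bracket_def)
qed

lemma bracket_field:
  assumes K: "K \<in> vector_fields A UNIV" and L: "L \<in> vector_fields A UNIV"
  shows "bracket K L \<in> vector_fields A UNIV"
proof -
  note Kt = vector_fieldsD(1)[OF K UNIV_I] and Lt = vector_fieldsD(1)[OF L UNIV_I]
  note Ks = vector_fields_smooth_fun[OF K] and Ls = vector_fields_smooth_fun[OF L]
  have "bracket K L p \<in> tangent_space A p" for p
    unfolding tangent_space_def
  proof (intro CollectI conjI ballI allI impI)
    fix f g assume fg: "f \<in> smooth_funs A" "g \<in> smooth_funs A"
    show "bracket K L p (\<lambda>q. f q + g q) = bracket K L p f + bracket K L p g"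
      by (simp add: bracket_def tangentD(1)[OF Kt fg] tangentD(1)[OF Lt fg] tangentD(1)[OF Kt Ls Ls] tangentD(1)[OF Lt Ks Ks])
    show "bracket K L p (\<lambda>q. f q * g q) = f p * bracket K L p g + g p * bracket K L p f"
      by (simp add: bracket_def tangentD(3)[OF Kt fg] tangentD(3)[OF Lt fg]
        tangentD(1)[OF Kt smooth_funs_mult[OF fg(1) Ls] smooth_funs_mult[OF fg(2) Ls]]
        tangentD(1)[OF Lt smooth_funs_mult[OF fg(1) Ks] smooth_funs_mult[OF fg(2) Ks]]
        tangentD(3)[OF Kt fg(1) Ls] tangentD(3)[OF Kt fg(2) Ls] tangentD(3)[OF Lt fg(1) Ks] tangentD(3)[OF Lt fg(2) Ks]
        algebra_simps)
  next
    fix a f assume f: "f \<in> smooth_funs A"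
    show "bracket K L p (\<lambda>q. a * f q) = a * bracket K L p f"
      by (simp add: bracket_def tangentD(2)[OF Kt f] tangentD(2)[OF Lt f] tangentD(2)[OF Kt Ls] tangentD(2)[OF Lt Ks] algebra_simps)
  qed (rule bracket_nonsmooth[OF K L])
  moreover have "msmooth A UNIV (\<lambda>p. bracket K L p f)" if "f \<in> smooth_funs A" for f
    unfolding bracket_def
    by (intro msmooth_diff open_UNIV vector_fieldsD(2)[OF K Ls] vector_fieldsD(2)[OF L Ks])
  ultimately show ?thesis by (simp add: vector_fields_def)
qed

lemma ext_deriv_linear:
  assumes \<alpha>: "\<alpha> \<in> one_forms A UNIV" and L: "L \<in> vector_fields A UNIV"
    and K: "K \<in> vector_fields A UNIV" and K': "K' \<in> vector_fields A UNIV"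
  shows "ext_deriv \<alpha> L (\<lambda>q f. a * K q f + K' q f) p = a * ext_deriv \<alpha> L K p + ext_deriv \<alpha> L K' p"
proof -
  note Lt = vector_fieldsD(1)[OF L UNIV_I] and Kt = vector_fieldsD(1)[OF K UNIV_I] and K't = vector_fieldsD(1)[OF K' UNIV_I]
  note \<alpha>c = one_formsD(1)[OF \<alpha> UNIV_I]
  have 1: "\<alpha> q (\<lambda>f. a * K q f + K' q f) = a * \<alpha> q (K q) + \<alpha> q (K' q)" for q
    using cotangentD(1)[OF \<alpha>c tangent_cmult[OF Kt] K't] cotangentD(2)[OF \<alpha>c Kt] by simp
  have 2: "L p (\<lambda>q. a * \<alpha> q (K q) + \<alpha> q (K' q)) = a * L p (\<lambda>q. \<alpha> q (K q)) + L p (\<lambda>q. \<alpha> q (K' q))"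
    using tangentD(1)[OF Lt smooth_funs_cmult[OF one_forms_smooth_fun[OF \<alpha> K]] one_forms_smooth_fun[OF \<alpha> K']]
      tangentD(2)[OF Lt one_forms_smooth_fun[OF \<alpha> K]] by simp
  have B: "bracket L (\<lambda>q f. a * K q f + K' q f) p = (\<lambda>f. a * bracket L K p f + bracket L K' p f)"
  proof
    fix f
    have "L p (\<lambda>q. a * K q f + K' q f) = a * L p (\<lambda>q. K q f) + L p (\<lambda>q. K' q f)"
      using tangentD(1)[OF Lt smooth_funs_cmult[OF vector_fields_smooth_fun[OF K]] vector_fields_smooth_fun[OF K']]
        tangentD(2)[OF Lt vector_fields_smooth_fun[OF K]] by simp
    thus "bracket L (\<lambda>q f. a * K q f + K' q f) p f = a * bracket L K p f + bracket L K' p f"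
      by (simp add: bracket_def algebra_simps)
  qed
  note b1 = vector_fieldsD(1)[OF bracket_field[OF L K] UNIV_I, of p]
  note b2 = vector_fieldsD(1)[OF bracket_field[OF L K'] UNIV_I, of p]
  have 3: "\<alpha> p (\<lambda>f. a * bracket L K p f + bracket L K' p f) = a * \<alpha> p (bracket L K p) + \<alpha> p (bracket L K' p)"
    using cotangentD(1)[OF \<alpha>c tangent_cmult[OF b1] b2] cotangentD(2)[OF \<alpha>c b1] by simp
  show ?thesis unfolding ext_deriv_def 1 2 B 3 by (simp add: algebra_simps)
qed

text \<open>If \<open>K = \<Sum> k\<^sub>i \<partial>\<^sub>i\<close> vanishes at \<open>p\<close>, both \<open>L(\<alpha>(K))\<close> and \<open>\<alpha>([L,K])\<close> reduce at \<open>p\<close> to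
  \<open>\<Sum> L(k\<^sub>i) \<alpha>(\<partial>\<^sub>i)\<close>.\<close>
lemma ext_deriv_eq_0:
  assumes \<alpha>: "\<alpha> \<in> one_forms A UNIV" and L: "L \<in> vector_fields A UNIV"
    and K: "K \<in> vector_fields A UNIV" and K0: "K p = (\<lambda>f. 0)"
  shows "ext_deriv \<alpha> L K p = 0"
proof -
  note Lt = vector_fieldsD(1)[OF L UNIV_I] and Kt = vector_fieldsD(1)[OF K UNIV_I]
  note \<alpha>c = one_formsD(1)[OF \<alpha> UNIV_I]
  obtain c where c: "c \<in> A" "p \<in> cdom c" using chart_cover by blast
  obtain y O' where y: "coords_on c O' y" "p \<in> O'" "O' \<subseteq> UNIV"
    by (rule local_coordinates[OF c(1) open_UNIV UNIV_I c(2)])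
  note yO = coords_onD[OF y(1)]
  obtain \<beta> Kc O2 where b: "bump_in O' O2 Kc \<beta>" "p \<in> O2" by (rule bump_exists[OF yO(1) y(2)])
  note bD = bump_inD[OF b(1)]
  define k where "k i q = K q (y i)" for i q
  have k: "k i \<in> smooth_funs A" "k i p = 0" for i
    using vector_fields_smooth_fun[OF K] K0 by (auto simp: k_def[abs_def])
  have Kq: "K q = (\<lambda>f. \<Sum>i\<in>UNIV. k i q * coord_vec A c i q f)" if "q \<in> O'" for q
    unfolding k_def by (rule tangent_coordinates[OF c(1) Kt y(1) that])
  have key: "L p F = (\<Sum>i\<in>UNIV. L p (k i) * a i p)"
    if F: "F \<in> smooth_funs A" and a: "\<And>i. msmooth A O' (a i)" and eq: "\<And>q. q \<in> O' \<Longrightarrow> F q = (\<Sum>i\<in>UNIV. k i q * a i q)" for F a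
  proof -
    define a' where "a' i q = \<beta> q * a i q" for i q
    have a': "a' i \<in> smooth_funs A" for i unfolding a'_def by (rule bump_mult[OF b(1) yO(1) a])
    have "L p F = L p (\<lambda>q. \<Sum>i\<in>UNIV. k i q * a' i q)"
    proof (rule tangent_local[OF Lt F _ bD(5) b(2)])
      show "(\<lambda>q. \<Sum>i\<in>UNIV. k i q * a' i q) \<in> smooth_funs A" by (intro smooth_funs_sum smooth_funs_mult k a')
      fix q assume "q \<in> O2"
      thus "F q = (\<Sum>i\<in>UNIV. k i q * a' i q)" using bD(7,8) eq by (auto simp: a'_def)
    qed
    also have "\<dots> = (\<Sum>i\<in>UNIV. L p (\<lambda>q. k i q * a' i q))"
      by (rule tangent_sum_fun[OF Lt smooth_funs_mult[OF k(1) a']])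
    also have "\<dots> = (\<Sum>i\<in>UNIV. L p (k i) * a i p)"
      unfolding tangentD(3)[OF Lt k(1) a'] using bD(8)[OF b(2)] by (simp add: k(2) a'_def mult.commute)
    finally show ?thesis .
  qed
  have "L p (\<lambda>q. \<alpha> q (K q)) = (\<Sum>i\<in>UNIV. L p (k i) * \<alpha> p (coord_vec A c i p))"
  proof (rule key[OF one_forms_smooth_fun[OF \<alpha> K]])
    show "msmooth A O' (\<lambda>q. \<alpha> q (coord_vec A c i q))" for i
      by (rule msmooth_subset[OF one_form_coeff_smooth[OF \<alpha> open_UNIV c(1)]]) (use yO in auto)
    fix q assume q: "q \<in> O'"
    hence qc: "q \<in> cdom c" using yO by auto
    show "\<alpha> q (K q) = (\<Sum>i\<in>UNIV. k i q * \<alpha> q (coord_vec A c i q))"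
      unfolding Kq[OF q] by (rule cotangent_sum[OF \<alpha>c coord_vec_tangent[OF c(1) qc]])
  qed
  moreover have "bracket L K p = (\<lambda>f. \<Sum>i\<in>UNIV. L p (k i) * coord_vec A c i p f)"
  proof
    fix f
    show "bracket L K p f = (\<Sum>i\<in>UNIV. L p (k i) * coord_vec A c i p f)"
    proof (cases "f \<in> smooth_funs A")
      case True
      have "L p (\<lambda>q. K q f) = (\<Sum>i\<in>UNIV. L p (k i) * coord_vec A c i p f)"
      proof (rule key[OF vector_fields_smooth_fun[OF K]])
        show "msmooth A O' (\<lambda>q. coord_vec A c i q f)" for i
          by (rule msmooth_subset[OF vector_fieldsD(2)[OF coord_vec_field[OF c(1)] True] yO(2)])
        show "K q f = (\<Sum>i\<in>UNIV. k i q * coord_vec A c i q f)" if "q \<in> O'" for q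
          using fun_cong[OF Kq[OF that]] .
      qed
      thus ?thesis by (simp add: bracket_def K0)
    next
      case False
      thus ?thesis using bracket_nonsmooth[OF L K False] by (simp add: coord_vec_def)
    qed
  qed
  moreover have "\<alpha> p (\<lambda>f. \<Sum>i\<in>UNIV. L p (k i) * coord_vec A c i p f) = (\<Sum>i\<in>UNIV. L p (k i) * \<alpha> p (coord_vec A c i p))"
    by (rule cotangent_sum[OF \<alpha>c coord_vec_tangent[OF c]])
  ultimately show ?thesis by (simp add: ext_deriv_def K0)
qed

lemma lie_eq:
  assumes \<alpha>: "\<alpha> \<in> one_forms A UNIV" and L: "L \<in> vector_fields A UNIV" and K: "K \<in> vector_fields A UNIV"
  shows "lie A L \<alpha> p (K p) = ext_deriv \<alpha> L K p"
proof -
  define K' where "K' = (SOME K'. K' \<in> vector_fields A UNIV \<and> K' p = K p)"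
  have K': "K' \<in> vector_fields A UNIV" "K' p = K p"
    using someI[of "\<lambda>K'. K' \<in> vector_fields A UNIV \<and> K' p = K p" K] K unfolding K'_def by blast+
  have "(\<lambda>q f. (-1) * K' q f + K q f) \<in> vector_fields A UNIV"
    by (intro fields_add fields_smult msmooth_const K K' open_UNIV)
  from ext_deriv_eq_0[OF \<alpha> L this, of p] have "ext_deriv \<alpha> L K p = ext_deriv \<alpha> L K' p"
    using K'(2) unfolding ext_deriv_linear[OF \<alpha> L K'(1) K] by simp
  thus ?thesis using vector_fieldsD(1)[OF K UNIV_I] by (simp add: lie_def K'_def)
qed

lemma lie_one_form:
  assumes \<alpha>: "\<alpha> \<in> one_forms A UNIV" and L: "L \<in> vector_fields A UNIV"
  shows "lie A L \<alpha> \<in> one_forms A UNIV"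
  unfolding one_forms_def
proof (intro CollectI conjI ballI)
  fix p
  show "lie A L \<alpha> p \<in> cotangent_space A p"
    unfolding cotangent_space_def complex_linear_on_def
  proof (intro CollectI conjI ballI allI impI)
    fix v w assume v: "v \<in> tangent_space A p" and w: "w \<in> tangent_space A p"
    obtain K where K: "K \<in> vector_fields A UNIV" "K p = v" by (rule field_extension[OF v])
    obtain K' where K': "K' \<in> vector_fields A UNIV" "K' p = w" by (rule field_extension[OF w])
    have "(\<lambda>q f. 1 * K q f + K' q f) \<in> vector_fields A UNIV"
      by (intro fields_add fields_smult msmooth_const K K' open_UNIV)
    from lie_eq[OF \<alpha> L this, of p] show "lie A L \<alpha> p (\<lambda>f. v f + w f) = lie A L \<alpha> p v + lie A L \<alpha> p w"
      unfolding ext_deriv_linear[OF \<alpha> L K(1) K'(1)]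
      using lie_eq[OF \<alpha> L K(1), of p] lie_eq[OF \<alpha> L K'(1), of p] K(2) K'(2) by simp
  next
    fix a v assume v: "v \<in> tangent_space A p"
    obtain K where K: "K \<in> vector_fields A UNIV" "K p = v" by (rule field_extension[OF v])
    obtain K' where K': "K' \<in> vector_fields A UNIV" "K' p = (\<lambda>f. 0)" by (rule field_extension[OF tangent_zero])
    have "(\<lambda>q f. a * K q f + K' q f) \<in> vector_fields A UNIV"
      by (intro fields_add fields_smult msmooth_const K K' open_UNIV)
    from lie_eq[OF \<alpha> L this, of p] show "lie A L \<alpha> p (\<lambda>f. a * v f) = a * lie A L \<alpha> p v"
      unfolding ext_deriv_linear[OF \<alpha> L K(1) K'(1)]
      using lie_eq[OF \<alpha> L K(1), of p] ext_deriv_eq_0[OF \<alpha> L K'] K(2) K'(2) by simp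
  qed (simp add: lie_def)
next
  fix K assume K: "K \<in> vector_fields A UNIV"
  show "msmooth A UNIV (\<lambda>p. lie A L \<alpha> p (K p))"
    unfolding lie_eq[OF \<alpha> L K] ext_deriv_def
    by (intro msmooth_diff open_UNIV vector_fieldsD(2)[OF L] vector_fieldsD(2)[OF K] one_forms_smooth_fun[OF \<alpha>] K L
      smooth_funs_msmooth bracket_field)
qed

lemma one_forms_combination:
  assumes "\<And>i. i \<in> I \<Longrightarrow> g i \<in> smooth_funs A" "\<And>i. i \<in> I \<Longrightarrow> \<omega> i \<in> one_forms A UNIV"
  shows "(\<lambda>p v. \<Sum>i\<in>I. g i p * \<omega> i p v) \<in> one_forms A UNIV"
  unfolding one_forms_def
proof (intro CollectI conjI ballI)
  show "(\<lambda>v. \<Sum>i\<in>I. g i p * \<omega> i p v) \<in> cotangent_space A p" for p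
    by (intro cotangent_sum_closed cotangent_cmult_closed one_formsD(1)[OF assms(2) UNIV_I])
  show "msmooth A UNIV (\<lambda>p. \<Sum>i\<in>I. g i p * \<omega> i p (K p))" if "K \<in> vector_fields A UNIV" for K
    by (intro msmooth_sum msmooth_mult open_UNIV smooth_funs_msmooth[OF assms(1)] one_formsD(2)[OF assms(2) that])
qed

end

locale cr_structure =
  fixes A :: "('m::{t2_space,second_countable_topology}, 'k::finite) chart set"
    and n d :: nat and V :: "'m \<Rightarrow> 'm tvec set"
  assumes cr: "cr_manifold A n d V"

sublocale cr_structure \<subseteq> smooth_manifold A
  by unfold_locales (use cr in \<open>simp add: cr_manifold_def\<close>)

context cr_structure
begin

section \<open>Holomorphic forms\<close>

definition frame_on :: "'m set \<Rightarrow> (nat \<Rightarrow> 'm \<Rightarrow> 'm tvec) \<Rightarrow> bool" where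
  "frame_on U F \<longleftrightarrow> open U \<and> (\<forall>i<n. F i \<in> sections_of A V U) \<and>
     (\<forall>q\<in>U. V q = {(\<lambda>f. \<Sum>i<n. a i * F i q f) | a :: nat \<Rightarrow> complex. True} \<and>
       (\<forall>a :: nat \<Rightarrow> complex. (\<forall>f. (\<Sum>i<n. a i * F i q f) = 0) \<longrightarrow> (\<forall>i<n. a i = 0)))"

lemma frame_exists:
  obtains U F where "frame_on U F" "p \<in> U"
proof -
  have "complex_subbundle A n V" using cr by (simp add: cr_manifold_def)
  from this[unfolded complex_subbundle_def, THEN spec, of p]
  obtain U F where "open U \<and> p \<in> U \<and> (\<forall>i<n. F i \<in> sections_of A V U) \<and>
     (\<forall>q\<in>U. V q = {(\<lambda>f. \<Sum>i<n. a i * F i q f) | a :: nat \<Rightarrow> complex. True} \<and>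
       (\<forall>a :: nat \<Rightarrow> complex. (\<forall>f. (\<Sum>i<n. a i * F i q f) = 0) \<longrightarrow> (\<forall>i<n. a i = 0)))"
    by (elim exE)
  note * = this
  have "frame_on U F"
    unfolding frame_on_def
    using *[THEN conjunct1] *[THEN conjunct2, THEN conjunct2, THEN conjunct1] *[THEN conjunct2, THEN conjunct2, THEN conjunct2]
    by (intro conjI)
  moreover have "p \<in> U" using *[THEN conjunct2, THEN conjunct1] .
  ultimately show ?thesis by (rule that)
qed

lemma frame_onD:
  assumes F: "frame_on U F"
  shows "open U" "i < n \<Longrightarrow> F i \<in> sections_of A V U"
    "q \<in> U \<Longrightarrow> V q = {(\<lambda>f. \<Sum>i<n. a i * F i q f) | a :: nat \<Rightarrow> complex. True}"
    "q \<in> U \<Longrightarrow> \<forall>f. (\<Sum>i<n. b i * F i q f) = 0 \<Longrightarrow> i < n \<Longrightarrow> b i = 0"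
proof -
  note * = F[unfolded frame_on_def]
  show "open U" using * by (rule conjunct1)
  show "i < n \<Longrightarrow> F i \<in> sections_of A V U" by (rule *[THEN conjunct2, THEN conjunct1, rule_format])
  show "q \<in> U \<Longrightarrow> V q = {(\<lambda>f. \<Sum>i<n. a i * F i q f) | a :: nat \<Rightarrow> complex. True}"
    by (rule *[THEN conjunct2, THEN conjunct2, THEN bspec, THEN conjunct1])
  show "q \<in> U \<Longrightarrow> \<forall>f. (\<Sum>i<n. b i * F i q f) = 0 \<Longrightarrow> i < n \<Longrightarrow> b i = 0"
    by (rule *[THEN conjunct2, THEN conjunct2, THEN bspec, THEN conjunct2, THEN spec, THEN mp, THEN spec, THEN mp])
qed

lemma zero_in_V: "(\<lambda>f. 0) \<in> V p"
proof -
  obtain U F where U: "frame_on U F" "p \<in> U" by (rule frame_exists)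
  show ?thesis unfolding frame_onD(3)[OF U] by (intro CollectI exI[of _ "\<lambda>i. 0"]) simp
qed

lemma V_cmult: "v \<in> V p \<Longrightarrow> (\<lambda>f. a * v f) \<in> V p"
proof -
  assume v: "v \<in> V p"
  obtain U F where U: "frame_on U F" "p \<in> U" by (rule frame_exists)
  then obtain b where "v = (\<lambda>f. \<Sum>i<n. b i * F i p f)" using v frame_onD(3)[OF U] by auto
  hence "(\<lambda>f. a * v f) = (\<lambda>f. \<Sum>i<n. (a * b i) * F i p f)" by (simp add: sum_distrib_left mult.assoc)
  thus ?thesis unfolding frame_onD(3)[OF U] by (intro CollectI exI[of _ "\<lambda>i. a * b i"]) simp
qed

lemma cr_fields_field: "L \<in> cr_fields A V \<Longrightarrow> L \<in> vector_fields A UNIV"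
  by (simp add: sections_of_def)

lemma hol_formsD:
  assumes "\<alpha> \<in> hol_forms A V"
  shows "\<alpha> \<in> one_forms A UNIV" "\<alpha> p \<in> hol_cotangent A V p"
  using assms by (auto simp: hol_forms_def)

lemma cr_extension:
  assumes v: "v \<in> V p"
  obtains K where "K \<in> cr_fields A V" "K p = v"
proof -
  obtain U F where fr: "frame_on U F" "p \<in> U" by (rule frame_exists)
  note U = frame_onD(1)[OF fr(1)] fr(2) and F = frame_onD(2)[OF fr(1)] and V = frame_onD(3)[OF fr(1)]
  obtain a where a: "v = (\<lambda>f. \<Sum>i<n. a i * F i p f)" using v V[OF U(2)] by auto
  obtain \<beta> K O' where b: "bump_in U O' K \<beta>" "p \<in> O'" by (rule bump_exists[OF U])
  define L where "L q f = (\<Sum>i<n. a i * F i q f)" for q f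
  have "L \<in> vector_fields A U"
    unfolding L_def using F U by (intro fields_sum fields_smult msmooth_const) (auto simp: sections_of_def)
  from field_mult[OF this U(1) b(1)] have vf: "(\<lambda>q f. \<beta> q * L q f) \<in> vector_fields A UNIV" .
  have "(\<lambda>f. \<beta> q * L q f) \<in> V q" for q
  proof (cases "q \<in> K")
    case True
    hence "q \<in> U" using bump_inD(4)[OF b(1)] by blast
    hence "L q \<in> V q" using V by (auto simp: L_def[abs_def])
    thus ?thesis by (rule V_cmult)
  next
    case False
    thus ?thesis using bump_inD(9)[OF b(1)] zero_in_V by simp
  qed
  hence "(\<lambda>q f. \<beta> q * L q f) \<in> cr_fields A V" using vf by (simp add: sections_of_def)
  moreover have "(\<lambda>f. \<beta> p * L p f) = v" using bump_inD(8)[OF b] by (simp add: a L_def)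
  ultimately show ?thesis by (rule that)
qed

lemma lie_hol_form:
  assumes L: "L \<in> cr_fields A V" and \<alpha>: "\<alpha> \<in> hol_forms A V"
  shows "lie A L \<alpha> \<in> hol_forms A V"
proof -
  note Lf = cr_fields_field[OF L] and \<alpha>1 = hol_formsD(1)[OF \<alpha>]
  have one: "lie A L \<alpha> \<in> one_forms A UNIV" by (rule lie_one_form[OF \<alpha>1 Lf])
  have ann: "\<alpha> q (K q) = 0" if "K \<in> cr_fields A V" for K q
  proof -
    have "K q \<in> V q" using that by (simp add: sections_of_def)
    thus ?thesis using hol_formsD(2)[OF \<alpha>, of q] by (simp add: hol_cotangent_def)
  qed
  have "lie A L \<alpha> p v = 0" if v: "v \<in> V p" for p v
  proof -
    obtain K where K: "K \<in> cr_fields A V" "K p = v" by (rule cr_extension[OF v])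
    have "bracket L K \<in> cr_fields A V" using cr K L by (simp add: cr_manifold_def)
    hence "ext_deriv \<alpha> L K p = 0"
      using tangent_const[OF vector_fieldsD(1)[OF Lf UNIV_I], of p 0]
        tangent_const[OF vector_fieldsD(1)[OF cr_fields_field[OF K(1)] UNIV_I], of p 0]
      by (simp add: ext_deriv_def ann K L)
    thus ?thesis using lie_eq[OF \<alpha>1 Lf cr_fields_field[OF K(1)], of p] K(2) by simp
  qed
  thus ?thesis using one one_formsD(1)[OF one UNIV_I] by (simp add: hol_forms_def hol_cotangent_def)
qed

lemma char_forms_hol: "\<tau> \<in> char_forms A V \<Longrightarrow> \<tau> \<in> hol_forms A V"
  by (auto simp: char_forms_def hol_forms_def char_cotangent_def hol_cotangent_def)

lemma hol_forms_combination:
  assumes "\<And>i. i \<in> I \<Longrightarrow> g i \<in> smooth_funs A" "\<And>i. i \<in> I \<Longrightarrow> \<omega> i \<in> hol_forms A V"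
  shows "(\<lambda>p v. \<Sum>i\<in>I. g i p * \<omega> i p v) \<in> hol_forms A V"
proof -
  have one: "(\<lambda>p v. \<Sum>i\<in>I. g i p * \<omega> i p v) \<in> one_forms A UNIV"
    by (intro one_forms_combination assms(1) hol_formsD(1)[OF assms(2)])
  moreover have "(\<Sum>i\<in>I. g i p * \<omega> i p v) = 0" if "v \<in> V p" for p v
  proof (rule sum.neutral, rule ballI)
    fix i assume "i \<in> I"
    thus "g i p * \<omega> i p v = 0" using hol_formsD(2)[OF assms(2), of i p] that by (simp add: hol_cotangent_def)
  qed
  ultimately show ?thesis using one_formsD(1)[OF one UNIV_I] by (simp add: hol_forms_def hol_cotangent_def)
qed

lemma foldr_lie_hol_form:
  "set Ks \<subseteq> cr_fields A V \<Longrightarrow> \<theta> \<in> hol_forms A V \<Longrightarrow> foldr (lie A) Ks \<theta> \<in> hol_forms A V"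
  by (induction Ks) (auto intro!: lie_hol_form)

lemma E_forms_hol: "\<omega> \<in> E_forms A V \<Longrightarrow> \<omega> \<in> hol_forms A V"
proof -
  assume "\<omega> \<in> E_forms A V"
  then obtain k and m :: nat and g Ks \<theta> where \<omega>: "\<omega> = (\<lambda>p v. \<Sum>i<m. g i p * foldr (lie A) (Ks i) (\<theta> i) p v)"
    and *: "\<forall>i<m. g i \<in> smooth_funs A \<and> set (Ks i) \<subseteq> cr_fields A V \<and> length (Ks i) \<le> k \<and> \<theta> i \<in> char_forms A V"
    unfolding E_forms_def E_step_def by blast
  show ?thesis unfolding \<omega>
    by (rule hol_forms_combination) (use * foldr_lie_hol_form char_forms_hol in \<open>auto simp: lessThan_iff\<close>)
qed

lemma hol_cotangentD:
  assumes "\<eta> \<in> hol_cotangent A V p"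
  shows "\<eta> \<in> cotangent_space A p" "v \<in> V p \<Longrightarrow> \<eta> v = 0"
  using assms by (auto simp: hol_cotangent_def)

lemma hol_cotangent_add: "\<eta> \<in> hol_cotangent A V p \<Longrightarrow> \<zeta> \<in> hol_cotangent A V p \<Longrightarrow> (\<lambda>v. \<eta> v + \<zeta> v) \<in> hol_cotangent A V p"
  by (auto simp: hol_cotangent_def cotangent_add_closed)

lemma hol_cotangent_cmult: "\<eta> \<in> hol_cotangent A V p \<Longrightarrow> (\<lambda>v. a * \<eta> v) \<in> hol_cotangent A V p"
  by (auto simp: hol_cotangent_def cotangent_cmult_closed)

lemma hol_cotangent_zero: "(\<lambda>v. 0) \<in> hol_cotangent A V p"
  by (auto simp: hol_cotangent_def cotangent_zero_closed)

lemma hol_cotangent_sum: "(\<And>i. i \<in> I \<Longrightarrow> \<eta> i \<in> hol_cotangent A V p) \<Longrightarrow> (\<lambda>v. \<Sum>i\<in>I. \<eta> i v) \<in> hol_cotangent A V p"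
  by (induction I rule: infinite_finite_induct) (auto simp: hol_cotangent_zero hol_cotangent_add)

text \<open>Completing the frame of \<open>\<V>\<close> at \<open>p\<close> to a basis of the tangent space, the coordinates
  belonging to the added vectors form a basis of the fiber of the holomorphic cotangent bundle.\<close>
lemma hol_cotangent_basis:
  assumes card: "CARD('r::finite) = n + d"
  obtains e :: "'r::finite \<Rightarrow> 'm covec" where "\<And>r. e r \<in> hol_cotangent A V p"
    "\<And>\<eta>. \<eta> \<in> hol_cotangent A V p \<Longrightarrow> \<exists>b. \<eta> = (\<lambda>v. \<Sum>r\<in>UNIV. b r * e r v)"
proof -
  obtain c where c: "c \<in> A" "p \<in> cdom c" using chart_cover by blast
  obtain U F where fr: "frame_on U F" "p \<in> U" by (rule frame_exists)
  note U = fr(2) and F' = frame_onD(2)[OF fr(1)] and V = frame_onD(3)[OF fr(1)] and ind = frame_onD(4)[OF fr(1)]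
  have F: "F i p \<in> tangent_space A p" "F i p \<in> V p" if "i < n" for i
    using F'[OF that] U by (auto simp: sections_of_def vector_fields_def)
  define C where "C v = (\<chi> i. vec_coeff A c p v i)" for v :: "'m tvec"
  define D where "D x = (\<lambda>f. \<Sum>i\<in>UNIV. x $ i * coord_vec A c i p f)" for x :: "complex^'k"
  have Dt: "D x \<in> tangent_space A p" for x
    unfolding D_def by (intro tangent_sum tangent_cmult coord_vec_tangent c)
  have DC: "D (C v) = v" if "v \<in> tangent_space A p" for v
    using vec_coeff_expand[OF c that] by (simp add: D_def C_def)
  have CD: "C (D x) = x" for x
    unfolding C_def D_def vec_coeff_combination[OF c] by (simp add: vec_eq_iff)
  have D_add: "D (x + z) = (\<lambda>f. D x f + D z f)" and D_scale: "D (a *s x) = (\<lambda>f. a * D x f)" for x z a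
    by (simp_all add: D_def fun_eq_iff sum.distrib distrib_right sum_distrib_left mult.assoc)
  have D_sum: "D (\<Sum>b\<in>B. g b *s h b) = (\<lambda>f. \<Sum>b\<in>B. g b * D (h b) f)" for B g and h :: "'z \<Rightarrow> complex^'k"
    by (induction B rule: infinite_finite_induct) (simp_all add: D_add D_scale D_def[of 0])
  have C_add: "C (\<lambda>f. v f + w f) = C v + C w" if "v \<in> tangent_space A p" "w \<in> tangent_space A p" for v w
  proof -
    have "D (C v + C w) = (\<lambda>f. v f + w f)" by (simp add: D_add DC that)
    thus ?thesis using CD by metis
  qed
  have C_scale: "C (\<lambda>f. a * v f) = a *s C v" if "v \<in> tangent_space A p" for v a
  proof -
    have "D (a *s C v) = (\<lambda>f. a * v f)" by (simp add: D_scale DC that)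
    thus ?thesis using CD by metis
  qed
  define f where "f i = C (F i p)" for i
  define S where "S = f ` {..<n}"
  have comb0: "a i = 0" if "(\<Sum>j<n. a j *s f j) = 0" "i < n" for a i
  proof -
    have "D (\<Sum>j<n. a j *s f j) = (\<lambda>g. \<Sum>j<n. a j * F j p g)"
      unfolding D_sum using DC F by (simp add: f_def)
    hence "\<forall>g. (\<Sum>j<n. a j * F j p g) = 0" using that(1) by (simp add: D_def fun_eq_iff)
    thus ?thesis using ind[OF U] that(2) by blast
  qed
  have inj: "inj_on f {..<n}"
  proof (rule inj_onI)
    fix i j assume ij: "i \<in> {..<n}" "j \<in> {..<n}" "f i = f j"
    show "i = j"
    proof (rule ccontr)
      assume ne: "i \<noteq> j"
      define a :: "nat \<Rightarrow> complex" where "a l = (if l = i then 1 else if l = j then -1 else 0)" for l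
      have "(\<Sum>l<n. a l *s f l) = (\<Sum>l\<in>{i, j}. a l *s f l)"
        using ij by (intro sum.mono_neutral_right) (auto simp: a_def)
      also have "\<dots> = 0" using ne ij(3) by (simp add: a_def vec_eq_iff)
      finally have "a i = 0" using ij by (intro comb0) auto
      thus False by (simp add: a_def)
    qed
  qed
  have cardS: "card S = n" unfolding S_def using card_image[OF inj] by simp
  have "vec.independent S"
    unfolding vec.independent_explicit_finite_subsets
  proof (intro allI impI ballI)
    fix T u x assume T: "T \<subseteq> S" "finite T" and s: "(\<Sum>v\<in>T. u v *s v) = 0" and x: "x \<in> T"
    define a where "a i = (if f i \<in> T then u (f i) else 0)" for i
    obtain i where i: "i < n" "x = f i" using T x by (auto simp: S_def)
    have "(\<Sum>v\<in>T. u v *s v) = (\<Sum>v\<in>S. (if v \<in> T then u v else 0) *s v)"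
      using T by (intro sum.mono_neutral_cong_left) (auto simp: S_def)
    also have "\<dots> = (\<Sum>j<n. a j *s f j)" unfolding S_def a_def by (subst sum.reindex[OF inj]) simp
    finally have "a i = 0" using s i(1) by (intro comb0) auto
    thus "u x = 0" using x i by (simp add: a_def)
  qed
  then obtain B where B: "S \<subseteq> B" "B \<subseteq> UNIV" "vec.independent B" "UNIV \<subseteq> vec.span B"
    by (rule vec.maximal_independent_subset_extend[OF subset_UNIV])
  have finB: "finite B" by (rule vec.finiteI_independent[OF B(3)])
  have "card B = vec.dim (UNIV :: (complex^'k) set)"
    by (rule vec.basis_card_eq_dim[OF subset_UNIV B(4,3)])
  hence "card B = CARD('k)" by (simp only: vec_dim_card)
  hence "card (B - S) = n + d"
    using cr card_Diff_subset[of S B] B(1) cardS finB by (simp add: cr_manifold_def finite_subset)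
  hence "\<exists>G. bij_betw G (UNIV :: 'r set) (B - S)"
    using card finB by (intro finite_same_card_bij) auto
  then obtain G where G: "bij_betw G (UNIV :: 'r set) (B - S)" by blast
  define \<rho> where "\<rho> x b = vec.representation B x b" for x b
  have spn: "x \<in> vec.span B" for x using B(4) by blast
  have \<rho>_sum: "x = (\<Sum>b\<in>B. \<rho> x b *s b)" for x
    unfolding \<rho>_def by (rule vec.sum_representation_eq[OF B(3) spn finB order_refl, symmetric])
  have \<rho>_add: "\<rho> (x + z) b = \<rho> x b + \<rho> z b" for x z b
    unfolding \<rho>_def using vec.representation_add[OF B(3) spn spn] by simp
  have \<rho>_scale: "\<rho> (a *s x) b = a * \<rho> x b" for x a b
    unfolding \<rho>_def using vec.representation_scale[OF B(3) spn] by simp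
  have \<rho>_basis: "\<rho> s b = (if b = s then 1 else 0)" if "s \<in> B" for s b
    unfolding \<rho>_def using vec.representation_basis[OF B(3) that] by (auto simp: fun_eq_iff)
  define e where "e r v = (if v \<in> tangent_space A p then \<rho> (C v) (G r) else 0)" for r v
  have e_cot: "e r \<in> cotangent_space A p" for r
    unfolding cotangent_space_def complex_linear_on_def
    by (auto simp: e_def tangent_add tangent_cmult C_add C_scale \<rho>_add \<rho>_scale)
  have eF: "e r (F i p) = 0" if "i < n" for r i
  proof -
    have fS: "f i \<in> S" using that by (auto simp: S_def)
    have "G r \<in> B - S" using G by (auto simp: bij_betw_def)
    hence "G r \<noteq> f i" using fS by (metis DiffD2)
    hence "\<rho> (f i) (G r) = 0" using \<rho>_basis[OF subsetD[OF B(1) fS]] by simp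
    thus ?thesis using F(1)[OF that] by (simp add: e_def f_def)
  qed
  show ?thesis
  proof (rule that[of e])
    fix r
    have "e r v = 0" if v: "v \<in> V p" for v
    proof -
      obtain a where "v = (\<lambda>f. \<Sum>i<n. a i * F i p f)" using v V[OF U] by auto
      hence "e r v = (\<Sum>i<n. a i * e r (F i p))"
        using cotangent_sum[where I = "{..<n}" and v = "\<lambda>i. F i p" and a = a, OF e_cot[of r]] F(1) by simp
      also have "\<dots> = 0" by (rule sum.neutral) (simp add: eF)
      finally show ?thesis .
    qed
    thus "e r \<in> hol_cotangent A V p" using e_cot by (simp add: hol_cotangent_def)
  next
    fix \<eta> assume \<eta>: "\<eta> \<in> hol_cotangent A V p"
    note \<eta>c = hol_cotangentD(1)[OF \<eta>]
    have "\<eta> v = (\<Sum>r\<in>UNIV. \<eta> (D (G r)) * e r v)" for v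
    proof (cases "v \<in> tangent_space A p")
      case True
      have "v = D (\<Sum>b\<in>B. \<rho> (C v) b *s b)" using DC[OF True] \<rho>_sum[of "C v"] by simp
      hence "\<eta> v = \<eta> (\<lambda>f. \<Sum>b\<in>B. \<rho> (C v) b * D b f)" unfolding D_sum by (rule arg_cong)
      also have "\<dots> = (\<Sum>b\<in>B. \<rho> (C v) b * \<eta> (D b))" by (rule cotangent_sum[OF \<eta>c Dt])
      also have "\<dots> = (\<Sum>b\<in>B - S. \<rho> (C v) b * \<eta> (D b))"
      proof (rule sum.mono_neutral_right[OF finB])
        show "\<forall>b\<in>B - (B - S). \<rho> (C v) b * \<eta> (D b) = 0"
        proof
          fix b assume "b \<in> B - (B - S)"
          then obtain i where "i < n" "b = f i" by (auto simp: S_def)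
          thus "\<rho> (C v) b * \<eta> (D b) = 0" using DC[OF F(1)] F(2) hol_cotangentD(2)[OF \<eta>] by (simp add: f_def)
        qed
      qed auto
      also have "\<dots> = (\<Sum>r\<in>UNIV. \<rho> (C v) (G r) * \<eta> (D (G r)))"
        by (rule sum.reindex_bij_betw[OF G, symmetric])
      finally show ?thesis using True by (simp add: e_def mult.commute)
    next
      case False
      thus ?thesis using cotangentD(3)[OF \<eta>c False] by (simp add: e_def)
    qed
    thus "\<exists>b. \<eta> = (\<lambda>v. \<Sum>r\<in>UNIV. b r * e r v)" by (intro exI[of _ "\<lambda>r. \<eta> (D (G r))"]) blast
  qed
qed

end

section \<open>Cramer's rule\<close>

lemma det_row_expansion:
  fixes c :: "'a::comm_ring_1^'r::finite^'r"
  shows "det (\<chi> i'. if i' = i then b else c $ i') = (\<Sum>k\<in>UNIV. b $ k * det (\<chi> i'. if i' = i then axis k 1 else c $ i'))"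
proof -
  have "b = (\<Sum>k\<in>UNIV. b $ k *s axis k 1)" by (simp add: vec_eq_iff axis_def if_distrib cong: if_cong)
  from arg_cong[OF this, where f = "\<lambda>x. det (\<chi> i'. if i' = i then x else c $ i')"]
  have "det (\<chi> i'. if i' = i then b else c $ i') = det (\<chi> i'. if i' = i then (\<Sum>k\<in>UNIV. b $ k *s axis k 1) else c $ i')" .
  also have "\<dots> = (\<Sum>k\<in>UNIV. det (\<chi> i'. if i' = i then b $ k *s axis k 1 else c $ i'))"
    by (rule det_linear_row_sum) simp
  also have "\<dots> = (\<Sum>k\<in>UNIV. b $ k * det (\<chi> i'. if i' = i then axis k 1 else c $ i'))"
    by (intro sum.cong refl det_row_mul)
  finally show ?thesis .
qed

lemma cofactor_row_column:
  fixes a :: "'a::comm_ring_1^'r::finite^'r"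
  shows "det (\<chi> i'. if i' = i then axis k 1 else a $ i') = det (\<chi> j'. if j' = k then axis i 1 else transpose a $ j')"
proof -
  have "det (\<chi> j'. if j' = k then axis i 1 else transpose a $ j') = det (transpose (\<chi> j'. if j' = k then axis i 1 else transpose a $ j'))"
    by (rule det_transpose[symmetric])
  also have "\<dots> = det (\<chi> i'. if i' = i then axis k 1 else a $ i')"
    unfolding det_def
  proof (rule sum.cong[OF refl])
    fix p assume "p \<in> {p. p permutes (UNIV :: 'r set)}"
    hence p: "p permutes UNIV" by simp
    have "(\<Prod>i'\<in>UNIV. transpose (\<chi> j'. if j' = k then axis i 1 else transpose a $ j') $ i' $ p i') =
        (\<Prod>i'\<in>UNIV. (\<chi> i'. if i' = i then axis k 1 else a $ i') $ i' $ p i')"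
    proof (cases "p i = k")
      case True
      show ?thesis
      proof (rule prod.cong[OF refl])
        fix i'
        have "p i' = k \<longleftrightarrow> i' = i" using True permutes_inj[OF p] by (auto dest: injD)
        thus "transpose (\<chi> j'. if j' = k then axis i 1 else transpose a $ j') $ i' $ p i' =
            (\<chi> i'. if i' = i then axis k 1 else a $ i') $ i' $ p i'"
          by (auto simp: transpose_def axis_def)
      qed
    next
      case False
      obtain l where l: "p l = k" using permutes_surj[OF p] by (metis surjD)
      hence "l \<noteq> i" using False by auto
      hence "transpose (\<chi> j'. if j' = k then axis i 1 else transpose a $ j') $ l $ p l = 0"
        using l by (simp add: transpose_def axis_def)
      moreover have "(\<chi> i'. if i' = i then axis k 1 else a $ i') $ i $ p i = 0"
        using False by (simp add: axis_def)
      ultimately show ?thesis by (metis (no_types, lifting) UNIV_I finite_class.finite_UNIV prod_zero)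
    qed
    thus "of_int (sign p) * (\<Prod>i'\<in>UNIV. transpose (\<chi> j'. if j' = k then axis i 1 else transpose a $ j') $ i' $ p i') =
        of_int (sign p) * (\<Prod>i'\<in>UNIV. (\<chi> i'. if i' = i then axis k 1 else a $ i') $ i' $ p i')" by simp
  qed
  finally show ?thesis by simp
qed

lemma Cramer_row_identity:
  fixes a :: "'a::comm_ring_1^'r::finite^'r"
  shows "(\<Sum>i\<in>UNIV. det (\<chi> i'. if i' = i then b else a $ i') * a $ i $ j) = b $ j * det a"
proof -
  have col: "(\<Sum>i\<in>UNIV. a $ i $ j * det (\<chi> i'. if i' = i then axis k 1 else a $ i')) = (if k = j then det a else 0)" for k
  proof -
    have "(\<Sum>i\<in>UNIV. a $ i $ j * det (\<chi> i'. if i' = i then axis k 1 else a $ i')) =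
        (\<Sum>i\<in>UNIV. (transpose a $ j) $ i * det (\<chi> j'. if j' = k then axis i 1 else transpose a $ j'))"
      by (intro sum.cong refl arg_cong2[where f = "(*)"] cofactor_row_column) (simp add: transpose_def)
    also have "\<dots> = det (\<chi> j'. if j' = k then transpose a $ j else transpose a $ j')"
      by (rule det_row_expansion[symmetric])
    also have "\<dots> = (if k = j then det a else 0)"
    proof (cases "k = j")
      case True
      have "(\<chi> j'. if j' = k then transpose a $ j else transpose a $ j') = transpose a"
        using True by (simp add: vec_eq_iff)
      thus ?thesis using True by (simp add: det_transpose)
    next
      case False
      have "det (\<chi> j'. if j' = k then transpose a $ j else transpose a $ j') = 0"
        by (rule det_identical_rows[OF False]) (use False in \<open>simp add: row_def vec_eq_iff\<close>)
      thus ?thesis using False by simp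
    qed
    finally show ?thesis .
  qed
  have "(\<Sum>i\<in>UNIV. det (\<chi> i'. if i' = i then b else a $ i') * a $ i $ j) =
      (\<Sum>i\<in>UNIV. \<Sum>k\<in>UNIV. b $ k * (a $ i $ j * det (\<chi> i'. if i' = i then axis k 1 else a $ i')))"
    by (subst det_row_expansion) (simp add: sum_distrib_left mult_ac)
  also have "\<dots> = (\<Sum>k\<in>UNIV. b $ k * (\<Sum>i\<in>UNIV. a $ i $ j * det (\<chi> i'. if i' = i then axis k 1 else a $ i')))"
    by (subst sum.swap) (simp add: sum_distrib_left)
  also have "\<dots> = b $ j * det a" unfolding col by (simp add: if_distrib cong: if_cong)
  finally show ?thesis .
qed

context cr_structure
begin

lemma dual_sectionsD:
  assumes "Y \<in> dual_sections A V"
  shows "\<eta> \<in> hol_cotangent A V p \<Longrightarrow> \<zeta> \<in> hol_cotangent A V p \<Longrightarrow> Y p (\<lambda>v. \<eta> v + \<zeta> v) = Y p \<eta> + Y p \<zeta>"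
    "\<eta> \<in> hol_cotangent A V p \<Longrightarrow> Y p (\<lambda>v. a * \<eta> v) = a * Y p \<eta>"
    "\<eta> \<notin> hol_cotangent A V p \<Longrightarrow> Y p \<eta> = 0"
    "\<omega> \<in> hol_forms A V \<Longrightarrow> (\<lambda>p. Y p (\<omega> p)) \<in> smooth_funs A"
  using assms by (auto simp: dual_sections_def)

lemma dual_section_zero: "Y \<in> dual_sections A V \<Longrightarrow> Y p (\<lambda>v. 0) = 0"
  using dual_sectionsD(2)[of Y "\<lambda>v. 0" p 0] hol_cotangent_zero by simp

lemma dual_section_sum:
  assumes Y: "Y \<in> dual_sections A V" and e: "\<And>i. i \<in> I \<Longrightarrow> e i \<in> hol_cotangent A V p"
  shows "Y p (\<lambda>v. \<Sum>i\<in>I. b i * e i v) = (\<Sum>i\<in>I. b i * Y p (e i))"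
  using e
proof (induction I rule: infinite_finite_induct)
  case (insert i I)
  have "Y p (\<lambda>v. b i * e i v + (\<Sum>i\<in>I. b i * e i v)) = Y p (\<lambda>v. b i * e i v) + Y p (\<lambda>v. \<Sum>i\<in>I. b i * e i v)"
    using insert by (intro dual_sectionsD(1)[OF Y] hol_cotangent_cmult hol_cotangent_sum) auto
  thus ?case using insert dual_sectionsD(2)[OF Y, of "e i" p "b i"] by simp
qed (simp_all add: dual_section_zero[OF Y])

lemma Cramer_hol_cotangent:
  fixes W :: "'r::finite \<Rightarrow> 'm covec" and Y :: "'r \<Rightarrow> 'm \<Rightarrow> 'm covec \<Rightarrow> complex"
  assumes card: "CARD('r) = n + d" and W: "\<And>i. W i \<in> hol_cotangent A V p" and s: "s \<in> hol_cotangent A V p"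
    and Y: "\<And>j. Y j \<in> dual_sections A V"
  shows "(\<Sum>i\<in>UNIV. det (\<chi> i' j. Y j p (if i' = i then s else W i')) * W i v) = det (\<chi> i j. Y j p (W i)) * s v"
proof -
  obtain e :: "'r \<Rightarrow> 'm covec" where e: "\<And>r. e r \<in> hol_cotangent A V p"
    and ex: "\<And>\<eta>. \<eta> \<in> hol_cotangent A V p \<Longrightarrow> \<exists>b. \<eta> = (\<lambda>v. \<Sum>r\<in>UNIV. b r * e r v)"
    by (rule hol_cotangent_basis[OF card, of p]) (rule that)
  obtain b0 where b0: "s = (\<lambda>v. \<Sum>r\<in>UNIV. b0 r * e r v)" using ex[OF s] by blast
  have "\<forall>i. \<exists>b. W i = (\<lambda>v. \<Sum>r\<in>UNIV. b r * e r v)" by (intro allI ex W)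
  then obtain a0 where "\<forall>i. W i = (\<lambda>v. \<Sum>r\<in>UNIV. a0 i r * e r v)" by (rule choice[THEN exE])
  hence a0: "\<And>i. W i = (\<lambda>v. \<Sum>r\<in>UNIV. a0 i r * e r v)" by (rule spec)
  define a where "a = (\<chi> i r. a0 i r)"
  define b where "b = (\<chi> r. b0 r)"
  define y where "y = (\<chi> r j. Y j p (e r))"
  have Ys: "Y j p (\<lambda>v. \<Sum>r\<in>UNIV. c r * e r v) = (\<Sum>r\<in>UNIV. c r * Y j p (e r))" for j c
    by (rule dual_section_sum[OF Y e])
  have 1: "(\<chi> i j. Y j p (W i)) = a ** y"
    unfolding a0 Ys by (simp add: vec_eq_iff matrix_matrix_mult_def a_def y_def)
  have 2: "(\<chi> i' j. Y j p (if i' = i then s else W i')) = (\<chi> i'. if i' = i then b else a $ i') ** y" for i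
    using Ys by (simp add: vec_eq_iff matrix_matrix_mult_def a_def y_def b_def b0 a0)
  have "(\<Sum>i\<in>UNIV. det (\<chi> i' j. Y j p (if i' = i then s else W i')) * W i v) =
      (\<Sum>i\<in>UNIV. \<Sum>r\<in>UNIV. det y * e r v * (det (\<chi> i'. if i' = i then b else a $ i') * a $ i $ r))"
    unfolding 2 det_mul by (simp add: a0 a_def sum_distrib_left sum_distrib_right mult_ac)
  also have "\<dots> = (\<Sum>r\<in>UNIV. det y * e r v * (\<Sum>i\<in>UNIV. det (\<chi> i'. if i' = i then b else a $ i') * a $ i $ r))"
    by (subst sum.swap) (simp add: sum_distrib_left)
  also have "\<dots> = det a * det y * s v"
    unfolding Cramer_row_identity by (simp add: b0 b_def sum_distrib_left mult_ac)
  finally show ?thesis unfolding 1 det_mul .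
qed

end

section \<open>Change of variables over an arbitrary finite index type\<close>

typedef (overloaded) ('a::finite) indexed = "UNIV :: 'a set" morphisms unindexed indexed by simp

definition index_of :: "'a::finite \<Rightarrow> nat" where "index_of = (SOME f. inj f)"

lemma inj_index_of: "inj (index_of :: 'a::finite \<Rightarrow> nat)"
proof -
  obtain f :: "'a \<Rightarrow> nat" where "inj f"
    using finite_imp_inj_to_nat_seg[OF finite_class.finite_UNIV] by blast
  thus ?thesis unfolding index_of_def by (rule someI[of inj])
qed

instantiation indexed :: (finite) wellorder
begin

definition "a \<le> b \<longleftrightarrow> index_of (unindexed a) \<le> index_of (unindexed b)"
definition "a < b \<longleftrightarrow> index_of (unindexed a) < index_of (unindexed b)"

instance
proof
  fix a b :: "'a indexed" assume "a \<le> b" "b \<le> a"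
  hence "index_of (unindexed a) = index_of (unindexed b)" by (simp add: less_eq_indexed_def)
  hence "unindexed a = unindexed b" by (rule injD[OF inj_index_of])
  thus "a = b" by (simp add: unindexed_inject)
next
  fix P :: "'a indexed \<Rightarrow> bool" and a :: "'a indexed" assume step: "\<And>x. (\<And>y. y < x \<Longrightarrow> P y) \<Longrightarrow> P x"
  show "P a"
    by (induction a rule: measure_induct_rule[of "\<lambda>a. index_of (unindexed a)"])
      (rule step, simp add: less_indexed_def)
qed (auto simp: less_eq_indexed_def less_indexed_def)

end

instance indexed :: (finite) finite
proof
  have "UNIV = range (indexed :: 'a \<Rightarrow> 'a indexed)" by (metis UNIV_I surjI unindexed_inverse)
  thus "finite (UNIV :: 'a indexed set)" by (metis finite_class.finite_UNIV finite_imageI)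
qed

lemma bij_indexed: "bij (indexed :: 'a::finite \<Rightarrow> 'a indexed)"
  by (metis bij_betw_byWitness UNIV_I indexed_inverse unindexed_inverse subset_UNIV)

lemma det_reindex:
  fixes M :: "'c::comm_ring_1^'b::finite^'b" and f :: "'a::finite \<Rightarrow> 'b"
  assumes f: "bij f"
  shows "det (\<chi> i j. M $ f i $ f j) = det M"
proof -
  let ?m = "map_permutation UNIV f" and ?m' = "map_permutation UNIV (inv f)"
  have b: "bij_betw ?m {p. p permutes UNIV} {p. p permutes UNIV}"
  proof (rule bij_betw_byWitness[where f' = ?m'])
    show "\<forall>p\<in>{p. p permutes UNIV}. ?m' (?m p) = p"
      using map_permutation_compose_inv[OF f, of _ "inv f"] f by (auto simp: bij_is_inj)
    show "\<forall>p\<in>{p. p permutes UNIV}. ?m (?m' p) = p"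
      using map_permutation_compose_inv[OF bij_imp_bij_inv[OF f], of _ f] f by (auto simp: bij_is_surj surj_f_inv_f)
    show "?m ` {p. p permutes UNIV} \<subseteq> {p. p permutes UNIV}"
      using map_permutation_permutes[OF f] by auto
    show "?m' ` {p. p permutes UNIV} \<subseteq> {p. p permutes UNIV}"
      using map_permutation_permutes[OF bij_imp_bij_inv[OF f]] by auto
  qed
  have "det M = (\<Sum>p\<in>{p. p permutes UNIV}. of_int (sign (?m p)) * (\<Prod>i\<in>UNIV. M $ i $ ?m p i))"
    unfolding det_def by (rule sum.reindex_bij_betw[OF b, symmetric])
  also have "\<dots> = (\<Sum>p\<in>{p. p permutes UNIV}. of_int (sign p) * (\<Prod>i\<in>UNIV. M $ f i $ f (p i)))"
  proof (intro sum.cong refl)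
    fix p :: "'a \<Rightarrow> 'a" assume "p \<in> {p. p permutes UNIV}"
    hence p: "p permutes UNIV" by simp
    have "(\<Prod>i\<in>UNIV. M $ i $ ?m p i) = (\<Prod>i\<in>UNIV. M $ f i $ ?m p (f i))"
      by (rule prod.reindex_bij_betw[OF f, symmetric])
    also have "\<dots> = (\<Prod>i\<in>UNIV. M $ f i $ f (p i))"
      using map_permutation_apply[of f UNIV] f by (simp add: bij_is_inj)
    finally show "of_int (sign (?m p)) * (\<Prod>i\<in>UNIV. M $ i $ ?m p i) = of_int (sign p) * (\<Prod>i\<in>UNIV. M $ f i $ f (p i))"
      using sign_map_permutation[OF _ p, of f] f by (simp add: bij_is_inj)
  qed
  finally show ?thesis by (simp add: det_def)
qed

definition reindex :: "('a \<Rightarrow> 'b) \<Rightarrow> real^'b::finite \<Rightarrow> real^'a::finite" where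
  "reindex f x = (\<chi> i. x $ f i)"

lemma reindex_nth [simp]: "reindex f x $ i = x $ f i" by (simp add: reindex_def)

lemma reindex_inverse: "bij f \<Longrightarrow> reindex (inv f) (reindex f x) = x" "bij f \<Longrightarrow> reindex f (reindex (inv f) y) = y"
  by (auto simp: vec_eq_iff bij_is_surj surj_f_inv_f bij_is_inj)

lemma bounded_linear_reindex: "bounded_linear (reindex f)"
proof -
  have "linear (reindex f)" by (intro linearI) (simp_all add: vec_eq_iff)
  thus ?thesis by (simp add: linear_conv_bounded_linear)
qed

lemma lborel_reindex:
  assumes f: "bij (f :: 'a::finite \<Rightarrow> 'b::finite)"
  shows "distr lborel borel (reindex f) = lborel"
proof -
  have m: "reindex f \<in> borel_measurable borel"
    by (intro borel_measurable_continuous_onI linear_continuous_on bounded_linear_reindex)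
  have "lborel = distr lborel borel (reindex f)"
  proof (rule lborel_eqI)
    fix l u :: "real^'a" assume le: "\<And>b. b \<in> Basis \<Longrightarrow> l \<bullet> b \<le> u \<bullet> b"
    have pB: "(\<Prod>b\<in>Basis. (u - l) \<bullet> b) = (\<Prod>i\<in>UNIV. u $ i - l $ i)" for u l :: "real^'z::finite"
    proof -
      have "inj (\<lambda>i::'z. axis i (1::real) :: real^'z)" by (auto simp: inj_def axis_eq_axis)
      moreover have "(Basis :: (real^'z) set) = range (\<lambda>i. axis i 1)" by (auto simp: Basis_vec_def)
      ultimately have "(\<Prod>b\<in>Basis. (u - l) \<bullet> b) = (\<Prod>i\<in>UNIV. (u - l) \<bullet> axis i 1)"
        using prod.reindex[of "\<lambda>i. axis i 1" UNIV "\<lambda>b. (u - l) \<bullet> b"] by (simp add: comp_def)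
      thus ?thesis by (simp add: inner_axis)
    qed
    have "reindex f -` box l u = box (reindex (inv f) l) (reindex (inv f) u)" (is "?L = ?R")
    proof (rule set_eqI)
      fix x :: "real^'b"
      have "x \<in> ?R \<longleftrightarrow> (\<forall>j. l $ inv f j < x $ j \<and> x $ j < u $ inv f j)" by (simp add: mem_box_cart)
      also have "\<dots> \<longleftrightarrow> (\<forall>i. l $ i < x $ f i \<and> x $ f i < u $ i)"
        using f by (metis bij_inv_eq_iff)
      finally show "x \<in> ?L \<longleftrightarrow> x \<in> ?R" by (simp add: mem_box_cart)
    qed
    moreover have "\<And>b. b \<in> Basis \<Longrightarrow> reindex (inv f) l \<bullet> b \<le> reindex (inv f) u \<bullet> b"
    proof -
      fix b :: "real^'b" assume "b \<in> Basis"
      then obtain j where b: "b = axis j 1" by (auto simp: Basis_vec_def)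
      have "l \<bullet> axis (inv f j) 1 \<le> u \<bullet> axis (inv f j) 1" by (rule le) (auto simp: Basis_vec_def)
      thus "reindex (inv f) l \<bullet> b \<le> reindex (inv f) u \<bullet> b" by (simp add: b inner_axis)
    qed
    ultimately have "emeasure (distr lborel borel (reindex f)) (box l u) =
        (\<Prod>j\<in>UNIV. u $ inv f j - l $ inv f j)"
      using m by (simp add: emeasure_distr pB emeasure_lborel_box)
    also have "(\<Prod>j\<in>UNIV. u $ inv f j - l $ inv f j) = (\<Prod>i\<in>UNIV. u $ i - l $ i)"
      by (rule prod.reindex_bij_betw[OF bij_imp_bij_inv[OF f]])
    finally show "emeasure (distr lborel borel (reindex f)) (box l u) = (\<Prod>b\<in>Basis. (u - l) \<bullet> b)"
      by (simp add: pB)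
  qed simp
  thus ?thesis by simp
qed

lemma set_integral_reindex:
  fixes F :: "real^'a::finite \<Rightarrow> complex"
  assumes f: "bij (f :: 'a::finite \<Rightarrow> 'b::finite)" and F: "set_borel_measurable borel S F"
  shows "set_integrable lborel (reindex f -` S) (\<lambda>x. F (reindex f x)) \<longleftrightarrow> set_integrable lborel S F"
    "(LINT x:reindex f -` S|lborel. F (reindex f x)) = (LINT y:S|lborel. F y)"
proof -
  have m: "reindex f \<in> lborel \<rightarrow>\<^sub>M borel"
    by (simp add: borel_measurable_continuous_onI linear_continuous_on bounded_linear_reindex)
  have ind: "indicator (reindex f -` S) x = indicator S (reindex f x)" for x
    by (simp add: indicator_def)
  have "set_integrable lborel S F \<longleftrightarrow> integrable (distr lborel borel (reindex f)) (\<lambda>y. indicat_real S y *\<^sub>R F y)"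
    by (simp add: set_integrable_def lborel_reindex[OF f])
  also have "\<dots> \<longleftrightarrow> integrable lborel (\<lambda>x. indicat_real S (reindex f x) *\<^sub>R F (reindex f x))"
    using F by (intro integrable_distr_eq[OF m]) (simp add: set_borel_measurable_def)
  finally show "set_integrable lborel (reindex f -` S) (\<lambda>x. F (reindex f x)) \<longleftrightarrow> set_integrable lborel S F"
    by (simp add: set_integrable_def ind)
  have "(LINT y:S|lborel. F y) = (LINT y|distr lborel borel (reindex f). indicat_real S y *\<^sub>R F y)"
    by (simp add: set_lebesgue_integral_def lborel_reindex[OF f])
  also have "\<dots> = (LINT x|lborel. indicat_real S (reindex f x) *\<^sub>R F (reindex f x))"
    using F by (intro integral_distr[OF m]) (simp add: set_borel_measurable_def)
  finally show "(LINT x:reindex f -` S|lborel. F (reindex f x)) = (LINT y:S|lborel. F y)"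
    by (simp add: set_lebesgue_integral_def ind)
qed

lemma change_of_variables_wellorder:
  fixes T :: "real^'m::{finite,wellorder} \<Rightarrow> real^'m::_" and F :: "real^'m::_ \<Rightarrow> complex"
  assumes S: "open S" and T': "\<And>x. x \<in> S \<Longrightarrow> (T has_derivative T' x) (at x)" and inj: "inj_on T S"
    and cont: "continuous_on S (\<lambda>x. det (matrix (T' x)))" and F: "continuous_on (T ` S) F"
    and int: "set_integrable lborel (T ` S) F"
  shows "(LINT y:T ` S|lborel. F y) = (LINT x:S|lborel. of_real \<bar>det (matrix (T' x))\<bar> * F (T x))"
proof -
  define h where "h z = Complex (z $ 1) (z $ 2)" for z :: "real^2"
  define e :: "complex \<Rightarrow> real^2" where "e w = (\<chi> i. if i = 1 then Re w else Im w)" for w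
  have he: "h (e w) = w" for w by (simp add: h_def e_def)
  have "linear h" "linear e" by (auto intro!: linearI simp: h_def e_def complex_eq_iff vec_eq_iff)
  hence bl: "bounded_linear h" "bounded_linear e" by (simp_all add: linear_conv_bounded_linear)
  have Tc: "continuous_on S T" using T' S by (intro has_derivative_continuous_on) (auto intro: has_derivative_at_withinI)
  have Sm: "S \<in> sets lebesgue" using S by simp
  have T'w: "\<And>x. x \<in> S \<Longrightarrow> (T has_derivative T' x) (at x within S)" by (rule has_derivative_at_withinI[OF T'])
  let ?G = "\<lambda>x. \<bar>det (matrix (T' x))\<bar> *\<^sub>R F (T x)"
  have "F absolutely_integrable_on T ` S"
    using int unfolding set_integrable_def by (intro integrable_completion[THEN iffD2]) auto
  hence eF: "(e \<circ> F) absolutely_integrable_on T ` S" by (rule absolutely_integrable_linear) (rule bl)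
  hence eG: "(\<lambda>x. \<bar>det (matrix (T' x))\<bar> *\<^sub>R (e \<circ> F) (T x)) absolutely_integrable_on S"
    using absolutely_integrable_change_of_variables[OF Sm T'w inj] by blast
  have heq: "h \<circ> (\<lambda>x. \<bar>det (matrix (T' x))\<bar> *\<^sub>R (e \<circ> F) (T x)) = ?G"
    using linear_scale[OF \<open>linear h\<close>] by (simp add: fun_eq_iff he)
  have "?G absolutely_integrable_on S"
    using absolutely_integrable_linear[OF eG bl(1)] unfolding heq .
  moreover have Gc: "continuous_on S ?G" using F Tc by (intro continuous_intros cont continuous_on_compose2[OF F Tc]) auto
  hence Gm: "(\<lambda>x. indicat_real S x *\<^sub>R ?G x) \<in> borel_measurable lborel"
    using borel_measurable_continuous_on_indicator[OF borel_open[OF S] Gc] by simp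
  ultimately have G: "set_integrable lborel S ?G"
    unfolding set_integrable_def using integrable_completion[OF Gm] by simp
  have "(LINT y:T ` S|lborel. F y) = integral (T ` S) F" by (rule set_borel_integral_eq_integral(2)[OF int])
  also have "\<dots> = integral (T ` S) (h \<circ> (e \<circ> F))" by (simp add: he comp_def)
  also have "\<dots> = h (integral (T ` S) (e \<circ> F))"
    by (rule integral_linear[OF set_lebesgue_integral_eq_integral(1)[OF eF] bl(1)])
  also have "\<dots> = h (integral S (\<lambda>x. \<bar>det (matrix (T' x))\<bar> *\<^sub>R (e \<circ> F) (T x)))"
    using integral_change_of_variables[OF Sm T'w inj disjI1[OF eF]] by simp
  also have "\<dots> = integral S ?G" unfolding heq[symmetric]
    by (rule integral_linear[OF set_lebesgue_integral_eq_integral(1)[OF eG] bl(1), symmetric])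
  also have "\<dots> = (LINT x:S|lborel. ?G x)" by (rule set_borel_integral_eq_integral(2)[OF G, symmetric])
  finally show ?thesis by (simp add: scaleR_conv_of_real)
qed

theorem change_of_variables:
  fixes T :: "real^'k::finite \<Rightarrow> real^'k" and F :: "real^'k \<Rightarrow> complex"
  assumes S: "open S" and TS: "open (T ` S)" and T': "\<And>x. x \<in> S \<Longrightarrow> (T has_derivative T' x) (at x)" and inj: "inj_on T S"
    and cont: "continuous_on S (\<lambda>x. det (matrix (T' x)))" and F: "continuous_on (T ` S) F"
    and int: "set_integrable lborel (T ` S) F"
  shows "(LINT y:T ` S|lborel. F y) = (LINT x:S|lborel. of_real \<bar>det (matrix (T' x))\<bar> * F (T x))"
proof -
  define f where "f = (indexed :: 'k \<Rightarrow> 'k indexed)"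
  have f: "bij f" unfolding f_def by (rule bij_indexed)
  define r where "r = reindex (inv f)"
  define s where "s = reindex f"
  have rs: "r (s y) = y" and sr: "s (r x) = x" for x y
    unfolding r_def s_def by (rule reindex_inverse[OF f])+
  have bl: "bounded_linear r" "bounded_linear s" unfolding r_def s_def by (rule bounded_linear_reindex)+
  define S' where "S' = s -` S"
  define U where "U y = r (T (s y))" for y
  have memS': "y \<in> S' \<longleftrightarrow> s y \<in> S" for y by (simp add: S'_def)
  have im: "U ` S' = s -` (T ` S)"
  proof (intro set_eqI iffI)
    fix z assume "z \<in> U ` S'"
    then obtain y where "y \<in> S'" "z = U y" by blast
    thus "z \<in> s -` (T ` S)" by (simp add: U_def sr rs memS')
  next
    fix z assume "z \<in> s -` (T ` S)"
    then obtain x where x: "x \<in> S" "s z = T x" by auto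
    have "z = U (r x)" unfolding U_def sr x(2)[symmetric] rs ..
    thus "z \<in> U ` S'" using x(1) by (auto simp: memS' sr)
  qed
  have sc: "continuous_on X s" for X by (intro linear_continuous_on bl)
  have oS': "open S'" unfolding S'_def by (intro open_vimage S sc)
  have oU: "open (U ` S')" unfolding im by (intro open_vimage TS sc)
  define U' where "U' y v = r (T' (s y) (s v))" for y v
  have dU: "(U has_derivative U' y) (at y)" if "y \<in> S'" for y
    unfolding U_def U'_def
    by (intro bounded_linear.has_derivative[OF bl(1)] has_derivative_compose[OF bounded_linear_imp_has_derivative[OF bl(2)] T', unfolded comp_def])
      (use that in \<open>simp add: memS'\<close>)
  have injU: "inj_on U S'"
  proof (rule inj_onI)
    fix y z assume yz: "y \<in> S'" "z \<in> S'" "U y = U z"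
    have "T (s y) = T (s z)" using arg_cong[OF yz(3), of s] by (simp add: U_def sr)
    hence "s y = s z" using yz inj by (auto simp: memS' dest: inj_onD)
    from arg_cong[OF this, of r] show "y = z" by (simp add: rs)
  qed
  have s_axis: "s (axis j 1) = axis (inv f j) 1" for j
    using f by (auto simp: s_def vec_eq_iff axis_def bij_is_inj bij_is_surj surj_f_inv_f inv_f_f)
  have detU: "det (matrix (U' y)) = det (matrix (T' (s y)))" for y
  proof -
    have "matrix (U' y) = (\<chi> i j. matrix (T' (s y)) $ inv f i $ inv f j)"
      by (simp add: matrix_def U'_def r_def s_axis vec_eq_iff)
    thus ?thesis using det_reindex[OF bij_imp_bij_inv[OF f], of "matrix (T' (s y))"] by simp
  qed
  have Fm: "set_borel_measurable borel (T ` S) F"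
    unfolding set_borel_measurable_def by (rule borel_measurable_continuous_on_indicator[OF borel_open[OF TS] F])
  have Tc: "continuous_on S T"
    using T' by (intro has_derivative_continuous_on) (auto intro: has_derivative_at_withinI)
  have Gm: "set_borel_measurable borel S (\<lambda>x. complex_of_real \<bar>det (matrix (T' x))\<bar> * F (T x))"
    unfolding set_borel_measurable_def
    by (intro borel_measurable_continuous_on_indicator borel_open S continuous_intros cont continuous_on_compose2[OF F Tc]) auto
  have "(LINT y:T ` S|lborel. F y) = (LINT z:U ` S'|lborel. F (s z))"
    unfolding im s_def by (rule set_integral_reindex(2)[OF f Fm, symmetric])
  also have "\<dots> = (LINT y:S'|lborel. of_real \<bar>det (matrix (U' y))\<bar> * F (s (U y)))"
  proof (rule change_of_variables_wellorder[OF oS' dU injU])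
    show "continuous_on S' (\<lambda>y. det (matrix (U' y)))"
      unfolding detU by (rule continuous_on_compose2[OF cont sc]) (auto simp: memS')
    show "continuous_on (U ` S') (\<lambda>z. F (s z))"
      unfolding im by (rule continuous_on_compose2[OF F sc]) auto
    show "set_integrable lborel (U ` S') (\<lambda>z. F (s z))"
      unfolding im s_def using set_integral_reindex(1)[OF f Fm] int by blast
  qed
  also have "\<dots> = (LINT y:s -` S|lborel. of_real \<bar>det (matrix (T' (s y)))\<bar> * F (T (s y)))"
    by (simp add: detU U_def sr S'_def)
  also have "\<dots> = (LINT x:S|lborel. of_real \<bar>det (matrix (T' x))\<bar> * F (T x))"
    unfolding s_def by (rule set_integral_reindex(2)[OF f Gm])
  finally show ?thesis .
qed

lemma smooth_on_det:
  fixes M :: "real^'k::finite \<Rightarrow> 'r::finite \<Rightarrow> 'r \<Rightarrow> real"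
  assumes "open S" "\<And>i j. smooth_on S (\<lambda>x. M x i j)"
  shows "smooth_on S (\<lambda>x. det (\<chi> i j. M x i j))"
  unfolding det_def using assms by (auto intro!: smooth_intros)

lemma smooth_on_abs:
  fixes f :: "real^'k::finite \<Rightarrow> real"
  assumes S: "open S" and f: "smooth_on S f" and nz: "\<And>x. x \<in> S \<Longrightarrow> f x \<noteq> 0"
  shows "smooth_on S (\<lambda>x. \<bar>f x\<bar>)"
proof (rule smooth_on_local)
  fix x assume x: "x \<in> S"
  have c: "continuous_on S f" by (rule smooth_on_continuous[OF f])
  show "\<exists>T. open T \<and> x \<in> T \<and> smooth_on T (\<lambda>x. \<bar>f x\<bar>)"
  proof (cases "f x > 0")
    case True
    let ?T = "S \<inter> f -` {0<..}"
    have o: "open ?T" by (rule continuous_open_preimage[OF c S]) simp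
    have "smooth_on ?T (\<lambda>x. \<bar>f x\<bar>)"
      by (rule smooth_on_cong[OF o _ smooth_on_subset[OF f]]) auto
    thus ?thesis using True x by (intro exI[of _ ?T]) (simp add: o)
  next
    case False
    let ?T = "S \<inter> f -` {..<0}"
    have o: "open ?T" by (rule continuous_open_preimage[OF c S]) simp
    have "smooth_on ?T (\<lambda>x. - f x)" by (rule smooth_on_minus[OF o smooth_on_subset[OF f]]) auto
    hence "smooth_on ?T (\<lambda>x. \<bar>f x\<bar>)"
      by (rule smooth_on_cong[OF o, rotated]) auto
    thus ?thesis using False nz[OF x] x by (intro exI[of _ ?T]) (simp add: o)
  qed
qed

lemma divergence_by_parts:
  fixes a :: "'k::finite \<Rightarrow> real^'k \<Rightarrow> complex"
  assumes \<Omega>: "open \<Omega>" and f: "smooth_on \<Omega> f" and m: "smooth_on \<Omega> m" and a: "\<And>i. smooth_on \<Omega> (a i)"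
    and supp: "f \<in> test_funs \<Omega> \<or> m \<in> test_funs \<Omega>"
  shows "(LINT x|lborel. f x * (\<Sum>i\<in>UNIV. pderiv1 i (\<lambda>y. a i y * m y) x)) =
    - (LINT x|lborel. (\<Sum>i\<in>UNIV. a i x * pderiv1 i f x) * m x)"
proof -
  have am: "smooth_on \<Omega> (\<lambda>y. a i y * m y)" for i by (intro smooth_intros \<Omega> a m)
  have "integrable lborel (\<lambda>x. f x * pderiv1 i (\<lambda>y. a i y * m y) x) \<and>
      integrable lborel (\<lambda>x. pderiv1 i f x * (a i x * m x)) \<and>
      (LINT x|lborel. f x * pderiv1 i (\<lambda>y. a i y * m y) x) = - (LINT x|lborel. pderiv1 i f x * (a i x * m x))" for i
    using supp
  proof
    assume ft: "f \<in> test_funs \<Omega>"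
    have "(LINT x|lborel. (a i x * m x) * pderiv1 i f x) = - (LINT x|lborel. pderiv1 i (\<lambda>y. a i y * m y) x * f x)"
      by (rule integral_by_parts[OF \<Omega> ft am])
    moreover have "integrable lborel (\<lambda>x. pderiv1 i (\<lambda>y. a i y * m y) x * f x)"
      by (rule test_funs_integrable_mult[OF ft smooth_on_continuous[OF smooth_on_pderiv1[OF am]]])
    moreover have "integrable lborel (\<lambda>x. (a i x * m x) * pderiv1 i f x)"
      by (rule test_funs_integrable_mult[OF test_funs_pderiv1[OF ft] smooth_on_continuous[OF am]])
    ultimately show ?thesis by (simp add: mult_ac)
  next
    assume mt: "m \<in> test_funs \<Omega>"
    have amt: "(\<lambda>y. a i y * m y) \<in> test_funs \<Omega>" by (rule test_funs_smooth_mult[OF \<Omega> mt a])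
    have "(LINT x|lborel. f x * pderiv1 i (\<lambda>y. a i y * m y) x) = - (LINT x|lborel. pderiv1 i f x * (a i x * m x))"
      by (rule integral_by_parts[OF \<Omega> amt f])
    moreover have "integrable lborel (\<lambda>x. f x * pderiv1 i (\<lambda>y. a i y * m y) x)"
      by (rule test_funs_integrable_mult[OF test_funs_pderiv1[OF amt] smooth_on_continuous[OF f]])
    moreover have "integrable lborel (\<lambda>x. pderiv1 i f x * (a i x * m x))"
      by (rule test_funs_integrable_mult[OF amt smooth_on_continuous[OF smooth_on_pderiv1[OF f]]])
    ultimately show ?thesis by simp
  qed
  hence 1: "\<And>i. integrable lborel (\<lambda>x. f x * pderiv1 i (\<lambda>y. a i y * m y) x)"
    and 2: "\<And>i. integrable lborel (\<lambda>x. pderiv1 i f x * (a i x * m x))"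
    and 3: "\<And>i. (LINT x|lborel. f x * pderiv1 i (\<lambda>y. a i y * m y) x) = - (LINT x|lborel. pderiv1 i f x * (a i x * m x))"
    by blast+
  have "(LINT x|lborel. f x * (\<Sum>i\<in>UNIV. pderiv1 i (\<lambda>y. a i y * m y) x)) =
      (\<Sum>i\<in>UNIV. LINT x|lborel. f x * pderiv1 i (\<lambda>y. a i y * m y) x)"
    unfolding sum_distrib_left by (rule Bochner_Integration.integral_sum[OF 1])
  also have "\<dots> = - (\<Sum>i\<in>UNIV. LINT x|lborel. pderiv1 i f x * (a i x * m x))"
    unfolding 3 by (simp add: sum_negf)
  also have "(\<Sum>i\<in>UNIV. LINT x|lborel. pderiv1 i f x * (a i x * m x)) =
      (LINT x|lborel. (\<Sum>i\<in>UNIV. pderiv1 i f x * (a i x * m x)))"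
    by (rule Bochner_Integration.integral_sum[OF 2, symmetric])
  also have "(\<lambda>x. \<Sum>i\<in>UNIV. pderiv1 i f x * (a i x * m x)) = (\<lambda>x. (\<Sum>i\<in>UNIV. a i x * pderiv1 i f x) * m x)"
    by (simp add: fun_eq_iff sum_distrib_right sum_distrib_left mult_ac)
  finally show ?thesis .
qed

context smooth_manifold
begin

section \<open>Jacobians and densities\<close>

lemma transition_domain:
  assumes c: "c \<in> A" "c' \<in> A" and p: "p \<in> cdom c" "p \<in> cdom c'"
  shows "open (coord c ` (cdom c \<inter> cdom c'))" "coord c p \<in> coord c ` (cdom c \<inter> cdom c')"
  using open_coord_image[OF c(1) chart_open(1)[OF c(2)]] p by (auto simp: Int_commute)

lemma transition_derivative:
  assumes c: "c \<in> A" "c' \<in> A" and p: "p \<in> cdom c" "p \<in> cdom c'"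
  shows "((\<lambda>x. coord c' (cinv c x)) has_derivative frechet_derivative (coord c' \<circ> cinv c) (at (coord c p))) (at (coord c p))"
  using smooth_on_differentiable_at[OF transition_smooth[OF c] transition_domain[OF c p]]
  by (simp add: frechet_derivative_works comp_def)

lemma jac_pderiv: "jac c c' p = det (\<chi> i j. pderiv1 j (\<lambda>x. coord c' (cinv c x)) (coord c p) $ i)"
  by (simp add: jac_def matrix_def pderiv1_def comp_def)

lemma jac_refl:
  assumes c: "c \<in> A" and p: "p \<in> cdom c"
  shows "jac c c p = 1"
proof -
  have "((\<lambda>x. coord c (cinv c x)) has_derivative (\<lambda>v. v)) (at (coord c p))"
    by (rule has_derivative_transform_within_open[OF has_derivative_ident chart_open(2)[OF c] coord_in_cran[OF p]])
      (simp add: coord_cinv[OF c])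
  hence "frechet_derivative (coord c \<circ> cinv c) (at (coord c p)) = (\<lambda>v. v)"
    unfolding comp_def by (metis frechet_derivative_at)
  thus ?thesis by (simp add: jac_def matrix_id_mat_1[unfolded id_def])
qed

lemma jac_cocycle:
  assumes c: "c \<in> A" "c' \<in> A" "c'' \<in> A" and p: "p \<in> cdom c" "p \<in> cdom c'" "p \<in> cdom c''"
  shows "jac c c'' p = jac c c' p * jac c' c'' p"
proof -
  let ?D = "\<lambda>c c'. frechet_derivative (coord c' \<circ> cinv c) (at (coord c p))"
  have inv: "cinv c (coord c p) = p" by (rule cinv_coord[OF c(1) p(1)])
  have "((\<lambda>x. coord c'' (cinv c' (coord c' (cinv c x)))) has_derivative (\<lambda>v. ?D c' c'' (?D c c' v))) (at (coord c p))"
    by (rule has_derivative_compose[OF transition_derivative[OF c(1,2) p(1,2)], of "\<lambda>y. coord c'' (cinv c' y)"])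
      (use transition_derivative[OF c(2,3) p(2,3)] in \<open>simp add: inv comp_def\<close>)
  hence "((\<lambda>x. coord c'' (cinv c x)) has_derivative (\<lambda>v. ?D c' c'' (?D c c' v))) (at (coord c p))"
  proof (rule has_derivative_transform_within_open[OF _ transition_domain[OF c(1,2) p(1,2)]])
    fix x assume "x \<in> coord c ` (cdom c \<inter> cdom c')"
    hence "cinv c x \<in> cdom c'" using cinv_coord[OF c(1)] by auto
    thus "coord c'' (cinv c' (coord c' (cinv c x))) = coord c'' (cinv c x)" by (simp add: cinv_coord[OF c(2)])
  qed
  hence "?D c c'' = ?D c' c'' \<circ> ?D c c'"
    unfolding comp_def by (metis frechet_derivative_at)
  moreover have "linear (?D c c')" "linear (?D c' c'')"
    using has_derivative_linear transition_derivative c p by blast+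
  ultimately show ?thesis by (simp add: jac_def matrix_compose det_mul mult.commute)
qed

lemma jac_nonzero:
  assumes "c \<in> A" "c' \<in> A" "p \<in> cdom c" "p \<in> cdom c'"
  shows "jac c c' p \<noteq> 0"
  using jac_cocycle[of c c' c p] jac_refl[of c p] assms by auto

lemma jac_smooth:
  assumes c: "c \<in> A" "c' \<in> A"
  shows "smooth_on (coord c ` (cdom c \<inter> cdom c')) (\<lambda>x. jac c c' (cinv c x))"
proof -
  let ?S = "coord c ` (cdom c \<inter> cdom c')"
  have S: "open ?S" using open_coord_image[OF c(1) chart_open(1)[OF c(2)]] by (simp add: Int_commute)
  show ?thesis
  proof (rule smooth_on_cong[OF S])
    show "smooth_on ?S (\<lambda>x. det (\<chi> i j. pderiv1 j (\<lambda>x. coord c' (cinv c x)) x $ i))"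
      by (intro smooth_on_det smooth_on_nth smooth_on_pderiv1 transition_smooth c S)
    fix x assume "x \<in> ?S"
    hence "coord c (cinv c x) = x" using cinv_coord[OF c(1)] by auto
    thus "jac c c' (cinv c x) = det (\<chi> i j. pderiv1 j (\<lambda>x. coord c' (cinv c x)) x $ i)"
      by (simp add: jac_pderiv)
  qed
qed

lemma abs_jac_smooth:
  assumes c: "c \<in> A" "c' \<in> A"
  shows "smooth_on (coord c ` (cdom c \<inter> cdom c')) (\<lambda>x. \<bar>jac c c' (cinv c x)\<bar>)"
proof (rule smooth_on_abs[OF _ jac_smooth[OF c]])
  show "open (coord c ` (cdom c \<inter> cdom c'))"
    using open_coord_image[OF c(1) chart_open(1)[OF c(2)]] by (simp add: Int_commute)
qed (auto simp: cinv_coord[OF c(1)] jac_nonzero[OF c])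

lemma abs_jac_msmooth:
  assumes c: "c \<in> A" "c' \<in> A"
  shows "msmooth A (cdom c \<inter> cdom c') (\<lambda>p. of_real \<bar>jac c c' p\<bar>)"
proof (rule msmooth_in_chart[OF c(1)])
  show "smooth_on (coord c ` (cdom c \<inter> cdom c')) (\<lambda>x. complex_of_real \<bar>jac c c' (cinv c x)\<bar>)"
    using open_coord_image[OF c(1) chart_open(1)[OF c(2)]]
    by (intro smooth_on_of_real abs_jac_smooth c) (simp add: Int_commute)
qed (use chart_open(1)[OF c(1)] chart_open(1)[OF c(2)] in auto)

definition chart_rep :: "('m, 'k) chart \<Rightarrow> ('m \<Rightarrow> complex) \<Rightarrow> real^'k \<Rightarrow> complex" where
  "chart_rep c h x = (if x \<in> cran c then h (cinv c x) else 0)"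

definition chart_integral :: "('m, 'k) chart \<Rightarrow> ('m \<Rightarrow> complex) \<Rightarrow> complex" where
  "chart_integral c h = (LINT x:cran c|lborel. h (cinv c x))"

lemma chart_integral_eq: "chart_integral c h = (LINT x|lborel. chart_rep c h x)"
  unfolding chart_integral_def set_lebesgue_integral_def
  by (rule arg_cong[of _ _ "lebesgue_integral lborel"]) (auto simp: chart_rep_def)

lemma chart_rep_coord: "c \<in> A \<Longrightarrow> p \<in> cdom c \<Longrightarrow> chart_rep c h (coord c p) = h p"
  by (simp add: chart_rep_def coord_in_cran cinv_coord)

lemma chart_rep_smooth:
  assumes c: "c \<in> A" and h: "msmooth A U h" and U: "open U"
  shows "smooth_on (coord c ` (U \<inter> cdom c)) (chart_rep c h)"
  by (rule smooth_on_cong[OF open_coord_image[OF c U] _ msmoothD[OF h c]])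
    (auto simp: chart_rep_def cran_def)

lemma compact_coord_image:
  assumes c: "c \<in> A" and K: "compact K" "K \<subseteq> cdom c"
  shows "compact (coord c ` K)"
  using chart_homeo[OF c] K by (intro compact_continuous_image) (auto simp: homeomorphism_def intro: continuous_on_subset)

lemma chart_rep_test:
  assumes c: "c \<in> A" and U: "open U" and K: "compact K" "K \<subseteq> U" "U \<subseteq> cdom c"
    and h: "msmooth A U h" "\<And>p. p \<in> cdom c \<Longrightarrow> p \<notin> K \<Longrightarrow> h p = 0"
  shows "chart_rep c h \<in> test_funs (coord c ` U)" "chart_rep c h \<in> test_funs (cran c)"
proof -
  have UU: "U \<inter> cdom c = U" using K by auto
  show t: "chart_rep c h \<in> test_funs (coord c ` U)"
  proof (rule test_funsI)
    show "open (coord c ` U)" using open_coord_image[OF c U] by (simp add: UU)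
    show "compact (coord c ` K)" using K by (intro compact_coord_image c) auto
    show "smooth_on (coord c ` U) (chart_rep c h)" using chart_rep_smooth[OF c h(1) U] by (simp add: UU)
    fix x assume "x \<notin> coord c ` K"
    hence "cinv c x \<notin> K" if "x \<in> cran c" using coord_cinv[OF c that] by (metis imageI)
    thus "chart_rep c h x = 0" using h(2)[OF cinv_in_cdom[OF c]] by (simp add: chart_rep_def)
  qed (use K in auto)
  show "chart_rep c h \<in> test_funs (cran c)" by (rule test_funs_mono[OF t]) (use K in \<open>auto simp: cran_def\<close>)
qed

lemma chart_integral_change:
  assumes c: "c \<in> A" "c' \<in> A" and Q: "compact Q" "Q \<subseteq> cdom c \<inter> cdom c'"
    and h: "msmooth A (cdom c \<inter> cdom c') h" "\<And>p. p \<notin> Q \<Longrightarrow> h p = 0"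
  shows "chart_integral c' h = chart_integral c (\<lambda>p. of_real \<bar>jac c c' p\<bar> * h p)"
proof -
  define W where "W = cdom c \<inter> cdom c'"
  have W: "open W" "W \<subseteq> cdom c" "W \<subseteq> cdom c'" using chart_open(1)[OF c(1)] chart_open(1)[OF c(2)] by (auto simp: W_def)
  define S where "S = coord c ` W"
  define T where "T x = coord c' (cinv c x)" for x
  have WW: "W \<inter> cdom c = W" "W \<inter> cdom c' = W" using W by auto
  have S: "open S" using open_coord_image[OF c(1) W(1)] by (simp add: S_def WW)
  have TS: "T ` S = coord c' ` W" unfolding T_def S_def image_image
    by (rule image_cong[OF refl]) (use cinv_coord[OF c(1) subsetD[OF W(2)]] in simp)
  have oTS: "open (T ` S)" unfolding TS using open_coord_image[OF c(2) W(1)] by (simp add: WW)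
  have inj: "inj_on T S"
  proof (rule inj_onI)
    fix x y assume xy: "x \<in> S" "y \<in> S" "T x = T y"
    obtain p where p: "p \<in> W" "x = coord c p" using xy(1) by (auto simp: S_def)
    obtain q where q: "q \<in> W" "y = coord c q" using xy(2) by (auto simp: S_def)
    have "coord c' p = coord c' q"
      using xy(3) cinv_coord[OF c(1) subsetD[OF W(2) p(1)]] cinv_coord[OF c(1) subsetD[OF W(2) q(1)]]
      by (simp add: T_def p(2) q(2))
    from arg_cong[OF this, of "cinv c'"] have "p = q"
      using cinv_coord[OF c(2) subsetD[OF W(3) p(1)]] cinv_coord[OF c(2) subsetD[OF W(3) q(1)]] by simp
    thus "x = y" by (simp add: p(2) q(2))
  qed
  define T' where "T' x = frechet_derivative (coord c' \<circ> cinv c) (at x)" for x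
  have T': "(T has_derivative T' x) (at x)" if x: "x \<in> S" for x
  proof -
    obtain p where p: "p \<in> cdom c" "p \<in> cdom c'" "x = coord c p" using x by (auto simp: S_def W_def)
    show ?thesis unfolding T_def T'_def p(3) by (rule transition_derivative[OF c p(1,2)])
  qed
  have det: "det (matrix (T' x)) = jac c c' (cinv c x)" if x: "x \<in> S" for x
  proof -
    obtain p where p: "p \<in> cdom c" "x = coord c p" using x by (auto simp: S_def W_def)
    show ?thesis unfolding T'_def p(2) cinv_coord[OF c(1) p(1)] jac_def ..
  qed
  have ht: "chart_rep c' h \<in> test_funs (T ` S)" unfolding TS
    by (rule chart_rep_test(1)[OF c(2) W(1) Q(1) _ W(3)]) (use Q h in \<open>auto simp: W_def\<close>)
  have "chart_integral c' h = (LINT y:T ` S|lborel. chart_rep c' h y)"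
    unfolding chart_integral_eq set_lebesgue_integral_def
    by (rule Bochner_Integration.integral_cong) (auto simp: indicator_def test_funs_outside[OF ht])
  also have "\<dots> = (LINT x:S|lborel. of_real \<bar>det (matrix (T' x))\<bar> * chart_rep c' h (T x))"
  proof (rule change_of_variables[OF S oTS T' inj])
    show "continuous_on S (\<lambda>x. det (matrix (T' x)))"
      using smooth_on_continuous[OF jac_smooth[OF c]] det by (simp add: S_def W_def cong: continuous_on_cong_simp)
    show "continuous_on (T ` S) (chart_rep c' h)" by (rule test_funs_continuous[OF ht])
    show "set_integrable lborel (T ` S) (chart_rep c' h)"
      unfolding set_integrable_def by (rule integrable_mult_indicator[OF _ test_funs_integrable[OF ht]]) (simp add: oTS)
  qed
  also have "\<dots> = chart_integral c (\<lambda>p. of_real \<bar>jac c c' p\<bar> * h p)"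
    unfolding chart_integral_eq set_lebesgue_integral_def
  proof (rule Bochner_Integration.integral_cong[OF refl])
    fix x
    show "indicat_real S x *\<^sub>R (of_real \<bar>det (matrix (T' x))\<bar> * chart_rep c' h (T x)) =
      chart_rep c (\<lambda>p. of_real \<bar>jac c c' p\<bar> * h p) x"
    proof (cases "x \<in> S")
      case True
      then obtain p where p: "p \<in> W" "x = coord c p" by (auto simp: S_def)
      hence pc: "p \<in> cdom c" "p \<in> cdom c'" using W by auto
      show ?thesis using True det[OF True]
        by (simp add: p(2) T_def cinv_coord[OF c(1) pc(1)] chart_rep_coord[OF c(1) pc(1)] chart_rep_coord[OF c(2) pc(2)])
    next
      case False
      have "h (cinv c x) = 0" if "x \<in> cran c"
      proof (rule h(2), rule)
        assume "cinv c x \<in> Q"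
        hence "coord c (cinv c x) \<in> S" using Q(2) by (auto simp: S_def W_def)
        thus False using False coord_cinv[OF c(1) that] by simp
      qed
      thus ?thesis using False by (simp add: chart_rep_def)
    qed
  qed
  finally show ?thesis .
qed

lemma test_densD:
  assumes "\<mu> \<in> test_dens_in A K"
  shows "\<mu> c p \<noteq> 0 \<Longrightarrow> c \<in> A \<and> p \<in> cdom c \<and> p \<in> K"
    "c \<in> A \<Longrightarrow> c' \<in> A \<Longrightarrow> p \<in> cdom c \<Longrightarrow> p \<in> cdom c' \<Longrightarrow> \<mu> c p = of_real \<bar>jac c c' p\<bar> * \<mu> c' p"
    "c \<in> A \<Longrightarrow> msmooth A (cdom c) (\<mu> c)"
  using assms unfolding test_dens_in_def by blast+

lemma test_densI:
  assumes "\<And>c p. \<mu> c p \<noteq> 0 \<Longrightarrow> c \<in> A \<and> p \<in> cdom c \<and> p \<in> K"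
    "\<And>c c' p. c \<in> A \<Longrightarrow> c' \<in> A \<Longrightarrow> p \<in> cdom c \<Longrightarrow> p \<in> cdom c' \<Longrightarrow> \<mu> c p = of_real \<bar>jac c c' p\<bar> * \<mu> c' p"
    "\<And>c. c \<in> A \<Longrightarrow> msmooth A (cdom c) (\<mu> c)"
  shows "\<mu> \<in> test_dens_in A K"
  using assms unfolding test_dens_in_def by blast

lemma test_dens_compact: "compact K \<Longrightarrow> \<mu> \<in> test_dens_in A K \<Longrightarrow> \<mu> \<in> test_dens A"
  by (auto simp: test_dens_def)

lemma test_dens_mult:
  assumes g: "g \<in> smooth_funs A" and \<mu>: "\<mu> \<in> test_dens_in A K"
  shows "(\<lambda>c p. g p * \<mu> c p) \<in> test_dens_in A K"
proof (rule test_densI)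
  show "c \<in> A \<and> p \<in> cdom c \<and> p \<in> K" if "g p * \<mu> c p \<noteq> 0" for c p
    by (rule test_densD(1)[OF \<mu>]) (use that in simp)
  show "g p * \<mu> c p = of_real \<bar>jac c c' p\<bar> * (g p * \<mu> c' p)"
    if "c \<in> A" "c' \<in> A" "p \<in> cdom c" "p \<in> cdom c'" for c c' p
    using test_densD(2)[OF \<mu> that] by simp
  show "msmooth A (cdom c) (\<lambda>p. g p * \<mu> c p)" if "c \<in> A" for c
    by (intro msmooth_mult smooth_funs_msmooth g test_densD(3)[OF \<mu> that] chart_open that)
qed

lemma compact_cinv_image:
  assumes c: "c \<in> A" and K: "compact K" "K \<subseteq> cran c"
  shows "compact (cinv c ` K)" "cinv c ` K \<subseteq> cdom c"
  using chart_homeo[OF c] K cinv_in_cdom[OF c]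
  by (auto simp: homeomorphism_def intro!: compact_continuous_image intro: continuous_on_subset)

lemma chart_dens_self: "c \<in> A \<Longrightarrow> p \<in> cdom c \<Longrightarrow> chart_dens A c \<psi> c p = \<psi> (coord c p)"
  by (simp add: chart_dens_def jac_refl)

lemma chart_dens_test:
  assumes c: "c \<in> A" and \<psi>: "smooth_on UNIV \<psi>" and K: "compact K" "K \<subseteq> cran c" "\<And>x. x \<notin> K \<Longrightarrow> \<psi> x = 0"
  shows "chart_dens A c \<psi> \<in> test_dens_in A (cinv c ` K)"
proof (rule test_densI)
  note cK = compact_cinv_image[OF c K(1,2)]
  have supp: "q \<in> cinv c ` K" if "q \<in> cdom c" "\<psi> (coord c q) \<noteq> 0" for q
    using that K(3) cinv_coord[OF c that(1)] by (intro image_eqI[of _ _ "coord c q"]) auto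
  show "c' \<in> A \<and> p \<in> cdom c' \<and> p \<in> cinv c ` K" if "chart_dens A c \<psi> c' p \<noteq> 0" for c' p
    using that supp[of p] by (auto simp: chart_dens_def split: if_splits)
  show "chart_dens A c \<psi> c1 p = of_real \<bar>jac c1 c2 p\<bar> * chart_dens A c \<psi> c2 p"
    if "c1 \<in> A" "c2 \<in> A" "p \<in> cdom c1" "p \<in> cdom c2" for c1 c2 p
    using that jac_cocycle[OF that(1,2) c that(3,4)] by (simp add: chart_dens_def abs_mult)
  show "msmooth A (cdom c1) (chart_dens A c \<psi> c1)" if c1: "c1 \<in> A" for c1
  proof (rule msmooth_extend[OF chart_open(1)[OF c] compact_imp_closed[OF cK(1)] cK(2) _ _ chart_open(1)[OF c1]])
    have o: "open (cdom c \<inter> cdom c1)" using chart_open c c1 by blast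
    have "msmooth A (cdom c) (\<lambda>p. \<psi> (coord c p))"
    proof (rule msmooth_in_chart[OF c chart_open(1)[OF c] order_refl])
      show "smooth_on (coord c ` cdom c) (\<lambda>x. \<psi> (coord c (cinv c x)))"
        unfolding cran_def[symmetric]
        by (rule smooth_on_cong[OF chart_open(2)[OF c] _ smooth_on_subset[OF \<psi>]]) (simp_all add: coord_cinv[OF c])
    qed
    hence "msmooth A (cdom c \<inter> cdom c1) (\<lambda>p. of_real \<bar>jac c1 c p\<bar> * \<psi> (coord c p))"
      using abs_jac_msmooth[OF c1 c] by (intro msmooth_mult o) (auto simp: Int_commute intro: msmooth_subset)
    thus "msmooth A (cdom c \<inter> cdom c1) (chart_dens A c \<psi> c1)"
      by (rule msmooth_cong[OF o, rotated]) (simp add: chart_dens_def c1)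
    show "chart_dens A c \<psi> c1 p = 0" if "p \<notin> cinv c ` K" for p
      using that supp[of p] by (auto simp: chart_dens_def)
  qed
qed

lemma chart_dens_eq:
  assumes \<mu>: "\<mu> \<in> test_dens_in A K" and K: "K \<subseteq> cdom c" and c: "c \<in> A"
  shows "\<mu> = chart_dens A c (chart_rep c (\<mu> c))"
proof (intro ext)
  fix c' p
  show "\<mu> c' p = chart_dens A c (chart_rep c (\<mu> c)) c' p"
  proof (cases "c' \<in> A \<and> p \<in> cdom c' \<inter> cdom c")
    case True
    thus ?thesis using test_densD(2)[OF \<mu>, of c' c p] c by (simp add: chart_dens_def chart_rep_coord)
  next
    case False
    hence "\<mu> c' p = 0" using test_densD(1)[OF \<mu>, of c' p] K by blast
    thus ?thesis using False by (auto simp: chart_dens_def)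
  qed
qed

lemma density_rep_test:
  assumes \<mu>: "\<mu> \<in> test_dens_in A K" and K: "compact K" "K \<subseteq> cdom c" and c: "c \<in> A"
  shows "chart_rep c (\<mu> c) \<in> test_funs (cran c)"
  by (rule chart_rep_test(2)[OF c chart_open(1)[OF c] K order_refl test_densD(3)[OF \<mu> c]])
    (use test_densD(1)[OF \<mu>] in blast)

lemma chart_integral_cong:
  assumes "c \<in> A" "\<And>p. p \<in> cdom c \<Longrightarrow> f p = g p"
  shows "chart_integral c f = chart_integral c g"
  unfolding chart_integral_eq
  by (rule arg_cong[of _ _ "lebesgue_integral lborel"]) (auto simp: chart_rep_def cinv_in_cdom assms)

lemma chart_test_function:
  assumes c: "c \<in> A" and W: "open W" "W \<subseteq> cdom c" and \<psi>: "\<psi> \<in> test_funs (coord c ` W)"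
  obtains f Q where "f \<in> smooth_funs A" "compact Q" "Q \<subseteq> W" "\<And>p. p \<notin> Q \<Longrightarrow> f p = 0" "chart_rep c f = \<psi>"
proof -
  obtain K where K: "compact K" "K \<subseteq> coord c ` W" "smooth_on UNIV \<psi>" "\<And>x. x \<notin> K \<Longrightarrow> \<psi> x = 0"
    by (rule test_funsE[OF \<psi>]) (rule that)
  have Kr: "K \<subseteq> cran c" using K(2) W(2) by (auto simp: cran_def)
  define f where "f p = (if p \<in> cdom c then \<psi> (coord c p) else 0)" for p
  have Q: "compact (cinv c ` K)" by (rule compact_cinv_image(1)[OF c K(1) Kr])
  have QW: "cinv c ` K \<subseteq> W"
  proof
    fix p assume "p \<in> cinv c ` K"
    then obtain q where "q \<in> W" "p = cinv c (coord c q)" using K(2) by blast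
    thus "p \<in> W" using cinv_coord[OF c subsetD[OF W(2)]] by simp
  qed
  have f0: "f p = 0" if p: "p \<notin> cinv c ` K" for p
  proof (cases "p \<in> cdom c")
    case True
    have "coord c p \<notin> K" using p cinv_coord[OF c True] by (metis imageI)
    thus ?thesis using K(4) by (simp add: f_def)
  qed (simp add: f_def)
  have "f \<in> smooth_funs A"
  proof (rule smooth_funs_extend[OF chart_open(1)[OF c] compact_imp_closed[OF Q] _ _ f0])
    show "cinv c ` K \<subseteq> cdom c" using QW W(2) by blast
    show "msmooth A (cdom c) f"
    proof (rule msmooth_in_chart[OF c chart_open(1)[OF c] order_refl])
      show "smooth_on (coord c ` cdom c) (\<lambda>x. f (cinv c x))" unfolding cran_def[symmetric]
        by (rule smooth_on_cong[OF chart_open(2)[OF c] _ smooth_on_subset[OF K(3)]])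
          (simp_all add: f_def coord_cinv[OF c] cinv_in_cdom[OF c])
    qed
  qed
  moreover have "chart_rep c f = \<psi>"
  proof
    fix x
    show "chart_rep c f x = \<psi> x"
      using K(4)[of x] Kr by (auto simp: chart_rep_def f_def coord_cinv[OF c] cinv_in_cdom[OF c])
  qed
  ultimately show ?thesis using Q QW f0 that by blast
qed

section \<open>The Lie derivative of a density\<close>

lemma field_chart_smooth:
  assumes c: "c \<in> A" and L: "L \<in> vector_fields A UNIV"
  shows "smooth_on (cran c) (\<lambda>x. vec_coeff A c (cinv c x) (L (cinv c x)) i)"
  using msmoothD[OF vec_coeff_smooth[OF c open_UNIV L] c] by (simp add: cran_def)

lemma msmooth_chart: "c \<in> A \<Longrightarrow> msmooth A (cdom c) h \<Longrightarrow> smooth_on (cran c) (\<lambda>x. h (cinv c x))"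
  using msmoothD[of "cdom c" h c] by (simp add: cran_def)

lemma field_apply:
  assumes c: "c \<in> A" and p: "p \<in> cdom c" and L: "L \<in> vector_fields A UNIV" and f: "f \<in> smooth_funs A"
  shows "L p f = (\<Sum>i\<in>UNIV. vec_coeff A c p (L p) i * pderiv1 i (\<lambda>x. f (cinv c x)) (coord c p))"
proof -
  have "L p = (\<lambda>f. \<Sum>i\<in>UNIV. vec_coeff A c p (L p) i * coord_vec A c i p f)"
    by (rule vec_coeff_expand[OF c p vector_fieldsD(1)[OF L UNIV_I]])
  from fun_cong[OF this, of f] show ?thesis by (simp add: coord_vec_apply[OF f])
qed

lemma lie_dens_by_parts:
  assumes c: "c \<in> A" and L: "L \<in> vector_fields A UNIV" and f: "f \<in> smooth_funs A"
    and m: "msmooth A (cdom c) (\<mu> c)" and Q: "compact Q" "Q \<subseteq> cdom c"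
    and supp: "(\<forall>p. p \<notin> Q \<longrightarrow> f p = 0) \<or> (\<forall>p. p \<notin> Q \<longrightarrow> \<mu> c p = 0)"
  shows "chart_integral c (\<lambda>p. f p * lie_dens A L \<mu> c p) = - chart_integral c (\<lambda>p. L p f * \<mu> c p)"
proof -
  define a where "a i x = vec_coeff A c (cinv c x) (L (cinv c x)) i" for i x
  note oc = chart_open[OF c]
  have sm: "smooth_on (cran c) (chart_rep c h)" if "msmooth A (cdom c) h" for h
    using chart_rep_smooth[OF c that oc(1)] by (simp add: cran_def)
  have fm: "msmooth A (cdom c) f" by (rule smooth_funs_msmooth[OF f])
  have t: "chart_rep c h \<in> test_funs (cran c)" if "msmooth A (cdom c) h" "\<forall>p. p \<notin> Q \<longrightarrow> h p = 0" for h
    by (rule chart_rep_test(2)[OF c oc(1) Q order_refl that(1)]) (use that(2) in blast)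
  have "chart_rep c (\<lambda>p. f p * lie_dens A L \<mu> c p) =
      (\<lambda>x. chart_rep c f x * (\<Sum>i\<in>UNIV. pderiv1 i (\<lambda>y. a i y * chart_rep c (\<mu> c) y) x))"
  proof
    fix x
    show "chart_rep c (\<lambda>p. f p * lie_dens A L \<mu> c p) x =
      chart_rep c f x * (\<Sum>i\<in>UNIV. pderiv1 i (\<lambda>y. a i y * chart_rep c (\<mu> c) y) x)"
    proof (cases "x \<in> cran c")
      case True
      have "pderiv1 i (\<lambda>y. a i y * chart_rep c (\<mu> c) y) x = pderiv1 i (\<lambda>y. a i y * \<mu> c (cinv c y)) x" for i
        by (rule pderiv1_cong[OF oc(2) True]) (simp add: chart_rep_def)
      thus ?thesis using True c
        by (simp add: chart_rep_def lie_dens_def cinv_in_cdom[OF c True] coord_cinv[OF c True] a_def)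
    qed (simp add: chart_rep_def)
  qed
  hence "chart_integral c (\<lambda>p. f p * lie_dens A L \<mu> c p) =
      (LINT x|lborel. chart_rep c f x * (\<Sum>i\<in>UNIV. pderiv1 i (\<lambda>y. a i y * chart_rep c (\<mu> c) y) x))"
    by (simp add: chart_integral_eq)
  also have "\<dots> = - (LINT x|lborel. (\<Sum>i\<in>UNIV. a i x * pderiv1 i (chart_rep c f) x) * chart_rep c (\<mu> c) x)"
    by (rule divergence_by_parts[OF oc(2) sm[OF fm] sm[OF m]])
      (use field_chart_smooth[OF c L] supp t[OF fm] t[OF m] in \<open>auto simp: a_def[abs_def]\<close>)
  also have "(\<lambda>x. (\<Sum>i\<in>UNIV. a i x * pderiv1 i (chart_rep c f) x) * chart_rep c (\<mu> c) x) =
      chart_rep c (\<lambda>p. L p f * \<mu> c p)"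
  proof
    fix x
    show "(\<Sum>i\<in>UNIV. a i x * pderiv1 i (chart_rep c f) x) * chart_rep c (\<mu> c) x = chart_rep c (\<lambda>p. L p f * \<mu> c p) x"
    proof (cases "x \<in> cran c")
      case True
      have "pderiv1 i (chart_rep c f) x = pderiv1 i (\<lambda>y. f (cinv c y)) x" for i
        by (rule pderiv1_cong[OF oc(2) True]) (simp add: chart_rep_def)
      thus ?thesis using True field_apply[OF c cinv_in_cdom[OF c True] L f]
        by (simp add: chart_rep_def a_def coord_cinv[OF c True])
    qed (simp add: chart_rep_def)
  qed
  finally show ?thesis by (simp add: chart_integral_eq)
qed

lemma lie_dens_smooth:
  assumes c: "c \<in> A" and L: "L \<in> vector_fields A UNIV" and m: "msmooth A (cdom c) (\<mu> c)"
  shows "msmooth A (cdom c) (lie_dens A L \<mu> c)"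
proof (rule msmooth_in_chart[OF c chart_open(1)[OF c] order_refl])
  note oc = chart_open[OF c]
  let ?q = "\<lambda>x. \<Sum>i\<in>UNIV. pderiv1 i (\<lambda>x. vec_coeff A c (cinv c x) (L (cinv c x)) i * \<mu> c (cinv c x)) x"
  have "smooth_on (cran c) ?q"
    by (intro smooth_on_sum smooth_on_pderiv1 smooth_on_mult oc field_chart_smooth[OF c L] msmooth_chart[OF c m])
  hence "smooth_on (cran c) (\<lambda>x. lie_dens A L \<mu> c (cinv c x))"
    by (rule smooth_on_cong[OF oc(2), rotated]) (simp add: lie_dens_def c cinv_in_cdom[OF c] coord_cinv[OF c])
  thus "smooth_on (coord c ` cdom c) (\<lambda>x. lie_dens A L \<mu> c (cinv c x))" by (simp add: cran_def)
qed

lemma lie_dens_outside: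
  assumes c: "c \<in> A" and p: "p \<in> cdom c" "p \<notin> K" and K: "closed K" and \<mu>: "\<mu> \<in> test_dens_in A K"
  shows "lie_dens A L \<mu> c p = 0"
proof -
  let ?S = "coord c ` (- K \<inter> cdom c)"
  have S: "open ?S" using open_coord_image[OF c] K by auto
  have pS: "coord c p \<in> ?S" using p by blast
  have "pderiv1 i (\<lambda>x. vec_coeff A c (cinv c x) (L (cinv c x)) i * \<mu> c (cinv c x)) (coord c p) =
      pderiv1 i (\<lambda>x. 0) (coord c p)" for i
  proof (rule pderiv1_cong[OF S pS])
    fix y assume "y \<in> ?S"
    hence "cinv c y \<notin> K" using cinv_coord[OF c] by auto
    hence "\<mu> c (cinv c y) = 0" using test_densD(1)[OF \<mu>, of c "cinv c y"] by blast
    thus "vec_coeff A c (cinv c y) (L (cinv c y)) i * \<mu> c (cinv c y) = 0" by simp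
  qed
  thus ?thesis by (simp add: lie_dens_def)
qed

lemma field_outside:
  assumes L: "L \<in> vector_fields A UNIV" and f: "f \<in> smooth_funs A" and Q: "closed Q" "\<And>p. p \<notin> Q \<Longrightarrow> f p = 0"
    and p: "p \<notin> Q"
  shows "L p f = 0"
proof -
  have "L p f = L p (\<lambda>q. 0)"
    by (rule tangent_local[OF vector_fieldsD(1)[OF L UNIV_I] f smooth_funs_const, of "- Q"]) (use Q p in auto)
  thus ?thesis using tangent_const[OF vector_fieldsD(1)[OF L UNIV_I]] by simp
qed

lemma lie_dens_test:
  assumes L: "L \<in> vector_fields A UNIV" and K: "compact K" and \<mu>: "\<mu> \<in> test_dens_in A K"
  shows "lie_dens A L \<mu> \<in> test_dens_in A K"
proof (rule test_densI)
  show "c \<in> A \<and> p \<in> cdom c \<and> p \<in> K" if nz: "lie_dens A L \<mu> c p \<noteq> 0" for c p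
  proof -
    have c: "c \<in> A" "p \<in> cdom c" using nz by (auto simp: lie_dens_def split: if_splits)
    thus ?thesis using lie_dens_outside[OF c _ compact_imp_closed[OF K] \<mu>] nz by blast
  qed
  have sm: "msmooth A (cdom c) (lie_dens A L \<mu> c)" if "c \<in> A" for c
    by (rule lie_dens_smooth[where \<mu> = \<mu>, OF that L test_densD(3)[OF \<mu> that]])
  thus "msmooth A (cdom c) (lie_dens A L \<mu> c)" if "c \<in> A" for c using that .
  fix c c' p assume c: "c \<in> A" "c' \<in> A" and p: "p \<in> cdom c" "p \<in> cdom c'"
  define W where "W = cdom c \<inter> cdom c'"
  have W: "open W" "W \<subseteq> cdom c" "W \<subseteq> cdom c'"
    using chart_open(1)[OF c(1)] chart_open(1)[OF c(2)] by (auto simp: W_def)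
  have WW: "W \<inter> cdom c = W" using W by auto
  have S: "open (coord c ` W)" using open_coord_image[OF c(1) W(1)] by (simp add: WW)
  define h1 where "h1 = lie_dens A L \<mu> c"
  define h2 where "h2 q = of_real \<bar>jac c c' q\<bar> * lie_dens A L \<mu> c' q" for q
  have m1: "msmooth A W h1" unfolding h1_def by (rule msmooth_subset[OF sm[OF c(1)] W(2)])
  have m2: "msmooth A W h2" unfolding h2_def
    using msmooth_subset[OF sm[OF c(2)] W(3)] abs_jac_msmooth[OF c] by (intro msmooth_mult W) (simp_all add: W_def)
  have mG: "msmooth A W (\<lambda>q. h1 q - h2 q)" by (rule msmooth_diff[OF W(1) m1 m2])
  have "chart_rep c (\<lambda>q. h1 q - h2 q) (coord c p) = 0"
  proof (rule fundamental_lemma[OF S])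
    show "continuous_on (coord c ` W) (chart_rep c (\<lambda>q. h1 q - h2 q))"
      using smooth_on_continuous[OF chart_rep_smooth[OF c(1) mG W(1)]] by (simp add: WW)
    show "coord c p \<in> coord c ` W" using p by (auto simp: W_def)
    fix \<psi> assume "\<psi> \<in> test_funs (coord c ` W)"
    then obtain f Q where f: "f \<in> smooth_funs A" "compact Q" "Q \<subseteq> W" "\<And>p. p \<notin> Q \<Longrightarrow> f p = 0" "chart_rep c f = \<psi>"
      by (rule chart_test_function[OF c(1) W(1,2)]) (rule that)
    have fm: "msmooth A U f" for U by (rule smooth_funs_msmooth[OF f(1)])
    have t: "chart_rep c (\<lambda>q. f q * h q) \<in> test_funs (coord c ` W)" if "msmooth A W h" for h
      by (rule chart_rep_test(1)[OF c(1) W(1) f(2,3) W(2)]) (use f(4) fm that W(1) in \<open>auto intro: msmooth_mult\<close>)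
    note int = test_funs_integrable[OF t[OF m1]] test_funs_integrable[OF t[OF m2]]
    have "(LINT x|lborel. chart_rep c (\<lambda>q. h1 q - h2 q) x * \<psi> x) =
        (LINT x|lborel. chart_rep c (\<lambda>q. f q * h1 q) x - chart_rep c (\<lambda>q. f q * h2 q) x)"
      unfolding f(5)[symmetric] by (rule arg_cong[of _ _ "lebesgue_integral lborel"]) (auto simp: chart_rep_def algebra_simps)
    also have "\<dots> = chart_integral c (\<lambda>q. f q * h1 q) - chart_integral c (\<lambda>q. f q * h2 q)"
      unfolding chart_integral_eq by (rule Bochner_Integration.integral_diff[OF int])
    also have "chart_integral c (\<lambda>q. f q * h1 q) = - chart_integral c (\<lambda>q. L q f * \<mu> c q)"
      unfolding h1_def by (rule lie_dens_by_parts[where \<mu> = \<mu>, OF c(1) L f(1) test_densD(3)[OF \<mu> c(1)] f(2)]) (use f(3,4) W(2) in auto)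
    also have "chart_integral c (\<lambda>q. f q * h2 q) = chart_integral c (\<lambda>q. of_real \<bar>jac c c' q\<bar> * (f q * lie_dens A L \<mu> c' q))"
      by (simp add: h2_def mult_ac)
    also have "\<dots> = chart_integral c' (\<lambda>q. f q * lie_dens A L \<mu> c' q)"
      by (rule chart_integral_change[OF c f(2), symmetric])
        (use f(3,4) fm msmooth_subset[OF sm[OF c(2)] W(3)] W(1) in \<open>auto simp: W_def intro!: msmooth_mult\<close>)
    also have "\<dots> = - chart_integral c' (\<lambda>q. L q f * \<mu> c' q)"
      by (rule lie_dens_by_parts[where \<mu> = \<mu>, OF c(2) L f(1) test_densD(3)[OF \<mu> c(2)] f(2)]) (use f(3,4) W(3) in auto)
    also have "chart_integral c' (\<lambda>q. L q f * \<mu> c' q) = chart_integral c (\<lambda>q. of_real \<bar>jac c c' q\<bar> * (L q f * \<mu> c' q))"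
    proof (rule chart_integral_change[OF c f(2)])
      show "msmooth A (cdom c \<inter> cdom c') (\<lambda>q. L q f * \<mu> c' q)"
        using msmooth_subset[OF test_densD(3)[OF \<mu> c(2)] W(3)] smooth_funs_msmooth[OF vector_fields_smooth_fun[OF L]] W(1)
        by (intro msmooth_mult) (simp_all add: W_def)
      show "L q f * \<mu> c' q = 0" if "q \<notin> Q" for q
        using field_outside[OF L f(1) compact_imp_closed[OF f(2)] f(4) that] by simp
    qed (use f(3) in \<open>simp add: W_def\<close>)
    also have "\<dots> = chart_integral c (\<lambda>q. L q f * \<mu> c q)"
    proof (rule chart_integral_cong[OF c(1)])
      fix q assume q: "q \<in> cdom c"
      show "of_real \<bar>jac c c' q\<bar> * (L q f * \<mu> c' q) = L q f * \<mu> c q"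
      proof (cases "q \<in> Q")
        case True
        hence "q \<in> cdom c'" using f(3) W(3) by blast
        thus ?thesis using test_densD(2)[OF \<mu> c q] by simp
      next
        case False
        thus ?thesis using field_outside[OF L f(1) compact_imp_closed[OF f(2)] f(4) False] by simp
      qed
    qed
    finally show "(LINT x|lborel. chart_rep c (\<lambda>q. h1 q - h2 q) x * \<psi> x) = 0" by simp
  qed
  thus "lie_dens A L \<mu> c p = of_real \<bar>jac c c' p\<bar> * lie_dens A L \<mu> c' p"
    by (simp add: chart_rep_coord[OF c(1) p(1)] h1_def h2_def)
qed

section \<open>Scalar distributions on the manifold\<close>

definition represents :: "('m \<Rightarrow> complex) \<Rightarrow> (('m, 'k) dens \<Rightarrow> complex) \<Rightarrow> bool" where
  "represents f u \<longleftrightarrow> f \<in> smooth_funs A \<and> (\<forall>c\<in>A. \<forall>K. compact K \<and> K \<subseteq> cdom c \<longrightarrow>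
     (\<forall>\<mu>\<in>test_dens_in A K. u \<mu> = chart_integral c (\<lambda>p. f p * \<mu> c p)))"

lemma smooth_dist_iff: "smooth_dist A u \<longleftrightarrow> (\<exists>f. represents f u)"
  unfolding smooth_dist_def represents_def chart_integral_def Bex_def by (rule refl)

lemma representsD:
  assumes "represents f u"
  shows "f \<in> smooth_funs A"
    "c \<in> A \<Longrightarrow> compact K \<Longrightarrow> K \<subseteq> cdom c \<Longrightarrow> \<mu> \<in> test_dens_in A K \<Longrightarrow> u \<mu> = chart_integral c (\<lambda>p. f p * \<mu> c p)"
  using assms by (simp_all only: represents_def simp_thms)

lemma representsI:
  assumes "f \<in> smooth_funs A"
    "\<And>c K \<mu>. c \<in> A \<Longrightarrow> compact K \<Longrightarrow> K \<subseteq> cdom c \<Longrightarrow> \<mu> \<in> test_dens_in A K \<Longrightarrow> u \<mu> = chart_integral c (\<lambda>p. f p * \<mu> c p)"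
  shows "represents f u"
  unfolding represents_def by (intro conjI ballI allI impI assms(1), elim conjE, rule assms(2))

lemma represents_dist_deriv:
  assumes f: "represents f u" and L: "L \<in> vector_fields A UNIV"
  shows "represents (\<lambda>p. L p f) (dist_deriv A L u)"
proof (rule representsI)
  show "(\<lambda>p. L p f) \<in> smooth_funs A" by (rule vector_fields_smooth_fun[OF L])
  fix c K \<mu> assume c: "c \<in> A" and K: "compact K" "K \<subseteq> cdom c" and \<mu>: "\<mu> \<in> test_dens_in A K"
  have \<mu>0: "\<forall>p. p \<notin> K \<longrightarrow> \<mu> c p = 0" using test_densD(1)[OF \<mu>, of c] by blast
  have "dist_deriv A L u \<mu> = - chart_integral c (\<lambda>p. f p * lie_dens A L \<mu> c p)"
    unfolding dist_deriv_def by (simp add: representsD(2)[OF f c K lie_dens_test[OF L K(1) \<mu>]])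
  also have "\<dots> = chart_integral c (\<lambda>p. L p f * \<mu> c p)"
    using lie_dens_by_parts[where \<mu> = \<mu>, OF c L representsD(1)[OF f] test_densD(3)[OF \<mu> c] K] \<mu>0 by simp
  finally show "dist_deriv A L u \<mu> = chart_integral c (\<lambda>p. L p f * \<mu> c p)" .
qed

lemma smooth_dist_from_charts:
  assumes ex: "\<And>c. c \<in> A \<Longrightarrow> \<exists>g. smooth_on (cran c) g \<and>
      (\<forall>\<psi>\<in>test_funs (cran c). u (chart_dens A c \<psi>) = (LINT x|lborel. g x * \<psi> x))"
  shows "\<exists>f. represents f u"
proof -
  have "\<forall>c. \<exists>g. c \<in> A \<longrightarrow> smooth_on (cran c) g \<and>
      (\<forall>\<psi>\<in>test_funs (cran c). u (chart_dens A c \<psi>) = (LINT x|lborel. g x * \<psi> x))"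
    using ex by blast
  then obtain G where G: "\<forall>c. c \<in> A \<longrightarrow> smooth_on (cran c) (G c) \<and>
      (\<forall>\<psi>\<in>test_funs (cran c). u (chart_dens A c \<psi>) = (LINT x|lborel. G c x * \<psi> x))"
    by (rule choice[THEN exE])
  have Gs: "smooth_on (cran c) (G c)" if "c \<in> A" for c using G that by blast
  have Gu: "u (chart_dens A c \<psi>) = (LINT x|lborel. G c x * \<psi> x)" if "c \<in> A" "\<psi> \<in> test_funs (cran c)" for c \<psi>
    using G that by blast
  have Gm: "msmooth A (cdom c) (\<lambda>p. G c (coord c p))" if c: "c \<in> A" for c
  proof (rule msmooth_in_chart[OF c chart_open(1)[OF c] order_refl])
    show "smooth_on (coord c ` cdom c) (\<lambda>x. G c (coord c (cinv c x)))" unfolding cran_def[symmetric]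
      by (rule smooth_on_cong[OF chart_open(2)[OF c] _ Gs[OF c]]) (simp add: coord_cinv[OF c])
  qed
  have Gint: "u \<mu> = chart_integral c (\<lambda>p. G c (coord c p) * \<mu> c p)"
    if c: "c \<in> A" and K: "compact K" "K \<subseteq> cdom c" and \<mu>: "\<mu> \<in> test_dens_in A K" for c K \<mu>
  proof -
    have "u \<mu> = (LINT x|lborel. G c x * chart_rep c (\<mu> c) x)"
      by (subst chart_dens_eq[OF \<mu> K(2) c]) (rule Gu[OF c density_rep_test[OF \<mu> K c]])
    also have "\<dots> = chart_integral c (\<lambda>p. G c (coord c p) * \<mu> c p)"
      unfolding chart_integral_eq
      by (rule arg_cong[of _ _ "lebesgue_integral lborel"]) (auto simp: chart_rep_def coord_cinv[OF c])
    finally show ?thesis .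
  qed
  have agree: "G c (coord c p) = G c' (coord c' p)"
    if c: "c \<in> A" "c' \<in> A" and p: "p \<in> cdom c" "p \<in> cdom c'" for c c' p
  proof -
    define W where "W = cdom c \<inter> cdom c'"
    have W: "open W" "W \<subseteq> cdom c" "W \<subseteq> cdom c'"
      using chart_open(1)[OF c(1)] chart_open(1)[OF c(2)] by (auto simp: W_def)
    have WW: "W \<inter> cdom c = W" using W by auto
    have S: "open (coord c ` W)" using open_coord_image[OF c(1) W(1)] by (simp add: WW)
    define h1 where "h1 q = G c (coord c q)" for q
    define h2 where "h2 q = G c' (coord c' q)" for q
    have m1: "msmooth A W h1" unfolding h1_def by (rule msmooth_subset[OF Gm[OF c(1)] W(2)])
    have m2: "msmooth A W h2" unfolding h2_def by (rule msmooth_subset[OF Gm[OF c(2)] W(3)])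
    have mG: "msmooth A W (\<lambda>q. h1 q - h2 q)" by (rule msmooth_diff[OF W(1) m1 m2])
    have "chart_rep c (\<lambda>q. h1 q - h2 q) (coord c p) = 0"
    proof (rule fundamental_lemma[OF S])
      show "continuous_on (coord c ` W) (chart_rep c (\<lambda>q. h1 q - h2 q))"
        using smooth_on_continuous[OF chart_rep_smooth[OF c(1) mG W(1)]] by (simp add: WW)
      show "coord c p \<in> coord c ` W" using p by (auto simp: W_def)
      fix \<psi> assume \<psi>: "\<psi> \<in> test_funs (coord c ` W)"
      then obtain f Q where f: "f \<in> smooth_funs A" "compact Q" "Q \<subseteq> W" "\<And>p. p \<notin> Q \<Longrightarrow> f p = 0" "chart_rep c f = \<psi>"
        by (rule chart_test_function[OF c(1) W(1,2)]) (rule that)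
      have fm: "msmooth A U f" for U by (rule smooth_funs_msmooth[OF f(1)])
      have QW: "coord c ` Q \<subseteq> cran c" "Q \<subseteq> cdom c" "Q \<subseteq> cdom c'" using f(3) W by (auto simp: cran_def)
      have \<psi>0: "\<psi> x = 0" if "x \<notin> coord c ` Q" for x
      proof (cases "x \<in> cran c")
        case True
        hence "cinv c x \<notin> Q" using that coord_cinv[OF c(1) True] by (metis imageI)
        thus ?thesis unfolding f(5)[symmetric] using f(4) by (simp add: chart_rep_def)
      qed (simp add: f(5)[symmetric] chart_rep_def)
      have QQ: "cinv c ` coord c ` Q = Q" unfolding image_image
        using cinv_coord[OF c(1) subsetD[OF QW(2)]] by (simp cong: image_cong)
      define \<mu> where "\<mu> = chart_dens A c \<psi>"
      have \<mu>: "\<mu> \<in> test_dens_in A Q"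
        using chart_dens_test[OF c(1) test_funs_smooth[OF \<psi>] compact_coord_image[OF c(1) f(2) QW(2)] QW(1) \<psi>0]
        by (simp add: \<mu>_def QQ)
      have \<mu>c: "\<mu> c q = f q" if "q \<in> cdom c" for q
        unfolding \<mu>_def chart_dens_self[OF c(1) that] f(5)[symmetric] by (rule chart_rep_coord[OF c(1) that])
      have t: "chart_rep c (\<lambda>q. h q * f q) \<in> test_funs (coord c ` W)" if "msmooth A W h" for h
        by (rule chart_rep_test(1)[OF c(1) W(1) f(2,3) W(2)]) (use f(4) fm that W(1) in \<open>auto intro: msmooth_mult\<close>)
      note int = test_funs_integrable[OF t[OF m1]] test_funs_integrable[OF t[OF m2]]
      have "(LINT x|lborel. chart_rep c (\<lambda>q. h1 q - h2 q) x * \<psi> x) =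
          (LINT x|lborel. chart_rep c (\<lambda>q. h1 q * f q) x - chart_rep c (\<lambda>q. h2 q * f q) x)"
        unfolding f(5)[symmetric] by (rule arg_cong[of _ _ "lebesgue_integral lborel"]) (auto simp: chart_rep_def algebra_simps)
      also have "\<dots> = chart_integral c (\<lambda>q. h1 q * f q) - chart_integral c (\<lambda>q. h2 q * f q)"
        unfolding chart_integral_eq by (rule Bochner_Integration.integral_diff[OF int])
      also have "chart_integral c (\<lambda>q. h1 q * f q) = u \<mu>"
        unfolding Gint[OF c(1) f(2) QW(2) \<mu>] by (rule chart_integral_cong[OF c(1)]) (simp add: h1_def \<mu>c)
      also have "u \<mu> = chart_integral c' (\<lambda>q. h2 q * \<mu> c' q)"
        unfolding Gint[OF c(2) f(2) QW(3) \<mu>] h2_def ..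
      also have "\<dots> = chart_integral c (\<lambda>q. of_real \<bar>jac c c' q\<bar> * (h2 q * \<mu> c' q))"
      proof (rule chart_integral_change[OF c f(2)])
        show "msmooth A (cdom c \<inter> cdom c') (\<lambda>q. h2 q * \<mu> c' q)"
          using m2 msmooth_subset[OF test_densD(3)[OF \<mu> c(2)] W(3)] W(1) by (intro msmooth_mult) (simp_all add: W_def)
        show "h2 q * \<mu> c' q = 0" if "q \<notin> Q" for q using test_densD(1)[OF \<mu>, of c' q] that by auto
      qed (use f(3) in \<open>simp add: W_def\<close>)
      also have "\<dots> = chart_integral c (\<lambda>q. h2 q * f q)"
      proof (rule chart_integral_cong[OF c(1)])
        fix q assume q: "q \<in> cdom c"
        show "of_real \<bar>jac c c' q\<bar> * (h2 q * \<mu> c' q) = h2 q * f q"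
        proof (cases "q \<in> Q")
          case True
          hence "q \<in> cdom c'" using QW(3) by blast
          thus ?thesis using test_densD(2)[OF \<mu> c q] \<mu>c[OF q] by simp
        next
          case False
          thus ?thesis using f(4)[OF False] test_densD(1)[OF \<mu>, of c' q] False by auto
        qed
      qed
      finally show "(LINT x|lborel. chart_rep c (\<lambda>q. h1 q - h2 q) x * \<psi> x) = 0" by simp
    qed
    thus ?thesis by (simp add: chart_rep_coord[OF c(1) p(1)] h1_def h2_def)
  qed
  define C where "C p = (SOME c. c \<in> A \<and> p \<in> cdom c)" for p
  have C: "C p \<in> A" "p \<in> cdom (C p)" for p
    using someI_ex[of "\<lambda>c. c \<in> A \<and> p \<in> cdom c"] chart_cover[of p] unfolding C_def by blast+
  define f where "f p = G (C p) (coord (C p) p)" for p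
  have fc: "f p = G c (coord c p)" if "c \<in> A" "p \<in> cdom c" for c p
    unfolding f_def by (rule agree[OF C(1) that(1) C(2) that(2)])
  have "represents f u"
  proof (rule representsI)
    have "msmooth A UNIV f"
    proof (rule msmooth_local)
      fix p :: 'm
      have "msmooth A (cdom (C p)) f"
        by (rule msmooth_cong[OF chart_open(1)[OF C(1)] _ Gm[OF C(1)]]) (rule fc[OF C(1)])
      thus "\<exists>O'. open O' \<and> p \<in> O' \<and> msmooth A O' f" using C chart_open(1)[OF C(1)] by blast
    qed
    thus "f \<in> smooth_funs A" by (simp add: smooth_funs_def)
    fix c K \<mu> assume *: "c \<in> A" "compact K" "K \<subseteq> cdom c" "\<mu> \<in> test_dens_in A K"
    show "u \<mu> = chart_integral c (\<lambda>p. f p * \<mu> c p)"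
      unfolding Gint[OF *] by (rule chart_integral_cong[OF *(1)]) (simp add: fc[OF *(1)])
  qed
  thus ?thesis by blast
qed

end

context cr_structure
begin

section \<open>Pairing distributions with holomorphic forms\<close>

lemma test_cdensI:
  assumes "\<And>c p. c \<in> A \<and> p \<in> cdom c \<and> p \<in> K \<or> s c p = (\<lambda>v. 0)"
    "\<And>c p. s c p \<in> hol_cotangent A V p"
    "\<And>c c' p. c \<in> A \<Longrightarrow> c' \<in> A \<Longrightarrow> p \<in> cdom c \<Longrightarrow> p \<in> cdom c' \<Longrightarrow> s c p = (\<lambda>v. of_real \<bar>jac c c' p\<bar> * s c' p v)"
    "\<And>c. c \<in> A \<Longrightarrow> s c \<in> one_forms A (cdom c)"
  shows "s \<in> test_cdens_in A V K"
  unfolding test_cdens_in_def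
proof (rule CollectI, intro conjI allI ballI)
  fix c c' p assume "c \<in> A" "c' \<in> A" "p \<in> cdom c \<inter> cdom c'"
  thus "s c p = (\<lambda>v. of_real \<bar>jac c c' p\<bar> * s c' p v)" by (intro assms(3)) simp_all
qed (rule assms(1) assms(2) assms(4), assumption?)+

lemma test_cdensD:
  assumes "s \<in> test_cdens_in A V K"
  shows "c \<in> A \<and> p \<in> cdom c \<and> p \<in> K \<or> s c p = (\<lambda>v. 0)"
    "s c p \<in> hol_cotangent A V p"
    "c \<in> A \<Longrightarrow> c' \<in> A \<Longrightarrow> p \<in> cdom c \<Longrightarrow> p \<in> cdom c' \<Longrightarrow> s c p = (\<lambda>v. of_real \<bar>jac c c' p\<bar> * s c' p v)"
    "c \<in> A \<Longrightarrow> s c \<in> one_forms A (cdom c)"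
proof -
  note s = assms[unfolded test_cdens_in_def mem_Collect_eq]
  show "c \<in> A \<and> p \<in> cdom c \<and> p \<in> K \<or> s c p = (\<lambda>v. 0)"
    by (rule s[THEN conjunct1, THEN spec, THEN spec])
  show "s c p \<in> hol_cotangent A V p"
    by (rule s[THEN conjunct2, THEN conjunct1, THEN spec, THEN spec])
  show "c \<in> A \<Longrightarrow> c' \<in> A \<Longrightarrow> p \<in> cdom c \<Longrightarrow> p \<in> cdom c' \<Longrightarrow> s c p = (\<lambda>v. of_real \<bar>jac c c' p\<bar> * s c' p v)"
    by (rule s[THEN conjunct2, THEN conjunct2, THEN conjunct1, THEN bspec, THEN bspec, THEN bspec]) simp_all
  show "c \<in> A \<Longrightarrow> s c \<in> one_forms A (cdom c)"
    by (rule s[THEN conjunct2, THEN conjunct2, THEN conjunct2, THEN bspec])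
qed

lemma one_formsI:
  assumes "\<And>p. p \<in> U \<Longrightarrow> \<alpha> p \<in> cotangent_space A p"
    "\<And>K. K \<in> vector_fields A UNIV \<Longrightarrow> msmooth A U (\<lambda>p. \<alpha> p (K p))"
  shows "\<alpha> \<in> one_forms A U"
  unfolding one_forms_def by (rule CollectI, intro conjI ballI) (rule assms, assumption)+

lemma test_cdens_compact: "compact K \<Longrightarrow> s \<in> test_cdens_in A V K \<Longrightarrow> s \<in> test_cdens A V"
  by (auto simp: test_cdens_def)

lemma pairing_test:
  assumes \<omega>: "\<omega> \<in> hol_forms A V" and \<mu>: "\<mu> \<in> test_dens_in A K"
  shows "(\<lambda>c p v. \<mu> c p * \<omega> p v) \<in> test_cdens_in A V K"
proof (rule test_cdensI)
  show "c \<in> A \<and> p \<in> cdom c \<and> p \<in> K \<or> (\<lambda>v. \<mu> c p * \<omega> p v) = (\<lambda>v. 0)" for c p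
    using test_densD(1)[OF \<mu>, of c p] by (cases "\<mu> c p = 0") simp_all
  show "(\<lambda>v. \<mu> c p * \<omega> p v) \<in> hol_cotangent A V p" for c p
    by (rule hol_cotangent_cmult[OF hol_formsD(2)[OF \<omega>]])
  show "(\<lambda>v. \<mu> c p * \<omega> p v) = (\<lambda>v. of_real \<bar>jac c c' p\<bar> * (\<mu> c' p * \<omega> p v))"
    if "c \<in> A" "c' \<in> A" "p \<in> cdom c" "p \<in> cdom c'" for c c' p
    using test_densD(2)[OF \<mu> that] by (simp add: mult.assoc)
  show "(\<lambda>p v. \<mu> c p * \<omega> p v) \<in> one_forms A (cdom c)" if c: "c \<in> A" for c
  proof (rule one_formsI)
    show "(\<lambda>v. \<mu> c p * \<omega> p v) \<in> cotangent_space A p" for p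
      by (rule cotangent_cmult_closed[OF one_formsD(1)[OF hol_formsD(1)[OF \<omega>] UNIV_I]])
    show "msmooth A (cdom c) (\<lambda>p. \<mu> c p * \<omega> p (K p))" if "K \<in> vector_fields A UNIV" for K
      by (intro msmooth_mult chart_open c test_densD(3)[OF \<mu> c] smooth_funs_msmooth
        one_forms_smooth_fun[OF hol_formsD(1)[OF \<omega>] that])
  qed
qed

lemma vdistributionsD:
  assumes "X \<in> vdistributions A V"
  shows "s \<in> test_cdens A V \<Longrightarrow> t \<in> test_cdens A V \<Longrightarrow> X (\<lambda>c p v. s c p v + t c p v) = X s + X t"
    "s \<in> test_cdens A V \<Longrightarrow> X (\<lambda>c p v. a * s c p v) = a * X s"
    "c \<in> A \<Longrightarrow> compact K \<Longrightarrow> K \<subseteq> cdom c \<Longrightarrow> \<exists>C r. \<forall>s\<in>test_cdens_in A V K. \<forall>B.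
       (\<forall>i is. \<forall>p\<in>K. length is \<le> r \<longrightarrow>
          norm (pderivs is (\<lambda>x. s c (cinv c x) (coord_vec A c i (cinv c x))) (coord c p)) \<le> B)
       \<longrightarrow> norm (X s) \<le> C * B"
proof -
  note X = assms[unfolded vdistributions_def mem_Collect_eq]
  show "s \<in> test_cdens A V \<Longrightarrow> t \<in> test_cdens A V \<Longrightarrow> X (\<lambda>c p v. s c p v + t c p v) = X s + X t"
    by (rule X[THEN conjunct1, THEN bspec, THEN bspec])
  show "s \<in> test_cdens A V \<Longrightarrow> X (\<lambda>c p v. a * s c p v) = a * X s"
    by (rule X[THEN conjunct2, THEN conjunct1, THEN spec, THEN bspec])
  show "c \<in> A \<Longrightarrow> compact K \<Longrightarrow> K \<subseteq> cdom c \<Longrightarrow> \<exists>C r. \<forall>s\<in>test_cdens_in A V K. \<forall>B.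
       (\<forall>i is. \<forall>p\<in>K. length is \<le> r \<longrightarrow>
          norm (pderivs is (\<lambda>x. s c (cinv c x) (coord_vec A c i (cinv c x))) (coord c p)) \<le> B)
       \<longrightarrow> norm (X s) \<le> C * B"
    by (rule X[THEN conjunct2, THEN conjunct2, THEN bspec, THEN spec, THEN mp]) simp_all
qed

lemma test_cdens_add:
  assumes s: "s \<in> test_cdens_in A V K" and t: "t \<in> test_cdens_in A V K"
  shows "(\<lambda>c p v. s c p v + t c p v) \<in> test_cdens_in A V K"
proof (rule test_cdensI)
  show "c \<in> A \<and> p \<in> cdom c \<and> p \<in> K \<or> (\<lambda>v. s c p v + t c p v) = (\<lambda>v. 0)" for c p
    using test_cdensD(1)[OF s, of c p] test_cdensD(1)[OF t, of c p]
    by (cases "c \<in> A \<and> p \<in> cdom c \<and> p \<in> K") simp_all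
  show "(\<lambda>v. s c p v + t c p v) \<in> hol_cotangent A V p" for c p
    by (rule hol_cotangent_add[OF test_cdensD(2)[OF s] test_cdensD(2)[OF t]])
  show "(\<lambda>v. s c p v + t c p v) = (\<lambda>v. of_real \<bar>jac c c' p\<bar> * (s c' p v + t c' p v))"
    if "c \<in> A" "c' \<in> A" "p \<in> cdom c" "p \<in> cdom c'" for c c' p
    by (simp add: test_cdensD(3)[OF s that] test_cdensD(3)[OF t that] distrib_left)
  show "(\<lambda>p v. s c p v + t c p v) \<in> one_forms A (cdom c)" if c: "c \<in> A" for c
  proof (rule one_formsI)
    note f = test_cdensD(4)[OF s c] test_cdensD(4)[OF t c]
    show "(\<lambda>v. s c p v + t c p v) \<in> cotangent_space A p" if "p \<in> cdom c" for p
      by (rule cotangent_add_closed[OF one_formsD(1)[OF f(1) that] one_formsD(1)[OF f(2) that]])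
    show "msmooth A (cdom c) (\<lambda>p. s c p (K p) + t c p (K p))" if "K \<in> vector_fields A UNIV" for K
      by (rule msmooth_add[OF chart_open(1)[OF c] one_formsD(2)[OF f(1) that] one_formsD(2)[OF f(2) that]])
  qed
qed

lemma test_cdens_zero: "(\<lambda>c p v. 0) \<in> test_cdens_in A V K"
  by (rule test_cdensI) (auto simp: hol_cotangent_zero cotangent_zero_closed intro!: one_formsI msmooth_const)

lemma vdistribution_sum:
  assumes X: "X \<in> vdistributions A V" and K: "compact K" and s: "\<And>i. i \<in> I \<Longrightarrow> s i \<in> test_cdens_in A V K"
  shows "(\<lambda>c p v. \<Sum>i\<in>I. s i c p v) \<in> test_cdens_in A V K \<and> X (\<lambda>c p v. \<Sum>i\<in>I. s i c p v) = (\<Sum>i\<in>I. X (s i))"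
proof -
  have z: "X (\<lambda>c p v. 0) = 0"
    using vdistributionsD(2)[OF X test_cdens_compact[OF K test_cdens_zero], of 0] by simp
  show ?thesis using s
  proof (induction I rule: infinite_finite_induct)
    case (insert i I)
    have i: "s i \<in> test_cdens_in A V K" using insert by blast
    have I: "(\<lambda>c p v. \<Sum>i\<in>I. s i c p v) \<in> test_cdens_in A V K" "X (\<lambda>c p v. \<Sum>i\<in>I. s i c p v) = (\<Sum>i\<in>I. X (s i))"
      using insert by blast+
    show ?case
      using test_cdens_add[OF i I(1)] vdistributionsD(1)[OF X test_cdens_compact[OF K i] test_cdens_compact[OF K I(1)]]
        insert(1,2) I(2) by simp
  qed (simp_all add: z test_cdens_zero)
qed

lemma pairing_chart_distribution:
  assumes X: "X \<in> vdistributions A V" and \<omega>: "\<omega> \<in> hol_forms A V" and c: "c \<in> A"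
  shows "euclidean_distribution (cran c) (\<lambda>\<psi>. pairing \<omega> X (chart_dens A c \<psi>))"
proof -
  define u where "u \<psi> = pairing \<omega> X (chart_dens A c \<psi>)" for \<psi>
  define s where "s \<psi> = (\<lambda>c' p v. chart_dens A c \<psi> c' p * \<omega> p v)" for \<psi>
  have us: "u \<psi> = X (s \<psi>)" for \<psi> by (simp add: u_def s_def pairing_def)
  have st: "s \<psi> \<in> test_cdens_in A V (cinv c ` K)"
    if "\<psi> \<in> test_funs (cran c)" "compact K" "K \<subseteq> cran c" "\<And>x. x \<notin> K \<Longrightarrow> \<psi> x = 0" for \<psi> K
    unfolding s_def by (rule pairing_test[OF \<omega> chart_dens_test[OF c test_funs_smooth[OF that(1)] that(2-4)]])
  have st': "s \<psi> \<in> test_cdens A V" if \<psi>: "\<psi> \<in> test_funs (cran c)" for \<psi>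
  proof -
    obtain K where K: "compact K" "K \<subseteq> cran c" "smooth_on UNIV \<psi>" "\<And>x. x \<notin> K \<Longrightarrow> \<psi> x = 0"
      by (rule test_funsE[OF \<psi>]) (rule that)
    show ?thesis by (rule test_cdens_compact[OF compact_cinv_image(1)[OF c K(1,2)] st[OF \<psi> K(1,2,4)]])
  qed
  have u_scale: "u (\<lambda>x. a * \<phi> x) = a * u \<phi>" if "\<phi> \<in> test_funs (cran c)" for a \<phi>
  proof -
    have "s (\<lambda>x. a * \<phi> x) = (\<lambda>c p v. a * s \<phi> c p v)" by (simp add: s_def chart_dens_def fun_eq_iff)
    thus ?thesis by (simp add: us vdistributionsD(2)[OF X st'[OF that]])
  qed
  have "euclidean_distribution (cran c) u"
  proof
    show "open (cran c)" by (rule chart_open(2)[OF c])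
    show "u (\<lambda>x. \<phi> x + \<psi> x) = u \<phi> + u \<psi>" if "\<phi> \<in> test_funs (cran c)" "\<psi> \<in> test_funs (cran c)" for \<phi> \<psi>
    proof -
      have "s (\<lambda>x. \<phi> x + \<psi> x) = (\<lambda>c p v. s \<phi> c p v + s \<psi> c p v)"
        by (simp add: s_def chart_dens_def fun_eq_iff algebra_simps)
      thus ?thesis by (simp add: us vdistributionsD(1)[OF X st'[OF that(1)] st'[OF that(2)]])
    qed
    show "u (\<lambda>x. a * \<phi> x) = a * u \<phi>" if "\<phi> \<in> test_funs (cran c)" for a \<phi> by (rule u_scale[OF that])
    fix K assume K: "compact K" "K \<subseteq> cran c"
    show "\<exists>C r. \<forall>\<phi>\<in>test_funs (cran c). \<forall>B. (\<forall>x. x \<notin> K \<longrightarrow> \<phi> x = 0) \<longrightarrow>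
      (\<forall>is. \<forall>x\<in>K. length is \<le> r \<longrightarrow> norm (pderivs is \<phi> x) \<le> B) \<longrightarrow> norm (u \<phi>) \<le> C * B"
    proof (cases "K = {}")
      case True
      have "norm (u \<phi>) \<le> 0 * B" if "\<forall>x. x \<notin> K \<longrightarrow> \<phi> x = 0" for \<phi> and B :: real
      proof -
        have "\<phi> = (\<lambda>x. 0)" using that True by auto
        thus ?thesis using u_scale[OF test_funs_zero, of 0] by simp
      qed
      thus ?thesis by (intro exI[of _ 0]) blast
    next
      case False
      note cK = compact_cinv_image[OF c K]
      obtain C r where Cr: "\<forall>s\<in>test_cdens_in A V (cinv c ` K). \<forall>B.
         (\<forall>i is. \<forall>p\<in>cinv c ` K. length is \<le> r \<longrightarrow>
            norm (pderivs is (\<lambda>x. s c (cinv c x) (coord_vec A c i (cinv c x))) (coord c p)) \<le> B)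
         \<longrightarrow> norm (X s) \<le> C * B"
        using vdistributionsD(3)[OF X c cK] by (elim exE) (rule that)
      define w where "w i x = \<omega> (cinv c x) (coord_vec A c i (cinv c x))" for i x
      have ws: "smooth_on (cran c) (w i)" for i
        using msmoothD[OF one_form_coeff_smooth[OF hol_formsD(1)[OF \<omega>] open_UNIV c] c]
        by (simp add: cran_def w_def[abs_def])
      define bd where "bd i M \<longleftrightarrow> M \<ge> 0 \<and> (\<forall>q B. smooth_on (cran c) q \<longrightarrow>
          (\<forall>is. \<forall>x\<in>K. length is \<le> r \<longrightarrow> norm (pderivs is q x) \<le> B) \<longrightarrow>
          (\<forall>is. \<forall>x\<in>K. length is \<le> r \<longrightarrow> norm (pderivs is (\<lambda>x. w i x * q x) x) \<le> M * B))" for i M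
      have "\<forall>i. \<exists>M. bd i M" unfolding bd_def
        by (intro allI pderivs_mult_bound[OF chart_open(2)[OF c] K ws])
      then obtain M where M: "\<forall>i. bd i (M i)" by (rule choice[THEN exE])
      have M0: "M i \<ge> 0" for i using M unfolding bd_def by blast
      have Mb: "norm (pderivs is (\<lambda>x. w i x * q x) x) \<le> M i * B"
        if "smooth_on (cran c) q" "\<forall>is. \<forall>x\<in>K. length is \<le> r \<longrightarrow> norm (pderivs is q x) \<le> B" "x \<in> K" "length is \<le> r"
        for i q B x "is"
        using M that unfolding bd_def by blast
      define M' where "M' = (\<Sum>i\<in>UNIV. M i)"
      have MM: "M i \<le> M'" for i unfolding M'_def by (rule member_le_sum) (auto simp: M0)
      have "norm (u \<phi>) \<le> (C * M') * B"
        if \<phi>: "\<phi> \<in> test_funs (cran c)" and \<phi>0: "\<forall>x. x \<notin> K \<longrightarrow> \<phi> x = 0"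
          and B: "\<forall>is. \<forall>x\<in>K. length is \<le> r \<longrightarrow> norm (pderivs is \<phi> x) \<le> B" for \<phi> B
      proof -
        obtain x0 where "x0 \<in> K" using False by blast
        hence "norm (pderivs [] \<phi> x0) \<le> B" using B by (metis le0 list.size(3))
        hence B0: "B \<ge> 0" by (rule order_trans[OF norm_ge_zero])
        have "norm (pderivs is (\<lambda>x. s \<phi> c (cinv c x) (coord_vec A c i (cinv c x))) (coord c p)) \<le> M' * B"
          if p: "p \<in> cinv c ` K" and len: "length is \<le> r" for i p "is"
        proof -
          obtain x where x: "x \<in> K" "p = cinv c x" using p by blast
          have xr: "x \<in> cran c" using x K by blast
          have "pderivs is (\<lambda>x. s \<phi> c (cinv c x) (coord_vec A c i (cinv c x))) x = pderivs is (\<lambda>x. w i x * \<phi> x) x"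
            by (rule pderivs_cong[OF chart_open(2)[OF c] _ xr])
              (simp add: s_def w_def chart_dens_self[OF c] cinv_in_cdom[OF c] coord_cinv[OF c] mult.commute)
          moreover have "norm (pderivs is (\<lambda>x. w i x * \<phi> x) x) \<le> M i * B"
            by (rule Mb[OF test_funs_smooth[OF \<phi>] B x(1) len])
          ultimately show ?thesis using mult_right_mono[OF MM[of i] B0] by (simp add: x(2) coord_cinv[OF c xr])
        qed
        hence "norm (X (s \<phi>)) \<le> C * (M' * B)" using Cr st[OF \<phi> K] \<phi>0 by blast
        thus ?thesis by (simp add: us mult.assoc)
      qed
      thus ?thesis by (intro exI[of _ "C * M'"] exI[of _ r]) blast
    qed
  qed
  thus ?thesis by (simp add: u_def[abs_def])
qed

section \<open>Characteristic forms\<close>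

lemma WF_euclid_symmetric:
  fixes \<Omega> :: "(real^'z::finite) set"
  assumes real: "\<And>\<psi>. \<psi> \<in> test_funs \<Omega> \<Longrightarrow> u (\<lambda>x. cnj (\<psi> x)) = cnj (u \<psi>)"
    and WF: "(x, \<xi>) \<in> WF_euclid \<Omega> u"
  shows "(x, - \<xi>) \<in> WF_euclid \<Omega> u"
proof (rule ccontr)
  assume not: "(x, - \<xi>) \<notin> WF_euclid \<Omega> u"
  define P where "P \<phi> W \<eta> \<longleftrightarrow> open W \<and> \<eta> \<in> W \<and> (\<forall>\<xi>\<in>W. \<forall>t>0. t *\<^sub>R \<xi> \<in> W) \<and>
     (\<forall>k::nat. \<exists>C. \<forall>\<xi>\<in>W. norm (u (\<lambda>x. \<phi> x * cis (- (x \<bullet> \<xi>)))) * (1 + norm \<xi>) ^ k \<le> C)"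
    for \<phi> and W :: "(real^'z) set" and \<eta>
  have iff: "(y, \<eta>) \<in> WF_euclid \<Omega> u \<longleftrightarrow> y \<in> \<Omega> \<and> \<eta> \<noteq> 0 \<and> \<not> (\<exists>\<phi>\<in>test_funs \<Omega>. \<phi> y \<noteq> 0 \<and> (\<exists>W. P \<phi> W \<eta>))" for y \<eta>
    unfolding WF_euclid_def P_def by simp
  obtain \<phi> W where \<phi>: "\<phi> \<in> test_funs \<Omega>" "\<phi> x \<noteq> 0" and P: "P \<phi> W (- \<xi>)"
    using not WF unfolding iff by auto
  have "P (\<lambda>x. cnj (\<phi> x)) (uminus ` W) \<xi>"
    unfolding P_def
  proof (intro conjI ballI allI impI)
    show "open (uminus ` W)" using P unfolding P_def by (intro open_negations) blast
    show "\<xi> \<in> uminus ` W" using P unfolding P_def by (intro image_eqI[of _ _ "- \<xi>"]) auto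
    fix \<eta> and t :: real assume "\<eta> \<in> uminus ` W" "t > 0"
    thus "t *\<^sub>R \<eta> \<in> uminus ` W" using P unfolding P_def by (intro image_eqI[of _ _ "- (t *\<^sub>R \<eta>)"]) (auto simp flip: scaleR_minus_right)
  next
    fix k :: nat
    obtain C where C: "\<forall>\<xi>\<in>W. norm (u (\<lambda>x. \<phi> x * cis (- (x \<bullet> \<xi>)))) * (1 + norm \<xi>) ^ k \<le> C"
      using P unfolding P_def by blast
    have "norm (u (\<lambda>x. cnj (\<phi> x) * cis (- (x \<bullet> \<eta>)))) * (1 + norm \<eta>) ^ k \<le> C" if \<eta>: "\<eta> \<in> uminus ` W" for \<eta>
    proof -
      obtain \<zeta> where \<zeta>: "\<zeta> \<in> W" "\<eta> = - \<zeta>" using \<eta> by blast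
      have "(\<lambda>x. wave (- \<zeta>) x * \<phi> x) \<in> test_funs \<Omega>" by (rule test_funs_mult[OF \<phi>(1) smooth_on_wave])
      from real[OF this] have "u (\<lambda>x. cnj (\<phi> x) * cis (- (x \<bullet> \<eta>))) = cnj (u (\<lambda>x. \<phi> x * cis (- (x \<bullet> \<zeta>))))"
        by (simp add: \<zeta>(2) wave_def cis_cnj mult.commute)
      thus ?thesis using C \<zeta> by simp
    qed
    thus "\<exists>C. \<forall>\<xi>\<in>uminus ` W. norm (u (\<lambda>x. cnj (\<phi> x) * cis (- (x \<bullet> \<xi>)))) * (1 + norm \<xi>) ^ k \<le> C" by blast
  qed
  moreover have "(\<lambda>x. cnj (\<phi> x)) \<in> test_funs \<Omega>" by (rule test_funs_cnj[OF \<phi>(1)])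
  ultimately have "\<exists>\<phi>\<in>test_funs \<Omega>. \<phi> x \<noteq> 0 \<and> (\<exists>W. P \<phi> W \<xi>)"
    using \<phi>(2) by (intro bexI[of _ "\<lambda>x. cnj (\<phi> x)"] conjI exI[of _ "uminus ` W"]) simp_all
  thus False using WF unfolding iff by blast
qed

lemma char_form_no_WF:
  assumes diffeo: "inf_cr_diffeo A V X" and ext: "extends_microlocally A V X"
    and \<tau>: "\<tau> \<in> char_forms A V" and c: "c \<in> A"
  shows "WF_euclid (cran c) (\<lambda>\<psi>. pairing \<tau> X (chart_dens A c \<psi>)) = {}"
proof (rule ccontr)
  define u where "u \<psi> = pairing \<tau> X (chart_dens A c \<psi>)" for \<psi>
  assume "WF_euclid (cran c) (\<lambda>\<psi>. pairing \<tau> X (chart_dens A c \<psi>)) \<noteq> {}"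
  then obtain x \<xi> where WF: "(x, \<xi>) \<in> WF_euclid (cran c) u" unfolding u_def[abs_def] by auto
  hence x: "x \<in> cran c" and \<xi>: "\<xi> \<noteq> 0" by (auto simp: WF_euclid_def)
  have "u (\<lambda>x. cnj (\<psi> x)) = cnj (u \<psi>)" if \<psi>: "\<psi> \<in> test_funs (cran c)" for \<psi>
  proof -
    have eq: "dist_eq A (pairing \<tau> X) (dist_cnj (pairing \<tau> X))"
      using diffeo \<tau> unfolding inf_cr_diffeo_def by blast
    obtain K where K: "compact K" "K \<subseteq> cran c" "smooth_on UNIV \<psi>" "\<And>x. x \<notin> K \<Longrightarrow> \<psi> x = 0"
      by (rule test_funsE[OF \<psi>]) (rule that)
    have "chart_dens A c \<psi> \<in> test_dens A"
      by (rule test_dens_compact[OF compact_cinv_image(1)[OF c K(1,2)] chart_dens_test[OF c K(3,1,2,4)]])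
    hence "u \<psi> = cnj (pairing \<tau> X (\<lambda>c' p. cnj (chart_dens A c \<psi> c' p)))"
      using eq unfolding dist_eq_def dist_cnj_def u_def by blast
    moreover have "(\<lambda>c' p. cnj (chart_dens A c \<psi> c' p)) = chart_dens A c (\<lambda>x. cnj (\<psi> x))"
      by (simp add: chart_dens_def fun_eq_iff)
    ultimately show ?thesis by (simp add: u_def)
  qed
  hence WF': "(x, - \<xi>) \<in> WF_euclid (cran c) u" by (rule WF_euclid_symmetric[OF _ WF])
  define p where "p = cinv c x"
  have p: "p \<in> cdom c" "coord c p = x" using x by (simp_all add: p_def cinv_in_cdom[OF c] coord_cinv[OF c])
  obtain \<eta> where \<eta>: "\<eta> \<in> cotangent_space A p" "cov_cnj \<eta> = \<eta>" "\<And>i. \<eta> (coord_vec A c i p) = of_real (\<xi> $ i)"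
    by (rule real_covector_exists[OF c p(1)]) (rule that)
  define \<zeta> where "\<zeta> = (\<lambda>v. - \<eta> v)"
  have \<zeta>: "\<zeta> \<in> cotangent_space A p" "cov_cnj \<zeta> = \<zeta>" "\<And>i. \<zeta> (coord_vec A c i p) = of_real (- \<xi> $ i)"
    using cotangent_cmult_closed[OF \<eta>(1), of "-1"] \<eta>(2,3) by (simp_all add: \<zeta>_def cov_cnj_def fun_eq_iff)
  have comp: "(\<chi> i. Re (\<eta> (coord_vec A c i p))) = \<xi>" "(\<chi> i. Re (\<zeta> (coord_vec A c i p))) = - \<xi>"
    by (simp_all add: \<eta>(3) \<zeta>(3) vec_eq_iff)
  have "\<exists>c\<in>A. p \<in> cdom c \<and> (coord c p, \<chi> i. Re (\<eta> (coord_vec A c i p))) \<in>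
      WF_euclid (cran c) (\<lambda>\<psi>. pairing \<tau> X (chart_dens A c \<psi>))"
    using WF p by (intro bexI[OF _ c]) (simp add: comp u_def[abs_def])
  hence 1: "(p, \<eta>) \<in> WF A (pairing \<tau> X)" unfolding WF_def using \<eta>(1,2) by simp
  have "\<exists>c\<in>A. p \<in> cdom c \<and> (coord c p, \<chi> i. Re (\<zeta> (coord_vec A c i p))) \<in>
      WF_euclid (cran c) (\<lambda>\<psi>. pairing \<tau> X (chart_dens A c \<psi>))"
    using WF' p by (intro bexI[OF _ c]) (simp add: comp u_def[abs_def])
  hence 2: "(p, \<zeta>) \<in> WF A (pairing \<tau> X)" unfolding WF_def using \<zeta>(1,2) by simp
  obtain \<Gamma> :: "'m \<Rightarrow> 'm covec set" where
      sub: "\<forall>p. closedin (top_of_set (char_cotangent A V p - {\<lambda>v. 0})) (\<Gamma> p) \<and>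
             (\<forall>\<eta>\<in>\<Gamma> p. \<forall>t::real. t > 0 \<longrightarrow> (\<lambda>v. of_real t * \<eta> v) \<in> \<Gamma> p) \<and>
             (\<forall>\<eta>\<in>\<Gamma> p. \<forall>\<zeta>\<in>\<Gamma> p. \<forall>t\<in>{0..1::real}.
                (\<lambda>v. of_real (1 - t) * \<eta> v + of_real t * \<zeta> v) \<in> \<Gamma> p)"
    and WF\<Gamma>: "\<forall>\<omega>\<in>hol_forms A V. WF A (pairing \<omega> X) \<subseteq> Sigma UNIV \<Gamma>"
    using ext unfolding extends_microlocally_def by (elim exE conjE) (rule that)
  have WFp: "WF A (pairing \<tau> X) \<subseteq> Sigma UNIV \<Gamma>" by (rule bspec[OF WF\<Gamma> char_forms_hol[OF \<tau>]])
  have in\<Gamma>: "\<eta> \<in> \<Gamma> p" "\<zeta> \<in> \<Gamma> p" using subsetD[OF WFp 1] subsetD[OF WFp 2] by simp_all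
  have convex: "\<forall>\<eta>\<in>\<Gamma> p. \<forall>\<zeta>\<in>\<Gamma> p. \<forall>t\<in>{0..1::real}. (\<lambda>v. of_real (1 - t) * \<eta> v + of_real t * \<zeta> v) \<in> \<Gamma> p"
    by (rule spec[OF sub, THEN conjunct2, THEN conjunct2])
  from bspec[OF bspec[OF bspec[OF convex in\<Gamma>(1)] in\<Gamma>(2)], of "1 / 2"] have "(\<lambda>v. 0) \<in> \<Gamma> p" by (simp add: \<zeta>_def)
  moreover have "\<Gamma> p \<subseteq> char_cotangent A V p - {\<lambda>v. 0}"
    using closedin_subset[OF spec[OF sub, THEN conjunct1]] by simp
  ultimately show False by blast
qed

lemma char_form_smooth:
  assumes diffeo: "inf_cr_diffeo A V X" and ext: "extends_microlocally A V X" and \<tau>: "\<tau> \<in> char_forms A V"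
  shows "\<exists>f. represents f (pairing \<tau> X)"
proof (rule smooth_dist_from_charts)
  fix c assume c: "c \<in> A"
  have X: "X \<in> vdistributions A V" using diffeo by (simp add: inf_cr_diffeo_def)
  interpret euclidean_distribution "cran c" "\<lambda>\<psi>. pairing \<tau> X (chart_dens A c \<psi>)"
    by (rule pairing_chart_distribution[OF X char_forms_hol[OF \<tau>] c])
  obtain g where "smooth_on (cran c) g"
    "\<And>\<psi>. \<psi> \<in> test_funs (cran c) \<Longrightarrow> pairing \<tau> X (chart_dens A c \<psi>) = (LINT x|lborel. g x * \<psi> x)"
    by (rule smooth_if_WF_empty[OF char_form_no_WF[OF diffeo ext \<tau> c]]) (rule that)
  thus "\<exists>g. smooth_on (cran c) g \<and>
      (\<forall>\<psi>\<in>test_funs (cran c). pairing \<tau> X (chart_dens A c \<psi>) = (LINT x|lborel. g x * \<psi> x))" by blast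
qed

section \<open>Lie derivatives and smooth combinations\<close>

lemma lie_pairing_smooth:
  assumes diffeo: "inf_cr_diffeo A V X" and L: "L \<in> cr_fields A V" and \<alpha>: "\<alpha> \<in> hol_forms A V"
    and f: "represents f (pairing \<alpha> X)"
  shows "represents (\<lambda>p. L p f) (pairing (lie A L \<alpha>) X)"
proof (rule representsI)
  have d: "represents (\<lambda>p. L p f) (dist_deriv A L (pairing \<alpha> X))"
    by (rule represents_dist_deriv[OF f cr_fields_field[OF L]])
  show "(\<lambda>p. L p f) \<in> smooth_funs A" by (rule representsD(1)[OF d])
  fix c K \<mu> assume *: "c \<in> A" "compact K" "K \<subseteq> cdom c" "\<mu> \<in> test_dens_in A K"
  have "dist_eq A (dist_deriv A L (pairing \<alpha> X)) (pairing (lie A L \<alpha>) X)"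
    using diffeo L \<alpha> unfolding inf_cr_diffeo_def by blast
  hence "pairing (lie A L \<alpha>) X \<mu> = dist_deriv A L (pairing \<alpha> X) \<mu>"
    using test_dens_compact[OF *(2,4)] unfolding dist_eq_def by simp
  also have "\<dots> = chart_integral c (\<lambda>p. L p f * \<mu> c p)" by (rule representsD(2)[OF d *])
  finally show "pairing (lie A L \<alpha>) X \<mu> = chart_integral c (\<lambda>p. L p f * \<mu> c p)" .
qed

lemma iterated_lie_pairing_smooth:
  assumes diffeo: "inf_cr_diffeo A V X" and ext: "extends_microlocally A V X" and \<theta>: "\<theta> \<in> char_forms A V"
    and Ks: "set Ks \<subseteq> cr_fields A V"
  shows "\<exists>f. represents f (pairing (foldr (lie A) Ks \<theta>) X)"
  using Ks
proof (induction Ks)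
  case Nil
  show ?case using char_form_smooth[OF diffeo ext \<theta>] by simp
next
  case (Cons L Ks)
  have "set Ks \<subseteq> cr_fields A V" and L: "L \<in> cr_fields A V" using Cons.prems by auto
  from Cons.IH[OF this(1)] obtain f where f: "represents f (pairing (foldr (lie A) Ks \<theta>) X)" by blast
  have "represents (\<lambda>p. L p f) (pairing (lie A L (foldr (lie A) Ks \<theta>)) X)"
    by (rule lie_pairing_smooth[OF diffeo L foldr_lie_hol_form[OF \<open>set Ks \<subseteq> _\<close> char_forms_hol[OF \<theta>]] f])
  thus ?case by auto
qed

lemma sum_pairing_integral:
  assumes X: "X \<in> vdistributions A V" and c: "c \<in> A" and K: "compact K" "K \<subseteq> cdom c"
    and \<omega>: "\<And>i. i \<in> I \<Longrightarrow> \<omega> i \<in> hol_forms A V" and \<mu>: "\<And>i. i \<in> I \<Longrightarrow> \<mu> i \<in> test_dens_in A K"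
    and f: "\<And>i. i \<in> I \<Longrightarrow> represents (f i) (pairing (\<omega> i) X)"
  shows "X (\<lambda>c p v. \<Sum>i\<in>I. \<mu> i c p * \<omega> i p v) = chart_integral c (\<lambda>p. \<Sum>i\<in>I. f i p * \<mu> i c p)"
proof -
  have "X (\<lambda>c p v. \<Sum>i\<in>I. \<mu> i c p * \<omega> i p v) = (\<Sum>i\<in>I. X (\<lambda>c p v. \<mu> i c p * \<omega> i p v))"
    using vdistribution_sum[OF X K(1), of I "\<lambda>i c p v. \<mu> i c p * \<omega> i p v"] pairing_test[OF \<omega> \<mu>] by blast
  also have "\<dots> = (\<Sum>i\<in>I. (LINT x|lborel. chart_rep c (\<lambda>p. f i p * \<mu> i c p) x))"
  proof (rule sum.cong[OF refl])
    fix i assume i: "i \<in> I"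
    show "X (\<lambda>c p v. \<mu> i c p * \<omega> i p v) = (LINT x|lborel. chart_rep c (\<lambda>p. f i p * \<mu> i c p) x)"
      using representsD(2)[OF f[OF i] c K \<mu>[OF i]] by (simp add: pairing_def chart_integral_eq)
  qed
  also have "\<dots> = (LINT x|lborel. (\<Sum>i\<in>I. chart_rep c (\<lambda>p. f i p * \<mu> i c p) x))"
  proof (rule Bochner_Integration.integral_sum[symmetric])
    fix i assume i: "i \<in> I"
    show "integrable lborel (chart_rep c (\<lambda>p. f i p * \<mu> i c p))"
      by (rule test_funs_integrable[OF density_rep_test[OF test_dens_mult[OF representsD(1)[OF f[OF i]] \<mu>[OF i]] K c]])
  qed
  also have "(\<lambda>x. \<Sum>i\<in>I. chart_rep c (\<lambda>p. f i p * \<mu> i c p) x) = chart_rep c (\<lambda>p. \<Sum>i\<in>I. f i p * \<mu> i c p)"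
    by (auto simp: chart_rep_def fun_eq_iff)
  finally show ?thesis by (simp add: chart_integral_eq)
qed

theorem E_forms_smooth:
  assumes diffeo: "inf_cr_diffeo A V X" and ext: "extends_microlocally A V X" and \<omega>: "\<omega> \<in> E_forms A V"
  shows "\<exists>f. represents f (pairing \<omega> X)"
proof -
  have X: "X \<in> vdistributions A V" using diffeo by (simp add: inf_cr_diffeo_def)
  obtain k and m :: nat and g Ks \<theta> where \<omega>: "\<omega> = (\<lambda>p v. \<Sum>i<m. g i p * foldr (lie A) (Ks i) (\<theta> i) p v)"
    and *: "\<forall>i<m. g i \<in> smooth_funs A \<and> set (Ks i) \<subseteq> cr_fields A V \<and> length (Ks i) \<le> k \<and> \<theta> i \<in> char_forms A V"
    using \<omega> unfolding E_forms_def E_step_def by blast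
  have g: "g i \<in> smooth_funs A" and Ks: "set (Ks i) \<subseteq> cr_fields A V" and \<theta>: "\<theta> i \<in> char_forms A V" if "i < m" for i
    using * that by blast+
  define \<alpha> where "\<alpha> i = foldr (lie A) (Ks i) (\<theta> i)" for i
  have \<alpha>: "\<alpha> i \<in> hol_forms A V" if "i < m" for i
    unfolding \<alpha>_def by (rule foldr_lie_hol_form[OF Ks[OF that] char_forms_hol[OF \<theta>[OF that]]])
  have "\<forall>i. \<exists>f. i < m \<longrightarrow> represents f (pairing (\<alpha> i) X)"
    using iterated_lie_pairing_smooth[OF diffeo ext \<theta> Ks] unfolding \<alpha>_def by blast
  then obtain f where "\<forall>i. i < m \<longrightarrow> represents (f i) (pairing (\<alpha> i) X)" by (rule choice[THEN exE])
  hence f: "\<And>i. i \<in> {..<m} \<Longrightarrow> represents (f i) (pairing (\<alpha> i) X)" by simp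
  have "represents (\<lambda>p. \<Sum>i<m. g i p * f i p) (pairing \<omega> X)"
  proof (rule representsI)
    show "(\<lambda>p. \<Sum>i<m. g i p * f i p) \<in> smooth_funs A"
      by (intro smooth_funs_sum smooth_funs_mult) (simp_all add: g representsD(1)[OF f])
    fix c K \<mu> assume c: "c \<in> A" and K: "compact K" "K \<subseteq> cdom c" and \<mu>: "\<mu> \<in> test_dens_in A K"
    have "pairing \<omega> X \<mu> = X (\<lambda>c p v. \<Sum>i<m. (g i p * \<mu> c p) * \<alpha> i p v)"
      by (simp add: pairing_def \<omega> \<alpha>_def sum_distrib_left mult_ac)
    also have "\<dots> = chart_integral c (\<lambda>p. \<Sum>i<m. f i p * (g i p * \<mu> c p))"
      by (rule sum_pairing_integral[OF X c K, of "{..<m}" \<alpha> "\<lambda>i c p. g i p * \<mu> c p" f])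
        (simp_all add: \<alpha> f test_dens_mult[OF g \<mu>])
    also have "\<dots> = chart_integral c (\<lambda>p. (\<Sum>i<m. g i p * f i p) * \<mu> c p)"
      by (simp add: sum_distrib_left sum_distrib_right mult_ac)
    finally show "pairing \<omega> X \<mu> = chart_integral c (\<lambda>p. (\<Sum>i<m. g i p * f i p) * \<mu> c p)" .
  qed
  thus ?thesis by blast
qed

section \<open>Multiplication by the determinant ideal\<close>

lemma dual_section_local_smooth:
  assumes Y: "Y \<in> dual_sections A V" and U: "open U" and \<alpha>: "\<alpha> \<in> one_forms A U" "\<And>p. \<alpha> p \<in> hol_cotangent A V p"
  shows "msmooth A U (\<lambda>p. Y p (\<alpha> p))"
proof (rule msmooth_local)
  fix p assume p: "p \<in> U"
  obtain \<beta> K O' where b: "bump_in U O' K \<beta>" "p \<in> O'" by (rule bump_exists[OF U p])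
  define \<omega> where "\<omega> = (\<lambda>q v. \<beta> q * \<alpha> q v)"
  have "\<omega> \<in> hol_forms A V" unfolding hol_forms_def
  proof (rule CollectI, rule conjI)
    show "\<forall>p. \<omega> p \<in> hol_cotangent A V p" unfolding \<omega>_def by (intro allI hol_cotangent_cmult \<alpha>(2))
    show "\<omega> \<in> one_forms A UNIV"
    proof (rule one_formsI)
      show "\<omega> q \<in> cotangent_space A q" for q
        unfolding \<omega>_def by (rule cotangent_cmult_closed[OF hol_cotangentD(1)[OF \<alpha>(2)]])
      fix L assume L: "L \<in> vector_fields A UNIV"
      have "(\<lambda>q. \<beta> q * \<alpha> q (L q)) \<in> smooth_funs A" by (rule bump_mult[OF b(1) U one_formsD(2)[OF \<alpha>(1) L]])
      thus "msmooth A UNIV (\<lambda>q. \<omega> q (L q))" unfolding \<omega>_def by (rule smooth_funs_msmooth)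
    qed
  qed
  hence "msmooth A O' (\<lambda>q. Y q (\<omega> q))" by (intro smooth_funs_msmooth dual_sectionsD(4)[OF Y])
  hence "msmooth A O' (\<lambda>q. Y q (\<alpha> q))"
    by (rule msmooth_cong[OF bump_inD(5)[OF b(1)], rotated]) (simp add: \<omega>_def bump_inD(8)[OF b(1)])
  thus "\<exists>O'. open O' \<and> p \<in> O' \<and> msmooth A O' (\<lambda>p. Y p (\<alpha> p))" using b bump_inD(5)[OF b(1)] by blast
qed

definition replaced_det :: "('r::finite \<Rightarrow> 'm \<Rightarrow> 'm covec \<Rightarrow> complex) \<Rightarrow> ('r \<Rightarrow> 'm \<Rightarrow> 'm covec) \<Rightarrow> 'r \<Rightarrow> 'm \<Rightarrow> 'm covec \<Rightarrow> complex" where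
  "replaced_det Y W i p \<eta> = det (\<chi> i' j. Y j p (if i' = i then \<eta> else W i' p))"

lemma replaced_det_row:
  "replaced_det Y W i p \<eta> = det (\<chi> i'. if i' = i then \<chi> j. Y j p \<eta> else \<chi> j. Y j p (W i' p))"
  unfolding replaced_det_def by (rule arg_cong[of _ _ det]) (simp add: vec_eq_iff)

lemma replaced_det_linear:
  assumes Y: "\<And>j. Y j \<in> dual_sections A V" and \<eta>: "\<eta> \<in> hol_cotangent A V p"
  shows "\<zeta> \<in> hol_cotangent A V p \<Longrightarrow> replaced_det Y W i p (\<lambda>v. \<eta> v + \<zeta> v) = replaced_det Y W i p \<eta> + replaced_det Y W i p \<zeta>"
    "replaced_det Y W i p (\<lambda>v. a * \<eta> v) = a * replaced_det Y W i p \<eta>"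
proof -
  show "replaced_det Y W i p (\<lambda>v. \<eta> v + \<zeta> v) = replaced_det Y W i p \<eta> + replaced_det Y W i p \<zeta>"
    if \<zeta>: "\<zeta> \<in> hol_cotangent A V p"
  proof -
    have r: "(\<chi> j. Y j p (\<lambda>v. \<eta> v + \<zeta> v)) = (\<chi> j. Y j p \<eta>) + (\<chi> j. Y j p \<zeta>)"
      by (simp add: vec_eq_iff dual_sectionsD(1)[OF Y \<eta> \<zeta>])
    show ?thesis unfolding replaced_det_row r by (rule det_row_add)
  qed
  have r: "(\<chi> j. Y j p (\<lambda>v. a * \<eta> v)) = a *s (\<chi> j. Y j p \<eta>)"
    by (simp add: vec_eq_iff dual_sectionsD(2)[OF Y \<eta>])
  show "replaced_det Y W i p (\<lambda>v. a * \<eta> v) = a * replaced_det Y W i p \<eta>"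
    unfolding replaced_det_row r by (rule det_row_mul)
qed

lemma replaced_det_smooth:
  assumes Y: "\<And>j. Y j \<in> dual_sections A V" and W: "\<And>i. W i \<in> hol_forms A V"
    and U: "open U" and \<alpha>: "\<alpha> \<in> one_forms A U" "\<And>p. \<alpha> p \<in> hol_cotangent A V p"
  shows "msmooth A U (\<lambda>p. replaced_det Y W i p (\<alpha> p))"
  unfolding replaced_det_def
proof (rule msmooth_det[OF U])
  fix i' j
  show "msmooth A U (\<lambda>p. Y j p (if i' = i then \<alpha> p else W i' p))"
  proof (cases "i' = i")
    case True
    thus ?thesis using dual_section_local_smooth[OF Y U \<alpha>] by simp
  next
    case False
    thus ?thesis using smooth_funs_msmooth[OF dual_sectionsD(4)[OF Y W]] by simp
  qed
qed

lemma replaced_det_density: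
  assumes Y: "\<And>j. Y j \<in> dual_sections A V" and W: "\<And>i. W i \<in> hol_forms A V" and s: "s \<in> test_cdens_in A V K"
  shows "(\<lambda>c p. replaced_det Y W i p (s c p)) \<in> test_dens_in A K"
proof (rule test_densI)
  show "c \<in> A \<and> p \<in> cdom c \<and> p \<in> K" if nz: "replaced_det Y W i p (s c p) \<noteq> 0" for c p
  proof (rule ccontr)
    assume "\<not> (c \<in> A \<and> p \<in> cdom c \<and> p \<in> K)"
    hence s0: "s c p = (\<lambda>v. 0)" using test_cdensD(1)[OF s, of c p] by blast
    have "replaced_det Y W i p (\<lambda>v. 0) = 0"
      using replaced_det_linear(2)[OF Y hol_cotangent_zero, where a = 0] by simp
    thus False using nz s0 by simp
  qed
  show "replaced_det Y W i p (s c p) = of_real \<bar>jac c c' p\<bar> * replaced_det Y W i p (s c' p)"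
    if "c \<in> A" "c' \<in> A" "p \<in> cdom c" "p \<in> cdom c'" for c c' p
    unfolding test_cdensD(3)[OF s that] by (rule replaced_det_linear(2)[OF Y test_cdensD(2)[OF s]])
  show "msmooth A (cdom c) (\<lambda>p. replaced_det Y W i p (s c p))" if c: "c \<in> A" for c
    by (rule replaced_det_smooth[OF Y W chart_open(1)[OF c] test_cdensD(4)[OF s c] test_cdensD(2)[OF s]])
qed

theorem S_ideal_smooth:
  assumes card: "CARD('r::finite) = n + d" and diffeo: "inf_cr_diffeo A V X" and ext: "extends_microlocally A V X"
    and h: "h \<in> S_ideal TYPE('r) A V"
  shows "smooth_vdist A V (mult_vdist h X)"
proof -
  have X: "X \<in> vdistributions A V" using diffeo by (simp add: inf_cr_diffeo_def)
  define gen where "gen m g W Y \<longleftrightarrow>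
      h = (\<lambda>p. \<Sum>l<m. g l p * det (\<chi> i j. Y l j p (W l i p) :: complex^'r^'r)) \<and>
      (\<forall>l<m. g l \<in> smooth_funs A \<and> (\<forall>i. W l i \<in> E_forms A V) \<and> (\<forall>j. Y l j \<in> dual_sections A V))"
    for m :: nat and g W Y
  have "\<exists>m g W Y. gen m g W Y" using h unfolding S_ideal_def mem_Collect_eq gen_def .
  then obtain m g W Y where gen: "gen m g W Y" by blast
  note h = gen[unfolded gen_def, THEN conjunct1]
  have g: "g l \<in> smooth_funs A" and WE: "W l i \<in> E_forms A V" and Y: "Y l j \<in> dual_sections A V" if "l < m" for l i j
    using gen[unfolded gen_def, THEN conjunct2, THEN spec, THEN mp, OF that] by simp_all
  note W = E_forms_hol[OF WE]
  define I where "I = {..<m} \<times> (UNIV :: 'r set)"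
  have "\<forall>a. \<exists>f. a \<in> I \<longrightarrow> represents f (pairing (W (fst a) (snd a)) X)"
    using E_forms_smooth[OF diffeo ext WE] by (auto simp: I_def)
  then obtain f where "\<forall>a. a \<in> I \<longrightarrow> represents (f a) (pairing (W (fst a) (snd a)) X)" by (rule choice[THEN exE])
  hence f: "\<And>a. a \<in> I \<Longrightarrow> represents (f a) (pairing (W (fst a) (snd a)) X)" by blast
  define R where "R a = replaced_det (Y (fst a)) (W (fst a)) (snd a)" for a
  define Z where "Z p \<eta> = (if \<eta> \<in> hol_cotangent A V p then \<Sum>a\<in>I. f a p * (g (fst a) p * R a p \<eta>) else 0)" for p \<eta>
  have Im: "fst a < m" if "a \<in> I" for a using that by (auto simp: I_def)
  have "Z \<in> dual_sections A V"
    unfolding dual_sections_def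
  proof (rule CollectI, intro conjI allI ballI impI)
    fix p \<eta> \<zeta> assume \<eta>: "\<eta> \<in> hol_cotangent A V p" and \<zeta>: "\<zeta> \<in> hol_cotangent A V p"
    have "R a p (\<lambda>v. \<eta> v + \<zeta> v) = R a p \<eta> + R a p \<zeta>" if "a \<in> I" for a
      unfolding R_def by (rule replaced_det_linear(1)[OF Y[OF Im[OF that]] \<eta> \<zeta>])
    thus "Z p (\<lambda>v. \<eta> v + \<zeta> v) = Z p \<eta> + Z p \<zeta>"
      by (simp add: Z_def \<eta> \<zeta> hol_cotangent_add sum.distrib[symmetric] distrib_left)
  next
    fix p a \<eta> assume \<eta>: "\<eta> \<in> hol_cotangent A V p"
    have "R b p (\<lambda>v. a * \<eta> v) = a * R b p \<eta>" if "b \<in> I" for b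
      unfolding R_def by (rule replaced_det_linear(2)[OF Y[OF Im[OF that]] \<eta>])
    thus "Z p (\<lambda>v. a * \<eta> v) = a * Z p \<eta>"
      by (simp add: Z_def \<eta> hol_cotangent_cmult sum_distrib_left mult_ac)
  next
    show "Z p \<eta> = 0" if "\<eta> \<notin> hol_cotangent A V p" for p \<eta> using that by (simp add: Z_def)
  next
    fix \<omega> assume \<omega>: "\<omega> \<in> hol_forms A V"
    have Rs: "(\<lambda>p. R a p (\<omega> p)) \<in> smooth_funs A" if "a \<in> I" for a
      unfolding R_def smooth_funs_def
      by (rule CollectI, rule replaced_det_smooth[OF Y[OF Im[OF that]] W[OF Im[OF that]] open_UNIV hol_formsD[OF \<omega>]])
    have "(\<lambda>p. \<Sum>a\<in>I. f a p * (g (fst a) p * R a p (\<omega> p))) \<in> smooth_funs A"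
      by (intro smooth_funs_sum smooth_funs_mult representsD(1)[OF f] g Im Rs)
    thus "(\<lambda>p. Z p (\<omega> p)) \<in> smooth_funs A" by (simp add: Z_def hol_formsD(2)[OF \<omega>])
  qed
  moreover have "mult_vdist h X s = (LINT x:cran c|lborel. Z (cinv c x) (s c (cinv c x)))"
    if c: "c \<in> A" and K: "compact K" "K \<subseteq> cdom c" and s: "s \<in> test_cdens_in A V K" for c K s
  proof -
    define \<mu> where "\<mu> a c p = g (fst a) p * R a p (s c p)" for a :: "nat \<times> 'r" and c p
    have \<mu>: "\<mu> a \<in> test_dens_in A K" if "a \<in> I" for a
      unfolding \<mu>_def R_def
      by (rule test_dens_mult[OF g[OF Im[OF that]] replaced_det_density[OF Y[OF Im[OF that]] W[OF Im[OF that]] s]])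
    have "h p * s c p v = (\<Sum>a\<in>I. \<mu> a c p * W (fst a) (snd a) p v)" for c p v
    proof -
      have "h p * s c p v = (\<Sum>l<m. g l p * (det (\<chi> i j. Y l j p (W l i p)) * s c p v))"
        by (simp add: h sum_distrib_right mult.assoc)
      also have "\<dots> = (\<Sum>l<m. g l p * (\<Sum>i\<in>UNIV. replaced_det (Y l) (W l) i p (s c p) * W l i p v))"
      proof (intro sum.cong refl arg_cong2[where f = "(*)"])
        fix l assume "l \<in> {..<m}"
        hence l: "l < m" by simp
        show "det (\<chi> i j. Y l j p (W l i p)) * s c p v = (\<Sum>i\<in>UNIV. replaced_det (Y l) (W l) i p (s c p) * W l i p v)"
          unfolding replaced_det_def
          by (rule Cramer_hol_cotangent[OF card hol_formsD(2)[OF W[OF l]] test_cdensD(2)[OF s] Y[OF l], symmetric])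
      qed
      also have "\<dots> = (\<Sum>l<m. \<Sum>i\<in>UNIV. \<mu> (l, i) c p * W l i p v)"
        by (simp add: \<mu>_def R_def sum_distrib_left mult.assoc)
      also have "\<dots> = (\<Sum>a\<in>I. \<mu> a c p * W (fst a) (snd a) p v)"
        unfolding I_def by (simp add: sum.cartesian_product case_prod_beta)
      finally show ?thesis .
    qed
    hence "mult_vdist h X s = X (\<lambda>c p v. \<Sum>a\<in>I. \<mu> a c p * W (fst a) (snd a) p v)" by (simp add: mult_vdist_def)
    also have "\<dots> = chart_integral c (\<lambda>p. \<Sum>a\<in>I. f a p * \<mu> a c p)"
      by (rule sum_pairing_integral[OF X c K W[OF Im] \<mu> f])
    also have "\<dots> = chart_integral c (\<lambda>p. Z p (s c p))"
      by (simp add: Z_def test_cdensD(2)[OF s] \<mu>_def)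
    finally show ?thesis by (simp add: chart_integral_def)
  qed
  ultimately show ?thesis unfolding smooth_vdist_def by blast
qed

end

theorem theorem1:
  fixes A :: "('m::{t2_space,second_countable_topology}, 'k::finite) chart set"
    and V :: "'m \<Rightarrow> 'm tvec set"
    and n d :: nat
    and X :: "('m, 'k) cdens \<Rightarrow> complex"
  assumes "cr_manifold A n d V"
    and "CARD('r::finite) = n + d"
    and "inf_cr_diffeo A V X"
    and "extends_microlocally A V X"
  shows "(\<forall>\<omega>\<in>E_forms A V. smooth_dist A (pairing \<omega> X)) \<and>
         (\<forall>h\<in>S_ideal TYPE('r) A V. smooth_vdist A V (mult_vdist h X))"
proof -
  interpret cr_structure A n d V by unfold_locales (rule assms(1))
  show ?thesis
    using E_forms_smooth[OF assms(3,4)] S_ideal_smooth[OF assms(2-4)] by (simp add: smooth_dist_iff)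
qed

end
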